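(* Let $k$ be an algebraically closed field of characteristic zero, $Q=k[x_0,x_1,x_2,x_3]$, and let $t\ge 4$. The coordinate ring $R$ of $t$ general points in $\mathbb{P}^3$ has Tor algebra class determined by $t$: it is $\mathrm{H}(0,0)$ if $t=4$; $\mathrm{G}(5)$ if $t=5$; $\mathrm{H}(3,2)$ if $t=6$; $\mathrm{T}$ if $t=7$; $\mathrm{H}(1,0)$ if $t=8$; and $\mathrm{H}(0,0)$ if $t\ge 9$. Moreover, the Tor algebra $\operatorname{Tor}^Q(R,k)$ has maximum multiplication rank.
   Context: A property holds for $t$ general points in $\mathbb{P}^3$ if there is a nonempty Zariski open subset of $(\mathbb{P}^3)^t$ such that the property holds for every element of it. The coordinate ring of a finite set $X\subset\mathbb{P}^3$ is $Q/J$, with $J$ the homogeneous ideal of all forms vanishing on $X$. The Tor algebra of $R$ is $A=\operatorname{Tor}^Q(R,k)$, a graded-commutative $k$-algebra, bigraded with $[A_i]_d=\operatorname{Tor}^Q_i(R,k)_d$ ($i$ homological degree, $d$ internal degree). For subspaces $V,W\subseteq A$, $V\cdot W$ denotes the span of all products $vw$. Classes (codepth $3$): $R$ is in a given class if there are $k$-bases $\{e_i\}$ of $A_1$, $\{f_i\}$ of $A_2$, $\{g_i\}$ of $A_3$ for which the only nonzero products of basis elements (up to graded commutativity) in $A_1\cdot A_1$ and $A_1\cdot A_2$ are: - $\mathrm{T}$: $e_1e_2=f_3$, $e_3e_1=f_2$, $e_2e_3=f_1$; $A_1A_2=0$. - $\mathrm{G}(r)$: $A_1A_1=0$; $e_if_i=g_1$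 for $1\le i\le r$. - $\mathrm{H}(p,q)$: $e_{p+1}e_i=f_i$ for $1\le i\le p$; $e_{p+1}f_{p+j}=g_j$ for $1\le j\le q$. (So $\mathrm{H}(0,0)$ means $A_1A_1=0=A_1A_2$.) Maximum multiplication rank: for such $A$ one has the bounds (a) $\dim_k([A_i]_d\cdot[A_j]_e)\le\min(\dim_k[A_i]_d\cdot\dim_k[A_j]_e,\ \dim_k[A_{i+j}]_{d+e})$, and (b) for $i$ odd, $\dim_k([A_i]_d\cdot[A_i]_d)\le\min\left(\binom{\dim_k[A_i]_d}{2},\ \dim_k[A_{2i}]_{2d}\right)$. $A$ has maximum multiplication rank if equality holds in (b) for every odd $i$ and every $d$, and equality holds in (a) in all cases not covered by (b), subject to the following exceptions: if $A$ has Poincaré duality with top degree $c$, equality is not required where the product is forced to vanish by the equivalences, valid for $i+j+\ell=c$, $A_i\cdot A_j\ne0\iff A_i\cdot A_\ell\neq 0\iff A_j\cdot A_\ell\ne 0$. *)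

theory Defs
  imports
    "HOL-Library.Poly_Mapping"
    "HOL-Library.Numeral_Type"
    "HOL-Library.FuncSet"
    "HOL-Computational_Algebra.Polynomial"
    "HOL-Algebra.QuotRing"
    "HOL-Algebra.Embedded_Algebras"
begin

section \<open>Polynomials and points of projective space\<close>

type_synonym ('v, 'k) mpoly = "('v \<Rightarrow>\<^sub>0 nat) \<Rightarrow>\<^sub>0 'k"

definition mvar :: "'v \<Rightarrow> ('v, 'k::comm_ring_1) mpoly" where
  "mvar v = Poly_Mapping.single (Poly_Mapping.single v 1) 1"

definition mconst :: "'k \<Rightarrow> ('v, 'k::comm_ring_1) mpoly" where
  "mconst c = Poly_Mapping.single 0 c"

definition mon_deg :: "('v \<Rightarrow>\<^sub>0 nat) \<Rightarrow> nat" where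
  "mon_deg m = (\<Sum>v\<in>Poly_Mapping.keys m. Poly_Mapping.lookup m v)"

definition homogeneous :: "nat \<Rightarrow> ('v, 'k::comm_ring_1) mpoly \<Rightarrow> bool" where
  "homogeneous d f \<longleftrightarrow> (\<forall>m\<in>Poly_Mapping.keys f. mon_deg m = d)"

definition mpoly_eval :: "('v, 'k::comm_ring_1) mpoly \<Rightarrow> ('v \<Rightarrow> 'k) \<Rightarrow> 'k" where
  "mpoly_eval f x =
     (\<Sum>m\<in>Poly_Mapping.keys f. Poly_Mapping.lookup f m *
        (\<Prod>v\<in>Poly_Mapping.keys m. x v ^ Poly_Mapping.lookup m v))"

text \<open>A point of projective space is the set of all its vectors of homogeneous coordinates.\<close>

definition proj_space :: "('v \<Rightarrow> 'k::field) set set" where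
  "proj_space = {{\<lambda>v. c * x v | c. c \<noteq> 0} | x. x \<noteq> (\<lambda>_. 0)}"

definition vanishing_ideal :: "('v \<Rightarrow> 'k::field) set set \<Rightarrow> ('v, 'k) mpoly set" where
  "vanishing_ideal X =
     module.span (*) {f. (\<exists>d. homogeneous d f) \<and> (\<forall>P\<in>X. \<forall>x\<in>P. mpoly_eval f x = 0)}"

text \<open>
  The Zariski topology on the \<open>t\<close>-fold product of projective space: closed sets are the common
  zero loci of multihomogeneous polynomials in the variables \<open>(j, v)\<close>, \<open>j < t\<close>, where \<open>(j, v)\<close> is
  the \<open>v\<close>-th homogeneous coordinate of the \<open>j\<close>-th point.
\<close>

definition proj_tuples :: "nat \<Rightarrow> (nat \<Rightarrow> ('v \<Rightarrow> 'k::field) set) set" where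
  "proj_tuples t = {..<t} \<rightarrow>\<^sub>E proj_space"

definition multihomogeneous :: "nat \<Rightarrow> (nat \<times> 'v::finite, 'k::comm_ring_1) mpoly \<Rightarrow> bool" where
  "multihomogeneous t F \<longleftrightarrow>
     (\<exists>d :: nat \<Rightarrow> nat. \<forall>m\<in>Poly_Mapping.keys F.
        Poly_Mapping.keys m \<subseteq> {..<t} \<times> UNIV \<and>
        (\<forall>j<t. (\<Sum>v\<in>UNIV. Poly_Mapping.lookup m (j, v)) = d j))"

definition vanishes_at_tuple ::
    "nat \<Rightarrow> (nat \<times> 'v, 'k::field) mpoly \<Rightarrow> (nat \<Rightarrow> ('v \<Rightarrow> 'k) set) \<Rightarrow> bool" where
  "vanishes_at_tuple t F p \<longleftrightarrow>
     (\<forall>x. (\<forall>j<t. x j \<in> p j) \<longrightarrow> mpoly_eval F (\<lambda>(j, v). x j v) = 0)"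

definition zariski_closed :: "nat \<Rightarrow> (nat \<Rightarrow> ('v::finite \<Rightarrow> 'k::field) set) set \<Rightarrow> bool" where
  "zariski_closed t C \<longleftrightarrow>
     (\<exists>S. (\<forall>F\<in>S. multihomogeneous t F) \<and>
          C = {p \<in> proj_tuples t. \<forall>F\<in>S. vanishes_at_tuple t F p})"

definition zariski_open :: "nat \<Rightarrow> (nat \<Rightarrow> ('v::finite \<Rightarrow> 'k::field) set) set \<Rightarrow> bool" where
  "zariski_open t U \<longleftrightarrow> U \<subseteq> proj_tuples t \<and> zariski_closed t (proj_tuples t - U)"

definition for_general_points ::
    "nat \<Rightarrow> ((nat \<Rightarrow> ('v::finite \<Rightarrow> 'k::field) set) \<Rightarrow> bool) \<Rightarrow> bool" where
  "for_general_points t P \<longleftrightarrow> (\<exists>U. zariski_open t U \<and> U \<noteq> {} \<and> (\<forall>p\<in>U. P p))"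


section \<open>The Koszul resolution\<close>

text \<open>
  The free \<open>Q\<close>-module on the symbols \<open>e\<^sub>S\<close>, for \<open>S\<close> a set of variables;
  \<open>e\<^sub>S\<close> is the exterior product of the \<open>e\<^sub>v\<close>, \<open>v \<in> S\<close>, taken in increasing order.
\<close>

type_synonym ('v, 'k) koszul = "'v set \<Rightarrow>\<^sub>0 ('v, 'k) mpoly"

definition koszul_diff :: "('v::{finite,linorder}, 'k::comm_ring_1) koszul \<Rightarrow> ('v, 'k) koszul" where
  "koszul_diff a =
     (\<Sum>S\<in>UNIV. \<Sum>v\<in>S. Poly_Mapping.single (S - {v})
        ((- 1) ^ card {u \<in> S. u < v} * mvar v * Poly_Mapping.lookup a S))"

definition wedge_sign :: "'v::linorder set \<Rightarrow> 'v set \<Rightarrow> 'r::comm_ring_1" where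
  "wedge_sign S T =
     (if S \<inter> T = {} then (- 1) ^ card {(u, v). u \<in> S \<and> v \<in> T \<and> v < u} else 0)"

definition wedge ::
    "('v::{finite,linorder}, 'k::comm_ring_1) koszul \<Rightarrow> ('v, 'k) koszul \<Rightarrow> ('v, 'k) koszul" where
  "wedge a b =
     (\<Sum>S\<in>UNIV. \<Sum>T\<in>UNIV. Poly_Mapping.single (S \<union> T)
        (wedge_sign S T * Poly_Mapping.lookup a S * Poly_Mapping.lookup b T))"

text \<open>Homological degree \<open>i\<close>, internal degree \<open>d\<close>; the symbol \<open>e\<^sub>S\<close> has bidegree \<open>(|S|, |S|)\<close>.\<close>

definition koszul_component :: "nat \<Rightarrow> nat \<Rightarrow> ('v, 'k::comm_ring_1) koszul set" where
  "koszul_component i d =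
     {a. \<forall>S. \<forall>m\<in>Poly_Mapping.keys (Poly_Mapping.lookup a S). card S = i \<and> mon_deg m + i = d}"


subsection \<open>The Koszul complex is a differential graded algebra resolving the base field\<close>

lemma koszul_expand: "a = (\<Sum>S\<in>UNIV. Poly_Mapping.single S (Poly_Mapping.lookup a S))"
  for a :: "('v::finite, 'k::comm_ring_1) koszul"
  by (rule poly_mapping_eqI) (simp add: lookup_sum lookup_single when_def)

lemma additive_sum: "f (sum g A) = (\<Sum>x\<in>A. f (g x))"
  if "\<And>a b. f (a + b) = f a + f b" for f :: "'a::ab_group_add \<Rightarrow> 'b::ab_group_add"
proof -
  have "f 0 = 0" using that[of 0 0] by simp
  then show ?thesis by (induction A rule: infinite_finite_induct) (auto simp: that)
qed

lemma koszul_additive_eq: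
  fixes f g :: "('v::finite, 'k::comm_ring_1) koszul \<Rightarrow> 'b::ab_group_add"
  assumes "\<And>a b. f (a + b) = f a + f b" "\<And>a b. g (a + b) = g a + g b"
    and "\<And>S q. f (Poly_Mapping.single S q) = g (Poly_Mapping.single S q)"
  shows "f a = g a"
  by (subst (1 2) koszul_expand) (simp add: additive_sum assms)

lemma koszul_diff_add: "koszul_diff (a + b) = koszul_diff a + koszul_diff b"
  by (simp add: koszul_diff_def lookup_add algebra_simps single_add sum.distrib)

lemma koszul_diff_zero: "koszul_diff 0 = 0"
  by (simp add: koszul_diff_def)

lemma wedge_add_left: "wedge (a + b) c = wedge a c + wedge b c"
  by (simp add: wedge_def lookup_add algebra_simps single_add sum.distrib)

lemma wedge_add_right: "wedge a (b + c) = wedge a b + wedge a c"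
  by (simp add: wedge_def lookup_add algebra_simps single_add sum.distrib)

lemma koszul_diff_single:
  "koszul_diff (Poly_Mapping.single S q) =
     (\<Sum>v\<in>S. Poly_Mapping.single (S - {v}) ((- 1) ^ card {u \<in> S. u < v} * mvar v * q))"
proof -
  have "koszul_diff (Poly_Mapping.single S q) =
     (\<Sum>T\<in>UNIV. if T = S then (\<Sum>v\<in>S. Poly_Mapping.single (S - {v}) ((- 1) ^ card {u \<in> S. u < v} * mvar v * q)) else 0)"
    unfolding koszul_diff_def by (rule sum.cong) (auto simp: lookup_single)
  then show ?thesis by simp
qed

lemma wedge_single:
  "wedge (Poly_Mapping.single S q) (Poly_Mapping.single T r) =
     Poly_Mapping.single (S \<union> T) (wedge_sign S T * q * r)"
proof -
  let ?r = "Poly_Mapping.single (S \<union> T) (wedge_sign S T * q * r)"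
  have *: "Poly_Mapping.single (S' \<union> T') (wedge_sign S' T' * Poly_Mapping.lookup (Poly_Mapping.single S q) S'
         * Poly_Mapping.lookup (Poly_Mapping.single T r) T')
      = (if T' = T then if S' = S then ?r else 0 else 0)" for S' T'
    by (auto simp: lookup_single)
  show ?thesis unfolding wedge_def * by simp
qed

lemma sum_antisym:
  fixes F :: "'v::linorder \<Rightarrow> 'v \<Rightarrow> 'b::ab_group_add"
  assumes "finite S" "\<And>v w. v \<in> S \<Longrightarrow> w \<in> S \<Longrightarrow> v < w \<Longrightarrow> F w v = - F v w"
  shows "(\<Sum>v\<in>S. \<Sum>w\<in>S - {v}. F v w) = 0"
proof -
  have "(\<Sum>v\<in>S. \<Sum>w\<in>S - {v}. F v w) = (\<Sum>v\<in>S. (\<Sum>w\<in>{w\<in>S. v < w}. F v w) + (\<Sum>w\<in>{w\<in>S. w < v}. F v w))"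
  proof (rule sum.cong[OF refl])
    fix v assume "v \<in> S"
    have "S - {v} = {w\<in>S. v < w} \<union> {w\<in>S. w < v}" by auto
    moreover have "{w\<in>S. v < w} \<inter> {w\<in>S. w < v} = {}" by (blast dest: less_asym)
    ultimately show "(\<Sum>w\<in>S - {v}. F v w) = (\<Sum>w\<in>{w\<in>S. v < w}. F v w) + (\<Sum>w\<in>{w\<in>S. w < v}. F v w)"
      using assms(1) by (simp add: sum.union_disjoint)
  qed
  also have "\<dots> = (\<Sum>v\<in>S. (\<Sum>w\<in>{w\<in>S. v < w}. F v w)) + (\<Sum>v\<in>S. \<Sum>w\<in>{w\<in>S. w < v}. F v w)"
    by (simp add: sum.distrib)
  also have "(\<Sum>v\<in>S. \<Sum>w\<in>{w\<in>S. w < v}. F v w) = (\<Sum>v\<in>S. \<Sum>w\<in>{w\<in>S. v < w}. F w v)"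
    by (rule sum.swap_restrict) (use assms in auto)
  also have "\<dots> = (\<Sum>v\<in>S. \<Sum>w\<in>{w\<in>S. v < w}. - F v w)"
    by (intro sum.cong refl) (use assms in auto)
  finally show ?thesis by (simp add: sum_negf)
qed

lemma card_below_remove:
  assumes "finite S" "v \<in> S" 
  shows "card {u\<in>S. u < w} = card {u \<in> S - {v}. u < w} + (if v < w then 1 else 0)"
proof (cases "v < w")
  case True
  then have "{u\<in>S. u < w} = insert v {u \<in> S - {v}. u < w}" using assms by auto
  then show ?thesis using True assms by simp
next
  case False
  then have "{u\<in>S. u < w} = {u \<in> S - {v}. u < w}" by auto
  then show ?thesis using False by simp
qed

theorem koszul_diff_diff: "koszul_diff (koszul_diff a) = 0"
  for a :: "('v::{finite,linorder}, 'k::comm_ring_1) koszul"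
proof (rule koszul_additive_eq[where f = "\<lambda>a. koszul_diff (koszul_diff a)" and g = "\<lambda>_. 0"])
  fix S :: "'v set" and q :: "('v, 'k) mpoly"
  let ?c = "\<lambda>v. (- 1) ^ card {u \<in> S. u < v} :: ('v, 'k) mpoly"
  let ?F = "\<lambda>v w. Poly_Mapping.single (S - {v} - {w})
       ((- 1) ^ card {u \<in> S - {v}. u < w} * mvar w * (?c v * mvar v * q))"
  have "koszul_diff (koszul_diff (Poly_Mapping.single S q)) = (\<Sum>v\<in>S. \<Sum>w\<in>S - {v}. ?F v w)"
    by (simp add: koszul_diff_single additive_sum[of koszul_diff, OF koszul_diff_add])
  also have "\<dots> = 0"
  proof (rule sum_antisym)
    fix v w assume vw: "v \<in> S" "w \<in> S" "v < w"
    have 1: "?c w = - ((- 1) ^ card {u \<in> S - {v}. u < w})"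
      using card_below_remove[of S v w] vw by simp
    have 2: "?c v = (- 1) ^ card {u \<in> S - {w}. u < v}"
      using card_below_remove[of S w v] vw by auto
    have "S - {w} - {v} = S - {v} - {w}" by auto
    then show "?F w v = - ?F v w" unfolding 1 2 by (simp add: single_uminus algebra_simps)
  qed simp
  finally show "koszul_diff (koszul_diff (Poly_Mapping.single S q)) = 0" .
qed (auto simp: koszul_diff_add)


lemma mpoly_expand:
  "(q :: ('v, 'k::comm_ring_1) mpoly) =
     (\<Sum>m\<in>Poly_Mapping.keys q. Poly_Mapping.single m (Poly_Mapping.lookup q m))"
  by (rule poly_mapping_eqI) (auto simp: lookup_sum lookup_single when_def in_keys_iff)

lemma koszul_additive_eq_monomial:
  fixes f g :: "('v::finite, 'k::comm_ring_1) koszul \<Rightarrow> 'b::ab_group_add"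
  assumes "\<And>a b. f (a + b) = f a + f b" "\<And>a b. g (a + b) = g a + g b"
    and "\<And>S m c. f (Poly_Mapping.single S (Poly_Mapping.single m c)) =
                    g (Poly_Mapping.single S (Poly_Mapping.single m c))"
  shows "f a = g a"
proof (rule koszul_additive_eq[OF assms(1,2)])
  fix S and q :: "('v, 'k) mpoly"
  have "f (Poly_Mapping.single S q) = (\<Sum>m\<in>Poly_Mapping.keys q.
          f (Poly_Mapping.single S (Poly_Mapping.single m (Poly_Mapping.lookup q m))))"
    by (subst mpoly_expand) (rule additive_sum, simp add: single_add assms)
  also have "\<dots> = g (Poly_Mapping.single S q)"
    by (subst (2) mpoly_expand) (subst additive_sum[of "\<lambda>q. g (Poly_Mapping.single S q)"],
          simp_all add: single_add assms)
  finally show "f (Poly_Mapping.single S q) = g (Poly_Mapping.single S q)" .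
qed

lemma mvar_times_monomial:
  "mvar v * Poly_Mapping.single m c = Poly_Mapping.single (m + Poly_Mapping.single v 1) c"
  by (simp add: mvar_def mult_single add.commute)

lemma neg_one_power_times_single:
  "(- 1) ^ n * Poly_Mapping.single m c = Poly_Mapping.single m ((- 1) ^ n * c)"
  for c :: "'k::comm_ring_1"
  by (induction n) (auto simp: single_uminus)

lemma koszul_diff_monomial:
  "koszul_diff (Poly_Mapping.single S (Poly_Mapping.single m c)) =
     (\<Sum>v\<in>S. Poly_Mapping.single (S - {v})
        (Poly_Mapping.single (m + Poly_Mapping.single v 1) ((- 1) ^ card {u \<in> S. u < v} * c)))"
  by (simp add: koszul_diff_single mult.assoc mvar_times_monomial neg_one_power_times_single)

lemma koszul_homotopy:
  obtains h :: "('v::{finite,linorder}, 'k::comm_ring_1) koszul \<Rightarrow> ('v, 'k) koszul" where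
    "\<And>a. koszul_diff (h a) + h (koszul_diff a) =
       a - Poly_Mapping.single {} (mconst (Poly_Mapping.lookup (Poly_Mapping.lookup a {}) 0))"
    "\<And>a b. h (a + b) = h a + h b"
proof -
  define H :: "'v set \<Rightarrow> ('v \<Rightarrow>\<^sub>0 nat) \<Rightarrow> 'k \<Rightarrow> ('v, 'k) koszul" where
    "H S m c = (if Poly_Mapping.keys m \<union> S = {} \<or> Min (Poly_Mapping.keys m \<union> S) \<in> S then 0
       else let v = Min (Poly_Mapping.keys m \<union> S) in
         Poly_Mapping.single (insert v S) (Poly_Mapping.single (m - Poly_Mapping.single v 1) c))" for S m c
  define h :: "('v, 'k) koszul \<Rightarrow> ('v, 'k) koszul" where
    "h a = (\<Sum>S\<in>UNIV. \<Sum>m\<in>Poly_Mapping.keys (Poly_Mapping.lookup a S).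
              H S m (Poly_Mapping.lookup (Poly_Mapping.lookup a S) m))" for a
  have H0 [simp]: "H S m 0 = 0" for S m by (simp add: H_def)
  have H_add: "H S m (c + d) = H S m c + H S m d" for S m c d
    by (simp add: H_def Let_def single_add)
  have h_super: "h a = (\<Sum>S\<in>UNIV. \<Sum>m\<in>M. H S m (Poly_Mapping.lookup (Poly_Mapping.lookup a S) m))"
    if "finite M" "\<And>S. Poly_Mapping.keys (Poly_Mapping.lookup a S) \<subseteq> M" for a M
    unfolding h_def using that by (intro sum.cong sum.mono_neutral_left refl) (auto simp: in_keys_iff)
  have h_add: "h (a + b) = h a + h b" for a b
  proof -
    let ?M = "\<Union>S. Poly_Mapping.keys (Poly_Mapping.lookup a S) \<union> Poly_Mapping.keys (Poly_Mapping.lookup b S)"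
    have M: "finite ?M" by simp
    have "Poly_Mapping.keys (Poly_Mapping.lookup (a + b) S) \<subseteq> ?M" for S
      using Poly_Mapping.keys_add[of "Poly_Mapping.lookup a S" "Poly_Mapping.lookup b S"]
      by (auto simp: lookup_add)
    then show ?thesis
      by (subst (1 2 3) h_super[OF M]) (auto simp: lookup_add H_add sum.distrib)
  qed
  have h_monomial: "h (Poly_Mapping.single S (Poly_Mapping.single m c)) = H S m c" for S m c
  proof -
    have "h (Poly_Mapping.single S (Poly_Mapping.single m c)) =
        (\<Sum>T\<in>UNIV. if T = S then H S m c else 0)"
      unfolding h_def by (rule sum.cong) (auto simp: lookup_single)
    then show ?thesis by simp
  qed
  have "koszul_diff (h a) + h (koszul_diff a) =
      a - Poly_Mapping.single {} (mconst (Poly_Mapping.lookup (Poly_Mapping.lookup a {}) 0))" for a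
  proof (rule koszul_additive_eq_monomial[where f = "\<lambda>a. koszul_diff (h a) + h (koszul_diff a)"])
    fix S :: "'v set" and m :: "'v \<Rightarrow>\<^sub>0 nat" and c :: 'k
    let ?a = "Poly_Mapping.single S (Poly_Mapping.single m c)"
    let ?K = "Poly_Mapping.keys m \<union> S"
    let ?s = "\<lambda>v. Poly_Mapping.single v (1::nat)"
    define j where "j = Min ?K"
    have keys: "Poly_Mapping.keys (m + ?s v) = insert v (Poly_Mapping.keys m)" for v
      by (auto simp: in_keys_iff lookup_add lookup_single when_def split: if_splits)
    have K: "Poly_Mapping.keys (m + ?s v) \<union> (S - {v}) = ?K" if "v \<in> S" for v
      using that unfolding keys by auto
    have hD: "h (koszul_diff ?a) =
        (\<Sum>v\<in>S. H (S - {v}) (m + ?s v) ((- 1) ^ card {u \<in> S. u < v} * c))"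
      by (simp add: koszul_diff_monomial additive_sum[of h, OF h_add] h_monomial)
    show "koszul_diff (h ?a) + h (koszul_diff ?a) =
        ?a - Poly_Mapping.single {} (mconst (Poly_Mapping.lookup (Poly_Mapping.lookup ?a {}) 0))"
    proof (cases "?K = {}")
      case True
      moreover have "koszul_diff 0 = (0 :: ('v, 'k) koszul)" by (simp add: koszul_diff_def)
      ultimately show ?thesis
        unfolding hD by (simp add: h_monomial H_def mconst_def)
    next
      case False
      have j: "j \<in> ?K" unfolding j_def by (rule Min_in) (use False in auto)
      have j_le: "j \<le> u" if "u \<in> ?K" for u unfolding j_def by (rule Min_le) (use that in auto)
      have aug: "mconst (Poly_Mapping.lookup (Poly_Mapping.lookup ?a {}) 0) = 0"
        using False by (auto simp: lookup_single mconst_def when_def)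
      have below_j: "{u \<in> S. u < j} = {}" using j_le by (auto simp: not_less)
      show ?thesis
      proof (cases "j \<in> S")
        case True
        have "H (S - {v}) (m + ?s v) ((- 1) ^ card {u \<in> S. u < v} * c) = (if v = j then ?a else 0)"
          if "v \<in> S" for v
        proof (cases "v = j")
          case v: True
          have "card {u \<in> S. u < j} = 0" unfolding below_j by simp
          note this [simp]
          have "insert j S = S" using True by auto
          then show ?thesis
            using v True K[OF that] by (auto simp add: H_def Let_def simp flip: j_def)
        next
          case False
          then show ?thesis using True K[OF that] by (simp add: H_def flip: j_def)
        qed
        then have "h (koszul_diff ?a) = ?a" using True by (simp add: hD)
        moreover have "h ?a = 0" using True by (simp add: h_monomial H_def flip: j_def)
        ultimately show ?thesis unfolding aug by (simp add: koszul_diff_zero)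
      next
        case j_notin: False
        with j have "j \<in> Poly_Mapping.keys m" by auto
        then have m: "m - ?s j + ?s j = m"
          by (intro poly_mapping_eqI) (auto simp: lookup_add lookup_minus lookup_single when_def in_keys_iff)
        have m': "m + ?s v - ?s j = m - ?s j + ?s v" for v
        proof -
          have "m + ?s v = m - ?s j + ?s j + ?s v" by (simp only: m)
          also have "\<dots> = m - ?s j + ?s v + ?s j" by (simp only: add_ac)
          finally show ?thesis by (simp only: add_diff_cancel_right')
        qed
        have ha: "h ?a = Poly_Mapping.single (insert j S) (Poly_Mapping.single (m - ?s j) c)"
          using j_notin False by (auto simp add: h_monomial H_def Let_def simp flip: j_def)
        have hD': "h (koszul_diff ?a) = (\<Sum>v\<in>S. Poly_Mapping.single (insert j (S - {v}))
            (Poly_Mapping.single (m - ?s j + ?s v) ((- 1) ^ card {u \<in> S. u < v} * c)))"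
          unfolding hD
        proof (rule sum.cong[OF refl])
          fix v assume v: "v \<in> S"
          show "H (S - {v}) (m + ?s v) ((- 1) ^ card {u \<in> S. u < v} * c) =
              Poly_Mapping.single (insert j (S - {v}))
               (Poly_Mapping.single (m - ?s j + ?s v) ((- 1) ^ card {u \<in> S. u < v} * c))"
            using j_notin False K[OF v] v
            by (auto simp add: H_def Let_def m' simp del: One_nat_def simp flip: j_def)
        qed
        have cj: "card {u \<in> insert j S. u < v} = Suc (card {u \<in> S. u < v})" if "v \<in> S" for v
        proof -
          have "j < v" using that j_le[of v] j_notin by (metis UnI2 order_le_less)
          then have "{u \<in> insert j S. u < v} = insert j {u \<in> S. u < v}" by auto
          then show ?thesis using j_notin by simp
        qed
        have below_j': "{u. (u = j \<or> u \<in> S) \<and> u < j} = {}" using below_j by auto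
        have "koszul_diff (h ?a) = ?a + (\<Sum>v\<in>S. Poly_Mapping.single (insert j S - {v})
            (Poly_Mapping.single (m - ?s j + ?s v) ((- 1) ^ card {u \<in> insert j S. u < v} * c)))"
          using j_notin by (simp add: ha koszul_diff_monomial m below_j' del: One_nat_def)
        also have "(\<Sum>v\<in>S. Poly_Mapping.single (insert j S - {v})
            (Poly_Mapping.single (m - ?s j + ?s v) ((- 1) ^ card {u \<in> insert j S. u < v} * c)))
            = - h (koszul_diff ?a)"
          unfolding hD' sum_negf[symmetric]
        proof (rule sum.cong[OF refl])
          fix v assume v: "v \<in> S"
          have "insert j S - {v} = insert j (S - {v})" using v j_notin by auto
          then show "Poly_Mapping.single (insert j S - {v})
             (Poly_Mapping.single (m - ?s j + ?s v) ((- 1) ^ card {u \<in> insert j S. u < v} * c)) =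
            - Poly_Mapping.single (insert j (S - {v}))
             (Poly_Mapping.single (m - ?s j + ?s v) ((- 1) ^ card {u \<in> S. u < v} * c))"
            by (simp only: cj[OF v]) (simp add: single_uminus)
        qed
        finally show ?thesis unfolding aug by simp
      qed
    qed
  qed (simp_all add: h_add koszul_diff_add lookup_add single_add mconst_def)
  with h_add that show thesis by blast
qed

text \<open>
  \<open>K\<close> is a free resolution of \<open>k\<close>: the sequence \<open>\<dots> \<rightarrow> K\<^sub>1 \<rightarrow> K\<^sub>0 \<rightarrow> k \<rightarrow> 0\<close> is exact, where the augmentation is
  the constant coefficient at \<open>e\<^sub>\<emptyset>\<close>.
\<close>

theorem koszul_exact:
  "range koszul_diff = {a :: ('v::{finite,linorder}, 'k::comm_ring_1) koszul. koszul_diff a = 0 \<and>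
     Poly_Mapping.lookup (Poly_Mapping.lookup a {}) 0 = 0}"
proof (intro subset_antisym subsetI)
  fix a :: "('v, 'k) koszul" assume "a \<in> range koszul_diff"
  then obtain b where b: "a = koszul_diff b" by auto
  have "Poly_Mapping.lookup (Poly_Mapping.lookup (koszul_diff b) {}) 0 = 0"
  proof (rule koszul_additive_eq_monomial[where
        f = "\<lambda>b. Poly_Mapping.lookup (Poly_Mapping.lookup (koszul_diff b) {}) 0" and g = "\<lambda>_. 0"])
    fix S :: "'v set" and m :: "'v \<Rightarrow>\<^sub>0 nat" and c :: 'k
    have "m + Poly_Mapping.single v (1::nat) \<noteq> 0" for v
      by (auto simp: poly_mapping_eq_iff fun_eq_iff lookup_add lookup_single intro!: exI[of _ v])
    then show "Poly_Mapping.lookup (Poly_Mapping.lookup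
        (koszul_diff (Poly_Mapping.single S (Poly_Mapping.single m c))) {}) 0 = 0"
      by (auto simp: koszul_diff_monomial lookup_sum lookup_single when_def intro!: sum.neutral)
  qed (simp_all add: koszul_diff_add lookup_add)
  then show "a \<in> {a. koszul_diff a = 0 \<and> Poly_Mapping.lookup (Poly_Mapping.lookup a {}) 0 = 0}"
    by (simp add: b koszul_diff_diff)
next
  fix a :: "('v, 'k) koszul"
  assume a: "a \<in> {a. koszul_diff a = 0 \<and> Poly_Mapping.lookup (Poly_Mapping.lookup a {}) 0 = 0}"
  obtain h :: "('v, 'k) koszul \<Rightarrow> ('v, 'k) koszul" where
    h: "\<And>a. koszul_diff (h a) + h (koszul_diff a) =
       a - Poly_Mapping.single {} (mconst (Poly_Mapping.lookup (Poly_Mapping.lookup a {}) 0))"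
    and "\<And>a b. h (a + b) = h a + h b" using koszul_homotopy by blast
  from this(2)[of 0 0] have "h 0 = 0" by simp
  with h[of a] a have "koszul_diff (h a) = a" by (simp add: mconst_def)
  then show "a \<in> range koszul_diff" by (metis rangeI)
qed


lemma wedge_sign_assoc:
  "wedge_sign S T * wedge_sign (S \<union> T) U = (wedge_sign T U * wedge_sign S (T \<union> U) :: 'r::comm_ring_1)"
  for S T U :: "'v::{finite,linorder} set"
proof (cases "S \<inter> T = {} \<and> S \<inter> U = {} \<and> T \<inter> U = {}")
  case True
  let ?I = "\<lambda>S T. {(u, v). u \<in> S \<and> v \<in> T \<and> v < (u::'v)}"
  have "?I (S \<union> T) U = ?I S U \<union> ?I T U" "?I S (T \<union> U) = ?I S T \<union> ?I S U" by auto
  moreover have "?I S U \<inter> ?I T U = {}" "?I S T \<inter> ?I S U = {}" using True by auto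
  ultimately have "card (?I (S \<union> T) U) = card (?I S U) + card (?I T U)"
    "card (?I S (T \<union> U)) = card (?I S T) + card (?I S U)"
    by (simp_all add: card_Un_disjoint)
  then show ?thesis using True
    by (simp add: wedge_sign_def Int_Un_distrib Int_Un_distrib2 power_add mult_ac)
qed (auto simp: wedge_sign_def)

lemma wedge_sign_commute:
  "wedge_sign T S = ((- 1) ^ (card S * card T) * wedge_sign S T :: 'r::comm_ring_1)"
  for S T :: "'v::{finite,linorder} set"
proof (cases "S \<inter> T = {}")
  case True
  let ?I = "{(u, v). u \<in> S \<and> v \<in> T \<and> v < u}" and ?J = "{(u, v). u \<in> S \<and> v \<in> T \<and> u < v}"
  have IJ: "?I \<union> ?J = S \<times> T"
  proof (rule Set.set_eqI)
    fix x :: "'v \<times> 'v"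
    obtain u v where x: "x = (u, v)" by fastforce
    have "u \<in> S \<Longrightarrow> v \<in> T \<Longrightarrow> u \<noteq> v" using True by blast
    then show "x \<in> ?I \<union> ?J \<longleftrightarrow> x \<in> S \<times> T" unfolding x by (cases u v rule: linorder_cases) auto
  qed
  have "?I \<inter> ?J = {}" by (blast dest: less_asym)
  then have "card S * card T = card ?I + card ?J"
    using card_Un_disjoint[of ?I ?J] unfolding IJ card_cartesian_product by simp
  moreover have "card {(u, v). u \<in> T \<and> v \<in> S \<and> v < u} = card ?J"
  proof -
    have "{(u, v). u \<in> T \<and> v \<in> S \<and> v < u} = ?J\<inverse>"
      by (rule Set.set_eqI) (simp add: split_paired_all conj_ac)
    then show ?thesis by (simp only: card_inverse)
  qed
  moreover have "(- 1 :: 'r) ^ card ?I * (- 1) ^ card ?I = 1"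
    by (simp flip: power_add mult_2 add: power_mult)
  moreover have "T \<inter> S = {}" using True by blast
  ultimately show ?thesis using True by (simp add: wedge_sign_def power_add mult_ac)
next
  case False
  then have "T \<inter> S \<noteq> {}" by blast
  with False show ?thesis by (simp add: wedge_sign_def)
qed

lemma wedge_assoc: "wedge (wedge a b) c = wedge a (wedge b c)"
  for a b c :: "('v::{finite,linorder}, 'k::comm_ring_1) koszul"
proof -
  note add = wedge_add_left wedge_add_right
  have "wedge (wedge (Poly_Mapping.single S p) (Poly_Mapping.single T q)) (Poly_Mapping.single U r) =
      wedge (Poly_Mapping.single S p) (wedge (Poly_Mapping.single T q) (Poly_Mapping.single U r))"
    for S T U :: "'v set" and p q r :: "('v, 'k) mpoly"
  proof -
    have "(wedge_sign S T * wedge_sign (S \<union> T) U) * (p * q * r) =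
        (wedge_sign T U * wedge_sign S (T \<union> U)) * (p * q * r)" by (simp only: wedge_sign_assoc)
    then show ?thesis by (simp add: wedge_single Un_assoc mult_ac)
  qed
  then have "wedge (wedge (Poly_Mapping.single S p) (Poly_Mapping.single T q)) c =
      wedge (Poly_Mapping.single S p) (wedge (Poly_Mapping.single T q) c)" for S T p q
    by (rule koszul_additive_eq[where a = c
          and f = "\<lambda>c. wedge (wedge (Poly_Mapping.single S p) (Poly_Mapping.single T q)) c"
          and g = "\<lambda>c. wedge (Poly_Mapping.single S p) (wedge (Poly_Mapping.single T q) c)", rotated 2])
      (simp_all only: add)
  then have "wedge (wedge (Poly_Mapping.single S p) b) c = wedge (Poly_Mapping.single S p) (wedge b c)" for S p
    by (rule koszul_additive_eq[where a = b and f = "\<lambda>b. wedge (wedge (Poly_Mapping.single S p) b) c"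
          and g = "\<lambda>b. wedge (Poly_Mapping.single S p) (wedge b c)", rotated 2])
      (simp_all only: add)
  then show ?thesis
    by (rule koszul_additive_eq[where a = a and f = "\<lambda>a. wedge (wedge a b) c"
          and g = "\<lambda>a. wedge a (wedge b c)", rotated 2])
      (simp_all only: add)
qed

lemma wedge_one_left: "wedge (Poly_Mapping.single {} 1) a = a"
  by (rule koszul_additive_eq[where f = "wedge (Poly_Mapping.single {} 1)" and g = "\<lambda>a. a"])
    (simp_all add: wedge_add_right wedge_single wedge_sign_def)

lemma wedge_one_right: "wedge a (Poly_Mapping.single {} 1) = a"
  by (rule koszul_additive_eq[where f = "\<lambda>a. wedge a (Poly_Mapping.single {} 1)" and g = "\<lambda>a. a"])
    (simp_all add: wedge_add_left wedge_single wedge_sign_def)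

lemma koszul_expand_degree:
  fixes a :: "('v::finite, 'k::comm_ring_1) koszul"
  assumes "\<forall>S. Poly_Mapping.lookup a S \<noteq> 0 \<longrightarrow> card S = i"
  shows "a = (\<Sum>S\<in>{S. card S = i}. Poly_Mapping.single S (Poly_Mapping.lookup a S))"
  by (rule poly_mapping_eqI) (use assms in \<open>auto simp: lookup_sum lookup_single when_def\<close>)

lemma wedge_sum_left: "wedge (\<Sum>x\<in>X. F x) b = (\<Sum>x\<in>X. wedge (F x) b)"
  by (rule additive_sum) (rule wedge_add_left)

lemma wedge_sum_right: "wedge a (\<Sum>x\<in>X. F x) = (\<Sum>x\<in>X. wedge a (F x))"
  by (rule additive_sum) (rule wedge_add_right)

theorem wedge_graded_commute:
  fixes a b :: "('v::{finite,linorder}, 'k::comm_ring_1) koszul"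
  assumes "\<forall>S. Poly_Mapping.lookup a S \<noteq> 0 \<longrightarrow> card S = i"
    and "\<forall>S. Poly_Mapping.lookup b S \<noteq> 0 \<longrightarrow> card S = j"
  shows "wedge b a = (if odd (i * j) then - wedge a b else wedge a b)"
proof -
  let ?a = "\<lambda>S. Poly_Mapping.single S (Poly_Mapping.lookup a S)"
  let ?b = "\<lambda>T. Poly_Mapping.single T (Poly_Mapping.lookup b T)"
  let ?A = "{S :: 'v set. card S = i}" and ?B = "{T :: 'v set. card T = j}"
  have ab: "wedge a b = (\<Sum>S\<in>?A. \<Sum>T\<in>?B. wedge (?a S) (?b T))"
    by (subst koszul_expand_degree[OF assms(1)], subst koszul_expand_degree[OF assms(2)])
      (simp add: wedge_sum_left wedge_sum_right, rule sum.swap)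
  have "wedge b a = (\<Sum>T\<in>?B. \<Sum>S\<in>?A. wedge (?b T) (?a S))"
    by (subst koszul_expand_degree[OF assms(1)], subst koszul_expand_degree[OF assms(2)])
      (simp add: wedge_sum_left wedge_sum_right, rule sum.swap)
  also have "\<dots> = (\<Sum>S\<in>?A. \<Sum>T\<in>?B. wedge (?b T) (?a S))" by (rule sum.swap)
  also have "\<dots> = (\<Sum>S\<in>?A. \<Sum>T\<in>?B. if odd (i * j) then - wedge (?a S) (?b T) else wedge (?a S) (?b T))"
  proof (intro sum.cong refl)
    fix S T assume "S \<in> ?A" "T \<in> ?B"
    then have "wedge_sign T S = ((- 1) ^ (i * j) * wedge_sign S T :: ('v, 'k) mpoly)"
      using wedge_sign_commute[of T S] by simp
    then show "wedge (?b T) (?a S) = (if odd (i * j) then - wedge (?a S) (?b T) else wedge (?a S) (?b T))"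
      by (cases "odd (i * j)") (simp_all add: wedge_single single_uminus Un_commute mult_ac)
  qed
  also have "\<dots> = (if odd (i * j) then - wedge a b else wedge a b)"
    by (simp add: ab sum_negf)
  finally show ?thesis .
qed

lemma koszul_leibniz_single:
  fixes b :: "('v::{finite,linorder}, 'k::comm_ring_1) koszul"
  shows "koszul_diff (wedge (Poly_Mapping.single S p) b) =
     wedge (koszul_diff (Poly_Mapping.single S p)) b +
     wedge (Poly_Mapping.single S ((- 1) ^ card S * p)) (koszul_diff b)"
proof (rule koszul_additive_eq[where a = b and f = "\<lambda>b. koszul_diff (wedge (Poly_Mapping.single S p) b)"])
  fix T :: "'v set" and q :: "('v, 'k) mpoly"
  let ?c = "\<lambda>S v. (- 1) ^ card {u \<in> S. u < (v::'v)} :: ('v, 'k) mpoly"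
  let ?I = "\<lambda>S T. {(u, v). u \<in> S \<and> v \<in> T \<and> v < (u::'v)}"
  define A where "A v = wedge_sign (S - {v}) T * ?c S v * mvar v * p * q" for v
  define B where "B v = (- 1) ^ card S * wedge_sign S (T - {v}) * ?c T v * mvar v * p * q" for v
  have I1: "card (?I S T) = card (?I (S - {v}) T) + card {u \<in> T. u < v}" if "v \<in> S" for v
  proof -
    have "?I S T = ?I (S - {v}) T \<union> Pair v ` {u \<in> T. u < v}" using that by auto
    moreover have "?I (S - {v}) T \<inter> Pair v ` {u \<in> T. u < v} = {}" by auto
    ultimately show ?thesis by (simp add: card_Un_disjoint card_image inj_on_def)
  qed
  have I2: "card (?I S T) + card {u \<in> S. u \<le> v} = card (?I S (T - {v})) + card S" if "v \<in> T" for v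
  proof -
    have "?I S T = ?I S (T - {v}) \<union> (\<lambda>u. (u, v)) ` {u \<in> S. v < u}" using that by auto
    moreover have "?I S (T - {v}) \<inter> (\<lambda>u. (u, v)) ` {u \<in> S. v < u} = {}" by auto
    ultimately have "card (?I S T) = card (?I S (T - {v})) + card {u \<in> S. v < u}"
      by (simp add: card_Un_disjoint card_image inj_on_def)
    moreover have "S = {u \<in> S. v < u} \<union> {u \<in> S. u \<le> v}" by auto
    then have "card S = card {u \<in> S. v < u} + card {u \<in> S. u \<le> v}"
      by (metis (no_types, lifting) card_Un_disjoint disjoint_iff finite leD mem_Collect_eq)
    ultimately show ?thesis by simp
  qed
  have L: "wedge (koszul_diff (Poly_Mapping.single S p)) (Poly_Mapping.single T q) =
      (\<Sum>v\<in>S. Poly_Mapping.single ((S - {v}) \<union> T) (A v))"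
    by (simp add: koszul_diff_single wedge_sum_left wedge_single A_def mult_ac)
  have R: "wedge (Poly_Mapping.single S ((- 1) ^ card S * p)) (koszul_diff (Poly_Mapping.single T q)) =
      (\<Sum>v\<in>T. Poly_Mapping.single (S \<union> (T - {v})) (B v))"
    by (simp add: koszul_diff_single wedge_sum_right wedge_single B_def mult_ac)
  show "koszul_diff (wedge (Poly_Mapping.single S p) (Poly_Mapping.single T q)) =
     wedge (koszul_diff (Poly_Mapping.single S p)) (Poly_Mapping.single T q) +
     wedge (Poly_Mapping.single S ((- 1) ^ card S * p)) (koszul_diff (Poly_Mapping.single T q))"
  proof (cases "S \<inter> T = {}")
    case True
    have c: "?c (S \<union> T) v = ?c S v * ?c T v" for v
    proof -
      have "{u \<in> S \<union> T. u < v} = {u \<in> S. u < v} \<union> {u \<in> T. u < v}" by auto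
      moreover have "{u \<in> S. u < v} \<inter> {u \<in> T. u < v} = {}" using True by auto
      ultimately show ?thesis by (simp add: card_Un_disjoint power_add)
    qed
    have sq: "(- 1) ^ n * (- 1) ^ n = (1 :: ('v, 'k) mpoly)" for n
      by (simp flip: power_add mult_2 add: power_mult)
    let ?D = "\<lambda>v. ?c (S \<union> T) v * mvar v * (wedge_sign S T * p * q)"
    have "koszul_diff (wedge (Poly_Mapping.single S p) (Poly_Mapping.single T q)) =
        (\<Sum>v\<in>S \<union> T. Poly_Mapping.single (S \<union> T - {v}) (?D v))"
      by (simp add: wedge_single koszul_diff_single)
    also have "\<dots> = (\<Sum>v\<in>S. Poly_Mapping.single (S \<union> T - {v}) (?D v)) +
        (\<Sum>v\<in>T. Poly_Mapping.single (S \<union> T - {v}) (?D v))"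
      by (rule sum.union_disjoint) (use True in auto)
    also have "(\<Sum>v\<in>S. Poly_Mapping.single (S \<union> T - {v}) (?D v)) =
        (\<Sum>v\<in>S. Poly_Mapping.single ((S - {v}) \<union> T) (A v))"
    proof (rule sum.cong[OF refl])
      fix v assume v: "v \<in> S"
      have "S \<union> T - {v} = (S - {v}) \<union> T" using True v by auto
      moreover have "(- 1) ^ card (?I S T) * ?c T v = (- 1) ^ card (?I (S - {v}) T)"
        by (simp only: I1[OF v] power_add mult.assoc sq mult_1_right)
      then have "?D v = A v"
        using True v by (simp only: c A_def wedge_sign_def) (auto simp: mult_ac)
      ultimately show "Poly_Mapping.single (S \<union> T - {v}) (?D v) =
          Poly_Mapping.single ((S - {v}) \<union> T) (A v)" by simp
    qed
    also have "(\<Sum>v\<in>T. Poly_Mapping.single (S \<union> T - {v}) (?D v)) =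
        (\<Sum>v\<in>T. Poly_Mapping.single (S \<union> (T - {v})) (B v))"
    proof (rule sum.cong[OF refl])
      fix v assume v: "v \<in> T"
      have "{u \<in> S. u \<le> v} = {u \<in> S. u < v}" using True v by (auto simp: order_le_less)
      with I2[OF v] have sign: "(- 1 :: ('v, 'k) mpoly) ^ card (?I S T) * ?c S v =
          (- 1) ^ card (?I S (T - {v})) * (- 1) ^ card S" by (simp flip: power_add)
      have ST: "S \<inter> (T - {v}) = {}" using True by auto
      have "?D v = ((- 1) ^ card (?I S T) * ?c S v) * (?c T v * mvar v * p * q)"
        by (simp only: c wedge_sign_def True if_True simp_thms mult_ac)
      also have "\<dots> = B v" unfolding sign
        by (simp only: B_def wedge_sign_def ST if_True simp_thms mult_ac)
      finally have "?D v = B v" .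
      moreover have "S \<union> T - {v} = S \<union> (T - {v})" using True v by auto
      ultimately show "Poly_Mapping.single (S \<union> T - {v}) (?D v) =
          Poly_Mapping.single (S \<union> (T - {v})) (B v)" by simp
    qed
    finally show ?thesis unfolding L R .
  next
    case False
    then obtain w where w: "w \<in> S" "w \<in> T" by auto
    have A0: "A v = 0" if "v \<noteq> w" for v using that w by (auto simp: A_def wedge_sign_def)
    have B0: "B v = 0" if "v \<noteq> w" for v using that w by (auto simp: B_def wedge_sign_def)
    have A: "wedge (koszul_diff (Poly_Mapping.single S p)) (Poly_Mapping.single T q) =
        Poly_Mapping.single (S \<union> T) (A w)"
    proof -
      have "(\<Sum>v\<in>S. Poly_Mapping.single ((S - {v}) \<union> T) (A v)) =
        (\<Sum>v\<in>S. if v = w then Poly_Mapping.single ((S - {v}) \<union> T) (A v) else 0)"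
        using A0 by (intro sum.cong) auto
      also have "\<dots> = Poly_Mapping.single ((S - {w}) \<union> T) (A w)" using w by simp
      also have "(S - {w}) \<union> T = S \<union> T" using w by auto
      finally show ?thesis unfolding L .
    qed
    have B: "wedge (Poly_Mapping.single S ((- 1) ^ card S * p)) (koszul_diff (Poly_Mapping.single T q)) =
        Poly_Mapping.single (S \<union> T) (B w)"
    proof -
      have "(\<Sum>v\<in>T. Poly_Mapping.single (S \<union> (T - {v})) (B v)) =
        (\<Sum>v\<in>T. if v = w then Poly_Mapping.single (S \<union> (T - {v})) (B v) else 0)"
        using B0 by (intro sum.cong) auto
      also have "\<dots> = Poly_Mapping.single (S \<union> (T - {w})) (B w)" using w by simp
      also have "S \<union> (T - {w}) = S \<union> T" using w by auto
      finally show ?thesis unfolding R .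
    qed
    have "A w + B w = 0"
    proof (cases "S \<inter> T = {w}")
      case True
      have 1: "(S - {w}) \<inter> T = {}" "S \<inter> (T - {w}) = {}" using True by auto
      have "{u \<in> S. u \<le> w} = insert w {u \<in> S. u < w}" using w by auto
      then have "card {u \<in> S. u \<le> w} = Suc (card {u \<in> S. u < w})" by simp
      with I1[OF w(1)] I2[OF w(2)]
      have "card (?I (S - {w}) T) + card {u \<in> T. u < w} + Suc (card {u \<in> S. u < w}) =
          card (?I S (T - {w})) + card S" by simp
      then have "(- 1) ^ (card (?I (S - {w}) T) + card {u \<in> T. u < w} + Suc (card {u \<in> S. u < w})) =
          (- 1 :: ('v, 'k) mpoly) ^ (card (?I S (T - {w})) + card S)" by simp
      then have *: "(- 1) ^ card S * (- 1) ^ card (?I S (T - {w})) =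
          - ((- 1) ^ card (?I (S - {w}) T) * ?c S w * ?c T w)"
        by (simp add: power_add mult_ac)
      have "?c T w * ?c T w = 1" by (simp flip: power_add mult_2 add: power_mult)
      then show ?thesis unfolding A_def B_def wedge_sign_def
        by (simp only: 1 if_True simp_thms *) (simp add: algebra_simps)
    next
      case False
      then have "(S - {w}) \<inter> T \<noteq> {}" "S \<inter> (T - {w}) \<noteq> {}" using w by auto
      then show ?thesis by (simp add: A_def B_def wedge_sign_def)
    qed
    moreover have "wedge (Poly_Mapping.single S p) (Poly_Mapping.single T q) = 0"
      using False by (simp add: wedge_single wedge_sign_def)
    ultimately show ?thesis unfolding A B by (simp add: koszul_diff_def flip: single_add)
  qed
qed (simp_all add: koszul_diff_add wedge_add_right)


definition parity_twist :: "('v::{finite,linorder}, 'k::comm_ring_1) koszul \<Rightarrow> ('v, 'k) koszul" where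
  "parity_twist a = (\<Sum>S\<in>UNIV. Poly_Mapping.single S ((- 1) ^ card S * Poly_Mapping.lookup a S))"

lemma lookup_parity_twist:
  "Poly_Mapping.lookup (parity_twist a) S = (- 1) ^ card S * Poly_Mapping.lookup a S"
  by (simp add: parity_twist_def lookup_sum lookup_single when_def)

lemma parity_twist_add: "parity_twist (a + b) = parity_twist a + parity_twist b"
  by (rule poly_mapping_eqI) (simp add: lookup_add lookup_parity_twist algebra_simps)

lemma parity_twist_twist: "parity_twist (parity_twist a) = a"
proof (rule poly_mapping_eqI)
  fix S
  have "(- 1) ^ card S * (- 1) ^ card S * Poly_Mapping.lookup a S = Poly_Mapping.lookup a S"
    by (simp flip: power_add mult_2 add: power_mult)
  then show "Poly_Mapping.lookup (parity_twist (parity_twist a)) S = Poly_Mapping.lookup a S"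
    by (simp add: lookup_parity_twist mult.assoc)
qed

lemma parity_twist_single:
  "parity_twist (Poly_Mapping.single S p) = Poly_Mapping.single S ((- 1) ^ card S * p)"
  by (rule poly_mapping_eqI) (simp add: lookup_parity_twist lookup_single when_def)

theorem koszul_leibniz:
  fixes a b :: "('v::{finite,linorder}, 'k::comm_ring_1) koszul"
  shows "koszul_diff (wedge a b) = wedge (koszul_diff a) b + wedge (parity_twist a) (koszul_diff b)"
  by (rule koszul_additive_eq[where a = a and f = "\<lambda>a. koszul_diff (wedge a b)"])
    (simp_all add: koszul_leibniz_single parity_twist_single koszul_diff_add wedge_add_left parity_twist_add)

lemma koszul_diff_parity_twist:
  fixes a :: "('v::{finite,linorder}, 'k::comm_ring_1) koszul"
  shows "koszul_diff (parity_twist a) = - parity_twist (koszul_diff a)"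
proof (rule koszul_additive_eq[where a = a and f = "\<lambda>a. koszul_diff (parity_twist a)"])
  fix S :: "'v set" and p :: "('v, 'k) mpoly"
  have card: "(- 1) ^ card S = - ((- 1) ^ card (S - {v}) :: ('v, 'k) mpoly)" if "v \<in> S" for v
    using that card_Suc_Diff1[of S v] by (metis finite mult_minus1 power_Suc)
  have "koszul_diff (parity_twist (Poly_Mapping.single S p)) =
      (\<Sum>v\<in>S. - parity_twist (Poly_Mapping.single (S - {v}) ((- 1) ^ card {u \<in> S. u < v} * mvar v * p)))"
    unfolding parity_twist_single koszul_diff_single
  proof (rule sum.cong[OF refl])
    fix v assume "v \<in> S"
    then show "Poly_Mapping.single (S - {v}) ((- 1) ^ card {u \<in> S. u < v} * mvar v * ((- 1) ^ card S * p)) =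
       - Poly_Mapping.single (S - {v}) ((- 1) ^ card (S - {v}) * ((- 1) ^ card {u \<in> S. u < v} * mvar v * p))"
      by (simp only: card) (simp add: single_uminus mult_ac)
  qed
  then show "koszul_diff (parity_twist (Poly_Mapping.single S p)) =
      - parity_twist (koszul_diff (Poly_Mapping.single S p))"
    by (simp add: koszul_diff_single sum_negf additive_sum[of parity_twist, OF parity_twist_add])
qed (simp_all add: koszul_diff_add parity_twist_add)


section \<open>Bigraded algebras\<close>

text \<open>
  The base field is the subset \<open>scalars A\<close> of the ring, so that spans, independence and dimension
  are those of \<^theory>\<open>HOL-Algebra.Embedded_Algebras\<close>.
\<close>

record 'a bigraded_algebra = "'a ring" +
  scalars :: "'a set"
  component :: "nat \<Rightarrow> nat \<Rightarrow> 'a set"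

definition alg_span :: "('a, 'b) bigraded_algebra_scheme \<Rightarrow> 'a set \<Rightarrow> 'a set" where
  "alg_span A V = (\<Union>us\<in>lists V. ring.Span A (scalars A) us)"

definition alg_dim :: "('a, 'b) bigraded_algebra_scheme \<Rightarrow> 'a set \<Rightarrow> nat" where
  "alg_dim A V = ring.dim A (scalars A) V"

definition hom_component :: "('a, 'b) bigraded_algebra_scheme \<Rightarrow> nat \<Rightarrow> 'a set" where
  "hom_component A i = alg_span A (\<Union>d. component A i d)"

definition product_space :: "('a, 'b) bigraded_algebra_scheme \<Rightarrow> 'a set \<Rightarrow> 'a set \<Rightarrow> 'a set" where
  "product_space A V W = alg_span A {v \<otimes>\<^bsub>A\<^esub> w | v w. v \<in> V \<and> w \<in> W}"

definition hom_basis ::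
    "('a, 'b) bigraded_algebra_scheme \<Rightarrow> nat \<Rightarrow> nat \<Rightarrow> (nat \<Rightarrow> 'a) \<Rightarrow> bool" where
  "hom_basis A i n b \<longleftrightarrow>
     ring.independent A (scalars A) (map b [1..<Suc n]) \<and>
     ring.Span A (scalars A) (map b [1..<Suc n]) = hom_component A i"


subsection \<open>Classes\<close>

text \<open>
  \<open>\<mu>\<close> and \<open>\<nu>\<close> list the nonzero products \<open>e\<^sub>i e\<^sub>j\<close> and \<open>e\<^sub>i f\<^sub>j\<close>. The list \<open>\<mu>\<close> is up to graded
  commutativity: an entry for \<open>(j, i)\<close> also determines \<open>e\<^sub>i e\<^sub>j = - e\<^sub>j e\<^sub>i\<close>.
\<close>

definition only_products ::
    "('a, 'b) bigraded_algebra_scheme \<Rightarrow> nat \<Rightarrow> (nat \<Rightarrow> 'a) \<Rightarrow> nat \<Rightarrow> (nat \<Rightarrow> 'a) \<Rightarrow>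
     (nat \<Rightarrow> nat \<Rightarrow> 'a option) \<Rightarrow> (nat \<Rightarrow> nat \<Rightarrow> 'a option) \<Rightarrow> bool" where
  "only_products A m e n f \<mu> \<nu> \<longleftrightarrow>
     (\<forall>i\<in>{1..m}. \<forall>j\<in>{1..m}. e i \<otimes>\<^bsub>A\<^esub> e j =
        (case \<mu> i j of Some y \<Rightarrow> y
         | None \<Rightarrow> (case \<mu> j i of Some y \<Rightarrow> \<ominus>\<^bsub>A\<^esub> y | None \<Rightarrow> \<zero>\<^bsub>A\<^esub>))) \<and>
     (\<forall>i\<in>{1..m}. \<forall>j\<in>{1..n}. e i \<otimes>\<^bsub>A\<^esub> f j =
        (case \<nu> i j of Some y \<Rightarrow> y | None \<Rightarrow> \<zero>\<^bsub>A\<^esub>))"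

datatype tor_class = Class_T | Class_G nat | Class_H nat nat

text \<open>
  The inequalities say that every basis element occurring in the multiplication table exists;
  thus \<open>e\<^sub>p\<^sub>+\<^sub>1\<close> is needed in \<open>Class_H p q\<close> unless \<open>p = q = 0\<close>.
\<close>

fun has_class :: "('a, 'b) bigraded_algebra_scheme \<Rightarrow> tor_class \<Rightarrow> bool" where
  "has_class A Class_T \<longleftrightarrow>
     (\<exists>m n l e f g. hom_basis A 1 m e \<and> hom_basis A 2 n f \<and> hom_basis A 3 l g \<and>
        3 \<le> m \<and> 3 \<le> n \<and>
        only_products A m e n f
          (\<lambda>i j. if (i, j) = (1, 2) then Some (f 3)
                 else if (i, j) = (3, 1) then Some (f 2)
                 else if (i, j) = (2, 3) then Some (f 1) else None)
          (\<lambda>i j. None))"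
| "has_class A (Class_G r) \<longleftrightarrow>
     (\<exists>m n l e f g. hom_basis A 1 m e \<and> hom_basis A 2 n f \<and> hom_basis A 3 l g \<and>
        r \<le> m \<and> r \<le> n \<and> (r > 0 \<longrightarrow> 1 \<le> l) \<and>
        only_products A m e n f
          (\<lambda>i j. None)
          (\<lambda>i j. if i = j \<and> i \<le> r then Some (g 1) else None))"
| "has_class A (Class_H p q) \<longleftrightarrow>
     (\<exists>m n l e f g. hom_basis A 1 m e \<and> hom_basis A 2 n f \<and> hom_basis A 3 l g \<and>
        (p > 0 \<or> q > 0 \<longrightarrow> p + 1 \<le> m) \<and> p + q \<le> n \<and> q \<le> l \<and>
        only_products A m e n f
          (\<lambda>i j. if i = p + 1 \<and> j \<le> p then Some (f j) else None)
          (\<lambda>i j. if i = p + 1 \<and> p < j \<and> j \<le> p + q then Some (g (j - p)) else None))"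


subsection \<open>Maximum multiplication rank\<close>

definition mult_rank_bound ::
    "('a, 'b) bigraded_algebra_scheme \<Rightarrow> nat \<Rightarrow> nat \<Rightarrow> nat \<Rightarrow> nat \<Rightarrow> nat" where
  "mult_rank_bound A i d j e =
     (if odd i \<and> j = i \<and> e = d
      then min (alg_dim A (component A i d) choose 2) (alg_dim A (component A (2 * i) (2 * d)))
      else min (alg_dim A (component A i d) * alg_dim A (component A j e))
               (alg_dim A (component A (i + j) (d + e))))"

definition poincare_duality :: "('a, 'b) bigraded_algebra_scheme \<Rightarrow> nat \<Rightarrow> bool" where
  "poincare_duality A c \<longleftrightarrow>
     alg_dim A (hom_component A c) = 1 \<and>
     (\<forall>i>c. hom_component A i = {\<zero>\<^bsub>A\<^esub>}) \<and>
     (\<forall>i\<le>c. \<forall>a\<in>hom_component A i. a \<noteq> \<zero>\<^bsub>A\<^esub> \<longrightarrow>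
        (\<exists>b\<in>hom_component A (c - i). a \<otimes>\<^bsub>A\<^esub> b \<noteq> \<zero>\<^bsub>A\<^esub>))"

text \<open>
  Under Poincare duality with top degree \<open>c = i + j + l\<close>, the products \<open>A\<^sub>i A\<^sub>j\<close>, \<open>A\<^sub>i A\<^sub>l\<close>, \<open>A\<^sub>j A\<^sub>l\<close>
  vanish simultaneously. So \<open>A\<^sub>i A\<^sub>j\<close> is forced to vanish if \<open>A\<^sub>i A\<^sub>l\<close> or \<open>A\<^sub>j A\<^sub>l\<close> is zero because all
  its rank bounds are zero. (Exempting \<open>A\<^sub>i A\<^sub>j\<close> whenever \<open>A\<^sub>i A\<^sub>l\<close> or \<open>A\<^sub>j A\<^sub>l\<close> happens to vanish would
  be circular, as the three products could then exempt each other.)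
\<close>

definition forced_to_vanish :: "('a, 'b) bigraded_algebra_scheme \<Rightarrow> nat \<Rightarrow> nat \<Rightarrow> bool" where
  "forced_to_vanish A i j \<longleftrightarrow>
     (\<exists>l. poincare_duality A (i + j + l) \<and>
          ((\<forall>d e. mult_rank_bound A i d l e = 0) \<or> (\<forall>d e. mult_rank_bound A j d l e = 0)))"

definition max_mult_rank :: "('a, 'b) bigraded_algebra_scheme \<Rightarrow> bool" where
  "max_mult_rank A \<longleftrightarrow>
     (\<forall>i d j e. \<not> forced_to_vanish A i j \<longrightarrow>
        alg_dim A (product_space A (component A i d) (component A j e)) = mult_rank_bound A i d j e)"


section \<open>The Tor algebra\<close>

text \<open>
  For an ideal \<open>J\<close> of \<open>Q\<close> and \<open>R = Q/J\<close>, the algebra \<open>Tor\<^sup>Q(R, k)\<close> is the homology of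
  \<open>R \<otimes>\<^sub>Q K = K/JK\<close> for the free resolution \<open>K\<close> of \<open>k\<close>, with the product induced by that of \<open>K\<close>.
  Here \<open>JK\<close> consists of the elements with all coefficients in \<open>J\<close>. The homology is presented as
  \<open>Z/B\<close>, with \<open>Z\<close> and \<open>B\<close> the preimages in \<open>K\<close> of the cycles and boundaries of \<open>K/JK\<close>; by
  \<open>ideal_tor_boundaries\<close> below, \<open>B\<close> is a two-sided ideal of the ring \<open>Z\<close>.
\<close>

definition tor_cycles ::
    "('v::{finite,linorder}, 'k::field) mpoly set \<Rightarrow> ('v, 'k) koszul set" where
  "tor_cycles J = {a. \<forall>S. Poly_Mapping.lookup (koszul_diff a) S \<in> J}"

definition tor_boundaries ::
    "('v::{finite,linorder}, 'k::field) mpoly set \<Rightarrow> ('v, 'k) koszul set" where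
  "tor_boundaries J = {a. \<exists>b. \<forall>S. Poly_Mapping.lookup (a - koszul_diff b) S \<in> J}"

definition tor_cycle_ring ::
    "('v::{finite,linorder}, 'k::field) mpoly set \<Rightarrow> ('v, 'k) koszul ring" where
  "tor_cycle_ring J =
     \<lparr>carrier = tor_cycles J, mult = wedge, one = Poly_Mapping.single {} 1, zero = 0, add = (+)\<rparr>"

definition tor_algebra ::
    "('v::{finite,linorder}, 'k::field) mpoly set \<Rightarrow> ('v, 'k) koszul set bigraded_algebra" where
  "tor_algebra J =
     (let Z = tor_cycle_ring J; B = tor_boundaries J in
      ring.extend (Z Quot B)
        (bigraded_algebra.fields
           {B +>\<^bsub>Z\<^esub> Poly_Mapping.single {} (mconst c) | c. True}
           (\<lambda>i d. {B +>\<^bsub>Z\<^esub> z | z. z \<in> tor_cycles J \<inter> koszul_component i d})))"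


lemma module_mult: "Modules.module ((*) :: 'r::comm_ring_1 \<Rightarrow> _)"
  by unfold_locales (simp_all add: algebra_simps)

lemma subspace_vanishing_ideal: "module.subspace (*) (vanishing_ideal X)"
  unfolding vanishing_ideal_def by (rule module.subspace_span[OF module_mult])

context
  fixes J :: "('v::{finite,linorder}, 'k::field) mpoly set"
  assumes J: "module.subspace (*) J"
begin

private definition JK :: "('v, 'k) koszul set" where
  "JK = {a. \<forall>S. Poly_Mapping.lookup a S \<in> J}"

private lemma J_closed: "0 \<in> J" "x \<in> J \<Longrightarrow> y \<in> J \<Longrightarrow> x + y \<in> J" "x \<in> J \<Longrightarrow> q * x \<in> J"
  using J unfolding module.subspace_def[OF module_mult] by auto

private lemma JK_closed:
  "0 \<in> JK" "a \<in> JK \<Longrightarrow> b \<in> JK \<Longrightarrow> a + b \<in> JK" "a \<in> JK \<Longrightarrow> - a \<in> JK" "a \<in> JK \<Longrightarrow> parity_twist a \<in> JK"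
  using J_closed(3)[of _ "- 1"]
  by (auto simp: JK_def lookup_add lookup_parity_twist intro: J_closed)

private lemma JK_sum: "(\<And>x. x \<in> X \<Longrightarrow> f x \<in> JK) \<Longrightarrow> sum f X \<in> JK"
  by (induction X rule: infinite_finite_induct) (auto intro: JK_closed)

private lemma JK_single: "x \<in> J \<Longrightarrow> Poly_Mapping.single S x \<in> JK"
  by (auto simp: JK_def lookup_single when_def intro: J_closed)

private lemma JK_wedge_left: "wedge a b \<in> JK" if "a \<in> JK"
proof -
  have "p * x * y \<in> J" if "x \<in> J" for p x y using J_closed(3)[OF that, of "p * y"] by (simp add: mult_ac)
  with that show ?thesis unfolding wedge_def by (intro JK_sum JK_single) (auto simp: JK_def)
qed

private lemma JK_wedge_right: "wedge a b \<in> JK" if "b \<in> JK"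
  unfolding wedge_def using that by (intro JK_sum JK_single J_closed) (auto simp: JK_def)

private lemmas JK_wedge = JK_wedge_left JK_wedge_right

private lemma tor_cycles_iff: "a \<in> tor_cycles J \<longleftrightarrow> koszul_diff a \<in> JK"
  by (simp add: tor_cycles_def JK_def)

private lemma tor_boundaries_iff: "a \<in> tor_boundaries J \<longleftrightarrow> (\<exists>b. a - koszul_diff b \<in> JK)"
  by (simp add: tor_boundaries_def JK_def)

private lemma JK_diff: "a \<in> JK \<Longrightarrow> koszul_diff a \<in> JK"
  unfolding koszul_diff_def by (intro JK_sum JK_single J_closed) (auto simp: JK_def)

private lemma koszul_diff_uminus: "koszul_diff (- a) = - koszul_diff a"
  using koszul_diff_add[of a "- a"] by (simp add: koszul_diff_zero eq_neg_iff_add_eq_0 add.commute)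

private lemma koszul_diff_one: "koszul_diff (Poly_Mapping.single {} q) = 0"
  by (simp add: koszul_diff_single)

theorem ring_tor_cycle_ring: "ring (tor_cycle_ring J)"
proof (rule ringI)
  show "abelian_group (tor_cycle_ring J)"
  proof (rule abelian_groupI)
    fix a assume "a \<in> carrier (tor_cycle_ring J)"
    then have "- a \<in> tor_cycles J"
      by (simp add: tor_cycle_ring_def tor_cycles_iff koszul_diff_uminus JK_closed)
    then show "\<exists>b\<in>carrier (tor_cycle_ring J). b \<oplus>\<^bsub>tor_cycle_ring J\<^esub> a = \<zero>\<^bsub>tor_cycle_ring J\<^esub>"
      by (auto simp: tor_cycle_ring_def intro!: bexI[of _ "- a"])
  qed (auto simp: tor_cycle_ring_def tor_cycles_iff koszul_diff_add koszul_diff_zero add_ac JK_closed)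
  show "Group.monoid (tor_cycle_ring J)"
    by (rule monoidI)
      (auto simp: tor_cycle_ring_def tor_cycles_iff koszul_leibniz koszul_diff_one wedge_assoc
        wedge_one_left wedge_one_right intro!: JK_closed intro: JK_wedge)
qed (auto simp: tor_cycle_ring_def wedge_add_left wedge_add_right)

theorem ideal_tor_boundaries: "ideal (tor_boundaries J) (tor_cycle_ring J)"
proof (rule idealI[OF ring_tor_cycle_ring])
  interpret Z: ring "tor_cycle_ring J" by (rule ring_tor_cycle_ring)
  have sub: "a \<in> tor_cycles J" if "a \<in> tor_boundaries J" for a
  proof -
    from that obtain b where "a - koszul_diff b \<in> JK" by (auto simp: tor_boundaries_iff)
    from JK_diff[OF this] have "koszul_diff (a + - koszul_diff b) \<in> JK" by simp
    then show ?thesis by (simp only: koszul_diff_add koszul_diff_uminus koszul_diff_diff tor_cycles_iff) simp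
  qed
  have uminus: "- a \<in> tor_boundaries J" if "a \<in> tor_boundaries J" for a
  proof -
    from that obtain b where "a - koszul_diff b \<in> JK" by (auto simp: tor_boundaries_iff)
    from JK_closed(3)[OF this] have "- a - koszul_diff (- b) \<in> JK" by (simp add: koszul_diff_uminus)
    then show ?thesis by (auto simp: tor_boundaries_iff)
  qed
  have inv: "inv\<^bsub>add_monoid (tor_cycle_ring J)\<^esub> a = - a" if "a \<in> tor_cycles J" for a
    using that Z.add.inv_equality[of "- a" a]
    by (simp add: tor_cycle_ring_def tor_cycles_iff koszul_diff_uminus JK_closed a_inv_def)
  show "subgroup (tor_boundaries J) (add_monoid (tor_cycle_ring J))"
  proof
    show "tor_boundaries J \<subseteq> carrier (add_monoid (tor_cycle_ring J))"
      using sub by (auto simp: tor_cycle_ring_def)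
    show "\<one>\<^bsub>add_monoid (tor_cycle_ring J)\<^esub> \<in> tor_boundaries J"
      by (auto simp: tor_cycle_ring_def tor_boundaries_iff koszul_diff_zero JK_closed intro!: exI[of _ 0])
    fix a assume a: "a \<in> tor_boundaries J"
    then show "inv\<^bsub>add_monoid (tor_cycle_ring J)\<^esub> a \<in> tor_boundaries J"
      using sub uminus inv by simp
    fix b assume "b \<in> tor_boundaries J"
    with a obtain a' b' where "a - koszul_diff a' \<in> JK" "b - koszul_diff b' \<in> JK"
      by (auto simp: tor_boundaries_iff)
    from JK_closed(2)[OF this] have "a + b - koszul_diff (a' + b') \<in> JK"
      by (simp add: koszul_diff_add algebra_simps)
    then show "a \<otimes>\<^bsub>add_monoid (tor_cycle_ring J)\<^esub> b \<in> tor_boundaries J"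
      by (auto simp: tor_cycle_ring_def tor_boundaries_iff)
  qed
  fix a z assume "a \<in> tor_boundaries J" and "z \<in> carrier (tor_cycle_ring J)"
  then obtain b where z: "koszul_diff z \<in> JK" and b: "a - koszul_diff b \<in> JK"
    by (auto simp: tor_boundaries_iff tor_cycle_ring_def tor_cycles_iff)
  define c where "c = a - koszul_diff b"
  have a: "a = koszul_diff b + c" and c: "c \<in> JK" using b by (simp_all add: c_def)
  have "koszul_diff (wedge (parity_twist z) b) =
      wedge (- parity_twist (koszul_diff z)) b + wedge z (koszul_diff b)"
    by (simp add: koszul_leibniz koszul_diff_parity_twist parity_twist_twist)
  then have "wedge z a - koszul_diff (wedge (parity_twist z) b) =
      wedge z c + - wedge (- parity_twist (koszul_diff z)) b"
    by (simp add: a wedge_add_right)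
  also have "\<dots> \<in> JK" using z c by (intro JK_closed(2,3)) (auto intro: JK_wedge JK_closed)
  finally show "z \<otimes>\<^bsub>tor_cycle_ring J\<^esub> a \<in> tor_boundaries J"
    by (auto simp: tor_boundaries_iff tor_cycle_ring_def)
  have "wedge a z - koszul_diff (wedge b z) = wedge c z + - wedge (parity_twist b) (koszul_diff z)"
    by (simp add: a wedge_add_left koszul_leibniz)
  also have "\<dots> \<in> JK" using z c by (intro JK_closed(2,3)) (auto intro: JK_wedge)
  finally show "a \<otimes>\<^bsub>tor_cycle_ring J\<^esub> z \<in> tor_boundaries J"
    by (auto simp: tor_boundaries_iff tor_cycle_ring_def)
qed

end

end

theory Submission
  imports Defs "Jordan_Normal_Form.Determinant"
begin

text \<open>
  If no form of degree \<open>s\<close> vanishes at the points and forms of degree \<open>r \<le> s + 1\<close> separate them, then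
  \<open>A\<^sub>i\<close> lives in internal degrees \<open>i + s\<close> to \<open>i + r\<close>. For \<open>t = 4\<close> and \<open>t \<ge> 11\<close> one has \<open>r < 2s\<close>, and all
  products vanish for degree reasons. For \<open>5 \<le> t \<le> 10\<close>, where \<open>s = 1\<close> and \<open>r = 2\<close>, only the products of
  quadrics with quadrics and with linear syzygies of quadrics can be nonzero.

  Five points form a Gorenstein scheme with five quadrics, and the products of quadrics and linear
  syzygies are a perfect pairing into the socle. Through six points passes a twisted cubic: the
  quadrics are the three minors of a \<open>2 \<times> 3\<close> matrix of linear forms, whose rows are the linear
  syzygies, and one further quadric, which is a nonzerodivisor modulo the minors. A seventh point
  off the cubic destroys the linear syzygies, and then the products of the \<open>10 - t\<close> remaining quadrics
  are independent.

  All genericity conditions are expressed by the nonvanishing of determinants, which is verified at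
  sample points found inductively: a nonzero form vanishing at the previous points is nonzero at
  some further point.
\<close>

section \<open>Evaluation and homogeneous components\<close>

text \<open>No free resolution of \<open>R\<close> is at hand, so Tor is computed from the Koszul
  side, point by point. A homogeneous element of the Koszul complex lies in \<open>JK\<close>
  exactly when its values at all points vanish. At a single point the differential becomes
  contraction with the coordinate vector, which is exact on the exterior algebra. Hence a cycle has
  a local primitive at every point, and its Tor class is the obstruction to gluing these primitives
  by forms of the available degree. Written as linear functionals, the obstructions bound dimensions
  from above, and explicit cycles bound them from below; for five points the same functionals also
  compute the products. Points enter through chosen coordinate vectors, which may be rescaled; this
  is used to make the fifth vector the sum of the first four. Since closed sets of the product are
  cut out by multihomogeneous polynomials, the multidegree of every determinant has to be
  tracked.\<close>

definition mon_eval :: "('v \<Rightarrow>\<^sub>0 nat) \<Rightarrow> ('v \<Rightarrow> 'k::comm_ring_1) \<Rightarrow> 'k" where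
  "mon_eval m x = (\<Prod>v\<in>Poly_Mapping.keys m. x v ^ Poly_Mapping.lookup m v)"

lemma mon_eval_superset:
  "finite V \<Longrightarrow> Poly_Mapping.keys m \<subseteq> V \<Longrightarrow> mon_eval m x = (\<Prod>v\<in>V. x v ^ Poly_Mapping.lookup m v)"
  unfolding mon_eval_def by (rule prod.mono_neutral_left) (auto simp: in_keys_iff)

lemma mon_eval_zero [simp]: "mon_eval 0 x = 1"
  by (simp add: mon_eval_def)

lemma mon_eval_add: "mon_eval (m + n) x = mon_eval m x * mon_eval n x"
proof -
  let ?V = "Poly_Mapping.keys m \<union> Poly_Mapping.keys n"
  have "Poly_Mapping.keys (m + n) \<subseteq> ?V" by (rule Poly_Mapping.keys_add)
  then show ?thesis
    by (subst (1 2 3) mon_eval_superset[of ?V]) (auto simp: lookup_add power_add prod.distrib)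
qed

lemma mon_eval_single [simp]: "mon_eval (Poly_Mapping.single v n) x = x v ^ n"
  by (subst mon_eval_superset[of "{v}"]) (auto simp: lookup_single)

lemma mpoly_eval_superset:
  assumes "finite M" "Poly_Mapping.keys f \<subseteq> M"
  shows "mpoly_eval f x = (\<Sum>m\<in>M. Poly_Mapping.lookup f m * mon_eval m x)"
  unfolding mpoly_eval_def mon_eval_def[symmetric]
  by (rule sum.mono_neutral_left) (use assms in \<open>auto simp: in_keys_iff\<close>)

lemma mpoly_eval_zero [simp]: "mpoly_eval 0 x = 0"
  by (simp add: mpoly_eval_def)

lemma mpoly_eval_add: "mpoly_eval (f + g) x = mpoly_eval f x + mpoly_eval g x"
proof -
  let ?M = "Poly_Mapping.keys f \<union> Poly_Mapping.keys g"
  have "Poly_Mapping.keys (f + g) \<subseteq> ?M" by (rule Poly_Mapping.keys_add)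
  then show ?thesis
    by (subst (1 2 3) mpoly_eval_superset[of ?M]) (auto simp: lookup_add algebra_simps sum.distrib)
qed

lemma mpoly_eval_single [simp]: "mpoly_eval (Poly_Mapping.single m c) x = c * mon_eval m x"
  by (subst mpoly_eval_superset[of "{m}"]) auto

lemma mpoly_eval_const [simp]: "mpoly_eval (mconst c) x = c"
  by (simp add: mconst_def)

lemma mpoly_eval_var [simp]: "mpoly_eval (mvar v) x = x v"
  by (simp add: mvar_def)

lemma mpoly_eval_one [simp]: "mpoly_eval 1 x = 1"
  using mpoly_eval_single[of 0 1 x] by (simp del: mpoly_eval_single)

lemma mpoly_additive_eq:
  fixes f g :: "('v, 'k::comm_ring_1) mpoly \<Rightarrow> 'b::ab_group_add"
  assumes "\<And>a b. f (a + b) = f a + f b" "\<And>a b. g (a + b) = g a + g b"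
    and "\<And>m c. f (Poly_Mapping.single m c) = g (Poly_Mapping.single m c)"
  shows "f a = g a"
  by (subst (1 2) mpoly_expand) (simp add: additive_sum[of f, OF assms(1)] additive_sum[of g, OF assms(2)] assms(3))

lemma mpoly_eval_mult: "mpoly_eval (f * g) x = mpoly_eval f x * mpoly_eval g x"
proof (rule mpoly_additive_eq[where f = "\<lambda>f. mpoly_eval (f * g) x" and g = "\<lambda>f. mpoly_eval f x * mpoly_eval g x"])
  fix m c
  show "mpoly_eval (Poly_Mapping.single m c * g) x = mpoly_eval (Poly_Mapping.single m c) x * mpoly_eval g x"
    by (rule mpoly_additive_eq[where f = "\<lambda>g. mpoly_eval (Poly_Mapping.single m c * g) x"])
      (simp_all add: mpoly_eval_add algebra_simps mult_single mon_eval_add)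
qed (simp_all add: mpoly_eval_add algebra_simps)

lemma mpoly_eval_sum: "mpoly_eval (\<Sum>i\<in>I. F i) x = (\<Sum>i\<in>I. mpoly_eval (F i) x)"
  by (rule additive_sum) (rule mpoly_eval_add)

lemma mpoly_eval_uminus: "mpoly_eval (- f) x = - mpoly_eval f x"
  using mpoly_eval_add[of f "- f" x] by (simp add: eq_neg_iff_add_eq_0 add.commute)

lemma mpoly_eval_diff: "mpoly_eval (f - g) x = mpoly_eval f x - mpoly_eval g x"
  using mpoly_eval_add[of f "- g" x] by (simp add: mpoly_eval_uminus)

lemma mpoly_eval_power: "mpoly_eval (f ^ n) x = mpoly_eval f x ^ n"
  by (induction n) (simp_all add: mpoly_eval_mult)

lemma mpoly_eval_prod: "mpoly_eval (\<Prod>i\<in>I. F i) x = (\<Prod>i\<in>I. mpoly_eval (F i) x)"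
  by (induction I rule: infinite_finite_induct) (simp_all add: mpoly_eval_mult)

lemmas mpoly_eval_simps = mpoly_eval_add mpoly_eval_mult mpoly_eval_sum mpoly_eval_uminus
  mpoly_eval_diff mpoly_eval_power mpoly_eval_prod

lemma mconst_add: "mconst (a + b) = mconst a + mconst b"
  by (simp add: mconst_def single_add)

lemma mconst_mult: "mconst (a * b) = mconst a * mconst b"
  by (simp add: mconst_def mult_single)

lemma mconst_uminus: "mconst (- a) = - mconst a"
  by (simp add: mconst_def single_uminus)

lemma mconst_diff: "mconst (a - b) = mconst a - mconst b"
  using mconst_add[of a "- b"] by (simp add: mconst_uminus)

lemma mconst_zero [simp]: "mconst 0 = 0"
  by (simp add: mconst_def)

lemma mconst_one [simp]: "mconst 1 = 1"
  by (simp add: mconst_def)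

lemma mconst_sum: "mconst (\<Sum>i\<in>I. F i) = (\<Sum>i\<in>I. mconst (F i))"
  by (rule additive_sum) (rule mconst_add)

lemma mon_deg_superset:
  "finite V \<Longrightarrow> Poly_Mapping.keys m \<subseteq> V \<Longrightarrow> mon_deg m = (\<Sum>v\<in>V. Poly_Mapping.lookup m v)"
  unfolding mon_deg_def by (rule sum.mono_neutral_left) (auto simp: in_keys_iff)

lemma mon_deg_add: "mon_deg (m + n) = mon_deg m + mon_deg n"
proof -
  let ?V = "Poly_Mapping.keys m \<union> Poly_Mapping.keys n"
  have "Poly_Mapping.keys (m + n) \<subseteq> ?V" by (rule Poly_Mapping.keys_add)
  then show ?thesis
    by (subst (1 2 3) mon_deg_superset[of ?V]) (auto simp: lookup_add sum.distrib)
qed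

lemma mon_deg_zero [simp]: "mon_deg 0 = 0"
  by (simp add: mon_deg_def)

lemma mon_deg_single [simp]: "mon_deg (Poly_Mapping.single v n) = n"
  by (subst mon_deg_superset[of "{v}"]) (auto simp: lookup_single)

lemma mon_deg_eq_0: "mon_deg m = 0 \<longleftrightarrow> m = 0"
  by (auto simp: mon_deg_def in_keys_iff intro!: poly_mapping_eqI)

lemma mon_deg_Suc:
  assumes "mon_deg m = Suc d"
  obtains v n where "m = n + Poly_Mapping.single v 1" "mon_deg n = d"
proof -
  from assms have "m \<noteq> 0" by auto
  then obtain v where v: "v \<in> Poly_Mapping.keys m" by (metis all_not_in_conv keys_eq_empty)
  let ?n = "m - Poly_Mapping.single v 1"
  have m: "m = ?n + Poly_Mapping.single v 1"
    using v by (intro poly_mapping_eqI) (auto simp: lookup_add lookup_minus lookup_single when_def in_keys_iff)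
  then have "mon_deg m = mon_deg ?n + 1" by (metis mon_deg_add mon_deg_single)
  with m assms show thesis using that by simp
qed

lemma finite_mon_deg: "finite {m :: 'v::finite \<Rightarrow>\<^sub>0 nat. mon_deg m = d}"
proof (induction d)
  case 0
  then show ?case by (simp add: mon_deg_eq_0)
next
  case (Suc d)
  have "{m :: 'v \<Rightarrow>\<^sub>0 nat. mon_deg m = Suc d} \<subseteq>
      (\<lambda>(m, v). m + Poly_Mapping.single v 1) ` ({m. mon_deg m = d} \<times> UNIV)"
  proof
    fix m :: "'v \<Rightarrow>\<^sub>0 nat" assume "m \<in> {m. mon_deg m = Suc d}"
    then obtain v n where "m = n + Poly_Mapping.single v 1" "mon_deg n = d" by (auto elim: mon_deg_Suc)
    then show "m \<in> (\<lambda>(m, v). m + Poly_Mapping.single v 1) ` ({m. mon_deg m = d} \<times> UNIV)"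
      by (intro image_eqI[of _ _ "(n, v)"]) auto
  qed
  then show ?case by (rule finite_subset) (use Suc in simp)
qed

lemma homogeneous_zero [simp]: "homogeneous d 0"
  by (simp add: homogeneous_def)

lemma homogeneous_add: "homogeneous d f \<Longrightarrow> homogeneous d g \<Longrightarrow> homogeneous d (f + g)"
  unfolding homogeneous_def using Poly_Mapping.keys_add[of f g] by blast

lemma homogeneous_single: "mon_deg m = d \<Longrightarrow> homogeneous d (Poly_Mapping.single m c)"
  by (simp add: homogeneous_def)

lemma homogeneous_uminus: "homogeneous d f \<Longrightarrow> homogeneous d (- f)"
  by (simp add: homogeneous_def in_keys_iff)

lemma homogeneous_diff: "homogeneous d f \<Longrightarrow> homogeneous d g \<Longrightarrow> homogeneous d (f - g)"
  using homogeneous_add[of d f "- g"] by (simp add: homogeneous_uminus)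

lemma homogeneous_sum: "(\<And>i. i \<in> I \<Longrightarrow> homogeneous d (F i)) \<Longrightarrow> homogeneous d (\<Sum>i\<in>I. F i)"
  by (induction I rule: infinite_finite_induct) (auto intro: homogeneous_add)

lemma homogeneous_mult: "homogeneous d f \<Longrightarrow> homogeneous e g \<Longrightarrow> homogeneous (d + e) (f * g)"
proof -
  assume f: "homogeneous d f" and g: "homogeneous e g"
  have "homogeneous (d + e) (\<Sum>m\<in>Poly_Mapping.keys f. \<Sum>n\<in>Poly_Mapping.keys g.
      Poly_Mapping.single m (Poly_Mapping.lookup f m) * Poly_Mapping.single n (Poly_Mapping.lookup g n))"
    using f g by (intro homogeneous_sum)
      (auto simp: mult_single homogeneous_def mon_deg_add split: if_splits)
  then show ?thesis
    by (subst mpoly_expand[of f], subst mpoly_expand[of g]) (simp only: sum_product)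
qed

lemma homogeneous_var: "homogeneous 1 (mvar v)"
  by (simp add: mvar_def homogeneous_def)

lemma homogeneous_const: "homogeneous 0 (mconst c)"
  by (simp add: mconst_def homogeneous_def)

lemma homogeneous_scale: "homogeneous d f \<Longrightarrow> homogeneous d (mconst c * f)"
  using homogeneous_mult[OF homogeneous_const] by force

lemma homogeneous_one [simp]: "homogeneous 0 1"
  using homogeneous_const[of 1] by simp

lemma homogeneous_0_iff: "homogeneous 0 f \<longleftrightarrow> f = mconst (Poly_Mapping.lookup f 0)"
proof
  assume "homogeneous 0 f"
  then have "Poly_Mapping.lookup f m = 0" if "m \<noteq> 0" for m
    using that by (auto simp: homogeneous_def mon_deg_eq_0 in_keys_iff)
  then show "f = mconst (Poly_Mapping.lookup f 0)"
    by (intro poly_mapping_eqI) (auto simp: mconst_def lookup_single when_def)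
qed (metis homogeneous_const)

lemma mon_eval_scale: "mon_eval m (\<lambda>v. c * x v) = c ^ mon_deg m * mon_eval m x"
  by (simp add: mon_eval_def mon_deg_def power_mult_distrib prod.distrib power_sum)

lemma mpoly_eval_scale:
  "homogeneous d f \<Longrightarrow> mpoly_eval f (\<lambda>v. c * x v) = c ^ d * mpoly_eval f x"
  by (subst (1 2) mpoly_eval_superset[OF finite_keys order_refl])
    (auto simp: mon_eval_scale homogeneous_def sum_distrib_left algebra_simps intro!: sum.cong)

definition hcomp :: "nat \<Rightarrow> ('v, 'k::comm_ring_1) mpoly \<Rightarrow> ('v, 'k) mpoly" where
  "hcomp d f = (\<Sum>m\<in>{m\<in>Poly_Mapping.keys f. mon_deg m = d}. Poly_Mapping.single m (Poly_Mapping.lookup f m))"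

lemma lookup_hcomp: "Poly_Mapping.lookup (hcomp d f) m = (if mon_deg m = d then Poly_Mapping.lookup f m else 0)"
  by (auto simp: hcomp_def lookup_sum lookup_single when_def in_keys_iff)

lemma hcomp_add: "hcomp d (f + g) = hcomp d f + hcomp d g"
  by (rule poly_mapping_eqI) (simp add: lookup_hcomp lookup_add)

lemma hcomp_zero [simp]: "hcomp d 0 = 0"
  by (simp add: hcomp_def)

lemma hcomp_diff: "hcomp d (f - g) = hcomp d f - hcomp d g"
  by (rule poly_mapping_eqI) (simp add: lookup_hcomp lookup_minus)

lemma homogeneous_hcomp: "homogeneous d (hcomp d f)"
  by (auto simp: homogeneous_def in_keys_iff lookup_hcomp split: if_splits)

lemma hcomp_homogeneous: "homogeneous e f \<Longrightarrow> hcomp d f = (if d = e then f else 0)"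
  by (rule poly_mapping_eqI) (auto simp: lookup_hcomp homogeneous_def in_keys_iff)

lemma hcomp_id [simp]: "homogeneous d f \<Longrightarrow> hcomp d f = f"
  by (simp add: hcomp_homogeneous)

lemma sum_hcomp: "f = (\<Sum>d\<in>mon_deg ` Poly_Mapping.keys f. hcomp d f)"
  by (rule poly_mapping_eqI) (auto simp: lookup_sum lookup_hcomp in_keys_iff sum.delta')

lemma hcomp_mult_homogeneous:
  assumes "homogeneous e g"
  shows "hcomp d (g * f) = (if e \<le> d then g * hcomp (d - e) f else 0)"
proof (rule mpoly_additive_eq[where f = "\<lambda>f. hcomp d (g * f)" and g = "\<lambda>f. if e \<le> d then g * hcomp (d - e) f else 0"])
  fix m c
  have "homogeneous (e + mon_deg m) (g * Poly_Mapping.single m c)"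
    by (rule homogeneous_mult[OF assms homogeneous_single]) simp
  from hcomp_homogeneous[OF this, of d] hcomp_homogeneous[OF homogeneous_single, of m "mon_deg m" "d - e" c]
  show "hcomp d (g * Poly_Mapping.single m c) =
      (if e \<le> d then g * hcomp (d - e) (Poly_Mapping.single m c) else 0)" by auto
qed (simp_all add: hcomp_add algebra_simps)

section \<open>Linear forms and their coefficient vectors\<close>

definition lform :: "('v::finite \<Rightarrow> 'k::comm_ring_1) \<Rightarrow> ('v, 'k) mpoly" where
  "lform c = (\<Sum>v\<in>UNIV. mconst (c v) * mvar v)"

definition dot :: "('v::finite \<Rightarrow> 'k::comm_ring_1) \<Rightarrow> ('v \<Rightarrow> 'k) \<Rightarrow> 'k" where
  "dot c x = (\<Sum>v\<in>UNIV. c v * x v)"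

lemma mpoly_eval_lform [simp]: "mpoly_eval (lform c) x = dot c x"
  by (simp add: lform_def dot_def mpoly_eval_simps)

lemma homogeneous_lform: "homogeneous 1 (lform c)"
  unfolding lform_def by (intro homogeneous_sum homogeneous_scale homogeneous_var)

lemma lookup_lform: "Poly_Mapping.lookup (lform c) (Poly_Mapping.single v 1) = c v"
proof -
  have "Poly_Mapping.lookup (lform c) (Poly_Mapping.single v 1) =
    (\<Sum>w\<in>UNIV. if w = v then c w else 0)"
    unfolding lform_def lookup_sum
    by (rule sum.cong) (auto simp: mconst_def mvar_def mult_single lookup_single when_def
        dest: arg_cong[where f = "\<lambda>m. Poly_Mapping.lookup m v"] split: if_splits)
  then show ?thesis by simp
qed

lemma homogeneous_1_eq: "homogeneous 1 f \<Longrightarrow> f = lform (\<lambda>v. Poly_Mapping.lookup f (Poly_Mapping.single v 1))"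
proof -
  assume f: "homogeneous 1 f"
  have "Poly_Mapping.lookup f m = Poly_Mapping.lookup (lform (\<lambda>v. Poly_Mapping.lookup f (Poly_Mapping.single v 1))) m" for m
  proof (cases "mon_deg m = 1")
    case True
    then obtain v n where "m = n + Poly_Mapping.single v 1" "mon_deg n = 0"
      by (metis One_nat_def mon_deg_Suc)
    then have m: "m = Poly_Mapping.single v 1" by (simp add: mon_deg_eq_0)
    show ?thesis unfolding m lookup_lform ..
  next
    case False
    then have "Poly_Mapping.lookup g m = 0" if "homogeneous 1 g" for g :: "('a, 'b) mpoly"
      using that by (auto simp: homogeneous_def in_keys_iff)
    then show ?thesis using f homogeneous_lform by metis
  qed
  then show ?thesis by (rule poly_mapping_eqI)
qed

lemma homogeneous_Suc_expand:
  fixes f :: "('v::finite, 'k::comm_ring_1) mpoly"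
  assumes "homogeneous (Suc d) f"
  obtains F where "\<And>v. homogeneous d (F v)" "f = (\<Sum>v\<in>UNIV. F v * mvar v)"
proof -
  have "\<exists>F. (\<forall>v. homogeneous d (F v)) \<and> Poly_Mapping.single m c = (\<Sum>v\<in>UNIV. F v * mvar v)"
    if "mon_deg m = Suc d" for m :: "'v \<Rightarrow>\<^sub>0 nat" and c :: 'k
  proof -
    from that obtain v n where m: "m = n + Poly_Mapping.single v 1" and n: "mon_deg n = d"
      by (rule mon_deg_Suc)
    let ?F = "\<lambda>w. if w = v then Poly_Mapping.single n c else 0"
    have "(\<Sum>w\<in>UNIV. ?F w * mvar w) = (\<Sum>w\<in>UNIV. if w = v then Poly_Mapping.single n c * mvar w else 0)"
      by (rule sum.cong) auto
    then have "(\<Sum>w\<in>UNIV. ?F w * mvar w) = Poly_Mapping.single m c"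
      by (simp add: m mvar_def mult_single)
    moreover have "\<forall>w. homogeneous d (?F w)" using n by (simp add: homogeneous_def)
    ultimately show ?thesis by (intro exI[of _ ?F]) simp
  qed
  then have "\<forall>(m :: 'v \<Rightarrow>\<^sub>0 nat) (c :: 'k). \<exists>F. mon_deg m = Suc d \<longrightarrow> (\<forall>v. homogeneous d (F v)) \<and>
      Poly_Mapping.single m c = (\<Sum>v\<in>UNIV. F v * mvar v)" by blast
  then obtain F where "\<forall>(m :: 'v \<Rightarrow>\<^sub>0 nat) (c :: 'k). mon_deg m = Suc d \<longrightarrow> (\<forall>v. homogeneous d (F m c v)) \<and>
      Poly_Mapping.single m c = (\<Sum>v\<in>UNIV. F m c v * mvar v)" unfolding choice_iff by blast
  then have F: "mon_deg m = Suc d \<Longrightarrow> (\<forall>v. homogeneous d (F m c v)) \<and>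
      Poly_Mapping.single m c = (\<Sum>v\<in>UNIV. F m c v * mvar v)" for m :: "'v \<Rightarrow>\<^sub>0 nat" and c :: 'k by blast
  let ?G = "\<lambda>v. \<Sum>m\<in>Poly_Mapping.keys f. F m (Poly_Mapping.lookup f m) v"
  have deg: "mon_deg m = Suc d" if "m \<in> Poly_Mapping.keys f" for m
    using assms that by (auto simp: homogeneous_def)
  have "f = (\<Sum>m\<in>Poly_Mapping.keys f. Poly_Mapping.single m (Poly_Mapping.lookup f m))"
    by (rule mpoly_expand)
  also have "\<dots> = (\<Sum>m\<in>Poly_Mapping.keys f. \<Sum>v\<in>UNIV. F m (Poly_Mapping.lookup f m) v * mvar v)"
    using F deg by (intro sum.cong refl) blast
  also have "\<dots> = (\<Sum>v\<in>UNIV. ?G v * mvar v)"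
    unfolding sum_distrib_right by (rule sum.swap)
  finally show thesis using F deg by (intro that[of ?G]) (auto intro!: homogeneous_sum)
qed

section \<open>The ideal of a tuple of points\<close>

text \<open>Vanishing is imposed on every homogeneous component separately, because a polynomial can
  vanish at one coordinate vector of a point without vanishing at its multiples. So this is a
  homogeneous ideal although each point is represented by a single vector.\<close>

definition pideal :: "nat \<Rightarrow> (nat \<Rightarrow> 'v \<Rightarrow> 'k::field) \<Rightarrow> ('v, 'k) mpoly set" where
  "pideal t x = {f. \<forall>d. \<forall>p<t. mpoly_eval (hcomp d f) (x p) = 0}"

lemma pideal_homogeneous: "homogeneous d f \<Longrightarrow> f \<in> pideal t x \<longleftrightarrow> (\<forall>p<t. mpoly_eval f (x p) = 0)"
  by (auto simp: pideal_def hcomp_homogeneous)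

lemma pideal_hcomp: "f \<in> pideal t x \<Longrightarrow> hcomp d f \<in> pideal t x"
  by (auto simp: pideal_def hcomp_homogeneous[OF homogeneous_hcomp])

lemma pideal_zero: "0 \<in> pideal t x"
  by (simp add: pideal_def)

lemma pideal_add: "f \<in> pideal t x \<Longrightarrow> g \<in> pideal t x \<Longrightarrow> f + g \<in> pideal t x"
  by (simp add: pideal_def hcomp_add mpoly_eval_add)

lemma pideal_mult: "f \<in> pideal t x \<Longrightarrow> q * f \<in> pideal t x"
proof -
  assume f: "f \<in> pideal t x"
  have "mpoly_eval (hcomp d (q * f)) (x p) = 0" if "p < t" for d p
  proof (rule mpoly_additive_eq[where f = "\<lambda>q. mpoly_eval (hcomp d (q * f)) (x p)" and g = "\<lambda>q. 0"])
    fix m c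
    show "mpoly_eval (hcomp d (Poly_Mapping.single m c * f)) (x p) = 0"
      using f that by (simp add: hcomp_mult_homogeneous[OF homogeneous_single[OF refl]] mpoly_eval_mult pideal_def)
  qed (simp_all add: hcomp_add mpoly_eval_add algebra_simps)
  then show ?thesis by (simp add: pideal_def)
qed

lemma subspace_pideal: "module.subspace (*) (pideal t x)"
  by (simp add: module.subspace_def[OF module_mult] pideal_zero pideal_add pideal_mult)

text \<open>A form that vanishes at one coordinate vector of a point vanishes at all its multiples,
  so the choice of the \<open>x j\<close> is immaterial. This is what later permits rescaling the
  vectors to a normal form.\<close>

lemma vanishing_ideal_eq_pideal:
  fixes P :: "nat \<Rightarrow> ('v \<Rightarrow> 'k::field) set"
  assumes "\<And>j. j < t \<Longrightarrow> P j \<in> proj_space" "\<And>j. j < t \<Longrightarrow> x j \<in> P j"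
  shows "vanishing_ideal (P ` {..<t}) = pideal t x"
proof -
  have hom: "(\<forall>Q\<in>P ` {..<t}. \<forall>y\<in>Q. mpoly_eval f y = 0) \<longleftrightarrow> (\<forall>p<t. mpoly_eval f (x p) = 0)"
    if f: "homogeneous d f" for d f
  proof (intro iffI ballI allI impI)
    fix Q y assume v: "\<forall>p<t. mpoly_eval f (x p) = 0" and Q: "Q \<in> P ` {..<t}" and y: "y \<in> Q"
    from Q obtain j where j: "j < t" "Q = P j" by auto
    from assms(1)[OF j(1)] obtain z where z: "P j = {\<lambda>v. c * z v | c. c \<noteq> 0}" by (auto simp: proj_space_def)
    from assms(2)[OF j(1)] z obtain c where c: "x j = (\<lambda>v. c * z v)" "c \<noteq> 0" by auto
    from y z j obtain d' where d: "y = (\<lambda>v. d' * z v)" by auto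
    have "y = (\<lambda>v. (d' / c) * x j v)" using c d by (simp add: fun_eq_iff)
    then show "mpoly_eval f y = 0" using v j mpoly_eval_scale[OF f, of "d' / c" "x j"] by simp
  qed (use assms in auto)
  have "{f. (\<exists>d. homogeneous d f) \<and> (\<forall>Q\<in>P ` {..<t}. \<forall>y\<in>Q. mpoly_eval f y = 0)} =
      {f \<in> pideal t x. \<exists>d. homogeneous d f}" (is "?G = ?H")
  proof (rule Set.set_eqI)
    fix f
    show "f \<in> ?G \<longleftrightarrow> f \<in> ?H"
    proof (cases "\<exists>d. homogeneous d f")
      case True
      then obtain d where d: "homogeneous d f" by blast
      show ?thesis by (simp only: mem_Collect_eq hom[OF d] pideal_homogeneous[OF d] conj_commute)
    qed blast
  qed
  moreover have "module.span (*) ?H = pideal t x"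
  proof (rule subset_antisym)
    show "module.span (*) ?H \<subseteq> pideal t x"
      by (rule module.span_minimal[OF module_mult]) (auto intro: subspace_pideal)
    show "pideal t x \<subseteq> module.span (*) ?H"
    proof
      fix f assume "f \<in> pideal t x"
      then have "hcomp d f \<in> ?H" for d using pideal_hcomp homogeneous_hcomp by blast
      then have "(\<Sum>d\<in>mon_deg ` Poly_Mapping.keys f. hcomp d f) \<in> module.span (*) ?H"
        by (intro module.span_sum[OF module_mult]) (rule module.span_base[OF module_mult])
      then show "f \<in> module.span (*) ?H" by (simp flip: sum_hcomp)
    qed
  qed
  ultimately show ?thesis unfolding vanishing_ideal_def by simp
qed

section \<open>Nonvanishing and linear relations\<close>

lemma sum_digits_less:
  fixes a :: "nat \<Rightarrow> nat"
  assumes "\<And>i. i < n \<Longrightarrow> a i < D"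
  shows "(\<Sum>i<n. a i * D ^ i) < D ^ n"
  using assms
proof (induction n)
  case (Suc n)
  have "(\<Sum>i<n. a i * D ^ i) + a n * D ^ n < D ^ n + a n * D ^ n" using Suc by auto
  also have "\<dots> = Suc (a n) * D ^ n" by simp
  also have "\<dots> \<le> D * D ^ n" using Suc.prems[of n] by (intro mult_right_mono) auto
  finally show ?case by simp
qed simp

lemma digits_inj:
  fixes a b :: "nat \<Rightarrow> nat"
  assumes "\<And>i. i < n \<Longrightarrow> a i < D" "\<And>i. i < n \<Longrightarrow> b i < D"
    and "(\<Sum>i<n. a i * D ^ i) = (\<Sum>i<n. b i * D ^ i)" "i < n"
  shows "a i = b i"
  using assms
proof (induction n)
  case (Suc n)
  have "(\<Sum>i<Suc n. c i * D ^ i) div D ^ n = c n" if "\<And>i. i < Suc n \<Longrightarrow> c i < D" for c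
    proof -
    have "(\<Sum>i<n. c i * D ^ i) < D ^ n" using that by (intro sum_digits_less) simp
    then have "((\<Sum>i<n. c i * D ^ i) + c n * D ^ n) div D ^ n = c n"
      by (metis add.right_neutral add.commute div_less div_mult_self3 not_less_zero)
    then show ?thesis by simp
  qed
  then have n: "a n = b n" using Suc.prems by metis
  show ?case
  proof (cases "i = n")
    case False
    then show ?thesis using Suc n by auto
  qed (use n in simp)
qed simp

text \<open>Kronecker substitution: putting \<open>s ^ (D ^ e v)\<close> for the variable
  \<open>v\<close> sends distinct monomials of \<open>f\<close> to distinct powers of
  \<open>s\<close>. A nonzero polynomial in one variable remains, and it has only finitely many
  roots.\<close>

lemma mpoly_nonvanishing:
  fixes f :: "('v::finite, 'k::field) mpoly"
  assumes "infinite (UNIV :: 'k set)" "f \<noteq> 0"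
  obtains x where "mpoly_eval f x \<noteq> 0"
proof -
  obtain e :: "'v \<Rightarrow> nat" where e: "bij_betw e UNIV {..<card (UNIV :: 'v set)}"
    using ex_bij_betw_finite_nat[of "UNIV :: 'v set"] by (auto simp: atLeast0LessThan)
  let ?n = "card (UNIV :: 'v set)"
  let ?g = "the_inv_into UNIV e"
  have g: "bij_betw ?g {..<?n} UNIV" using e by (rule bij_betw_the_inv_into)
  have ge: "?g (e v) = v" for v using e by (simp add: bij_betw_def the_inv_into_f_f)
  \<comment> \<open>Larger than every exponent in \<open>f\<close>, so that the exponents of a
    monomial are digits in base \<open>D\<close> and can be recovered by
    \<open>digits_inj\<close>.\<close>
  define D where "D = Suc (\<Sum>m\<in>Poly_Mapping.keys f. mon_deg m)"
  have lt: "Poly_Mapping.lookup m v < D" if "m \<in> Poly_Mapping.keys f" for m v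
  proof -
    have "Poly_Mapping.lookup m v \<le> mon_deg m"
      by (subst mon_deg_superset[of UNIV]) (auto intro: member_le_sum)
    also have "\<dots> \<le> (\<Sum>m\<in>Poly_Mapping.keys f. mon_deg m)" using that by (intro member_le_sum) auto
    finally show ?thesis by (simp add: D_def)
  qed
  define w where "w m = (\<Sum>v\<in>UNIV. Poly_Mapping.lookup m v * D ^ e v)" for m :: "'v \<Rightarrow>\<^sub>0 nat"
  have w: "w m = (\<Sum>i<?n. Poly_Mapping.lookup m (?g i) * D ^ i)" for m
    unfolding w_def using sum.reindex_bij_betw[OF e, of "\<lambda>i. Poly_Mapping.lookup m (?g i) * D ^ i"] by (simp add: ge)
  have inj: "m = m'" if "m \<in> Poly_Mapping.keys f" "m' \<in> Poly_Mapping.keys f" "w m = w m'" for m m'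
  proof (rule poly_mapping_eqI)
    fix v
    have "e v < ?n" using e by (auto simp: bij_betw_def)
    from digits_inj[of ?n "\<lambda>i. Poly_Mapping.lookup m (?g i)" D "\<lambda>i. Poly_Mapping.lookup m' (?g i)", OF _ _ _ this]
    show "Poly_Mapping.lookup m v = Poly_Mapping.lookup m' v" using that lt by (simp add: w ge)
  qed
  define p where "p = (\<Sum>m\<in>Poly_Mapping.keys f. Polynomial.monom (Poly_Mapping.lookup f m) (w m))"
  obtain m where m: "m \<in> Poly_Mapping.keys f" using assms(2) by (metis all_not_in_conv keys_eq_empty)
  have "Polynomial.coeff p (w m) = (\<Sum>n\<in>Poly_Mapping.keys f. if n = m then Poly_Mapping.lookup f n else 0)"
    unfolding p_def coeff_sum by (rule sum.cong) (use inj m in auto)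
  also have "\<dots> \<noteq> 0" using m by (simp add: in_keys_iff)
  finally have "p \<noteq> 0" by auto
  then have "finite {s. poly p s = 0}" by (rule poly_roots_finite)
  then obtain s where s: "poly p s \<noteq> 0" using assms(1) by (metis (mono_tags, lifting) UNIV_I finite_subset mem_Collect_eq subsetI)
  have "poly p s = mpoly_eval f (\<lambda>v. s ^ (D ^ e v))"
    unfolding p_def poly_sum mpoly_eval_superset[OF finite_keys order_refl] poly_monom
    by (intro sum.cong refl, subst mon_eval_superset[of UNIV])
      (auto simp: w_def power_sum mult.commute simp flip: power_mult)
  with s show thesis using that by auto
qed

text \<open>Gaussian elimination, by induction on the number of equations. It serves all dimension
  counts: forms through points, forms separating points, and bounds for components of Tor.\<close>

lemma linear_relation_exists:
  fixes f :: "nat \<Rightarrow> 'b \<Rightarrow> 'k::field"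
  assumes "finite B" "n < card B"
  shows "\<exists>c. (\<exists>b\<in>B. c b \<noteq> 0) \<and> (\<forall>a<n. (\<Sum>b\<in>B. c b * f a b) = 0)"
  using assms
proof (induction n arbitrary: B f)
  case 0
  then have "B \<noteq> {}" by auto
  then show ?case by (intro exI[of _ "\<lambda>_. 1"]) auto
next
  case (Suc n)
  note relation = Suc.IH
  show ?case
  proof (cases "\<forall>b\<in>B. f n b = 0")
    case True
    obtain c where "\<exists>b\<in>B. c b \<noteq> 0" "\<forall>a<n. (\<Sum>b\<in>B. c b * f a b) = 0"
      using relation[of B f] Suc.prems by auto
    with True show ?thesis by (intro exI[of _ c]) (auto simp: less_Suc_eq)
  next
    case False
    then obtain b0 where b0: "b0 \<in> B" "f n b0 \<noteq> 0" by auto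
    have reduced: "\<exists>c. (\<exists>b\<in>C. c b \<noteq> 0) \<and> (\<forall>a<n. (\<Sum>b\<in>C. c b * f a b) =
        (\<Sum>b\<in>C. c b * f n b) * f a b0 / f n b0)" if "finite C" "n < card C" for C
      using relation[OF that, of "\<lambda>a b. f a b - f n b * (f a b0 / f n b0)"]
      by (simp add: right_diff_distrib sum_subtractf sum_distrib_right sum_divide_distrib mult.assoc)
    have "n < card (B - {b0})" using Suc.prems b0 by simp
    moreover have "finite (B - {b0})" using Suc.prems by simp
    ultimately obtain c where c1: "\<exists>b\<in>B - {b0}. c b \<noteq> 0"
      and c2: "\<And>a. a < n \<Longrightarrow> (\<Sum>b\<in>B - {b0}. c b * f a b) =
       (\<Sum>b\<in>B - {b0}. c b * f n b) * f a b0 / f n b0"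
      using reduced[of "B - {b0}"] by blast
    note c = c1 c2
    \<comment> \<open>The value at the pivot \<open>b0\<close> is chosen to satisfy equation
      \<open>n\<close>; the other equations were reduced modulo this one before the induction
      hypothesis was applied.\<close>
    let ?c = "c(b0 := - (\<Sum>b\<in>B - {b0}. c b * f n b) / f n b0)"
    have s: "(\<Sum>b\<in>B. ?c b * f a b) = (\<Sum>b\<in>B - {b0}. c b * f a b) - (\<Sum>b\<in>B - {b0}. c b * f n b) / f n b0 * f a b0" for a
    proof -
      have "(\<Sum>b\<in>B. ?c b * f a b) = ?c b0 * f a b0 + (\<Sum>b\<in>B - {b0}. ?c b * f a b)"
        using b0 Suc.prems by (intro sum.remove) auto
      also have "(\<Sum>b\<in>B - {b0}. ?c b * f a b) = (\<Sum>b\<in>B - {b0}. c b * f a b)"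
        by (rule sum.cong) auto
      finally show ?thesis by simp
    qed
    have "(\<Sum>b\<in>B. ?c b * f a b) = 0" if "a < Suc n" for a
      unfolding s using c(2)[of a] b0 that by (cases "a = n") auto
    moreover have "\<exists>b\<in>B. ?c b \<noteq> 0" using c(1) by auto
    ultimately show ?thesis by (intro exI[of _ ?c]) blast
  qed
qed

section \<open>Calculus in the Koszul complex\<close>

abbreviation lk :: "('v, 'k::comm_ring_1) koszul \<Rightarrow> 'v set \<Rightarrow> ('v, 'k) mpoly" where
  "lk \<equiv> Poly_Mapping.lookup"

lemma koszul_eqI: "(\<And>S. lk a S = lk b S) \<Longrightarrow> a = b"
  by (rule poly_mapping_eqI)

text \<open>Scaling by a polynomial is encoded as a wedge with a multiple of the unit, so that
  compatibility with products and with the differential follows from associativity and the Leibniz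
  rule.\<close>

definition pscale :: "('v::{finite,linorder}, 'k::comm_ring_1) mpoly \<Rightarrow> ('v, 'k) koszul \<Rightarrow> ('v, 'k) koszul" where
  "pscale f a = wedge (Poly_Mapping.single {} f) a"

lemma wedge_zero_left [simp]: "wedge 0 a = 0"
  using wedge_add_left[of 0 0 a] by simp

lemma wedge_zero_right [simp]: "wedge a 0 = 0"
  using wedge_add_right[of a 0 0] by simp

lemma wedge_uminus_left: "wedge (- a) b = - wedge a b"
  using wedge_add_left[of a "- a" b] by (simp add: eq_neg_iff_add_eq_0 add.commute)

lemma wedge_uminus_right: "wedge a (- b) = - wedge a b"
  using wedge_add_right[of a b "- b"] by (simp add: eq_neg_iff_add_eq_0 add.commute)

lemma wedge_diff_left: "wedge (a - b) c = wedge a c - wedge b c"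
  using wedge_add_left[of a "- b" c] by (simp add: wedge_uminus_left)

lemma wedge_diff_right: "wedge a (b - c) = wedge a b - wedge a c"
  using wedge_add_right[of a b "- c"] by (simp add: wedge_uminus_right)

lemma lookup_pscale [simp]: "lk (pscale f a) S = f * lk a S"
proof (rule koszul_additive_eq[where f = "\<lambda>a. lk (pscale f a) S" and g = "\<lambda>a. f * lk a S"])
  fix T q
  show "lk (pscale f (Poly_Mapping.single T q)) S = f * lk (Poly_Mapping.single T q) S"
    by (simp add: pscale_def wedge_single wedge_sign_def lookup_single when_def)
qed (simp_all add: pscale_def wedge_add_right lookup_add algebra_simps)

lemma pscale_add_left: "pscale (f + g) a = pscale f a + pscale g a"
  by (rule koszul_eqI) (simp add: lookup_add algebra_simps)

lemma pscale_add_right: "pscale f (a + b) = pscale f a + pscale f b"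
  by (rule koszul_eqI) (simp add: lookup_add algebra_simps)

lemma pscale_pscale [simp]: "pscale f (pscale g a) = pscale (f * g) a"
  by (rule koszul_eqI) (simp add: algebra_simps)

lemma pscale_zero_left [simp]: "pscale 0 a = 0"
  by (rule koszul_eqI) simp

lemma pscale_zero_right [simp]: "pscale f 0 = 0"
  by (rule koszul_eqI) simp

lemma pscale_one [simp]: "pscale 1 a = a"
  by (rule koszul_eqI) simp

lemma pscale_uminus_left: "pscale (- f) a = - pscale f a"
  by (rule koszul_eqI) simp

lemma pscale_uminus_right: "pscale f (- a) = - pscale f a"
  by (rule koszul_eqI) simp

lemma pscale_diff_left: "pscale (f - g) a = pscale f a - pscale g a"
  by (rule koszul_eqI) (simp add: lookup_minus algebra_simps)

lemma pscale_diff_right: "pscale f (a - b) = pscale f a - pscale f b"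
  by (rule koszul_eqI) (simp add: lookup_minus algebra_simps)

lemma pscale_sum_right: "pscale f (\<Sum>i\<in>I. F i) = (\<Sum>i\<in>I. pscale f (F i))"
  by (rule additive_sum) (rule pscale_add_right)

lemma wedge_pscale_left: "wedge (pscale f a) b = pscale f (wedge a b)"
  by (simp add: pscale_def wedge_assoc)

lemma wedge_pscale_right: "wedge a (pscale f b) = pscale f (wedge a b)"
proof (rule koszul_additive_eq[where f = "\<lambda>a. wedge a (pscale f b)" and g = "\<lambda>a. pscale f (wedge a b)"])
  fix S q
  show "wedge (Poly_Mapping.single S q) (pscale f b) = pscale f (wedge (Poly_Mapping.single S q) b)"
    by (rule koszul_additive_eq[where f = "\<lambda>b. wedge (Poly_Mapping.single S q) (pscale f b)"])
      (simp_all add: pscale_def wedge_add_left wedge_add_right wedge_single wedge_sign_def algebra_simps)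
qed (simp_all add: wedge_add_left pscale_add_right)

lemma koszul_diff_uminus: "koszul_diff (- a) = - koszul_diff a"
  using koszul_diff_add[of a "- a"] by (simp add: koszul_diff_zero eq_neg_iff_add_eq_0 add.commute)

lemma koszul_diff_diff_eq: "koszul_diff (a - b) = koszul_diff a - koszul_diff b"
  using koszul_diff_add[of a "- b"] by (simp add: koszul_diff_uminus)

lemma koszul_diff_sum: "koszul_diff (\<Sum>i\<in>I. F i) = (\<Sum>i\<in>I. koszul_diff (F i))"
  by (rule additive_sum) (rule koszul_diff_add)

lemma koszul_diff_const [simp]: "koszul_diff (Poly_Mapping.single {} q) = 0"
  by (simp add: koszul_diff_single)

lemma koszul_diff_pscale: "koszul_diff (pscale f a) = pscale f (koszul_diff a)"
  by (simp add: pscale_def koszul_leibniz parity_twist_single)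

lemma koszul_component_iff:
  "a \<in> koszul_component i d \<longleftrightarrow>
    (\<forall>S. if card S = i \<and> i \<le> d then homogeneous (d - i) (lk a S) else lk a S = 0)"
proof -
  have "(\<forall>m\<in>Poly_Mapping.keys q. c = i \<and> mon_deg m + i = d) \<longleftrightarrow>
      (if c = i \<and> i \<le> d then homogeneous (d - i) q else q = 0)" for q :: "('a, 'b) mpoly" and c :: nat
  proof (cases "c = i \<and> i \<le> d")
    case True
    then have "mon_deg m + i = d \<longleftrightarrow> mon_deg m = d - i" for m :: "'a \<Rightarrow>\<^sub>0 nat" by auto
    with True show ?thesis by (simp add: homogeneous_def)
  next
    case False
    then have "\<not> (c = i \<and> mon_deg m + i = d)" for m :: "'a \<Rightarrow>\<^sub>0 nat" by auto
    then have "(\<forall>m\<in>Poly_Mapping.keys q. c = i \<and> mon_deg m + i = d) \<longleftrightarrow> Poly_Mapping.keys q = {}" by blast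
    also have "\<dots> \<longleftrightarrow> q = 0" by simp
    finally show ?thesis using False by auto
  qed
  then show ?thesis unfolding koszul_component_def by simp
qed

abbreviation kc :: "nat \<Rightarrow> nat \<Rightarrow> ('v, 'k::comm_ring_1) koszul set" where
  "kc \<equiv> koszul_component"

lemma kc_lookup: "a \<in> kc i d \<Longrightarrow> homogeneous (d - i) (lk a S)"
  by (auto simp: koszul_component_iff dest!: spec[of _ S] split: if_splits)

lemma kc_card: "a \<in> kc i d \<Longrightarrow> lk a S \<noteq> 0 \<Longrightarrow> card S = i"
  by (auto simp: koszul_component_iff dest!: spec[of _ S] split: if_splits)

lemma kc_zero [simp]: "0 \<in> kc i d"
  by (simp add: koszul_component_iff)

lemma kc_add: "a \<in> kc i d \<Longrightarrow> b \<in> kc i d \<Longrightarrow> a + b \<in> kc i d"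
  by (auto simp: koszul_component_iff lookup_add intro: homogeneous_add)

lemma kc_uminus: "a \<in> kc i d \<Longrightarrow> - a \<in> kc i d"
  by (auto simp: koszul_component_iff intro: homogeneous_uminus)

lemma kc_diff: "a \<in> kc i d \<Longrightarrow> b \<in> kc i d \<Longrightarrow> a - b \<in> kc i d"
  using kc_add[of a i d "- b"] kc_uminus by auto

lemma kc_sum: "(\<And>x. x \<in> I \<Longrightarrow> F x \<in> kc i d) \<Longrightarrow> (\<Sum>x\<in>I. F x) \<in> kc i d"
  by (induction I rule: infinite_finite_induct) (auto intro: kc_add)

lemma kc_single: "card S = i \<Longrightarrow> homogeneous d q \<Longrightarrow> Poly_Mapping.single S q \<in> kc i (d + i)"
  by (auto simp: koszul_component_iff lookup_single when_def)

lemma kc_pscale: "homogeneous e f \<Longrightarrow> a \<in> kc i d \<Longrightarrow> pscale f a \<in> kc i (e + d)"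
  unfolding koszul_component_iff
proof (intro allI)
  fix S
  assume f: "homogeneous e f" and a: "\<forall>S. if card S = i \<and> i \<le> d then homogeneous (d - i) (lk a S) else lk a S = 0"
  have "e + (d - i) = e + d - i" if "i \<le> d" using that by simp
  then show "if card S = i \<and> i \<le> e + d then homogeneous (e + d - i) (lk (pscale f a) S) else lk (pscale f a) S = 0"
    using a[rule_format, of S] homogeneous_mult[OF f, of "d - i" "lk a S"] by (auto split: if_splits)
qed

lemma kc_scale: "a \<in> kc i d \<Longrightarrow> pscale (mconst c) a \<in> kc i d"
  using kc_pscale[OF homogeneous_const, of a i d c] by simp

lemma mconst_neg_one_power: "mconst ((- 1) ^ n) = (- 1) ^ n"
  by (induction n) (simp_all add: mconst_mult mconst_uminus)

lemma kc_wedge: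
  fixes a :: "('a::{finite,linorder}, 'b::comm_ring_1) koszul"
  assumes a: "a \<in> kc i d" and b: "b \<in> kc j e"
  shows "wedge a b \<in> kc (i + j) (d + e)"
  unfolding wedge_def
proof (intro kc_sum)
  fix S T :: "'a set"
  show "Poly_Mapping.single (S \<union> T) (wedge_sign S T * lk a S * lk b T) \<in> kc (i + j) (d + e)"
  proof (cases "S \<inter> T = {} \<and> lk a S \<noteq> 0 \<and> lk b T \<noteq> 0")
    case True
    with a have S: "card S = i" "i \<le> d" "homogeneous (d - i) (lk a S)"
      by (auto simp: koszul_component_iff dest!: spec[of _ S] split: if_splits)
    from True b have T: "card T = j" "j \<le> e" "homogeneous (e - j) (lk b T)"
      by (auto simp: koszul_component_iff dest!: spec[of _ T] split: if_splits)
    have w: "wedge_sign S T = (mconst ((- 1) ^ card {(u, v). u \<in> S \<and> v \<in> T \<and> v < u}) :: ('a, 'b) mpoly)"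
      using True neg_one_power_times_single[of _ 0 1] by (simp add: wedge_sign_def mconst_def)
    have "homogeneous ((d - i) + (e - j)) (wedge_sign S T * lk a S * lk b T)"
      unfolding w mult.assoc by (intro homogeneous_scale homogeneous_mult S T)
    moreover have "card (S \<union> T) = i + j" using True S T by (simp add: card_Un_disjoint)
    ultimately show ?thesis using kc_single[of "S \<union> T" "i + j" "(d - i) + (e - j)"] S T by (simp add: add.commute)
  qed (auto simp: wedge_sign_def)
qed

lemma kc_koszul_diff:
  fixes a :: "('a::{finite,linorder}, 'b::comm_ring_1) koszul"
  assumes a: "a \<in> kc (Suc i) d"
  shows "koszul_diff a \<in> kc i d"
  unfolding koszul_diff_def
proof (intro kc_sum)
  fix S :: "'a set" and v assume v: "v \<in> S"
  show "Poly_Mapping.single (S - {v}) ((- 1) ^ card {u \<in> S. u < v} * mvar v * lk a S) \<in> kc i d"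
  proof (cases "lk a S = 0")
    case False
    with a have S: "card S = Suc i" "Suc i \<le> d" "homogeneous (d - Suc i) (lk a S)"
      by (auto simp: koszul_component_iff dest!: spec[of _ S] split: if_splits)
    have "(- 1) ^ n = (mconst ((- 1) ^ n) :: ('a, 'b) mpoly)" for n
      using neg_one_power_times_single[of n 0 1] by (simp add: mconst_def)
    then have "homogeneous (1 + (d - Suc i)) ((- 1) ^ card {u \<in> S. u < v} * mvar v * lk a S)"
      using homogeneous_scale[OF homogeneous_mult[OF homogeneous_var S(3)]] by (simp add: mult.assoc)
    moreover have "card (S - {v}) = i" using S v by simp
    ultimately show ?thesis using kc_single[of "S - {v}" i "1 + (d - Suc i)"] S by simp
  qed simp
qed

lemma koszul_diff_kc_0:
  fixes a :: "('a::{finite,linorder}, 'b::comm_ring_1) koszul"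
  assumes "a \<in> kc 0 d"
  shows "koszul_diff a = 0"
proof -
  have "lk a S = 0" if "S \<noteq> {}" for S :: "'a set" using assms that kc_card[of a 0 d S] by auto
  then have "a = Poly_Mapping.single {} (lk a {})"
    by (intro koszul_eqI) (auto simp: lookup_single when_def)
  then show ?thesis by (metis koszul_diff_const)
qed

lemma kc_top:
  fixes a :: "('v::finite, 'k::comm_ring_1) koszul"
  assumes "a \<in> kc i d" "card (UNIV :: 'v set) < i"
  shows "a = 0"
proof (rule koszul_eqI)
  fix S :: "'v set"
  have "card S \<le> card (UNIV :: 'v set)" by (rule card_mono) auto
  then show "lk a S = lk 0 S" using assms kc_card[of a i d S] by auto
qed

text \<open>Serves to replace an arbitrary primitive of a homogeneous element by a homogeneous one;
  the differential lowers the homological degree and keeps the internal degree.\<close>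

definition kproj :: "nat \<Rightarrow> nat \<Rightarrow> ('v::finite, 'k::comm_ring_1) koszul \<Rightarrow> ('v, 'k) koszul" where
  "kproj i d a = (\<Sum>S\<in>UNIV. Poly_Mapping.single S (if card S = i \<and> i \<le> d then hcomp (d - i) (lk a S) else 0))"

lemma lookup_kproj: "lk (kproj i d a) S = (if card S = i \<and> i \<le> d then hcomp (d - i) (lk a S) else 0)"
  by (simp add: kproj_def lookup_sum lookup_single when_def)

lemma kproj_kc: "kproj i d a \<in> kc i d"
  by (auto simp: koszul_component_iff lookup_kproj homogeneous_hcomp)

lemma kproj_add: "kproj i d (a + b) = kproj i d a + kproj i d b"
  by (rule koszul_eqI) (simp add: lookup_kproj lookup_add hcomp_add)

lemma kproj_diff: "kproj i d (a - b) = kproj i d a - kproj i d b"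
  by (rule koszul_eqI) (simp add: lookup_kproj lookup_minus hcomp_diff)

lemma kproj_id: "a \<in> kc i d \<Longrightarrow> kproj i d a = a"
  by (rule koszul_eqI) (auto simp: koszul_component_iff lookup_kproj split: if_splits)

lemma kproj_other:
  assumes "a \<in> kc j e" "(j, e) \<noteq> (i, d)"
  shows "kproj i d a = 0"
proof (rule koszul_eqI)
  fix S
  show "lk (kproj i d a) S = lk 0 S"
    using assms(1)[unfolded koszul_component_iff, rule_format, of S] assms(2)
    by (auto simp: lookup_kproj hcomp_homogeneous split: if_splits)
qed

lemma kproj_koszul_diff: "kproj i d (koszul_diff a) = koszul_diff (kproj (Suc i) d a)"
  for a :: "('a::{finite,linorder}, 'b::comm_ring_1) koszul"
proof (rule koszul_additive_eq_monomial[where f = "\<lambda>a. kproj i d (koszul_diff a)"])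
  fix S :: "'a set" and m :: "'a \<Rightarrow>\<^sub>0 nat" and c :: 'b
  let ?a = "Poly_Mapping.single S (Poly_Mapping.single m c)"
  have a: "?a \<in> kc (card S) (mon_deg m + card S)"
    by (rule kc_single) (simp_all add: homogeneous_single)
  show "kproj i d (koszul_diff ?a) = koszul_diff (kproj (Suc i) d ?a)"
  proof (cases "card S")
    case 0
    then have "koszul_diff ?a = 0" using koszul_diff_kc_0 a by metis
    moreover have "kproj (Suc i) d ?a = 0" by (rule kproj_other[OF a]) (simp add: 0)
    ultimately show ?thesis by (simp add: kproj_id koszul_diff_zero)
  next
    case (Suc n)
    then have b: "koszul_diff ?a \<in> kc n (mon_deg m + card S)" using kc_koszul_diff a by metis
    show ?thesis
    proof (cases "(n, mon_deg m + card S) = (i, d)")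
      case True
      with a b Suc have "?a \<in> kc (Suc i) d" "koszul_diff ?a \<in> kc i d" by auto
      then show ?thesis by (simp add: kproj_id)
    next
      case False
      have "kproj (Suc i) d ?a = 0" by (rule kproj_other[OF a]) (use False Suc in auto)
      then show ?thesis using kproj_other[OF b False] by (simp add: koszul_diff_zero)
    qed
  qed
qed (simp_all add: koszul_diff_add kproj_add)

text \<open>Bidegree \<open>(0, 0)\<close> is excluded, since there the augmentation obstructs
  exactness.\<close>

lemma koszul_exact_kc:
  assumes "a \<in> kc i d" "koszul_diff a = 0" "0 < i \<or> 0 < d"
  obtains b where "b \<in> kc (Suc i) d" "koszul_diff b = a"
proof -
  have "Poly_Mapping.lookup (lk a {}) 0 = 0"
  proof (cases "i = 0")
    case True
    then have "homogeneous d (lk a {})" using kc_lookup[OF assms(1), of "{}"] by simp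
    then have "0 \<notin> Poly_Mapping.keys (lk a {})"
      using True assms(3) by (auto simp: homogeneous_def)
    then show ?thesis by (simp add: in_keys_iff)
  next
    case False
    then have "lk a {} = 0" using kc_card[OF assms(1), of "{}"] by fastforce
    then show ?thesis by simp
  qed
  with assms(2) have "a \<in> range koszul_diff" unfolding koszul_exact by simp
  then obtain b where b: "a = koszul_diff b" by auto
  have "koszul_diff (kproj (Suc i) d b) = a" using b assms(1) by (metis kproj_id kproj_koszul_diff)
  then show thesis using that kproj_kc by blast
qed

lemma parity_twist_kc: "a \<in> kc i d \<Longrightarrow> parity_twist a = (if even i then a else - a)"
proof (rule koszul_eqI)
  fix S assume a: "a \<in> kc i d"
  show "lk (parity_twist a) S = lk (if even i then a else - a) S"
    using kc_card[OF a, of S] by (cases "lk a S = 0") (auto simp: lookup_parity_twist)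
qed

lemma koszul_leibniz_kc:
  "a \<in> kc i d \<Longrightarrow> koszul_diff (wedge a b) =
     wedge (koszul_diff a) b + (if even i then wedge a (koszul_diff b) else - wedge a (koszul_diff b))"
  by (simp add: koszul_leibniz parity_twist_kc wedge_uminus_left)

lemma wedge_commute_kc:
  "a \<in> kc i d \<Longrightarrow> b \<in> kc j e \<Longrightarrow> wedge b a = (if odd (i * j) then - wedge a b else wedge a b)"
  by (rule wedge_graded_commute) (use kc_card in blast)+

text \<open>Graded commutativity gives \<open>wedge a a = - wedge a a\<close>, and characteristic
  zero allows division by 2.\<close>

lemma wedge_self_odd:
  fixes a :: "('v::{finite,linorder}, 'k::field_char_0) koszul"
  assumes "a \<in> kc i d" "odd i"
  shows "wedge a a = 0"
proof -
  have "wedge a a = - wedge a a" using wedge_commute_kc[OF assms(1,1)] assms(2) by simp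
  then have "wedge a a + wedge a a = 0" by (simp add: eq_neg_iff_add_eq_0)
  moreover have "mconst (2 :: 'k) = (1 + 1 :: ('v, 'k) mpoly)"
    using mconst_add[of "1 :: 'k" 1] by (simp only: one_add_one mconst_one)
  ultimately have "pscale (mconst 2) (wedge a a) = 0"
    by (simp only: pscale_add_left pscale_one)
  then have "pscale (mconst (1 / 2) * mconst 2) (wedge a a) = 0"
    by (metis pscale_pscale pscale_zero_right)
  then show ?thesis by (simp flip: mconst_mult)
qed

section \<open>Covectors, evaluation at a point, and contraction\<close>

definition evec :: "('v::finite \<Rightarrow> 'k::comm_ring_1) \<Rightarrow> ('v, 'k) koszul" where
  "evec g = (\<Sum>v\<in>UNIV. Poly_Mapping.single {v} (mconst (g v)))"

lemma evec_kc: "evec g \<in> kc 1 1"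
  unfolding evec_def using kc_single[of "{_}" 1, OF _ homogeneous_const] by (intro kc_sum) simp

lemma koszul_diff_evec: "koszul_diff (evec g) = Poly_Mapping.single {} (lform g)"
  for g :: "'a::{finite,linorder} \<Rightarrow> 'b::comm_ring_1"
proof -
  have "koszul_diff (evec g) = (\<Sum>v\<in>UNIV. Poly_Mapping.single {} (mvar v * mconst (g v)))"
  proof -
    have "{u. u = v \<and> u < v} = {}" for v :: 'a by auto
    note [simp] = this
    show ?thesis unfolding evec_def koszul_diff_sum koszul_diff_single by simp
  qed
  also have "\<dots> = Poly_Mapping.single {} (\<Sum>v\<in>UNIV. mvar v * mconst (g v))"
    by (rule additive_sum[symmetric]) (simp add: single_add)
  finally show ?thesis by (simp add: lform_def mult.commute)
qed

lemma koszul_diff_evec_wedge: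
  "koszul_diff (wedge (evec g) a) = pscale (lform g) a - wedge (evec g) (koszul_diff a)"
  by (simp add: koszul_leibniz_kc[OF evec_kc] koszul_diff_evec pscale_def)

text \<open>The value at \<open>y\<close> is an element of the exterior algebra over the field. It
  is kept in the Koszul type as an element with constant coefficients, so that \<open>wedge\<close>
  and \<open>koszul_diff\<close> still apply.\<close>

definition evk :: "('v \<Rightarrow> 'k) \<Rightarrow> ('v::{finite,linorder}, 'k::comm_ring_1) koszul \<Rightarrow> ('v, 'k) koszul" where
  "evk y a = (\<Sum>S\<in>UNIV. Poly_Mapping.single S (mconst (mpoly_eval (lk a S) y)))"

lemma lookup_evk [simp]: "lk (evk y a) S = mconst (mpoly_eval (lk a S) y)"
  by (simp add: evk_def lookup_sum lookup_single when_def)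

lemma evk_add: "evk y (a + b) = evk y a + evk y b"
  by (rule koszul_eqI) (simp add: lookup_add mpoly_eval_add mconst_add)

lemma evk_zero [simp]: "evk y 0 = 0"
  by (rule koszul_eqI) simp

lemma evk_diff: "evk y (a - b) = evk y a - evk y b"
  by (rule koszul_eqI) (simp add: lookup_minus mpoly_eval_diff mconst_diff)

lemma evk_sum: "evk y (\<Sum>i\<in>I. F i) = (\<Sum>i\<in>I. evk y (F i))"
  by (rule additive_sum) (rule evk_add)

lemma evk_single: "evk y (Poly_Mapping.single S q) = Poly_Mapping.single S (mconst (mpoly_eval q y))"
  by (rule koszul_eqI) (simp add: lookup_single when_def)

lemma mpoly_eval_wedge_sign [simp]: "mpoly_eval (wedge_sign S T) y = wedge_sign S T"
  by (simp add: wedge_sign_def mpoly_eval_power mpoly_eval_uminus)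

lemma mconst_wedge_sign [simp]: "mconst (wedge_sign S T) = wedge_sign S T"
  by (simp add: wedge_sign_def mconst_neg_one_power)

lemma evk_wedge: "evk y (wedge a b) = wedge (evk y a) (evk y b)"
proof (rule koszul_additive_eq[where f = "\<lambda>a. evk y (wedge a b)" and g = "\<lambda>a. wedge (evk y a) (evk y b)"])
  fix S q
  show "evk y (wedge (Poly_Mapping.single S q) b) = wedge (evk y (Poly_Mapping.single S q)) (evk y b)"
    by (rule koszul_additive_eq[where f = "\<lambda>b. evk y (wedge (Poly_Mapping.single S q) b)"])
      (simp_all add: wedge_add_right evk_add evk_single wedge_single mpoly_eval_mult mconst_mult)
qed (simp_all add: wedge_add_left evk_add)

lemma evk_pscale: "evk y (pscale f a) = pscale (mconst (mpoly_eval f y)) (evk y a)"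
  by (simp add: pscale_def evk_wedge evk_single)

lemma evk_evk [simp]: "evk y (evk z a) = evk z a"
  by (rule koszul_eqI) simp

lemma evk_koszul_diff_evk: "evk y (koszul_diff (evk y a)) = evk y (koszul_diff a)"
  for a :: "('a::{finite,linorder}, 'b::comm_ring_1) koszul"
proof (rule koszul_additive_eq[where f = "\<lambda>a. evk y (koszul_diff (evk y a))"])
  fix S :: "'a set" and q :: "('a, 'b) mpoly"
  show "evk y (koszul_diff (evk y (Poly_Mapping.single S q))) = evk y (koszul_diff (Poly_Mapping.single S q))"
    by (simp add: evk_single koszul_diff_single evk_sum mpoly_eval_mult)
qed (simp_all add: koszul_diff_add evk_add)

lemma evk_const: "a \<in> kc i i \<Longrightarrow> evk y a = a"
proof (rule koszul_eqI)
  fix S assume a: "a \<in> kc i i"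
  then have "lk a S = mconst (Poly_Mapping.lookup (lk a S) 0)"
    using kc_lookup[OF a, of S] by (simp add: homogeneous_0_iff)
  then show "lk (evk y a) S = lk a S" by (metis lookup_evk mpoly_eval_const)
qed

lemma evk_kc: "a \<in> kc i d \<Longrightarrow> evk y a \<in> kc i i"
  using homogeneous_const by (auto simp: koszul_component_iff)

lemma evk_evec [simp]: "evk y (evec g) = evec g"
  by (rule evk_const[OF evec_kc])

text \<open>On constant coefficients this is contraction with \<open>y\<close> in the exterior algebra.\<close>

definition iota :: "('v \<Rightarrow> 'k) \<Rightarrow> ('v::{finite,linorder}, 'k::comm_ring_1) koszul \<Rightarrow> ('v, 'k) koszul" where
  "iota y a = evk y (koszul_diff a)"

lemma iota_evk: "iota y (evk y a) = iota y a"
  by (simp add: iota_def evk_koszul_diff_evk)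

lemma iota_add: "iota y (a + b) = iota y a + iota y b"
  by (simp add: iota_def koszul_diff_add evk_add)

lemma iota_diff: "iota y (a - b) = iota y a - iota y b"
  by (simp add: iota_def koszul_diff_diff_eq evk_diff)

lemma iota_zero [simp]: "iota y 0 = 0"
  by (simp add: iota_def koszul_diff_zero)

lemma iota_sum: "iota y (\<Sum>i\<in>I. F i) = (\<Sum>i\<in>I. iota y (F i))"
  by (rule additive_sum) (rule iota_add)

lemma iota_pscale: "iota y (pscale f a) = pscale (mconst (mpoly_eval f y)) (iota y a)"
  by (simp add: iota_def koszul_diff_pscale evk_pscale)

lemma iota_kc: "a \<in> kc (Suc i) d \<Longrightarrow> iota y a \<in> kc i i"
  unfolding iota_def by (rule evk_kc) (rule kc_koszul_diff)

lemma iota_iota: "iota y (iota y a) = 0"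
  by (simp add: iota_def evk_koszul_diff_evk koszul_diff_diff)

lemma iota_evec_wedge:
  "iota y (wedge (evec g) a) = pscale (mconst (dot g y)) (evk y a) - wedge (evec g) (iota y a)"
  by (simp add: iota_def koszul_diff_evec_wedge evk_diff evk_pscale evk_wedge)

text \<open>Contraction with \<open>y\<close> is an antiderivation, so multiplication by a covector
  with value 1 at \<open>y\<close> is a contracting homotopy. This is the source of all local
  primitives.\<close>

lemma iota_homotopy:
  assumes "dot g y = 1" "iota y a = 0"
  shows "evk y a = iota y (wedge (evec g) (evk y a))"
  using iota_evec_wedge[of y g "evk y a"] assms by (simp add: iota_evk)

lemma exists_dual_covector:
  fixes y :: "'v::finite \<Rightarrow> 'k::field"
  assumes "y \<noteq> (\<lambda>_. 0)"
  obtains g where "dot g y = 1"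
proof -
  from assms obtain v where v: "y v \<noteq> 0" by auto
  have "dot (\<lambda>w. if w = v then 1 / y v else 0) y = (\<Sum>w\<in>UNIV. if w = v then 1 / y v * y w else 0)"
    unfolding dot_def by (rule sum.cong) auto
  with v show thesis using that by simp
qed

section \<open>Cycles and boundaries modulo the ideal of points\<close>

abbreviation Zc :: "nat \<Rightarrow> (nat \<Rightarrow> 'v \<Rightarrow> 'k) \<Rightarrow> ('v::{finite,linorder}, 'k::field) koszul set" where
  "Zc t x \<equiv> tor_cycles (pideal t x)"

abbreviation Bd :: "nat \<Rightarrow> (nat \<Rightarrow> 'v \<Rightarrow> 'k) \<Rightarrow> ('v::{finite,linorder}, 'k::field) koszul set" where
  "Bd t x \<equiv> tor_boundaries (pideal t x)"

definition JK :: "nat \<Rightarrow> (nat \<Rightarrow> 'v \<Rightarrow> 'k) \<Rightarrow> ('v::{finite,linorder}, 'k::field) koszul set" where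
  "JK t x = {a. \<forall>S. lk a S \<in> pideal t x}"

text \<open>Reduces membership in \<open>JK\<close> to finitely many elements of the exterior
  algebra, one for each point.\<close>

lemma JK_kc_iff: "a \<in> kc i d \<Longrightarrow> a \<in> JK t x \<longleftrightarrow> (\<forall>p<t. evk (x p) a = 0)"
  for a :: "('a::{finite,linorder}, 'b::field) koszul"
proof -
  assume a: "a \<in> kc i d"
  have c: "mconst (c :: 'b) = 0 \<longleftrightarrow> c = 0" for c
    by (metis mpoly_eval_const mconst_zero)
  have "evk y a = 0 \<longleftrightarrow> (\<forall>S. mpoly_eval (lk a S) y = 0)" for y
    using lookup_evk[of y a] by (metis c koszul_eqI lookup_zero)
  then show ?thesis by (auto simp: JK_def pideal_homogeneous[OF kc_lookup[OF a]])
qed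

lemma JK_zero [simp]: "0 \<in> JK t x"
  by (simp add: JK_def pideal_zero)

lemma JK_add: "a \<in> JK t x \<Longrightarrow> b \<in> JK t x \<Longrightarrow> a + b \<in> JK t x"
  by (simp add: JK_def lookup_add pideal_add)

lemma JK_pscale: "a \<in> JK t x \<Longrightarrow> pscale f a \<in> JK t x"
  by (simp add: JK_def pideal_mult)

lemma JK_uminus: "a \<in> JK t x \<Longrightarrow> - a \<in> JK t x"
  using JK_pscale[of a t x "- 1"] by (simp add: pscale_uminus_left)

lemma JK_diff: "a \<in> JK t x \<Longrightarrow> b \<in> JK t x \<Longrightarrow> a - b \<in> JK t x"
  using JK_add[of a t x "- b"] JK_uminus by auto

lemma JK_sum: "(\<And>i. i \<in> I \<Longrightarrow> F i \<in> JK t x) \<Longrightarrow> (\<Sum>i\<in>I. F i) \<in> JK t x"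
  by (induction I rule: infinite_finite_induct) (auto intro: JK_add)

lemma JK_kproj: "a \<in> JK t x \<Longrightarrow> kproj i d a \<in> JK t x"
  by (simp add: JK_def lookup_kproj pideal_hcomp pideal_zero)

lemma pideal_mult_right: "f \<in> pideal t x \<Longrightarrow> f * q \<in> pideal t x"
  by (subst mult.commute) (rule pideal_mult)

lemma JK_pscale_ideal: "f \<in> pideal t x \<Longrightarrow> pscale f a \<in> JK t x"
  by (simp add: JK_def pideal_mult_right)

lemma Zc_iff: "a \<in> Zc t x \<longleftrightarrow> koszul_diff a \<in> JK t x"
  by (simp add: tor_cycles_def JK_def)

lemma Bd_iff: "a \<in> Bd t x \<longleftrightarrow> (\<exists>b. a - koszul_diff b \<in> JK t x)"
  by (simp add: tor_boundaries_def JK_def)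

lemma ring_Zc: "ring (tor_cycle_ring (pideal t x))"
  by (rule ring_tor_cycle_ring[OF subspace_pideal])

lemma ideal_Bd: "ideal (Bd t x) (tor_cycle_ring (pideal t x))"
  by (rule ideal_tor_boundaries[OF subspace_pideal])

lemma JK_Bd: "a \<in> JK t x \<Longrightarrow> a \<in> Bd t x"
  unfolding Bd_iff by (rule exI[of _ 0]) (simp add: koszul_diff_zero)

lemma koszul_diff_Bd: "koszul_diff b \<in> Bd t x"
  unfolding Bd_iff by (rule exI[of _ b]) simp

lemma Bd_zero [simp]: "0 \<in> Bd t x"
  by (rule JK_Bd) simp

lemma Bd_add: assumes "a \<in> Bd t x" "b \<in> Bd t x" shows "a + b \<in> Bd t x"
proof -
  from assms obtain a' b' where "a - koszul_diff a' \<in> JK t x" "b - koszul_diff b' \<in> JK t x"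
    by (auto simp: Bd_iff)
  from JK_add[OF this] have "(a + b) - koszul_diff (a' + b') \<in> JK t x"
    by (simp add: koszul_diff_add algebra_simps)
  then show ?thesis unfolding Bd_iff by blast
qed

lemma Bd_pscale: assumes "a \<in> Bd t x" shows "pscale f a \<in> Bd t x"
proof -
  from assms obtain b where "a - koszul_diff b \<in> JK t x" by (auto simp: Bd_iff)
  from JK_pscale[OF this, of f] have "pscale f a - koszul_diff (pscale f b) \<in> JK t x"
    by (simp add: koszul_diff_pscale pscale_diff_right)
  then show ?thesis unfolding Bd_iff by blast
qed

lemma Bd_uminus: "a \<in> Bd t x \<Longrightarrow> - a \<in> Bd t x"
  using Bd_pscale[of a t x "- 1"] by (simp add: pscale_uminus_left)

lemma Bd_kproj: assumes "a \<in> Bd t x" shows "kproj i d a \<in> Bd t x"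
proof -
  from assms obtain b where "a - koszul_diff b \<in> JK t x" by (auto simp: Bd_iff)
  from JK_kproj[OF this, of i d] have "kproj i d a - koszul_diff (kproj (Suc i) d b) \<in> JK t x"
    by (simp add: kproj_diff kproj_koszul_diff)
  then show ?thesis unfolding Bd_iff by blast
qed

text \<open>Projecting to the bidegree of \<open>a\<close> makes the primitive homogeneous, and the
  error stays in \<open>JK\<close> because the ideal is homogeneous.\<close>

lemma Bd_kc:
  assumes "a \<in> Bd t x" "a \<in> kc i d"
  obtains b where "b \<in> kc (Suc i) d" "a - koszul_diff b \<in> JK t x"
proof -
  from assms obtain b where "a - koszul_diff b \<in> JK t x" by (auto simp: Bd_iff)
  from JK_kproj[OF this, of i d] have "a - koszul_diff (kproj (Suc i) d b) \<in> JK t x"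
    by (simp add: kproj_diff kproj_koszul_diff kproj_id[OF assms(2)])
  then show thesis using that kproj_kc by blast
qed

lemma Zc_zero [simp]: "0 \<in> Zc t x"
  by (simp add: Zc_iff koszul_diff_zero)

lemma Zc_add: "a \<in> Zc t x \<Longrightarrow> b \<in> Zc t x \<Longrightarrow> a + b \<in> Zc t x"
  by (simp add: Zc_iff koszul_diff_add JK_add)

lemma Zc_pscale: "a \<in> Zc t x \<Longrightarrow> pscale f a \<in> Zc t x"
  by (simp add: Zc_iff koszul_diff_pscale JK_pscale)

lemma Zc_uminus: "a \<in> Zc t x \<Longrightarrow> - a \<in> Zc t x"
  by (simp add: Zc_iff koszul_diff_uminus JK_uminus)

lemma Zc_diff: "a \<in> Zc t x \<Longrightarrow> b \<in> Zc t x \<Longrightarrow> a - b \<in> Zc t x"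
  by (simp add: Zc_iff koszul_diff_diff_eq JK_diff)

lemma Zc_sum: "(\<And>i. i \<in> I \<Longrightarrow> F i \<in> Zc t x) \<Longrightarrow> (\<Sum>i\<in>I. F i) \<in> Zc t x"
  by (induction I rule: infinite_finite_induct) (auto intro: Zc_add)

lemma Zc_wedge: "a \<in> Zc t x \<Longrightarrow> b \<in> Zc t x \<Longrightarrow> wedge a b \<in> Zc t x"
  using monoid.m_closed[OF ring.is_monoid[OF ring_Zc], of a t x b] by (simp add: tor_cycle_ring_def)

lemma Bd_wedge_left: "a \<in> Bd t x \<Longrightarrow> b \<in> Zc t x \<Longrightarrow> wedge a b \<in> Bd t x"
  using ideal.I_r_closed[OF ideal_Bd, of a t x b] by (simp add: tor_cycle_ring_def)

lemma Bd_wedge_right: "a \<in> Zc t x \<Longrightarrow> b \<in> Bd t x \<Longrightarrow> wedge a b \<in> Bd t x"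
  using ideal.I_l_closed[OF ideal_Bd, of b t x a] by (simp add: tor_cycle_ring_def)

section \<open>Linear algebra in the Tor algebra\<close>

definition lincomb :: "(nat \<Rightarrow> 'k) \<Rightarrow> ('v::{finite,linorder}, 'k::comm_ring_1) koszul list \<Rightarrow> ('v, 'k) koszul" where
  "lincomb c zs = (\<Sum>i<length zs. pscale (mconst (c i)) (zs ! i))"

lemma lincomb_Nil [simp]: "lincomb c [] = 0"
  by (simp add: lincomb_def)

lemma lincomb_Cons: "lincomb c (z # zs) = pscale (mconst (c 0)) z + lincomb (\<lambda>i. c (Suc i)) zs"
  by (simp add: lincomb_def lessThan_Suc_eq_insert_0 sum.reindex)

lemma lincomb_append: "lincomb c (zs @ ws) = lincomb c zs + lincomb (\<lambda>i. c (length zs + i)) ws"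
  by (induction zs arbitrary: c) (simp_all add: lincomb_Cons add.assoc)

lemma lincomb_scale: "lincomb (\<lambda>i. a * c i) zs = pscale (mconst a) (lincomb c zs)"
  by (simp add: lincomb_def mconst_mult pscale_sum_right)

lemma lincomb_cong: "(\<And>i. i < length zs \<Longrightarrow> c i = d i) \<Longrightarrow> lincomb c zs = lincomb d zs"
  by (simp add: lincomb_def)

lemma lincomb_zero: "(\<And>i. i < length zs \<Longrightarrow> c i = 0) \<Longrightarrow> lincomb c zs = 0"
  by (simp add: lincomb_def)

lemma lincomb_Zc: "set zs \<subseteq> Zc t x \<Longrightarrow> lincomb c zs \<in> Zc t x"
  unfolding lincomb_def by (intro Zc_sum Zc_pscale) auto

lemma lincomb_kc: "set zs \<subseteq> kc i d \<Longrightarrow> lincomb c zs \<in> kc i d"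
  unfolding lincomb_def by (intro kc_sum kc_scale) auto

definition lin_functional :: "(('v::{finite,linorder}, 'k::comm_ring_1) koszul \<Rightarrow> 'k) \<Rightarrow> bool" where
  "lin_functional \<phi> \<longleftrightarrow> (\<forall>a b. \<phi> (a + b) = \<phi> a + \<phi> b) \<and> (\<forall>c a. \<phi> (pscale (mconst c) a) = c * \<phi> a)"

lemma lin_functional_add: "lin_functional \<phi> \<Longrightarrow> \<phi> (a + b) = \<phi> a + \<phi> b"
  by (simp add: lin_functional_def)

lemma lin_functional_scale: "lin_functional \<phi> \<Longrightarrow> \<phi> (pscale (mconst c) a) = c * \<phi> a"
  by (simp add: lin_functional_def)

lemma lin_functional_sum: "lin_functional \<phi> \<Longrightarrow> \<phi> (\<Sum>i\<in>I. F i) = (\<Sum>i\<in>I. \<phi> (F i))"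
  by (rule additive_sum) (simp add: lin_functional_def)

lemma lin_functional_lincomb:
  "lin_functional \<phi> \<Longrightarrow> \<phi> (lincomb c zs) = (\<Sum>i<length zs. c i * \<phi> (zs ! i))"
  unfolding lincomb_def by (simp add: lin_functional_sum lin_functional_scale)

lemma lin_functional_uminus: "lin_functional \<phi> \<Longrightarrow> \<phi> (- a) = - \<phi> a"
  using lin_functional_scale[of \<phi> "- 1" a] by (simp add: mconst_uminus pscale_uminus_left)

lemma lin_functional_diff: "lin_functional \<phi> \<Longrightarrow> \<phi> (a - b) = \<phi> a - \<phi> b"
  using lin_functional_add[of \<phi> a "- b"] by (simp add: lin_functional_uminus)

section \<open>The quotient algebra and bases of its components\<close>

locale tor_points =
  fixes t :: nat and x :: "nat \<Rightarrow> 'v::{finite,linorder} \<Rightarrow> 'k::field"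
  assumes t_pos: "0 < t" and x_nonzero: "\<And>p. p < t \<Longrightarrow> x p \<noteq> (\<lambda>_. 0)"
begin

abbreviation "Zr \<equiv> tor_cycle_ring (pideal t x)"
abbreviation "Z \<equiv> Zc t x"
abbreviation "B \<equiv> Bd t x"
abbreviation "A \<equiv> tor_algebra (pideal t x)"

definition cl :: "('v, 'k) koszul \<Rightarrow> ('v, 'k) koszul set" where
  "cl z = B +>\<^bsub>Zr\<^esub> z"

sublocale Zr: ring Zr by (rule ring_Zc)

sublocale Bd: ideal B Zr by (rule ideal_Bd)

lemma Zr_simps [simp]:
  "carrier Zr = Z" "mult Zr = wedge" "one Zr = Poly_Mapping.single {} 1" "zero Zr = 0" "add Zr = (+)"
  by (simp_all add: tor_cycle_ring_def)

lemma A_simps: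
  "carrier A = carrier (Zr Quot B)" "mult A = mult (Zr Quot B)" "one A = one (Zr Quot B)"
  "zero A = zero (Zr Quot B)" "add A = add (Zr Quot B)"
  by (simp_all add: tor_algebra_def ring.extend_def Let_def)

lemma scalars_A: "scalars A = {cl (Poly_Mapping.single {} (mconst c)) | c. True}"
  by (simp add: tor_algebra_def ring.extend_def bigraded_algebra.fields_def cl_def Let_def)

lemma component_A: "component A i d = cl ` (Z \<inter> kc i d)"
  by (auto simp: tor_algebra_def ring.extend_def bigraded_algebra.fields_def cl_def Let_def)

text \<open>The algebra has the operations of the quotient ring but belongs to a larger record type,
  so the ring axioms are transferred through their unfolded definitions.\<close>

lemma ring_A: "ring A"
proof -
  have "ring R'" if "ring R" "carrier R' = carrier R" "mult R' = mult R" "one R' = one R"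
    "zero R' = zero R" "add R' = add R" for R :: "('a, 'b) ring_scheme" and R' :: "('a, 'c) ring_scheme"
  proof -
    note defs = ring_def abelian_group_def abelian_monoid_def abelian_group_axioms_def
      Group.monoid_def ring_axioms_def Group.comm_monoid_def comm_monoid_axioms_def
      comm_group_def Group.group_def group_axioms_def Units_def
      partial_object.select_convs monoid.select_convs
    show ?thesis unfolding defs that(2-6) by (rule that(1)[unfolded defs])
  qed
  then show ?thesis using Bd.quotient_is_ring A_simps by metis
qed

sublocale A: ring A by (rule ring_A)

declare A.Span.simps [simp del]

lemma carrier_A: "carrier A = cl ` Z"
  by (auto simp: A_simps FactRing_def A_RCOSETS_def' cl_def)

lemma cl_mult: "a \<in> Z \<Longrightarrow> b \<in> Z \<Longrightarrow> cl a \<otimes>\<^bsub>A\<^esub> cl b = cl (wedge a b)"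
  using Bd.rcoset_mult_add[of a b] by (simp add: A_simps FactRing_simps cl_def)

lemma cl_add: "a \<in> Z \<Longrightarrow> b \<in> Z \<Longrightarrow> cl a \<oplus>\<^bsub>A\<^esub> cl b = cl (a + b)"
  using Bd.a_rcos_sum[of a b] by (simp add: A_simps FactRing_simps cl_def)

lemma Zr_minus: "a \<in> Z \<Longrightarrow> \<ominus>\<^bsub>Zr\<^esub> a = - a"
  using Zr.add.inv_equality[of "- a" a] by (simp add: Zc_uminus a_inv_def)

lemma cl_eq_iff: "a \<in> Z \<Longrightarrow> b \<in> Z \<Longrightarrow> cl a = cl b \<longleftrightarrow> a - b \<in> B"
proof -
  assume ab: "a \<in> Z" "b \<in> Z"
  have "a \<ominus>\<^bsub>Zr\<^esub> b = a - b" using ab by (simp add: Zr.minus_eq Zr_minus)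
  moreover have "cl a = cl b \<longleftrightarrow> a \<in> cl b"
    using ab Bd.a_repr_independence'[of a b] Bd.a_repr_independenceD[of a b] by (auto simp: cl_def)
  moreover have "a \<in> cl b \<longleftrightarrow> a \<ominus>\<^bsub>Zr\<^esub> b \<in> B"
    using Bd.a_rcos_module_minus[OF Zr.ring_axioms, of b a] ab by (simp add: cl_def)
  ultimately show ?thesis by simp
qed

lemma cl_zero: "\<zero>\<^bsub>A\<^esub> = cl 0"
  using A.l_zero[of "cl 0"] by (metis (no_types, lifting) A.add.l_cancel_one' A.zero_closed Zc_zero add.left_neutral carrier_A cl_add image_eqI)

lemma cl_eq_zero: "a \<in> Z \<Longrightarrow> cl a = \<zero>\<^bsub>A\<^esub> \<longleftrightarrow> a \<in> B"
  by (simp add: cl_zero cl_eq_iff)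

lemma cl_in_A [simp]: "a \<in> Z \<Longrightarrow> cl a \<in> carrier A"
  by (auto simp: carrier_A)

lemma cl_uminus: "a \<in> Z \<Longrightarrow> \<ominus>\<^bsub>A\<^esub> cl a = cl (- a)"
  by (rule A.minus_equality) (simp_all add: cl_add Zc_uminus cl_zero)

definition sc :: "'k \<Rightarrow> ('v, 'k) koszul" where
  "sc c = Poly_Mapping.single {} (mconst c)"

lemma sc_Z [simp]: "sc c \<in> Z"
  by (simp add: sc_def Zc_iff)

lemma scalars_sc: "scalars A = range (\<lambda>c. cl (sc c))"
  by (auto simp: scalars_A sc_def)

lemma wedge_sc: "wedge (sc c) z = pscale (mconst c) z"
  by (simp add: sc_def pscale_def)

lemma one_notin_B: "Poly_Mapping.single {} 1 \<notin> B"
proof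
  assume "Poly_Mapping.single {} 1 \<in> B"
  moreover have "Poly_Mapping.single {} 1 \<in> (kc 0 0 :: ('v, 'k) koszul set)"
    using kc_single[of "{}" 0 0 1] by simp
  ultimately obtain b where b: "b \<in> kc (Suc 0) 0" "Poly_Mapping.single {} 1 - koszul_diff b \<in> JK t x"
    by (rule Bd_kc)
  have "b = 0" using b(1) by (intro koszul_eqI) (auto simp: koszul_component_iff)
  with b have "lk (Poly_Mapping.single {} 1 :: ('v, 'k) koszul) {} \<in> pideal t x"
    by (auto simp: koszul_diff_zero JK_def dest!: spec[of _ "{}"])
  then have "(1 :: ('v, 'k) mpoly) \<in> pideal t x" by simp
  then show False using t_pos by (simp add: pideal_homogeneous[of 0])
qed

lemma sc_B_iff: "sc c \<in> B \<longleftrightarrow> c = 0"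
proof
  assume "sc c \<in> B"
  then have "pscale (mconst (1 / c)) (sc c) \<in> B" by (rule Bd_pscale)
  moreover have "pscale (mconst (1 / c)) (sc c) = Poly_Mapping.single {} 1" if "c \<noteq> 0"
    by (rule koszul_eqI) (use that in \<open>simp add: sc_def lookup_single when_def flip: mconst_mult\<close>)
  ultimately show "c = 0" using one_notin_B by metis
qed (simp add: sc_def)

lemma one_A: "\<one>\<^bsub>A\<^esub> = cl (sc 1)"
  by (simp add: A_simps FactRing_simps cl_def sc_def)

lemma sc_mult: "wedge (sc a) (sc b) = sc (a * b)"
  by (simp add: sc_def wedge_single wedge_sign_def mconst_mult)

lemma sc_add: "sc a + sc b = sc (a + b)"
  by (simp add: sc_def mconst_add single_add)

lemma subfield_scalars: "subfield (scalars A) A"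
proof (rule A.subfieldI)
  have "subring (scalars A) A"
  proof (rule A.subringI)
    fix h assume "h \<in> scalars A"
    then obtain c where h: "h = cl (sc c)" by (auto simp: scalars_sc)
    have "- sc c = sc (- c)" by (simp add: sc_def mconst_uminus single_uminus)
    then show "\<ominus>\<^bsub>A\<^esub> h \<in> scalars A" by (auto simp: h scalars_sc cl_uminus)
  qed (auto simp: scalars_sc one_A cl_mult cl_add sc_mult sc_add)
  then show "subcring (scalars A) A"
    by (rule A.subcringI) (auto simp: scalars_sc cl_mult sc_mult mult.commute)
  show "Units (A\<lparr>carrier := scalars A\<rparr>) = scalars A - {\<zero>\<^bsub>A\<^esub>}"
  proof (intro subset_antisym subsetI)
    fix h assume h: "h \<in> Units (A\<lparr>carrier := scalars A\<rparr>)"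
    then obtain k where k: "h \<in> scalars A" "k \<in> scalars A" "k \<otimes>\<^bsub>A\<^esub> h = \<one>\<^bsub>A\<^esub>"
      by (auto simp: Units_def)
    have "h \<noteq> \<zero>\<^bsub>A\<^esub>"
    proof
      assume "h = \<zero>\<^bsub>A\<^esub>"
      then have "\<one>\<^bsub>A\<^esub> = \<zero>\<^bsub>A\<^esub>" using k by (auto simp: scalars_sc)
      then show False using cl_eq_zero[of "sc 1"] by (simp add: one_A sc_B_iff)
    qed
    then show "h \<in> scalars A - {\<zero>\<^bsub>A\<^esub>}" using k by simp
  next
    fix h assume h: "h \<in> scalars A - {\<zero>\<^bsub>A\<^esub>}"
    then obtain c where c: "h = cl (sc c)" by (auto simp: scalars_sc)
    with h have "c \<noteq> 0" using cl_eq_zero[of "sc c"] by (auto simp: sc_B_iff)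
    then have "cl (sc (1 / c)) \<otimes>\<^bsub>A\<^esub> h = \<one>\<^bsub>A\<^esub>" "h \<otimes>\<^bsub>A\<^esub> cl (sc (1 / c)) = \<one>\<^bsub>A\<^esub>"
      by (simp_all add: c cl_mult sc_mult one_A)
    moreover have "cl (sc (1 / c)) \<in> scalars A" by (auto simp: scalars_sc)
    ultimately show "h \<in> Units (A\<lparr>carrier := scalars A\<rparr>)" using h by (auto simp: Units_def)
  qed
qed

abbreviation "K \<equiv> scalars A"

lemma combine_cl:
  assumes "set zs \<subseteq> Z"
  shows "A.combine (map (\<lambda>i. cl (sc (c i))) [0..<length zs]) (map cl zs) = cl (lincomb c zs)"
  using assms
proof (induction zs arbitrary: c)
  case (Cons z zs)
  have m: "map (\<lambda>i. cl (sc (c i))) [0..<length (z # zs)] =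
      cl (sc (c 0)) # map (\<lambda>i. cl (sc (c (Suc i)))) [0..<length zs]"
    by (simp add: upt_conv_Cons map_Suc_upt[symmetric] del: upt_Suc map_Suc_upt)
  show ?case unfolding m using Cons.prems Cons.IH[of "\<lambda>i. c (Suc i)"]
    by (simp add: cl_mult cl_add wedge_sc lincomb_Cons Zc_pscale lincomb_Zc)
qed (simp add: cl_zero)

lemma scalar_list:
  assumes "set Ks \<subseteq> K" "length Ks = n"
  obtains c where "Ks = map (\<lambda>i. cl (sc (c i))) [0..<n]"
proof -
  have "\<exists>c. i < n \<longrightarrow> Ks ! i = cl (sc c)" for i
  proof (cases "i < n")
    case True
    then have "Ks ! i \<in> K" using assms nth_mem by blast
    then show ?thesis by (auto simp: scalars_sc)
  qed simp
  then have "\<forall>i. \<exists>c. i < n \<longrightarrow> Ks ! i = cl (sc c)" by blast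
  then obtain c where "\<forall>i. i < n \<longrightarrow> Ks ! i = cl (sc (c i))" unfolding choice_iff by blast
  then have "Ks = map (\<lambda>i. cl (sc (c i))) [0..<n]" using assms(2) by (intro nth_equalityI) auto
  then show thesis by (rule that)
qed

lemma Span_cl: "set zs \<subseteq> Z \<Longrightarrow> A.Span K (map cl zs) = range (\<lambda>c. cl (lincomb c zs))"
proof -
  assume zs: "set zs \<subseteq> Z"
  then have s: "set (map cl zs) \<subseteq> carrier A" by auto
  show ?thesis unfolding A.Span_eq_combine_set_length_version[OF subfield_scalars s]
  proof (intro subset_antisym subsetI)
    fix a assume "a \<in> {A.combine Ks (map cl zs) | Ks. length Ks = length (map cl zs) \<and> set Ks \<subseteq> K}"
    then obtain Ks where "a = A.combine Ks (map cl zs)" "length Ks = length zs" "set Ks \<subseteq> K" by auto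
    then show "a \<in> range (\<lambda>c. cl (lincomb c zs))" using combine_cl[OF zs] by (auto elim!: scalar_list)
  next
    fix a assume "a \<in> range (\<lambda>c. cl (lincomb c zs))"
    then obtain c where "a = A.combine (map (\<lambda>i. cl (sc (c i))) [0..<length zs]) (map cl zs)"
      using combine_cl[OF zs] by auto
    then show "a \<in> {A.combine Ks (map cl zs) | Ks. length Ks = length (map cl zs) \<and> set Ks \<subseteq> K}"
      by (auto simp: scalars_sc intro!: exI[of _ "map (\<lambda>i. cl (sc (c i))) [0..<length zs]"])
  qed
qed

definition indep :: "('v, 'k) koszul list \<Rightarrow> bool" where
  "indep zs \<longleftrightarrow> set zs \<subseteq> Z \<and> (\<forall>c. lincomb c zs \<in> B \<longrightarrow> (\<forall>i<length zs. c i = 0))"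

lemma indep_Z: "indep zs \<Longrightarrow> set zs \<subseteq> Z"
  by (simp add: indep_def)

lemma indepD: "indep zs \<Longrightarrow> lincomb c zs \<in> B \<Longrightarrow> i < length zs \<Longrightarrow> c i = 0"
  by (simp add: indep_def)

lemma independent_cl: "indep zs \<Longrightarrow> A.independent K (map cl zs)"
proof (rule A.trivial_combine_imp_independent[OF subfield_scalars])
  assume zs: "indep zs"
  show "set (map cl zs) \<subseteq> carrier A" using indep_Z[OF zs] by auto
  fix Ks assume Ks: "set Ks \<subseteq> K" and 0: "A.combine Ks (map cl zs) = \<zero>\<^bsub>A\<^esub>"
  show "set (take (length (map cl zs)) Ks) \<subseteq> {\<zero>\<^bsub>A\<^esub>}"
  proof -
    let ?n = "length zs"
    \<comment> \<open>\<open>A.combine\<close> stops at the end of the shorter list, so the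
      coefficients are padded with zeros to the number of vectors.\<close>
    let ?Ks = "take ?n (Ks @ replicate ?n \<zero>\<^bsub>A\<^esub>)"
    have "\<zero>\<^bsub>A\<^esub> \<in> K" using scalars_sc by (auto simp: cl_zero sc_def intro: range_eqI[of _ _ 0])
    with Ks have "set ?Ks \<subseteq> K" using set_take_subset[of ?n "Ks @ replicate ?n \<zero>\<^bsub>A\<^esub>"] by (auto dest!: in_set_takeD)
    moreover have len: "length ?Ks = ?n" by simp
    ultimately obtain c where c: "?Ks = map (\<lambda>i. cl (sc (c i))) [0..<?n]" by (rule scalar_list)
    have "set (map cl zs) \<subseteq> carrier A" using indep_Z[OF zs] by auto
    then have "A.combine (map (\<lambda>i. cl (sc (c i))) [0..<?n]) (map cl zs) = \<zero>\<^bsub>A\<^esub>"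
      unfolding c[symmetric]
      using A.combine_take[of "map cl zs" "Ks @ replicate ?n \<zero>\<^bsub>A\<^esub>"] A.combine_append_replicate[of "map cl zs" Ks ?n] 0
      by simp
    then have "lincomb c zs \<in> B"
      using combine_cl[OF indep_Z[OF zs], of c] cl_eq_zero[OF lincomb_Zc[OF indep_Z[OF zs]]] by simp
    then have "c i = 0" if "i < ?n" for i using indepD[OF zs] that by auto
    then have "set ?Ks \<subseteq> {\<zero>\<^bsub>A\<^esub>}" unfolding c by (auto simp: cl_zero sc_def)
    then show ?thesis by auto
  qed
qed

lemma alg_dim_Span: "indep zs \<Longrightarrow> alg_dim A (A.Span K (map cl zs)) = length zs"
  using A.dimI[OF subfield_scalars A.dimension_independent[OF independent_cl]]
  by (simp add: alg_dim_def over_def)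

lemma alg_span_eq_Span:
  assumes zs: "set zs \<subseteq> Z" and X: "X \<subseteq> A.Span K (map cl zs)" and zX: "cl ` set zs \<subseteq> X"
  shows "alg_span A X = A.Span K (map cl zs)"
proof
  have s: "set (map cl zs) \<subseteq> carrier A" using zs by auto
  show "alg_span A X \<subseteq> A.Span K (map cl zs)"
    unfolding alg_span_def
    using A.subalgebra_Span_incl[OF subfield_scalars A.Span_is_subalgebra[OF subfield_scalars s]] X
    by (auto simp: lists_eq_set)
  show "A.Span K (map cl zs) \<subseteq> alg_span A X"
    unfolding alg_span_def using zX by (intro UN_upper) auto
qed

definition is_basis :: "nat \<Rightarrow> nat \<Rightarrow> ('v, 'k) koszul list \<Rightarrow> bool" where
  "is_basis i d zs \<longleftrightarrow> indep zs \<and> set zs \<subseteq> kc i d \<and> (\<forall>z\<in>Z \<inter> kc i d. \<exists>c. z - lincomb c zs \<in> B)"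

lemma is_basisD:
  "is_basis i d zs \<Longrightarrow> indep zs" "is_basis i d zs \<Longrightarrow> set zs \<subseteq> kc i d" "is_basis i d zs \<Longrightarrow> set zs \<subseteq> Z"
  by (auto simp: is_basis_def dest: indep_Z)

lemma is_basis_span:
  assumes "is_basis i d zs" "z \<in> Z" "z \<in> kc i d"
  obtains c where "z - lincomb c zs \<in> B"
  using assms by (auto simp: is_basis_def)

lemma component_eq_Span:
  assumes "is_basis i d zs"
  shows "component A i d = A.Span K (map cl zs)"
  unfolding component_A Span_cl[OF is_basisD(3)[OF assms]]
proof (intro subset_antisym subsetI)
  fix a assume "a \<in> cl ` (Z \<inter> kc i d)"
  then obtain z where z: "a = cl z" "z \<in> Z" "z \<in> kc i d" by auto
  then obtain c where "z - lincomb c zs \<in> B" using is_basis_span[OF assms] by blast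
  then have "a = cl (lincomb c zs)" using z cl_eq_iff lincomb_Zc[OF is_basisD(3)[OF assms]] by auto
  then show "a \<in> range (\<lambda>c. cl (lincomb c zs))" by auto
next
  fix a assume "a \<in> range (\<lambda>c. cl (lincomb c zs))"
  then show "a \<in> cl ` (Z \<inter> kc i d)"
    using lincomb_Zc[OF is_basisD(3)[OF assms]] lincomb_kc[OF is_basisD(2)[OF assms]] by auto
qed

lemma alg_dim_component: "is_basis i d zs \<Longrightarrow> alg_dim A (component A i d) = length zs"
  by (simp add: component_eq_Span alg_dim_Span is_basisD)

text \<open>If \<open>N\<close> functionals vanish simultaneously only on boundaries, then more than
  \<open>N\<close> classes would admit a nontrivial combination killed by all of them. The
  functionals are evaluated on cycles, not on classes, so they may depend on the choice of local
  primitives.\<close>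

lemma indep_length_le:
  assumes \<phi>: "\<And>a. a < N \<Longrightarrow> lin_functional (\<phi> a)"
    and ker: "\<And>z. z \<in> Z \<Longrightarrow> z \<in> kc i d \<Longrightarrow> \<forall>a<N. \<phi> a z = 0 \<Longrightarrow> z \<in> B"
    and zs: "indep zs" "set zs \<subseteq> kc i d"
  shows "length zs \<le> N"
proof (rule ccontr)
  assume "\<not> length zs \<le> N"
  then obtain c where c: "\<exists>b\<in>{..<length zs}. c b \<noteq> 0" "\<forall>a<N. (\<Sum>b\<in>{..<length zs}. c b * \<phi> a (zs ! b)) = 0"
    using linear_relation_exists[of "{..<length zs}" N "\<lambda>a b. \<phi> a (zs ! b)"] by auto
  have "lincomb c zs \<in> B"
    using c(2) \<phi> by (intro ker lincomb_Zc lincomb_kc zs indep_Z) (simp add: lin_functional_lincomb)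
  then show False using indepD[OF zs(1)] c(1) by auto
qed

lemma lin_functional_coeff: "lin_functional (\<lambda>a. Poly_Mapping.lookup (lk a S) m)"
proof -
  have "Poly_Mapping.lookup (mconst c * q) m = c * Poly_Mapping.lookup q m" for c and q :: "('a, 'b::comm_ring_1) mpoly"
  proof (rule mpoly_additive_eq[where f = "\<lambda>q. Poly_Mapping.lookup (mconst c * q) m" and g = "\<lambda>q. c * Poly_Mapping.lookup q m"])
    fix n d
    show "Poly_Mapping.lookup (mconst c * Poly_Mapping.single n d) m = c * Poly_Mapping.lookup (Poly_Mapping.single n d) m"
      by (simp add: mconst_def mult_single lookup_single when_def)
  qed (simp_all add: algebra_simps lookup_add)
  then show ?thesis by (simp add: lin_functional_def lookup_add)
qed

lemma indep_length_bounded: "\<exists>N. \<forall>zs. indep zs \<longrightarrow> set zs \<subseteq> kc i d \<longrightarrow> length zs \<le> N"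
proof -
  let ?M = "(UNIV :: 'v set set) \<times> {m :: 'v \<Rightarrow>\<^sub>0 nat. mon_deg m = d - i}"
  have fin: "finite ?M" by (simp add: finite_mon_deg)
  then obtain f where f: "bij_betw f {0..<card ?M} ?M" using ex_bij_betw_nat_finite by blast
  let ?\<phi> = "\<lambda>a z. Poly_Mapping.lookup (lk z (fst (f a))) (snd (f a))"
  have "length zs \<le> card ?M" if "indep zs" "set zs \<subseteq> kc i d" for zs
  proof (rule indep_length_le[where \<phi> = ?\<phi>, OF _ _ that])
    show "lin_functional (?\<phi> a)" for a by (rule lin_functional_coeff)
    fix z :: "('v, 'k) koszul" assume z: "z \<in> kc i d" "\<forall>a<card ?M. ?\<phi> a z = 0"
    have "Poly_Mapping.lookup (lk z S) m = 0" for S m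
    proof (cases "mon_deg m = d - i")
      case True
      then have "(S, m) \<in> f ` {0..<card ?M}" using f by (simp add: bij_betw_def)
      then obtain a where "a < card ?M" "f a = (S, m)" by auto
      with z(2) show ?thesis by (metis fst_conv snd_conv)
    next
      case False
      then show ?thesis using kc_lookup[OF z(1), of S] by (auto simp: homogeneous_def in_keys_iff)
    qed
    then have "z = 0" by (intro koszul_eqI poly_mapping_eqI) simp
    then show "z \<in> B" by simp
  qed
  then show ?thesis by blast
qed

lemma indep_Nil [simp]: "indep []"
  by (simp add: indep_def)

lemma indep_snoc:
  assumes zs: "indep zs" and z: "z \<in> Z" "\<And>c. z - lincomb c zs \<notin> B"
  shows "indep (zs @ [z])"
  unfolding indep_def
proof (intro conjI allI impI)
  show "set (zs @ [z]) \<subseteq> Z" using indep_Z[OF zs] z by auto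
  fix c i assume c: "lincomb c (zs @ [z]) \<in> B" and i: "i < length (zs @ [z])"
  let ?a = "c (length zs)"
  have l: "lincomb c (zs @ [z]) = lincomb c zs + pscale (mconst ?a) z"
    by (simp add: lincomb_append lincomb_Cons)
  have a: "?a = 0"
  proof (rule ccontr)
    assume a: "?a \<noteq> 0"
    have "pscale (mconst (1 / ?a)) (lincomb c (zs @ [z])) \<in> B" by (rule Bd_pscale[OF c])
    also have "pscale (mconst (1 / ?a)) (lincomb c (zs @ [z])) = z - lincomb (\<lambda>i. - (1 / ?a) * c i) zs"
      unfolding l lincomb_scale using a
      by (simp add: pscale_add_right mconst_uminus pscale_uminus_left flip: mconst_mult)
    finally show False using z(2) by blast
  qed
  with c l have "lincomb c zs \<in> B" by simp
  with a i show "c i = 0" using indepD[OF zs] by (cases "i = length zs") auto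
qed

text \<open>A list of maximal length spans; lengths are bounded because an element of a bidegree is
  determined by finitely many coefficients.\<close>

lemma extend_basis:
  assumes "indep zs" "set zs \<subseteq> kc i d"
  obtains ws where "is_basis i d (zs @ ws)"
proof -
  obtain N where N: "\<And>zs. indep zs \<Longrightarrow> set zs \<subseteq> kc i d \<Longrightarrow> length zs \<le> N"
    using indep_length_bounded by blast
  define P where "P n \<longleftrightarrow> (\<exists>ws. length ws = n \<and> indep (zs @ ws) \<and> set (zs @ ws) \<subseteq> kc i d)" for n
  have "P 0" using assms by (simp add: P_def)
  moreover have "\<forall>n. P n \<longrightarrow> n \<le> N" using N by (fastforce simp: P_def)
  ultimately obtain n where n: "P n" "\<And>m. P m \<Longrightarrow> m \<le> n" by (metis GreatestI_nat Greatest_le_nat)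
  then obtain ws where ws: "length ws = n" "indep (zs @ ws)" "set (zs @ ws) \<subseteq> kc i d" by (auto simp: P_def)
  have "is_basis i d (zs @ ws)"
    unfolding is_basis_def
  proof (intro conjI ballI ws)
    fix z assume z: "z \<in> Z \<inter> kc i d"
    show "\<exists>c. z - lincomb c (zs @ ws) \<in> B"
    proof (rule ccontr)
      assume "\<nexists>c. z - lincomb c (zs @ ws) \<in> B"
      then have "indep ((zs @ ws) @ [z])" using z by (intro indep_snoc ws) auto
      then have "P (Suc n)" unfolding P_def using ws z by (intro exI[of _ "ws @ [z]"]) auto
      then show False using n(2) by fastforce
    qed
  qed
  then show thesis by (rule that)
qed

lemma obtain_basis: obtains zs where "is_basis i d zs"
  using extend_basis[of "[]" i d] by auto

lemma basis_length_unique: "is_basis i d zs \<Longrightarrow> is_basis i d ws \<Longrightarrow> length zs = length ws"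
  using alg_dim_component by metis

lemma indep_is_basis: "indep zs \<Longrightarrow> set zs \<subseteq> kc i d \<Longrightarrow> is_basis i d ws \<Longrightarrow> length ws \<le> length zs \<Longrightarrow> is_basis i d zs"
  by (metis add_le_same_cancel1 append.right_neutral basis_length_unique extend_basis le_zero_eq length_0_conv length_append)

lemma zero_basis_iff: "is_basis i d [] \<longleftrightarrow> Z \<inter> kc i d \<subseteq> B"
  by (auto simp: is_basis_def)

lemma alg_dim_product_space:
  assumes us: "indep us" "cl ` set us \<subseteq> {cl (wedge z w) | z w. z \<in> Z \<inter> kc i d \<and> w \<in> Z \<inter> kc j e}"
    and span: "\<And>z w. z \<in> Z \<Longrightarrow> z \<in> kc i d \<Longrightarrow> w \<in> Z \<Longrightarrow> w \<in> kc j e \<Longrightarrow> \<exists>c. wedge z w - lincomb c us \<in> B"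
  shows "alg_dim A (product_space A (component A i d) (component A j e)) = length us"
proof -
  let ?X = "{v \<otimes>\<^bsub>A\<^esub> w | v w. v \<in> component A i d \<and> w \<in> component A j e}"
  have "\<exists>v w. cl (wedge z w') = v \<otimes>\<^bsub>A\<^esub> w \<and> v \<in> component A i d \<and> w \<in> component A j e"
    if "z \<in> Z \<inter> kc i d" "w' \<in> Z \<inter> kc j e" for z w'
    using that by (intro exI[of _ "cl z"] exI[of _ "cl w'"]) (simp add: cl_mult component_A)
  then have X: "?X = {cl (wedge z w) | z w. z \<in> Z \<inter> kc i d \<and> w \<in> Z \<inter> kc j e}"
    by (fastforce simp: component_A cl_mult)
  have "?X \<subseteq> A.Span K (map cl us)"
    unfolding X Span_cl[OF indep_Z[OF us(1)]]
  proof
    fix a assume "a \<in> {cl (wedge z w) | z w. z \<in> Z \<inter> kc i d \<and> w \<in> Z \<inter> kc j e}"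
    then obtain z w where a: "a = cl (wedge z w)" "z \<in> Z" "z \<in> kc i d" "w \<in> Z" "w \<in> kc j e" by auto
    then obtain c where "wedge z w - lincomb c us \<in> B" using span by blast
    then have "a = cl (lincomb c us)" unfolding a(1)
      using a by (subst cl_eq_iff) (auto intro: Zc_wedge lincomb_Zc[OF indep_Z[OF us(1)]])
    then show "a \<in> range (\<lambda>c. cl (lincomb c us))" by auto
  qed
  then have "alg_span A ?X = A.Span K (map cl us)"
    using us(2) X by (intro alg_span_eq_Span indep_Z us(1)) auto
  then show ?thesis unfolding product_space_def using alg_dim_Span[OF us(1)] by simp
qed

lemma indep_append_degrees:
  assumes zs: "indep zs" "set zs \<subseteq> kc i d" and ws: "indep ws" "set ws \<subseteq> kc i e" and "d \<noteq> e"
  shows "indep (zs @ ws)"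
  unfolding indep_def
proof (intro conjI allI impI)
  show "set (zs @ ws) \<subseteq> Z" using indep_Z zs ws by auto
  fix c j assume c: "lincomb c (zs @ ws) \<in> B" and j: "j < length (zs @ ws)"
  let ?d = "\<lambda>i. c (length zs + i)"
  have l: "lincomb c (zs @ ws) = lincomb c zs + lincomb ?d ws" by (rule lincomb_append)
  have k: "lincomb c zs \<in> kc i d" "lincomb ?d ws \<in> kc i e" using zs ws lincomb_kc by blast+
  have "kproj i d (lincomb c (zs @ ws)) = lincomb c zs"
    unfolding l kproj_add using k \<open>d \<noteq> e\<close> kproj_other[of _ i e i d] by (simp add: kproj_id)
  then have 1: "lincomb c zs \<in> B" using Bd_kproj[OF c, of i d] by simp
  have "kproj i e (lincomb c (zs @ ws)) = lincomb ?d ws"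
    unfolding l kproj_add using k \<open>d \<noteq> e\<close> kproj_other[of _ i d i e] by (simp add: kproj_id)
  then have 2: "lincomb ?d ws \<in> B" using Bd_kproj[OF c, of i e] by simp
  show "c j = 0"
  proof (cases "j < length zs")
    case False
    then show ?thesis using indepD[OF ws(1) 2, of "j - length zs"] j by simp
  qed (use indepD[OF zs(1) 1] in simp)
qed

text \<open>Only two internal degrees carry nonzero classes, so bases of two components together
  form a basis of the homological component. The order of the two lists can be chosen so that the
  elements named in a multiplication table come first. The shift by one turns lists into families
  indexed from 1.\<close>

lemma hom_basis_append:
  assumes zs: "is_basis i d zs" and ws: "is_basis i e ws" and "d \<noteq> e"
    and other: "\<And>d'. d' \<noteq> d \<Longrightarrow> d' \<noteq> e \<Longrightarrow> Z \<inter> kc i d' \<subseteq> B"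
  shows "hom_basis A i (length (zs @ ws)) (\<lambda>j. cl ((zs @ ws) ! (j - 1)))"
proof -
  let ?us = "zs @ ws"
  have us: "indep ?us" using is_basisD[OF zs] is_basisD[OF ws] \<open>d \<noteq> e\<close> indep_append_degrees by blast
  have m: "map (\<lambda>j. cl (?us ! (j - 1))) [1..<Suc (length ?us)] = map cl ?us"
    by (intro nth_equalityI) (auto simp del: upt_Suc map_append)
  have "hom_component A i = A.Span K (map cl ?us)"
    unfolding hom_component_def
  proof (rule alg_span_eq_Span[OF indep_Z[OF us]])
    have "component A i d' \<subseteq> A.Span K (map cl ?us)" for d'
    proof -
      have "cl z \<in> A.Span K (map cl ?us)" if z: "z \<in> Z" "z \<in> kc i d'" for z
      proof -
        consider "d' = d" | "d' = e" | "d' \<noteq> d" "d' \<noteq> e" by blast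
        then obtain c where "z - lincomb c ?us \<in> B"
        proof cases
          case 1
          then obtain c where "z - lincomb c zs \<in> B" using is_basis_span[OF zs] z by blast
          moreover have "lincomb (\<lambda>i. if i < length zs then c i else 0) ?us = lincomb c zs"
            by (simp add: lincomb_append lincomb_zero cong: lincomb_cong)
          ultimately show thesis using that by metis
        next
          case 2
          then obtain c where "z - lincomb c ws \<in> B" using is_basis_span[OF ws] z by blast
          moreover have "lincomb (\<lambda>i. if i < length zs then 0 else c (i - length zs)) ?us = lincomb c ws"
            by (simp add: lincomb_append lincomb_zero)
          ultimately show thesis using that by metis
        next
          case 3
          then have "z \<in> B" using other z by blast
          then show thesis using that[of "\<lambda>_. 0"] by (simp add: lincomb_zero)
        qed
        then have "cl z = cl (lincomb c ?us)" using z cl_eq_iff lincomb_Zc[OF indep_Z[OF us]] by auto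
        then show ?thesis unfolding Span_cl[OF indep_Z[OF us]] by blast
      qed
      then show ?thesis by (auto simp: component_A)
    qed
    then show "(\<Union>d'. component A i d') \<subseteq> A.Span K (map cl ?us)" by blast
    show "cl ` set ?us \<subseteq> (\<Union>d'. component A i d')"
    proof
      fix a assume "a \<in> cl ` set ?us"
      then obtain z where "a = cl z" "z \<in> set zs \<or> z \<in> set ws" by auto
      then have "a \<in> component A i d \<or> a \<in> component A i e"
        using is_basisD[OF zs] is_basisD[OF ws] by (auto simp: component_A)
      then show "a \<in> (\<Union>d'. component A i d')" by blast
    qed
  qed
  then show ?thesis unfolding hom_basis_def m using independent_cl[OF us] by simp
qed

end

section \<open>Vanishing of Tor outside two strands\<close>

text \<open>The points impose independent conditions on forms of degree \<open>r\<close>: evaluation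
  at the chosen vectors reaches every tuple of values.\<close>

definition separated :: "nat \<Rightarrow> nat \<Rightarrow> (nat \<Rightarrow> 'v \<Rightarrow> 'k::field) \<Rightarrow> bool" where
  "separated r t x \<longleftrightarrow> (\<forall>p<t. \<exists>h. homogeneous r h \<and> (\<forall>q<t. mpoly_eval h (x q) = (if q = p then 1 else 0)))"

lemma separated_Suc:
  fixes x :: "nat \<Rightarrow> 'v::finite \<Rightarrow> 'k::field"
  assumes "separated r t x" "\<And>p. p < t \<Longrightarrow> x p \<noteq> (\<lambda>_. 0)"
  shows "separated (Suc r) t x"
  unfolding separated_def
proof (intro allI impI)
  fix p assume p: "p < t"
  then obtain h where h: "homogeneous r h" "\<forall>q<t. mpoly_eval h (x q) = (if q = p then 1 else 0)"
    using assms(1) by (auto simp: separated_def)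
  obtain g where g: "dot g (x p) = 1" using exists_dual_covector assms(2)[OF p] by blast
  have "homogeneous (Suc r) (lform g * h)" using homogeneous_mult[OF homogeneous_lform h(1), of g] by simp
  then show "\<exists>h. homogeneous (Suc r) h \<and> (\<forall>q<t. mpoly_eval h (x q) = (if q = p then 1 else 0))"
    using h(2) g by (intro exI[of _ "lform g * h"]) (auto simp: mpoly_eval_mult)
qed

lemma separated_mono:
  fixes x :: "nat \<Rightarrow> 'v::finite \<Rightarrow> 'k::field"
  assumes "separated r t x" "\<And>p. p < t \<Longrightarrow> x p \<noteq> (\<lambda>_. 0)" "r \<le> r'"
  shows "separated r' t x"
  using assms(3) by (induction rule: dec_induct) (use assms(1) separated_Suc[OF _ assms(2)] in auto)

lemma lookup_mvar_mult: "Poly_Mapping.lookup (mvar v * f) (m + Poly_Mapping.single v 1) = Poly_Mapping.lookup f m"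
  for f :: "('v, 'k::comm_ring_1) mpoly"
  by (rule mpoly_additive_eq[where f = "\<lambda>f. Poly_Mapping.lookup (mvar v * f) (m + Poly_Mapping.single v 1)"])
    (simp_all add: algebra_simps lookup_add mvar_times_monomial lookup_single when_def)

lemma mvar_mult_eq_0: "mvar v * f = 0 \<Longrightarrow> f = 0" for f :: "('v, 'k::comm_ring_1) mpoly"
  using lookup_mvar_mult[of v f] by (intro poly_mapping_eqI) simp

text \<open>Multiplication by a variable is injective and preserves the ideal, so a form of lower
  degree would produce one of degree \<open>s\<close>.\<close>

lemma no_forms_mono:
  fixes x :: "nat \<Rightarrow> 'v::finite \<Rightarrow> 'k::field"
  assumes s: "\<And>f. homogeneous s f \<Longrightarrow> f \<in> pideal t x \<Longrightarrow> f = 0" and "e \<le> s"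
    and f: "homogeneous e f" "f \<in> pideal t x"
  shows "f = 0"
  using \<open>e \<le> s\<close> f
proof (induction e arbitrary: f rule: inc_induct)
  case (step e)
  obtain v :: 'v where True by simp
  have "homogeneous (Suc e) (mvar v * f)" using homogeneous_mult[OF homogeneous_var step.prems(1), of v] by simp
  then have "mvar v * f = 0" using step.IH pideal_mult[OF step.prems(2)] by blast
  then show ?case by (rule mvar_mult_eq_0)
qed (use s in blast)

context tor_points
begin

text \<open>Local primitives are glued: each is multiplied by a form of degree \<open>j - 1\<close>,
  at least \<open>r\<close>, that is 1 at its own point and 0 at the others. A primitive in internal
  degree \<open>i + j\<close> has coefficients of exactly this degree.\<close>

lemma vanish_high:
  assumes "separated r t x" "r < j" "z \<in> Z" "z \<in> kc i (i + j)"
  shows "z \<in> B"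
proof -
  from assms(2) obtain j' where j: "j = Suc j'" "r \<le> j'" by (cases j) auto
  have "separated j' t x" using separated_mono[OF assms(1) x_nonzero j(2)] .
  then have "\<forall>p. \<exists>h. p < t \<longrightarrow> homogeneous j' h \<and> (\<forall>q<t. mpoly_eval h (x q) = (if q = p then 1 else 0))"
    by (auto simp: separated_def)
  then obtain h where h: "\<And>p. p < t \<Longrightarrow> homogeneous j' (h p)"
    "\<And>p q. p < t \<Longrightarrow> q < t \<Longrightarrow> mpoly_eval (h p) (x q) = (if q = p then 1 else 0)"
    unfolding choice_iff by blast
  have "\<forall>p. \<exists>g. p < t \<longrightarrow> dot g (x p) = 1" using exists_dual_covector x_nonzero by metis
  then obtain g where g: "\<And>p. p < t \<Longrightarrow> dot (g p) (x p) = 1" unfolding choice_iff by blast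
  define b where "b = (\<Sum>p<t. pscale (h p) (wedge (evec (g p)) (evk (x p) z)))"
  have b: "b \<in> kc (Suc i) (i + j)"
    unfolding b_def
  proof (rule kc_sum)
    fix p assume "p \<in> {..<t}"
    then have "pscale (h p) (wedge (evec (g p)) (evk (x p) z)) \<in> kc (1 + i) (j' + (1 + i))"
      using h(1) by (intro kc_pscale kc_wedge evec_kc evk_kc[OF assms(4)]) auto
    then show "pscale (h p) (wedge (evec (g p)) (evk (x p) z)) \<in> kc (Suc i) (i + j)"
      by (simp add: j add.commute)
  qed
  have "z - koszul_diff b \<in> JK t x"
  proof -
    have db: "koszul_diff b \<in> kc i (i + j)" using kc_koszul_diff b by blast
    have "evk (x q) (z - koszul_diff b) = 0" if q: "q < t" for q
    proof -
      have "iota (x q) z = 0"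
      proof (cases i)
        case 0
        then show ?thesis using assms(4) koszul_diff_kc_0 by (metis evk_zero iota_def)
      next
        case (Suc i')
        then have "koszul_diff z \<in> kc i' (i + j)" using kc_koszul_diff assms(4) by blast
        then show ?thesis using assms(3) q by (simp add: Zc_iff JK_kc_iff iota_def)
      qed
      have "evk (x q) (koszul_diff b) = (\<Sum>p<t. if p = q then iota (x q) (wedge (evec (g q)) (evk (x q) z)) else 0)"
        unfolding b_def iota_def[symmetric] iota_sum iota_pscale using h(2) q by (intro sum.cong) auto
      also have "\<dots> = iota (x q) (wedge (evec (g q)) (evk (x q) z))" using q by simp
      also have "\<dots> = evk (x q) z" using iota_homotopy[OF g[OF q] \<open>iota (x q) z = 0\<close>] by simp
      finally show ?thesis by (simp add: evk_diff)
    qed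
    then show ?thesis using JK_kc_iff[OF kc_diff[OF assms(4) db]] by blast
  qed
  then show ?thesis unfolding Bd_iff by blast
qed

text \<open>The coefficients of \<open>koszul_diff z\<close> have degree at most \<open>s\<close>
  and lie in the ideal, so they vanish. Thus \<open>z\<close> is a cycle of the Koszul complex
  itself and bounds there.\<close>

lemma vanish_low:
  assumes s: "\<And>f. homogeneous s f \<Longrightarrow> f \<in> pideal t x \<Longrightarrow> f = 0"
    and z: "z \<in> Z" "z \<in> kc i d" and i: "0 < i" "d < i + s"
  shows "z \<in> B"
proof -
  obtain i' where i': "i = Suc i'" using i(1) by (cases i) auto
  have dz: "koszul_diff z \<in> kc i' d" using z(2) kc_koszul_diff by (simp add: i')
  have "lk (koszul_diff z) S = 0" for S
  proof (rule no_forms_mono[where s = s and e = "d - i'" and t = t and x = x, OF s])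
    show "d - i' \<le> s" using i(2) i' by simp
    show "homogeneous (d - i') (lk (koszul_diff z) S)" by (rule kc_lookup[OF dz])
    show "lk (koszul_diff z) S \<in> pideal t x" using z(1) by (simp add: Zc_iff JK_def)
  qed
  then have "koszul_diff z = 0" by (intro koszul_eqI) simp
  then obtain b where "koszul_diff b = z" using koszul_exact_kc[OF z(2)] i(1) by blast
  then show ?thesis using koszul_diff_Bd by blast
qed

lemma vanish_0:
  assumes "z \<in> kc 0 d" "0 < d"
  shows "z \<in> B"
proof -
  have "koszul_diff z = 0" using assms(1) by (rule koszul_diff_kc_0)
  then obtain b where "koszul_diff b = z" using koszul_exact_kc[OF assms(1)] assms(2) by blast
  then show ?thesis using koszul_diff_Bd by blast
qed

text \<open>A form of top degree whose contraction with a nonzero vector is zero must be zero, so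
  the values of a cycle vanish at every point. In four variables this confines Tor to homological
  degrees at most 3.\<close>

lemma vanish_top:
  assumes "z \<in> Z" "z \<in> kc i d" "card (UNIV :: 'v set) \<le> i"
  shows "z \<in> B"
proof (cases "i = card (UNIV :: 'v set)")
  case False
  then have "z = 0" using assms by (intro kc_top[OF assms(2)]) auto
  then show ?thesis by simp
next
  case True
  then have "i \<noteq> 0" by simp
  then obtain i' where i': "i = Suc i'" using not0_implies_Suc by blast
  have "evk (x q) z = 0" if q: "q < t" for q
  proof -
    obtain g where g: "dot g (x q) = 1" using exists_dual_covector x_nonzero[OF q] by blast
    have "koszul_diff z \<in> kc i' d" using kc_koszul_diff assms(2) i' by blast
    then have 0: "iota (x q) z = 0" using assms(1) q by (simp add: Zc_iff JK_kc_iff iota_def)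
    have "wedge (evec g) (evk (x q) z) \<in> kc (1 + i) (1 + i)"
      by (intro kc_wedge evec_kc evk_kc[OF assms(2)])
    then have "wedge (evec g) (evk (x q) z) = 0" by (rule kc_top) (simp add: True)
    then show ?thesis using iota_homotopy[OF g 0] by simp
  qed
  then show ?thesis using JK_kc_iff[OF assms(2)] JK_Bd by blast
qed

lemma basis_00: "is_basis 0 0 [Poly_Mapping.single {} 1]"
proof -
  have kc: "Poly_Mapping.single {} 1 \<in> (kc 0 0 :: ('v, 'k) koszul set)"
    using kc_single[of "{}" 0 0 1] by simp
  have Z: "Poly_Mapping.single {} 1 \<in> Z" by (simp add: Zc_iff)
  have l: "lincomb c [Poly_Mapping.single {} 1] = sc (c 0)" for c
    by (simp add: lincomb_Cons sc_def pscale_def wedge_single wedge_sign_def)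
  have "z = sc (Poly_Mapping.lookup (lk z {}) 0)" if z: "z \<in> kc 0 0" for z :: "('v, 'k) koszul"
  proof (rule koszul_eqI)
    fix S
    show "lk z S = lk (sc (Poly_Mapping.lookup (lk z {}) 0)) S"
    proof (cases "S = {}")
      case True
      have "homogeneous 0 (lk z {})" using kc_lookup[OF z, of "{}"] by simp
      then show ?thesis using True by (simp add: sc_def homogeneous_0_iff)
    next
      case False
      then have "lk z S = 0" using kc_card[OF z, of S] by auto
      then show ?thesis using False by (simp add: sc_def lookup_single when_def)
    qed
  qed
  then have "\<exists>c. z - lincomb c [Poly_Mapping.single {} 1] \<in> B" if "z \<in> Z \<inter> kc 0 0" for z
    using that unfolding l by (intro exI[of _ "\<lambda>_. Poly_Mapping.lookup (lk z {}) 0"]) (metis Bd_zero IntD2 diff_self)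
  then show ?thesis using kc Z by (auto simp: is_basis_def indep_def l sc_B_iff)
qed

lemma kc_0_0_sc:
  assumes "z \<in> kc 0 0"
  obtains c where "z = sc c"
proof -
  have "z = sc (Poly_Mapping.lookup (lk z {}) 0)"
  proof (rule koszul_eqI)
    fix S
    show "lk z S = lk (sc (Poly_Mapping.lookup (lk z {}) 0)) S"
    proof (cases "S = {}")
      case True
      have "homogeneous 0 (lk z {})" using kc_lookup[OF assms, of "{}"] by simp
      then show ?thesis using True by (simp add: sc_def homogeneous_0_iff)
    next
      case False
      then have "lk z S = 0" using kc_card[OF assms, of S] by auto
      then show ?thesis using False by (simp add: sc_def lookup_single when_def)
    qed
  qed
  then show thesis by (rule that)
qed

section \<open>Rank bounds that hold for trivial reasons\<close>

abbreviation "adim i d \<equiv> alg_dim A (component A i d)"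
abbreviation "pdim i d j e \<equiv> alg_dim A (product_space A (component A i d) (component A j e))"

lemma adim_zero: "Z \<inter> kc i d \<subseteq> B \<Longrightarrow> adim i d = 0"
  using alg_dim_component[of i d "[]"] by (simp add: zero_basis_iff)

lemma pdim_zero:
  assumes "\<And>z w. z \<in> Z \<Longrightarrow> z \<in> kc i d \<Longrightarrow> w \<in> Z \<Longrightarrow> w \<in> kc j e \<Longrightarrow> wedge z w \<in> B"
  shows "pdim i d j e = 0"
  using alg_dim_product_space[of "[]" i d j e] assms by simp

lemma rank_bound_zero:
  assumes "Z \<inter> kc i d \<subseteq> B \<or> Z \<inter> kc j e \<subseteq> B \<or> Z \<inter> kc (i + j) (d + e) \<subseteq> B"
  shows "mult_rank_bound A i d j e = 0"
  using assms adim_zero[of i d] adim_zero[of j e] adim_zero[of "i + j" "d + e"]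
  by (auto simp: mult_rank_bound_def mult_2 binomial_eq_0)

lemma pdim_rank_bound_zero:
  assumes "Z \<inter> kc i d \<subseteq> B \<or> Z \<inter> kc j e \<subseteq> B \<or> Z \<inter> kc (i + j) (d + e) \<subseteq> B"
  shows "pdim i d j e = mult_rank_bound A i d j e"
proof -
  have "pdim i d j e = 0"
  proof (rule pdim_zero)
    fix z w assume zw: "z \<in> Z" "z \<in> kc i d" "w \<in> Z" "w \<in> kc j e"
    from assms show "wedge z w \<in> B"
    proof (elim disjE)
      assume "Z \<inter> kc i d \<subseteq> B"
      then show ?thesis using zw Bd_wedge_left by blast
    next
      assume "Z \<inter> kc j e \<subseteq> B"
      then show ?thesis using zw Bd_wedge_right by blast
    next
      assume "Z \<inter> kc (i + j) (d + e) \<subseteq> B"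
      then show ?thesis using zw Zc_wedge kc_wedge by blast
    qed
  qed
  then show ?thesis using rank_bound_zero[OF assms] by simp
qed

lemma adim_00: "adim 0 0 = 1"
  using alg_dim_component[OF basis_00] by simp

lemma wedge_one_sc: "wedge z (sc c) = pscale (mconst c) z"
proof -
  have "sc c = pscale (mconst c) (Poly_Mapping.single {} 1)"
    by (simp add: sc_def pscale_def wedge_single wedge_sign_def)
  then show ?thesis by (simp add: wedge_pscale_right wedge_one_right)
qed

text \<open>Homological degree 0 of Tor is spanned by the unit, so multiplication by it loses
  nothing.\<close>

lemma pdim_0:
  assumes "i = 0 \<or> j = 0"
  shows "pdim i d j e = mult_rank_bound A i d j e"
proof (cases "(i = 0 \<and> 0 < d) \<or> (j = 0 \<and> 0 < e)")
  case True
  then show ?thesis using vanish_0 by (intro pdim_rank_bound_zero) blast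
next
  case False
  with assms consider "i = 0" "d = 0" | "j = 0" "e = 0" by auto
  then show ?thesis
  proof cases
    case 1
    obtain us where us: "is_basis j e us" by (rule obtain_basis)
    have "pdim 0 0 j e = length us"
    proof (rule alg_dim_product_space[OF is_basisD(1)[OF us]])
      show "cl ` set us \<subseteq> {cl (wedge z w) |z w. z \<in> Z \<inter> kc 0 0 \<and> w \<in> Z \<inter> kc j e}"
      proof
        fix a assume "a \<in> cl ` set us"
        then obtain u where u: "a = cl u" "u \<in> set us" by auto
        have "a = cl (wedge (Poly_Mapping.single {} 1) u)" using u by (simp add: wedge_one_left)
        then show "a \<in> {cl (wedge z w) |z w. z \<in> Z \<inter> kc 0 0 \<and> w \<in> Z \<inter> kc j e}"
          using u is_basisD[OF us] is_basisD[OF basis_00] by fastforce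
      qed
      fix z w assume z: "z \<in> Z" "z \<in> kc 0 0" and w: "w \<in> Z" "w \<in> kc j e"
      from z(2) obtain c where "z = sc c" by (rule kc_0_0_sc)
      then have "wedge z w = pscale (mconst c) w" by (simp add: wedge_sc)
      then show "\<exists>c. wedge z w - lincomb c us \<in> B"
        using is_basis_span[OF us, of "pscale (mconst c) w"] Zc_pscale[OF w(1)] kc_scale[OF w(2)] by metis
    qed
    then show ?thesis using 1 alg_dim_component[OF us] adim_00 by (simp add: mult_rank_bound_def)
  next
    case 2
    obtain us where us: "is_basis i d us" by (rule obtain_basis)
    have "pdim i d 0 0 = length us"
    proof (rule alg_dim_product_space[OF is_basisD(1)[OF us]])
      show "cl ` set us \<subseteq> {cl (wedge z w) |z w. z \<in> Z \<inter> kc i d \<and> w \<in> Z \<inter> kc 0 0}"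
      proof
        fix a assume "a \<in> cl ` set us"
        then obtain u where u: "a = cl u" "u \<in> set us" by auto
        have "a = cl (wedge u (Poly_Mapping.single {} 1))" using u by (simp add: wedge_one_right)
        then show "a \<in> {cl (wedge z w) |z w. z \<in> Z \<inter> kc i d \<and> w \<in> Z \<inter> kc 0 0}"
          using u is_basisD[OF us] is_basisD[OF basis_00] by fastforce
      qed
      fix z w assume z: "w \<in> Z" "w \<in> kc 0 0" and w: "z \<in> Z" "z \<in> kc i d"
      from z(2) obtain c where "w = sc c" by (rule kc_0_0_sc)
      then have "wedge z w = pscale (mconst c) z" by (simp add: wedge_one_sc)
      then show "\<exists>c. wedge z w - lincomb c us \<in> B"
        using is_basis_span[OF us, of "pscale (mconst c) z"] Zc_pscale[OF w(1)] kc_scale[OF w(2)] by metis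
    qed
    moreover have "\<not> (odd i \<and> 0 = i)" by auto
    ultimately show ?thesis using 2 alg_dim_component[OF us] adim_00 by (auto simp: mult_rank_bound_def)
  qed
qed

end

section \<open>The two strands of Tor for points in three-space\<close>

locale p3_points = tor_points t x for t and x :: "nat \<Rightarrow> 4 \<Rightarrow> 'k::field_char_0" +
  fixes s r :: nat
  assumes s_pos: "0 < s" and r_le: "r \<le> Suc s"
    and no_forms: "\<And>f. homogeneous s f \<Longrightarrow> f \<in> pideal t x \<Longrightarrow> f = 0"
    and sep: "separated r t x"
begin

lemma card_4: "card (UNIV :: 4 set) = 4"
  by simp

lemma nonzero_range:
  assumes "z \<in> Z" "z \<in> kc i d" "z \<notin> B" "0 < i"
  shows "i \<le> 3" "i + s \<le> d" "d \<le> i + r"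
proof -
  show "i \<le> 3"
  proof (rule ccontr)
    assume "\<not> i \<le> 3"
    then have "card (UNIV :: 4 set) \<le> i" by (simp only: card_4)
    with assms show False using vanish_top by blast
  qed
  show "i + s \<le> d"
    using vanish_low[OF no_forms assms(1,2,4)] assms(3) by (meson not_less)
  show "d \<le> i + r"
  proof (rule ccontr)
    assume "\<not> d \<le> i + r"
    then have "r < d - i" "i + (d - i) = d" by auto
    then show False using vanish_high[OF sep, of "d - i" z i] assms by simp
  qed
qed

lemma hom_basis_strands:
  assumes "is_basis i (i + s) zs" "is_basis i (i + Suc s) ws" "0 < i"
  shows "hom_basis A i (length (zs @ ws)) (\<lambda>j. cl ((zs @ ws) ! (j - 1)))"
proof (rule hom_basis_append[OF assms(1,2)])
  fix d' assume "d' \<noteq> i + s" "d' \<noteq> i + Suc s"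
  then show "Z \<inter> kc i d' \<subseteq> B" using nonzero_range[of _ i d'] assms(3) r_le by fastforce
qed simp

text \<open>Factors outside \<open>B\<close> have internal degrees at least \<open>i + s\<close> and
  \<open>j + s\<close>, so the product lies in degree at least \<open>i + j + 2 * s\<close>, above
  the last possible degree \<open>i + j + r\<close>.\<close>

lemma trivial_products:
  assumes "r < 2 * s" "z \<in> Z" "z \<in> kc i d" "w \<in> Z" "w \<in> kc j e" "0 < i" "0 < j"
  shows "wedge z w \<in> B"
proof (cases "z \<in> B \<or> w \<in> B")
  case True
  then show ?thesis using assms Bd_wedge_left Bd_wedge_right by blast
next
  case False
  have "wedge z w \<in> kc (i + j) (d + e)" using assms kc_wedge by blast
  moreover have "i + j + r < d + e" using nonzero_range[of z i d] nonzero_range[of w j e] assms False by auto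
  ultimately show ?thesis
    using nonzero_range(3)[of "wedge z w" "i + j" "d + e"] Zc_wedge[OF assms(2,4)] assms(6) by fastforce
qed

lemma has_class_H00:
  assumes zero: "\<And>z w i d j e. z \<in> Z \<Longrightarrow> z \<in> kc i d \<Longrightarrow> w \<in> Z \<Longrightarrow> w \<in> kc j e \<Longrightarrow> 0 < i \<Longrightarrow> 0 < j \<Longrightarrow> wedge z w \<in> B"
  shows "has_class A (Class_H 0 0)"
proof -
  have "\<forall>i. \<exists>b. is_basis i (i + s) b" "\<forall>i. \<exists>b. is_basis i (i + Suc s) b" using obtain_basis by blast+
  then obtain bs ws where b: "\<And>i. is_basis i (i + s) (bs i)" "\<And>i. is_basis i (i + Suc s) (ws i)"
    unfolding choice_iff by blast
  define us where "us i = bs i @ ws i" for i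
  define e where "e i j = cl (us i ! (j - 1))" for i j
  have hb: "hom_basis A i (length (us i)) (e i)" if "0 < i" for i
    using hom_basis_strands[OF b that] by (simp add: us_def e_def[abs_def])
  have prod: "e i a \<otimes>\<^bsub>A\<^esub> e j c = \<zero>\<^bsub>A\<^esub>"
    if "0 < i" "0 < j" "a \<in> {1..length (us i)}" "c \<in> {1..length (us j)}" for i j a c
  proof -
    have mem: "us i ! (a - 1) \<in> Z \<and> (us i ! (a - 1) \<in> kc i (i + s) \<or> us i ! (a - 1) \<in> kc i (i + Suc s))"
      if "a \<in> {1..length (us i)}" for i a
    proof -
      have "us i ! (a - 1) \<in> set (us i)" using that by (intro nth_mem) auto
      then have "us i ! (a - 1) \<in> set (bs i) \<union> set (ws i)" by (simp add: us_def)
      then show ?thesis using is_basisD(2,3)[OF b(1)] is_basisD(2,3)[OF b(2)] by blast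
    qed
    then have "us i ! (a - 1) \<in> Z" "us j ! (c - 1) \<in> Z" using that by blast+
    moreover have "wedge (us i ! (a - 1)) (us j ! (c - 1)) \<in> B"
      using mem[of a i] mem[of c j] that zero by metis
    ultimately show ?thesis by (simp add: e_def cl_mult cl_eq_zero Zc_wedge)
  qed
  show ?thesis
    unfolding has_class.simps
    by (intro exI[of _ "length (us 1)"] exI[of _ "length (us 2)"] exI[of _ "length (us 3)"]
        exI[of _ "e 1"] exI[of _ "e 2"] exI[of _ "e 3"] conjI hb)
      (auto simp: only_products_def prod)
qed

lemma max_mult_rankI:
  assumes "\<And>i d j e. 0 < i \<Longrightarrow> 0 < j \<Longrightarrow> pdim i d j e = mult_rank_bound A i d j e"
  shows "max_mult_rank A"
  unfolding max_mult_rank_def using assms pdim_0 by blast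

lemma trivial_case:
  assumes "r < 2 * s"
  shows "has_class A (Class_H 0 0)" "max_mult_rank A"
proof -
  show "has_class A (Class_H 0 0)"
    by (rule has_class_H00) (rule trivial_products[OF assms])
  show "max_mult_rank A"
  proof (rule max_mult_rankI)
    fix i d j e :: nat assume ij: "0 < i" "0 < j"
    show "pdim i d j e = mult_rank_bound A i d j e"
    proof (rule pdim_rank_bound_zero, rule ccontr)
      assume "\<not> (Z \<inter> kc i d \<subseteq> B \<or> Z \<inter> kc j e \<subseteq> B \<or> Z \<inter> kc (i + j) (d + e) \<subseteq> B)"
      then obtain z w y where "z \<in> Z" "z \<in> kc i d" "z \<notin> B" "w \<in> Z" "w \<in> kc j e" "w \<notin> B"
        "y \<in> Z" "y \<in> kc (i + j) (d + e)" "y \<notin> B" by blast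
      then show False
        using nonzero_range[of z i d] nonzero_range[of w j e] nonzero_range[of y "i + j" "d + e"] assms ij by auto
    qed
  qed
qed

end

section \<open>Exterior calculus in adapted coordinates\<close>

lemma lincomb_map: "lincomb c (map E [0..<n]) = (\<Sum>k<n. pscale (mconst (c k)) (E k))"
  by (simp add: lincomb_def)

lemma dot_add_right: "dot g (\<lambda>v. y v + z v) = dot g y + dot g z"
  by (simp add: dot_def algebra_simps sum.distrib)

lemma evk_linear_add:
  assumes "a \<in> kc i (Suc i)"
  shows "evk (\<lambda>v. y v + z v) a = evk y a + evk z a"
proof (rule koszul_eqI)
  fix S
  have "homogeneous 1 (lk a S)" using kc_lookup[OF assms, of S] by simp
  then obtain c where "lk a S = lform c" using homogeneous_1_eq by blast
  then show "lk (evk (\<lambda>v. y v + z v) a) S = lk (evk y a + evk z a) S"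
    by (simp add: lookup_add dot_add_right mconst_add)
qed

lemma iota_point_add:
  assumes "a \<in> kc (Suc i) (Suc i)"
  shows "iota (\<lambda>v. y v + z v) a = iota y a + iota z a"
  unfolding iota_def using evk_linear_add[OF kc_koszul_diff[OF assms]] .

text \<open>Polarization of \<open>iota_iota\<close>: contraction also squares to zero for the
  vector \<open>y + z\<close>, and on constant coefficients it is additive in the vector.\<close>

lemma iota_anticommute:
  assumes "a \<in> kc (Suc i) (Suc i)"
  shows "iota y (iota z a) = - iota z (iota y a)"
proof (cases i)
  case 0
  then have "iota y a \<in> kc 0 0" "iota z a \<in> kc 0 0" using assms iota_kc by metis+
  then show ?thesis by (simp add: iota_def koszul_diff_kc_0)
next
  case (Suc j)
  have k: "iota y a \<in> kc (Suc j) (Suc j)" "iota z a \<in> kc (Suc j) (Suc j)" using assms iota_kc Suc by metis+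
  have "iota (\<lambda>v. y v + z v) (iota (\<lambda>v. y v + z v) a) = 0" by (rule iota_iota)
  then have "iota y (iota y a) + iota y (iota z a) + (iota z (iota y a) + iota z (iota z a)) = 0"
    by (simp add: iota_point_add[OF assms] iota_add iota_point_add[OF k(1)] iota_point_add[OF k(2)] add_ac)
  then show ?thesis by (simp add: iota_iota eq_neg_iff_add_eq_0)
qed

section \<open>Top forms and three-forms in four variables\<close>

definition vol :: "(4, 'k::comm_ring_1) koszul" where
  "vol = Poly_Mapping.single UNIV 1"

definition topc :: "(4, 'k::comm_ring_1) koszul \<Rightarrow> 'k" where
  "topc a = Poly_Mapping.lookup (lk a UNIV) 0"

lemma vol_kc: "vol \<in> kc 4 4"
  using kc_single[of "UNIV :: 4 set" 4 0 1] by (simp add: vol_def)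

lemma topc_functional: "lin_functional topc"
  unfolding topc_def[abs_def] by (rule tor_points.lin_functional_coeff[of 1 "\<lambda>_ _. 1"]) (simp add: tor_points_def fun_eq_iff)

lemma topc_vol [simp]: "topc vol = 1"
  by (simp add: topc_def vol_def)

lemma kc_4_eq:
  assumes "a \<in> kc 4 d"
  shows "a = pscale (lk a UNIV) vol"
proof (rule koszul_eqI)
  fix S :: "4 set"
  show "lk a S = lk (pscale (lk a UNIV) vol) S"
  proof (cases "S = UNIV")
    case False
    then have "card S < card (UNIV :: 4 set)" by (intro psubset_card_mono) auto
    then have "lk a S = 0" using kc_card[OF assms, of S] by fastforce
    then show ?thesis using False by (simp add: vol_def lookup_single when_def)
  qed (simp add: vol_def)
qed

lemma kc_4_4_eq:
  assumes "a \<in> kc 4 4"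
  shows "a = pscale (mconst (topc a)) vol"
proof -
  have "homogeneous 0 (lk a UNIV)" using kc_lookup[OF assms, of UNIV] by simp
  then have "lk a UNIV = mconst (topc a)" by (simp add: homogeneous_0_iff topc_def)
  then show ?thesis using kc_4_eq[OF assms] by simp
qed

lemmas topc_simps [simp] = lin_functional_add[OF topc_functional] lin_functional_diff[OF topc_functional]
  lin_functional_scale[OF topc_functional] lin_functional_sum[OF topc_functional]
  lin_functional_uminus[OF topc_functional]

lemma topc_zero [simp]: "topc 0 = 0"
  by (simp add: topc_def)

lemma kc_5_zero: "a \<in> kc i d \<Longrightarrow> 4 < i \<Longrightarrow> a = 0" for a :: "(4, 'k::comm_ring_1) koszul"
  by (rule kc_top) simp_all

text \<open>For a set \<open>S\<close> missing a variable \<open>v\<close>, multiplication by the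
  symbol of \<open>v\<close> moves the coefficient at \<open>S\<close> to \<open>insert v S\<close>,
  up to sign and without cancellation.\<close>

lemma evec_wedge_zero_imp_zero:
  fixes a :: "('v::{finite,linorder}, 'k::field) koszul"
  assumes a: "a \<in> kc i d" "i < card (UNIV :: 'v set)"
    and zero: "\<And>g. wedge (evec g) a = 0"
  shows "a = 0"
proof (rule koszul_eqI)
  fix S :: "'v set"
  show "lk a S = lk 0 S"
  proof (cases "S = UNIV")
    case True
    then show ?thesis using kc_card[OF a(1), of S] a(2) by auto
  next
    case False
    then obtain v where v: "v \<notin> S" by auto
    have e: "evec (\<lambda>w. if w = v then 1 else 0) = Poly_Mapping.single {v} (1 :: ('v, 'k) mpoly)"
    proof -
      have "evec (\<lambda>w. if w = v then 1 else 0) =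
          (\<Sum>w\<in>UNIV. if w = v then Poly_Mapping.single {v} (1 :: ('v, 'k) mpoly) else 0)"
        unfolding evec_def by (rule sum.cong) auto
      then show ?thesis by simp
    qed
    have ins: "insert v T = insert v S \<longleftrightarrow> T = S" if "v \<notin> T" for T using v that by auto
    have "lk (wedge (Poly_Mapping.single {v} 1) a) (insert v S) =
      (\<Sum>T\<in>UNIV. if T = S then wedge_sign {v} S * lk a S else 0)"
    proof -
      have "wedge (Poly_Mapping.single {v} 1) a = (\<Sum>T\<in>UNIV. Poly_Mapping.single (insert v T) (wedge_sign {v} T * lk a T))"
        by (subst (1) koszul_expand[of a]) (simp add: wedge_sum_right wedge_single)
      then have "lk (wedge (Poly_Mapping.single {v} 1) a) (insert v S) =
          (\<Sum>T\<in>UNIV. lk (Poly_Mapping.single (insert v T) (wedge_sign {v} T * lk a T)) (insert v S))"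
        by (simp only: lookup_sum)
      also have "\<dots> = (\<Sum>T\<in>UNIV. if T = S then wedge_sign {v} S * lk a S else 0)"
      proof (rule sum.cong[OF refl])
        fix T :: "'v set"
        show "lk (Poly_Mapping.single (insert v T) (wedge_sign {v} T * lk a T)) (insert v S) =
            (if T = S then wedge_sign {v} S * lk a S else 0)"
          using v by (cases "v \<in> T") (auto simp: lookup_single when_def ins wedge_sign_def)
      qed
      finally show ?thesis .
    qed
    moreover have "wedge (Poly_Mapping.single {v} 1) a = 0" using zero e by metis
    ultimately have "wedge_sign {v} S * lk a S = 0" by simp
    moreover have "(- 1) ^ n * ((- 1) ^ n * q) = q" for n and q :: "('v, 'k) mpoly"
      by (simp flip: mult.assoc power_mult_distrib)
    ultimately show ?thesis using v by (simp add: wedge_sign_def)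
  qed
qed

lemma evec_add: "evec (\<lambda>v. g v + h v) = evec g + evec h"
  by (simp add: evec_def mconst_add single_add sum.distrib)

lemma evec_scale: "evec (\<lambda>v. c * g v) = pscale (mconst c) (evec g)"
proof (rule koszul_eqI)
  fix S
  show "lk (evec (\<lambda>v. c * g v)) S = lk (pscale (mconst c) (evec g)) S"
    by (simp add: evec_def lookup_sum sum_distrib_left lookup_single when_def mconst_mult)
      (rule sum.cong, auto)
qed

lemma evec_sum: "evec (\<lambda>v. \<Sum>i\<in>I. c i * g i v) = (\<Sum>i\<in>I. pscale (mconst (c i)) (evec (g i)))"
proof (induction I rule: infinite_finite_induct)
  case (insert j I)
  then show ?case by (simp add: evec_add[of "\<lambda>v. c j * g j v" "\<lambda>v. \<Sum>i\<in>I. c i * g i v"] evec_scale)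
qed (simp_all add: evec_def)

lemma lform_add: "lform (\<lambda>v. g v + h v) = lform g + lform h"
  by (simp add: lform_def mconst_add algebra_simps sum.distrib)

lemma lform_scale: "lform (\<lambda>v. c * g v) = mconst c * lform g"
  by (simp add: lform_def mconst_mult sum_distrib_left mult.assoc)

lemma lform_sum: "lform (\<lambda>v. \<Sum>i\<in>I. c i * g i v) = (\<Sum>i\<in>I. mconst (c i) * lform (g i))"
proof (induction I rule: infinite_finite_induct)
  case (insert j I)
  then show ?case by (simp add: lform_add[of "\<lambda>v. c j * g j v" "\<lambda>v. \<Sum>i\<in>I. c i * g i v"] lform_scale)
qed (simp_all add: lform_def)

text \<open>A projective frame: the first four vectors form a basis with dual basis
  \<open>g\<close>, and the fifth is their sum. Five points in linearly general position take this
  form after rescaling their vectors. The condition \<open>sep2\<close> supplies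
  \<open>r = 2\<close> for the two strands.\<close>

locale gp = tor_points t x for t and x :: "nat \<Rightarrow> 4 \<Rightarrow> 'k::field_char_0" +
  fixes g :: "nat \<Rightarrow> 4 \<Rightarrow> 'k"
  assumes t_ge_5: "5 \<le> t"
    and dual: "\<And>i j. i < 4 \<Longrightarrow> j < 4 \<Longrightarrow> dot (g i) (x j) = (if i = j then 1 else 0)"
    and coord: "\<And>y v. y v = (\<Sum>i<4. dot (g i) y * x i v)"
    and x4: "\<And>v. x 4 v = (\<Sum>i<4. x i v)"
    and sep2: "separated 2 t x"
begin

abbreviation "l i \<equiv> lform (g i)"
abbreviation "eps i \<equiv> evec (g i)"
abbreviation "om i \<equiv> iota (x i) vol"

lemma dot_coord: "dot c y = (\<Sum>i<4. dot (g i) y * dot c (x i))"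
proof -
  have "dot c y = (\<Sum>v\<in>UNIV. \<Sum>i<4. c v * (dot (g i) y * x i v))"
    unfolding dot_def[of c y] by (subst coord[of y]) (simp add: sum_distrib_left)
  also have "\<dots> = (\<Sum>i<4. dot (g i) y * dot c (x i))"
    by (subst sum.swap) (simp add: dot_def[of c] sum_distrib_left algebra_simps)
  finally show ?thesis .
qed

lemma dot_g_4: "i < 4 \<Longrightarrow> dot (g i) (x 4) = 1"
proof -
  assume i: "i < 4"
  have "dot (g i) (x 4) = (\<Sum>j<4. dot (g i) (x j))"
    unfolding dot_def x4 by (simp add: sum_distrib_left) (rule sum.swap)
  also have "\<dots> = (\<Sum>j<4. if j = i then 1 else 0)" using i dual by (intro sum.cong) auto
  finally show ?thesis using i by simp
qed

lemma covector_expand: "c v = (\<Sum>i<4. dot c (x i) * g i v)"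
proof -
  have u: "dot d (\<lambda>w. if w = v then 1 else 0) = d v" for d :: "4 \<Rightarrow> 'k"
  proof -
    have "dot d (\<lambda>w. if w = v then 1 else 0) = (\<Sum>w\<in>UNIV. if w = v then d w else 0)"
      unfolding dot_def by (rule sum.cong) auto
    then show ?thesis by simp
  qed
  show ?thesis using dot_coord[of c "\<lambda>w. if w = v then 1 else 0"] by (simp add: u mult.commute)
qed

lemma lform_expand: "lform c = (\<Sum>i<4. mconst (dot c (x i)) * l i)"
  by (subst covector_expand[abs_def, of c]) (rule lform_sum)

lemma evec_expand: "evec c = (\<Sum>i<4. pscale (mconst (dot c (x i))) (eps i))"
  by (subst covector_expand[abs_def, of c]) (rule evec_sum)

lemma no_linear_forms: "homogeneous 1 f \<Longrightarrow> f \<in> pideal t x \<Longrightarrow> f = 0"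
proof -
  assume f: "homogeneous 1 f" "f \<in> pideal t x"
  then obtain c where c: "f = lform c" using homogeneous_1_eq by blast
  have "dot c (x i) = 0" if "i < 4" for i
    using f that t_ge_5 by (auto simp: c pideal_homogeneous[OF f(1)[unfolded c]])
  then show "f = 0" unfolding c by (subst lform_expand) simp
qed

sublocale p3_points t x 1 2
  by unfold_locales (use no_linear_forms sep2 in auto)

lemma evec_iota_vol: "wedge (evec c) (iota y vol) = pscale (mconst (dot c y)) vol"
proof -
  have "wedge (evec c) vol \<in> kc (1 + 4) (1 + 4)" by (rule kc_wedge[OF evec_kc vol_kc])
  then have "wedge (evec c) vol = 0" by (rule kc_5_zero) simp
  then show ?thesis using iota_evec_wedge[of y c vol] evk_const[OF vol_kc, of y] by simp
qed

lemma om_kc: "(iota y vol :: (4, 'k) koszul) \<in> kc 3 3"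
  using iota_kc[of vol 3 4 y] vol_kc by simp

text \<open>The \<open>om i\<close> and \<open>eps i\<close> are dual under the pairing of
  three-forms with covectors, so the numbers \<open>topc (wedge (eps i) w)\<close> are the
  coordinates of \<open>w\<close>.\<close>

lemma threeform_expand:
  assumes w: "w \<in> kc 3 3"
  shows "w = (\<Sum>i<4. pscale (mconst (topc (wedge (eps i) w))) (om i))"
proof -
  let ?s = "\<Sum>i<4. pscale (mconst (topc (wedge (eps i) w))) (om i)"
  have s: "?s \<in> kc 3 3" by (intro kc_sum kc_scale om_kc)
  have e: "wedge (eps j) (w - ?s) = 0" if j: "j < 4" for j
  proof -
    have "wedge (eps j) w \<in> kc (1 + 3) (1 + 3)" by (rule kc_wedge[OF evec_kc w])
    then have jw: "wedge (eps j) w = pscale (mconst (topc (wedge (eps j) w))) vol"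
      by (intro kc_4_4_eq) simp
    have "wedge (eps j) ?s = (\<Sum>i<4. if i = j then pscale (mconst (topc (wedge (eps j) w))) vol else 0)"
      unfolding wedge_sum_right wedge_pscale_right evec_iota_vol using j dual by (intro sum.cong) auto
    also have "\<dots> = wedge (eps j) w" using j jw by simp
    finally show ?thesis by (simp add: wedge_diff_right)
  qed
  have "w - ?s = 0"
  proof (rule evec_wedge_zero_imp_zero)
    show "w - ?s \<in> kc 3 3" using w s by (rule kc_diff)
    fix c
    show "wedge (evec c) (w - ?s) = 0"
      by (subst evec_expand) (simp add: wedge_sum_left wedge_pscale_left e)
  qed simp
  then show ?thesis by simp
qed

lemma threeform_eqI:
  assumes "w \<in> kc 3 3" "w' \<in> kc 3 3" "\<And>i. i < 4 \<Longrightarrow> topc (wedge (eps i) w) = topc (wedge (eps i) w')"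
  shows "w = w'"
  using assms by (subst threeform_expand[OF assms(1)], subst threeform_expand[OF assms(2)]) simp

section \<open>Local primitives and the obstructions to gluing them\<close>

lemma bd_by_points:
  assumes z: "z \<in> kc i d" and b: "b \<in> kc (Suc i) d"
    and eq: "\<And>p. p < t \<Longrightarrow> iota (x p) b = evk (x p) z"
  shows "z \<in> B"
proof -
  have "z - koszul_diff b \<in> kc i d" using kc_diff[OF z kc_koszul_diff[OF b]] .
  then have "z - koszul_diff b \<in> JK t x"
    using eq by (simp add: JK_kc_iff evk_diff iota_def)
  then show ?thesis unfolding Bd_iff by blast
qed

lemma cycle_by_points:
  assumes z: "z \<in> kc (Suc i) d" and eq: "\<And>p. p < t \<Longrightarrow> iota (x p) z = 0"
  shows "z \<in> Z"
  using JK_kc_iff[OF kc_koszul_diff[OF z]] eq by (simp add: Zc_iff iota_def)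

lemma cycle_iota: "z \<in> Z \<Longrightarrow> z \<in> kc (Suc i) d \<Longrightarrow> p < t \<Longrightarrow> iota (x p) z = 0"
  unfolding Zc_iff iota_def using JK_kc_iff[OF kc_koszul_diff] by blast

text \<open>At frame points the dual covector is chosen, so that local primitives there can be
  computed explicitly.\<close>

definition eta :: "nat \<Rightarrow> 4 \<Rightarrow> 'k" where
  "eta p = (if p < 4 then g p else (SOME c. dot c (x p) = 1))"

lemma dot_eta: "p < t \<Longrightarrow> dot (eta p) (x p) = 1"
proof (cases "p < 4")
  case False
  assume "p < t"
  then have "\<exists>c. dot c (x p) = 1" using exists_dual_covector x_nonzero by metis
  then have "dot (SOME c. dot c (x p) = 1) (x p) = 1" by (rule someI_ex)
  then show ?thesis using False by (simp add: eta_def)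
qed (simp add: eta_def dual)

text \<open>The local primitive of a cycle at the point \<open>p\<close>. For a cycle of homological
  degree 2 it is unique up to multiples of \<open>om p\<close>, which span the kernel of contraction
  with \<open>x p\<close> on three-forms; \<open>alpha\<close> and \<open>gam\<close> below make use
  of this freedom.\<close>

definition Y :: "nat \<Rightarrow> (4, 'k) koszul \<Rightarrow> (4, 'k) koszul" where
  "Y p z = wedge (evec (eta p)) (evk (x p) z)"

lemma Y_kc: "z \<in> kc i d \<Longrightarrow> Y p z \<in> kc (Suc i) (Suc i)"
  unfolding Y_def using kc_wedge[OF evec_kc evk_kc, of z i d] by simp

lemma Y_add: "Y p (a + b) = Y p a + Y p b"
  by (simp add: Y_def evk_add wedge_add_right)

lemma Y_scale: "Y p (pscale (mconst c) a) = pscale (mconst c) (Y p a)"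
  by (simp add: Y_def evk_pscale wedge_pscale_right)

lemma iota_Y: "z \<in> Z \<Longrightarrow> z \<in> kc (Suc i) d \<Longrightarrow> p < t \<Longrightarrow> iota (x p) (Y p z) = evk (x p) z"
  unfolding Y_def using iota_homotopy[OF dot_eta cycle_iota] by metis

definition tau :: "nat \<Rightarrow> nat \<Rightarrow> (4, 'k) koszul \<Rightarrow> 'k" where
  "tau j p z = topc (wedge (eps j) (Y p z))"

lemma tau_functional: "lin_functional (tau j p)"
  by (simp add: lin_functional_def tau_def Y_add Y_scale wedge_add_right wedge_pscale_right)

text \<open>The obstruction for a cycle of bidegree \<open>(2, 4)\<close> at the fifth point can always be solved.\<close>

definition alpha :: "nat \<Rightarrow> (4, 'k) koszul \<Rightarrow> 'k" where
  "alpha i z = (\<Sum>j<4. tau i j z) - tau i 4 z"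

text \<open>Linear interpolation of corrected local primitives: the value at a frame point
  \<open>x i\<close> is \<open>Y i z\<close> up to a multiple of \<open>om i\<close>, and the value
  at \<open>x 4\<close> is the sum of the four corrected primitives. Comparing coordinates,
  \<open>alpha\<close> is exactly what makes this sum equal to \<open>Y 4 z\<close>.\<close>

definition prim24 :: "(4, 'k) koszul \<Rightarrow> (4, 'k) koszul" where
  "prim24 z = (\<Sum>i<4. pscale (l i) (Y i z - pscale (mconst (alpha i z)) (om i)))"

lemma prim24_kc: "z \<in> kc 2 4 \<Longrightarrow> prim24 z \<in> kc 3 4"
proof -
  assume z: "z \<in> kc 2 4"
  have "pscale (l i) (Y i z - pscale (mconst (alpha i z)) (om i)) \<in> kc 3 (1 + 3)" for i
    using Y_kc[OF z, of i] by (intro kc_pscale homogeneous_lform kc_diff kc_scale om_kc) simp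
  then show ?thesis unfolding prim24_def by (intro kc_sum) simp
qed

lemma iota_prim24: "iota y (prim24 z) =
    iota y (\<Sum>i<4. pscale (mconst (dot (g i) y)) (Y i z - pscale (mconst (alpha i z)) (om i)))"
  by (simp add: prim24_def iota_sum iota_pscale)

lemma iota_prim24_small:
  assumes "z \<in> Z" "z \<in> kc 2 4" "p < 5"
  shows "iota (x p) (prim24 z) = evk (x p) z"
proof (cases "p = 4")
  case True
  have "(\<Sum>i<4. Y i z - pscale (mconst (alpha i z)) (om i)) = Y 4 z"
  proof (rule threeform_eqI)
    show "(\<Sum>i<4. Y i z - pscale (mconst (alpha i z)) (om i)) \<in> kc 3 3"
      using Y_kc[OF assms(2)] by (intro kc_sum kc_diff kc_scale om_kc) simp
    show "Y 4 z \<in> kc 3 3" using Y_kc[OF assms(2)] by simp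
    fix i :: nat assume i: "i < 4"
    have "(\<Sum>j<4. alpha j z * (if i = j then 1 else 0)) = (\<Sum>j<4. if j = i then alpha i z else 0)"
      by (rule sum.cong) auto
    then have "(\<Sum>j<4. alpha j z * (if i = j then 1 else 0)) = alpha i z" using i by simp
    then show "topc (wedge (eps i) (\<Sum>i<4. Y i z - pscale (mconst (alpha i z)) (om i))) = topc (wedge (eps i) (Y 4 z))"
      using i by (simp add: wedge_sum_right wedge_diff_right wedge_pscale_right sum_subtractf evec_iota_vol dual
          tau_def[symmetric] alpha_def flip: mconst_mult)
  qed
  then show ?thesis using True iota_Y[OF assms(1), of 1 4 4] assms(2) t_ge_5
    by (simp add: iota_prim24 dot_g_4 numeral_2_eq_2)
next
  case False
  with assms(3) have p: "p < 4" by simp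
  have "(\<Sum>i<4. pscale (mconst (dot (g i) (x p))) (Y i z - pscale (mconst (alpha i z)) (om i))) =
      (\<Sum>i<4. if i = p then Y p z - pscale (mconst (alpha p z)) (om p) else 0)"
    using p dual by (intro sum.cong) auto
  then have "iota (x p) (prim24 z) = iota (x p) (Y p z - pscale (mconst (alpha p z)) (om p))"
    using p by (simp add: iota_prim24)
  also have "\<dots> = evk (x p) z"
    using iota_Y[OF assms(1), of 1 4 p] assms(2) p t_ge_5
    by (simp add: iota_diff iota_pscale iota_iota numeral_2_eq_2)
  finally show ?thesis .
qed

text \<open>For a cycle of homological degree 3 the local primitive is a multiple of
  \<open>vol\<close>, and this is the factor.\<close>

definition stop :: "nat \<Rightarrow> (4, 'k) koszul \<Rightarrow> 'k" where
  "stop p z = topc (Y p z)"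

lemma stop_functional: "lin_functional (stop p)"
  by (simp add: lin_functional_def stop_def Y_add Y_scale)

text \<open>A primitive in bidegree \<open>(4, 5)\<close> is a linear form times \<open>vol\<close>,
  so the numbers \<open>stop p z\<close> have to be the values of a linear form. The frame
  determines the form, and every further point gives one condition.\<close>

lemma bd_35:
  assumes z: "z \<in> Z" "z \<in> kc 3 5"
    and eq: "\<And>p. 4 \<le> p \<Longrightarrow> p < t \<Longrightarrow> (\<Sum>i<4. stop i z * dot (g i) (x p)) = stop p z"
  shows "z \<in> B"
proof (rule bd_by_points[OF z(2)])
  let ?f = "\<Sum>i<4. mconst (stop i z) * l i"
  have "homogeneous 1 ?f" by (intro homogeneous_sum homogeneous_scale homogeneous_lform)
  from kc_pscale[OF this vol_kc] show "pscale ?f vol \<in> kc (Suc 3) 5" by simp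
  fix p assume p: "p < t"
  have "(\<Sum>i<4. stop i z * dot (g i) (x p)) = stop p z"
  proof (cases "p < 4")
    case True
    then have "(\<Sum>i<4. stop i z * dot (g i) (x p)) = (\<Sum>i<4. if i = p then stop p z else 0)"
      using dual by (intro sum.cong) auto
    then show ?thesis using True by simp
  qed (use eq p in auto)
  then have 1: "iota (x p) (pscale ?f vol) = pscale (mconst (stop p z)) (om p)"
    by (simp add: iota_pscale mpoly_eval_simps)
  have "Y p z \<in> kc 4 4" using Y_kc[OF z(2)] by simp
  then have "Y p z = pscale (mconst (stop p z)) vol" unfolding stop_def by (rule kc_4_4_eq)
  then have "evk (x p) z = pscale (mconst (stop p z)) (om p)"
    using iota_Y[OF z(1), of 2 5 p] z(2) p by (simp add: iota_pscale numeral_3_eq_3 numeral_2_eq_2)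
  with 1 show "iota (x p) (pscale ?f vol) = evk (x p) z" by simp
qed

text \<open>With \<open>s = 1\<close> and \<open>r = 2\<close>, nonzero factors and a nonzero target
  force \<open>d = i + 1\<close>, \<open>e = j + 1\<close> and \<open>i + j \<le> 3\<close>. The
  product of homological degrees 2 and 1 reduces to the opposite order by graded
  commutativity.\<close>

lemma mmr12:
  assumes "pdim 1 2 1 2 = mult_rank_bound A 1 2 1 2" "pdim 1 2 2 3 = mult_rank_bound A 1 2 2 3"
  shows "max_mult_rank A"
proof (rule max_mult_rankI)
  fix i d j e :: nat assume ij: "0 < i" "0 < j"
  show "pdim i d j e = mult_rank_bound A i d j e"
  proof (cases "Z \<inter> kc i d \<subseteq> B \<or> Z \<inter> kc j e \<subseteq> B \<or> Z \<inter> kc (i + j) (d + e) \<subseteq> B")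
    case True
    then show ?thesis by (rule pdim_rank_bound_zero)
  next
    case False
    then obtain z w y where "z \<in> Z" "z \<in> kc i d" "z \<notin> B" "w \<in> Z" "w \<in> kc j e" "w \<notin> B"
        "y \<in> Z" "y \<in> kc (i + j) (d + e)" "y \<notin> B" by blast
    then have r: "i + j \<le> 3" "i + 1 \<le> d" "j + 1 \<le> e" "d + e \<le> i + j + 2"
      using nonzero_range[of z i d] nonzero_range[of w j e] nonzero_range[of y "i + j" "d + e"] ij by auto
    then have de: "d = i + 1" "e = j + 1" by auto
    from r ij have "(i = 1 \<and> j = 1) \<or> (i = 1 \<and> j = 2) \<or> (i = 2 \<and> j = 1)" by auto
    then consider "i = 1" "d = 2" "j = 1" "e = 2" | "i = 1" "d = 2" "j = 2" "e = 3" | "i = 2" "d = 3" "j = 1" "e = 2"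
      using de by auto
    then show ?thesis
    proof cases
      case 3
      have comm: "v \<otimes>\<^bsub>A\<^esub> w = w \<otimes>\<^bsub>A\<^esub> v" if "v \<in> component A 2 3" "w \<in> component A 1 2" for v w
      proof -
        from that obtain a b where a: "v = cl a" "a \<in> Z" "a \<in> kc 2 3" and b: "w = cl b" "b \<in> Z" "b \<in> kc 1 2"
          by (auto simp: component_A)
        have "wedge b a = wedge a b" using wedge_commute_kc[OF a(3) b(3)] by simp
        then show ?thesis using a b by (simp only: cl_mult)
      qed
      have "{v \<otimes>\<^bsub>A\<^esub> w |v w. v \<in> component A 2 3 \<and> w \<in> component A 1 2} =
          {v \<otimes>\<^bsub>A\<^esub> w |v w. v \<in> component A 1 2 \<and> w \<in> component A 2 3}"
        using comm by (intro subset_antisym subsetI) (auto, metis+)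
      then have "pdim 2 3 1 2 = pdim 1 2 2 3" by (simp only: product_space_def)
      moreover have "mult_rank_bound A 2 3 1 2 = mult_rank_bound A 1 2 2 3"
        by (simp add: mult_rank_bound_def mult.commute eval_nat_numeral)
      ultimately show ?thesis using 3 assms(2) by simp
    qed (use assms in simp_all)
  qed
qed

lemma quadric_expand:
  assumes "homogeneous 2 q"
  obtains C where "q = (\<Sum>i<4. \<Sum>j<4. mconst (C i j) * (l i * l j))"
proof -
  have "homogeneous (Suc 1) q" using assms by (simp add: numeral_2_eq_2)
  then obtain F where F: "\<And>v. homogeneous 1 (F v)" "q = (\<Sum>v\<in>UNIV. F v * mvar v)"
    using homogeneous_Suc_expand by blast
  have "\<exists>c. F v = lform c" for v using homogeneous_1_eq[OF F(1)] by blast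
  then obtain c where c: "\<And>v. F v = lform (c v)" by metis
  have mv: "(mvar v :: (4, 'k) mpoly) = lform (\<lambda>w. if w = v then 1 else 0)" for v :: 4
  proof -
    have "lform (\<lambda>w. if w = v then 1 else 0) = (\<Sum>w\<in>UNIV. if w = v then mvar w else (0 :: (4, 'k) mpoly))"
      unfolding lform_def by (rule sum.cong) auto
    then have "lform (\<lambda>w. if w = v then 1 else (0 :: 'k)) = mvar v" by simp
    then show ?thesis ..
  qed
  let ?u = "\<lambda>v w. if w = v then 1 else (0 :: 'k)"
  let ?C = "\<lambda>i j. \<Sum>v\<in>UNIV. dot (c v) (x i) * dot (?u v) (x j)"
  have "q = (\<Sum>v\<in>UNIV. \<Sum>i<4. \<Sum>j<4. mconst (dot (c v) (x i) * dot (?u v) (x j)) * (l i * l j))"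
    unfolding F(2) c mv
  proof (rule sum.cong[OF refl])
    fix v :: 4
    show "lform (c v) * lform (?u v) = (\<Sum>i<4. \<Sum>j<4. mconst (dot (c v) (x i) * dot (?u v) (x j)) * (l i * l j))"
      by (subst (1 2) lform_expand) (simp only: sum_product mconst_mult mult_ac)
  qed
  also have "\<dots> = (\<Sum>i<4. \<Sum>j<4. mconst (?C i j) * (l i * l j))"
    by (subst sum.swap, rule sum.cong[OF refl], subst sum.swap, rule sum.cong[OF refl])
      (simp only: mconst_sum sum_distrib_right)
  finally show thesis by (rule that)
qed

end

section \<open>Five points\<close>

lemma sum_lessThan_4: "(\<Sum>i<4. f i) = f 0 + f 1 + f 2 + f (3::nat)" for f :: "nat \<Rightarrow> 'b::comm_monoid_add"
  by (simp add: eval_nat_numeral add_ac)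

lemma sum_lessThan_5: "(\<Sum>i<5. f i) = f 0 + f 1 + f 2 + f 3 + f (4::nat)" for f :: "nat \<Rightarrow> 'b::comm_monoid_add"
  by (simp add: eval_nat_numeral add_ac)

lemma less_4_cases: "i < (4::nat) \<Longrightarrow> i = 0 \<or> i = 1 \<or> i = 2 \<or> i = 3"
  by auto

lemma less_5_cases: "i < (5::nat) \<Longrightarrow> i = 0 \<or> i = 1 \<or> i = 2 \<or> i = 3 \<or> i = 4"
  by auto

lemma koszul_diff_pscale_evec: "koszul_diff (pscale f (evec c)) = Poly_Mapping.single {} (f * lform c)"
  by (simp add: koszul_diff_pscale koszul_diff_evec) (simp add: pscale_def wedge_single wedge_sign_def)

lemma iota_pscale_evec: "iota y (pscale f (evec c)) = Poly_Mapping.single {} (mconst (mpoly_eval f y * dot c y))"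
  by (simp add: iota_def koszul_diff_pscale_evec evk_single mpoly_eval_mult)

lemma kc_lform_evec: "pscale (lform c) (evec d) \<in> kc 1 2"
  using kc_pscale[OF homogeneous_lform evec_kc] by (simp add: numeral_2_eq_2)

lemma (in tor_points) is_basis_ex:
  "is_basis i d zs \<Longrightarrow> z \<in> Z \<Longrightarrow> z \<in> kc i d \<Longrightarrow> \<exists>c. z - lincomb c zs \<in> B"
  by (simp add: is_basis_def)

lemma (in p3_points) strand_zero: "z \<in> Z \<Longrightarrow> z \<in> kc i d \<Longrightarrow> 0 < i \<Longrightarrow> i + r < d \<Longrightarrow> z \<in> B"
  using nonzero_range(3) by fastforce

section \<open>The functional on bidegree (3, 5) given by the fifth point\<close>

context gp
begin

text \<open>The obstruction of \<open>bd_35\<close> at the fifth point: since \<open>x 4\<close> is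
  the sum of the frame vectors, the value of a linear form there is the sum of its values at the
  frame. For five points this number determines the class.\<close>

definition sigma :: "(4, 'k) koszul \<Rightarrow> 'k" where
  "sigma z = stop 4 z - (\<Sum>i<4. stop i z)"

lemma sigma_functional: "lin_functional sigma"
  using stop_functional
  by (simp add: lin_functional_def sigma_def sum.distrib sum_distrib_left right_diff_distrib)

lemma stop_Bd:
  assumes "z \<in> B" "z \<in> kc 3 5"
  obtains c where "\<And>p. p < t \<Longrightarrow> stop p z = dot c (x p)"
proof -
  obtain b where b: "b \<in> kc (Suc 3) 5" "z - koszul_diff b \<in> JK t x" using assms by (rule Bd_kc)
  have kc: "z - koszul_diff b \<in> kc 3 5" using assms(2) kc_koszul_diff[OF b(1)] by (rule kc_diff)
  have bv: "b = pscale (lk b UNIV) vol" using b(1) by (intro kc_4_eq[of _ 5]) simp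
  have "homogeneous 1 (lk b UNIV)" using kc_lookup[OF b(1), of UNIV] by simp
  then obtain c where c: "lk b UNIV = lform c" using homogeneous_1_eq by blast
  have "stop p z = dot c (x p)" if p: "p < t" for p
  proof -
    have "evk (x p) z = iota (x p) b" using b(2) JK_kc_iff[OF kc] p by (simp add: evk_diff iota_def)
    also have "\<dots> = pscale (mconst (dot c (x p))) (om p)" by (subst bv) (simp add: iota_pscale c)
    finally have "Y p z = pscale (mconst (dot c (x p))) vol"
      unfolding Y_def by (simp add: wedge_pscale_right evec_iota_vol dot_eta[OF p])
    then show ?thesis by (simp add: stop_def)
  qed
  then show thesis by (rule that)
qed

lemma sigma_Bd: "z \<in> B \<Longrightarrow> z \<in> kc 3 5 \<Longrightarrow> sigma z = 0"
proof -
  assume "z \<in> B" "z \<in> kc 3 5"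
  then obtain c where "\<And>p. p < t \<Longrightarrow> stop p z = dot c (x p)" using stop_Bd by blast
  moreover have "dot c (x 4) = (\<Sum>i<4. dot c (x i))" by (subst dot_coord) (simp add: dot_g_4)
  ultimately show ?thesis using t_ge_5 by (simp add: sigma_def)
qed

lemma stop_wedge:
  assumes "z1 \<in> kc 1 d"
  shows "stop p (wedge z1 z2) = - topc (wedge (evk (x p) z1) (Y p z2))"
proof -
  have "evk (x p) z1 \<in> kc 1 1" using assms by (rule evk_kc)
  from wedge_commute_kc[OF this evec_kc, of "eta p"]
  have "wedge (evec (eta p)) (wedge (evk (x p) z1) (evk (x p) z2)) =
      - wedge (evk (x p) z1) (wedge (evec (eta p)) (evk (x p) z2))"
    by (simp add: wedge_uminus_left flip: wedge_assoc)
  then show ?thesis by (simp add: stop_def Y_def evk_wedge)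
qed

definition sg :: "nat \<Rightarrow> nat \<Rightarrow> (4, 'k) koszul \<Rightarrow> 'k" where
  "sg i j z = tau j i z - tau j 4 z"

text \<open>The factor \<open>l i\<close> vanishes at all frame points except \<open>x i\<close>, so
  only the contributions of \<open>x i\<close> and \<open>x 4\<close> survive.\<close>

lemma sigma_wedge_monomial:
  assumes "i < 4" "j < 4"
  shows "sigma (wedge (pscale (l i) (eps j)) z) = sg i j z"
proof -
  have "stop p (wedge (pscale (l i) (eps j)) z) = - dot (g i) (x p) * tau j p z" for p
    unfolding stop_wedge[OF kc_lform_evec] by (simp add: evk_pscale wedge_pscale_left tau_def)
  moreover have "(\<Sum>p<4. - dot (g i) (x p) * tau j p z) = (\<Sum>p<4. if p = i then - tau j i z else 0)"
    using assms dual by (intro sum.cong) auto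
  ultimately show ?thesis using assms by (simp add: sigma_def sg_def dot_g_4)
qed

text \<open>A linear syzygy of the quadrics through five points: contraction with \<open>x i\<close>
  or \<open>x j\<close> kills the two-form, and the coefficient \<open>l i - l j\<close> vanishes at
  \<open>x 4\<close> and at the two other frame points.\<close>

definition F :: "nat \<Rightarrow> nat \<Rightarrow> (4, 'k) koszul" where
  "F i j = pscale (l i - l j) (iota (x j) (iota (x i) vol))"

lemma iota_iota_vol_kc: "(iota y (iota y' vol) :: (4, 'k) koszul) \<in> kc 2 2"
proof -
  have "iota y' vol \<in> kc (Suc 2) 3" using om_kc[of y'] by (simp add: numeral_3_eq_3 numeral_2_eq_2)
  then show ?thesis by (rule iota_kc)
qed

lemma F_kc: "F i j \<in> kc 2 3"
  unfolding F_def
  using kc_pscale[OF homogeneous_diff[OF homogeneous_lform homogeneous_lform] iota_iota_vol_kc] by (simp add: eval_nat_numeral)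

lemma topc_eps_eps:
  assumes "a < 4" "b < 4" "i < 4" "j < 4"
  shows "topc (wedge (eps a) (wedge (eps b) (iota (x j) (iota (x i) vol)))) =
    (if b = j \<and> a = i then 1 else 0) - (if b = i \<and> a = j then 1 else 0)"
proof -
  have "iota (x j) (wedge (eps b) (om i)) = pscale (mconst (dot (g b) (x j))) (om i) - wedge (eps b) (iota (x j) (om i))"
    unfolding iota_evec_wedge using evk_const[OF om_kc] by simp
  then have step: "wedge (eps b) (iota (x j) (om i)) =
      pscale (mconst (dot (g b) (x j))) (om i) - pscale (mconst (dot (g b) (x i))) (om j)"
    by (simp add: evec_iota_vol iota_pscale)
  have "topc (wedge (eps a) (wedge (eps b) (iota (x j) (iota (x i) vol)))) =
      dot (g b) (x j) * dot (g a) (x i) - dot (g b) (x i) * dot (g a) (x j)"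
    unfolding step wedge_diff_right wedge_pscale_right evec_iota_vol topc_simps topc_vol by simp
  also have "\<dots> = (if b = j \<and> a = i then 1 else 0) - (if b = i \<and> a = j then 1 else 0)"
    unfolding dual[OF assms(2,4)] dual[OF assms(1,3)] dual[OF assms(2,3)] dual[OF assms(1,4)]
    by (cases "b = j"; cases "a = i"; cases "b = i"; cases "a = j"; simp only: if_True if_False simp_thms
        mult_1_left mult_1_right mult_zero_left mult_zero_right)
  finally show ?thesis .
qed

text \<open>Under the pairing, \<open>F i j\<close> detects only the product of the coordinates
  \<open>i\<close> and \<open>j\<close>, with the same value for both lifts of that product.\<close>

lemma sg_F:
  assumes "a < 4" "b < 4" "i < 4" "j < 4" "i \<noteq> j"
  shows "sg a b (F i j) = - (if a = i \<and> b = j \<or> a = j \<and> b = i then 1 else 0)"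
proof -
  have evF: "evk y (F i j) = pscale (mconst (dot (g i) y - dot (g j) y)) (iota (x j) (iota (x i) vol))" for y
    unfolding F_def evk_pscale using evk_const[OF iota_iota_vol_kc] by (simp add: mpoly_eval_diff)
  have "tau b 4 (F i j) = 0"
    using assms by (simp add: tau_def Y_def evF dot_g_4)
  moreover have "tau b a (F i j) = (dot (g i) (x a) - dot (g j) (x a)) *
      ((if a = j \<and> b = i then 1 else 0) - (if a = i \<and> b = j then 1 else 0))"
    using assms topc_eps_eps[of b a i j]
    by (simp add: tau_def Y_def evF eta_def wedge_pscale_right)
  ultimately show ?thesis using assms by (auto simp: sg_def dual)
qed

end

section \<open>The perfect pairing for five points\<close>

locale gp5 = gp t x g for t and x :: "nat \<Rightarrow> 4 \<Rightarrow> 'k::field_char_0" and g +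
  assumes t5: "t = 5"
begin

text \<open>Together with \<open>pj\<close> this lists the pairs of frame indices other than
  \<open>{2, 3}\<close>. The product \<open>l 2 * l 3\<close> is the reference term subtracted in
  every quadric, so that the quadric vanishes at \<open>x 4\<close>.\<close>

definition pi :: "nat \<Rightarrow> nat" where "pi k = [0, 0, 0, 1, 1] ! k"
definition pj :: "nat \<Rightarrow> nat" where "pj k = [1, 2, 3, 2, 3] ! k"

lemma pi_pj_simps [simp]:
  "pi 0 = 0" "pi 1 = 0" "pi (Suc 0) = 0" "pi 2 = 0" "pi 3 = 1" "pi 4 = 1"
  "pj 0 = 1" "pj 1 = 2" "pj (Suc 0) = 2" "pj 2 = 3" "pj 3 = 2" "pj 4 = 3"
  by (simp_all add: pi_def pj_def)

lemma pi_pj: "k < 5 \<Longrightarrow> pi k < 4 \<and> pj k < 4 \<and> pi k < pj k \<and> pi k < 2"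
  by (drule less_5_cases) auto

lemma pi_pj_inj: "k < 5 \<Longrightarrow> m < 5 \<Longrightarrow> pi k = pi m \<Longrightarrow> pj k = pj m \<Longrightarrow> k = m"
  by (drule less_5_cases, drule less_5_cases) auto

definition D :: "nat \<Rightarrow> nat \<Rightarrow> nat \<Rightarrow> nat \<Rightarrow> (4, 'k) koszul" where
  "D i j k m = pscale (l i) (eps j) - pscale (l k) (eps m)"

definition E :: "nat \<Rightarrow> (4, 'k) koszul" where
  "E k = D (pi k) (pj k) 2 3"

definition FF :: "nat \<Rightarrow> (4, 'k) koszul" where
  "FF k = F (pi k) (pj k)"

lemma D_kc: "D i j k m \<in> kc 1 2"
  unfolding D_def by (intro kc_diff kc_lform_evec)

lemma point_cases: "p < t \<Longrightarrow> p = 4 \<or> p < 4"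
  using t5 by auto

lemma D_Z:
  assumes "i < 4" "j < 4" "k < 4" "m < 4" "i \<noteq> j" "k \<noteq> m"
  shows "D i j k m \<in> Z"
proof (rule cycle_by_points)
  show "D i j k m \<in> kc (Suc 0) 2" using D_kc by simp
  fix p assume p: "p < t"
  have "dot (g a) (x p) * dot (g b) (x p) = (if p = 4 then 1 else 0)" if "a < 4" "b < 4" "a \<noteq> b" for a b
    using point_cases[OF p] that by (elim disjE) (simp_all add: dual dot_g_4)
  then show "iota (x p) (D i j k m) = 0"
    using assms by (simp add: D_def iota_diff iota_pscale_evec)
qed

lemma E_Z: "k < 5 \<Longrightarrow> E k \<in> Z"
  unfolding E_def using pi_pj[of k] by (intro D_Z) auto

lemma E_kc: "E k \<in> kc 1 2"
  unfolding E_def by (rule D_kc)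

lemma FF_kc: "FF k \<in> kc 2 3"
  unfolding FF_def by (rule F_kc)

lemma FF_Z: "k < 5 \<Longrightarrow> FF k \<in> Z"
proof (rule cycle_by_points)
  assume k: "k < 5"
  show "FF k \<in> kc (Suc 1) 3" using FF_kc by (simp add: numeral_2_eq_2)
  fix p assume p: "p < t"
  let ?i = "pi k" and ?j = "pj k"
  have ij: "?i < 4" "?j < 4" using pi_pj[OF k] by auto
  have "iota (x ?i) (iota (x ?j) (om ?i)) = - iota (x ?j) (iota (x ?i) (om ?i))"
    by (rule iota_anticommute[of _ 2]) (use om_kc in \<open>simp add: numeral_3_eq_3 numeral_2_eq_2\<close>)
  then have 1: "iota (x ?i) (iota (x ?j) (om ?i)) = 0" by (simp add: iota_iota)
  have "p = 4 \<or> p = ?i \<or> p = ?j \<or> (dot (g ?i) (x p) = 0 \<and> dot (g ?j) (x p) = 0)"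
    using point_cases[OF p] ij dual by auto
  then show "iota (x p) (FF k) = 0"
    using ij 1 by (auto simp: FF_def F_def iota_pscale mpoly_eval_diff dot_g_4 iota_iota)
qed

lemma sigma_D_wedge:
  assumes "i < 4" "j < 4" "k < 4" "m < 4"
  shows "sigma (wedge (D i j k m) z) = sg i j z - sg k m z"
  using assms by (simp add: D_def wedge_diff_left lin_functional_diff[OF sigma_functional] sigma_wedge_monomial)

text \<open>No \<open>FF m\<close> belongs to the pair \<open>{2, 3}\<close>, so the reference term
  never contributes and the pairing matrix is minus the identity. Independence of both lists and the
  multiplication table follow from this.\<close>

lemma sigma_E_FF: "k < 5 \<Longrightarrow> m < 5 \<Longrightarrow> sigma (wedge (E k) (FF m)) = (if k = m then -1 else 0)"
proof -
  assume k: "k < 5" and m: "m < 5"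
  have "sigma (wedge (E k) (FF m)) = sg (pi k) (pj k) (FF m) - sg 2 3 (FF m)"
    unfolding E_def using pi_pj[OF k] by (intro sigma_D_wedge) auto
  then show ?thesis
    using pi_pj[OF k] pi_pj[OF m] pi_pj_inj[OF k m] by (auto simp: FF_def sg_F)
qed

lemma kc_E_wedge: "z1 \<in> kc 1 2 \<Longrightarrow> z2 \<in> kc 2 3 \<Longrightarrow> wedge z1 z2 \<in> kc 3 5"
  using kc_wedge[of z1 1 2 z2 2 3] by (simp add: eval_nat_numeral)

abbreviation "Es \<equiv> map E [0..<5]"
abbreviation "Fs \<equiv> map FF [0..<5]"

lemma set_Es: "set Es \<subseteq> Z" "set Es \<subseteq> kc 1 2"
  using E_Z E_kc by auto

lemma set_Fs: "set Fs \<subseteq> Z" "set Fs \<subseteq> kc 2 3"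
  using FF_Z FF_kc by auto

lemma indep_Es: "indep Es"
  unfolding indep_def
proof (intro conjI set_Es allI impI)
  fix c k assume c: "lincomb c Es \<in> B" and k: "k < length Es"
  then have "wedge (lincomb c Es) (FF k) \<in> B" using FF_Z by (intro Bd_wedge_left) auto
  then have "sigma (wedge (lincomb c Es) (FF k)) = 0"
    using kc_E_wedge[OF lincomb_kc[OF set_Es(2)] FF_kc] by (rule sigma_Bd)
  moreover have "sigma (wedge (lincomb c Es) (FF k)) = (\<Sum>m<5. if m = k then - c k else 0)"
    unfolding lincomb_map wedge_sum_left wedge_pscale_left lin_functional_sum[OF sigma_functional]
      lin_functional_scale[OF sigma_functional]
    using k sigma_E_FF by (intro sum.cong) auto
  ultimately show "c k = 0" using k by simp
qed

lemma indep_Fs: "indep Fs"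
  unfolding indep_def
proof (intro conjI set_Fs allI impI)
  fix c k assume c: "lincomb c Fs \<in> B" and k: "k < length Fs"
  then have "wedge (E k) (lincomb c Fs) \<in> B" using E_Z by (intro Bd_wedge_right) auto
  then have "sigma (wedge (E k) (lincomb c Fs)) = 0"
    using kc_E_wedge[OF E_kc lincomb_kc[OF set_Fs(2)]] by (rule sigma_Bd)
  moreover have "sigma (wedge (E k) (lincomb c Fs)) = (\<Sum>m<5. if m = k then - c k else 0)"
    unfolding lincomb_map wedge_sum_right wedge_pscale_right lin_functional_sum[OF sigma_functional]
      lin_functional_scale[OF sigma_functional]
    using k sigma_E_FF by (intro sum.cong) auto
  ultimately show "c k = 0" using k by simp
qed

end

context gp
begin

lemma bound_12_23: "mult_rank_bound A 1 2 2 3 = min (adim 1 2 * adim 2 3) (adim 3 5)"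
  by (simp add: mult_rank_bound_def eval_nat_numeral)

lemma bound_12_12: "mult_rank_bound A 1 2 1 2 = min (adim 1 2 choose 2) (adim 2 4)"
  by (simp add: mult_rank_bound_def)

text \<open>The class depends only on the quadric, so any convenient lift may be used.\<close>

lemma same_quadric:
  assumes "z \<in> kc 1 2" "w \<in> kc 1 2" "koszul_diff z = koszul_diff w"
  shows "z - w \<in> B"
proof -
  have "z - w \<in> kc 1 2" using assms kc_diff by blast
  then obtain b where "koszul_diff b = z - w"
    using koszul_exact_kc[of "z - w" 1 2] assms(3) by (auto simp: koszul_diff_diff_eq)
  then show ?thesis using koszul_diff_Bd by metis
qed

lemma koszul_diff_quadric:
  assumes z: "z \<in> Z" "z \<in> kc 1 2"
  obtains q where "homogeneous 2 q" "koszul_diff z = Poly_Mapping.single {} q"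
    "\<And>p. p < t \<Longrightarrow> mpoly_eval q (x p) = 0"
proof -
  have dz: "koszul_diff z \<in> kc 0 2" using z(2) kc_koszul_diff by (metis One_nat_def)
  have "koszul_diff z = Poly_Mapping.single {} (lk (koszul_diff z) {})"
  proof (rule koszul_eqI)
    fix S :: "4 set"
    show "lk (koszul_diff z) S = lk (Poly_Mapping.single {} (lk (koszul_diff z) {})) S"
      using kc_card[OF dz, of S] by (cases "S = {}") (auto simp: lookup_single when_def)
  qed
  moreover have h: "homogeneous 2 (lk (koszul_diff z) {})" using kc_lookup[OF dz, of "{}"] by simp
  moreover have "mpoly_eval (lk (koszul_diff z) {}) (x p) = 0" if "p < t" for p
    using z(1) that pideal_homogeneous[OF h] by (auto simp: Zc_iff JK_def)
  ultimately show thesis using that by blast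
qed

text \<open>Quadrics through the four coordinate points are combinations of products of two distinct
  coordinates; the fifth point imposes that the coefficients sum to zero.\<close>

lemma quadric_normal_form:
  assumes "homogeneous 2 q" "\<And>p. p < t \<Longrightarrow> mpoly_eval q (x p) = 0"
  obtains c :: "nat \<Rightarrow> nat \<Rightarrow> 'k" where "q = mconst (c 0 1) * (l 0 * l 1) + mconst (c 0 2) * (l 0 * l 2) + mconst (c 0 3) * (l 0 * l 3)
      + mconst (c 1 2) * (l 1 * l 2) + mconst (c 1 3) * (l 1 * l 3) + mconst (c 2 3) * (l 2 * l (3::nat))"
    "c 0 1 + c 0 2 + c 0 3 + c 1 2 + c 1 3 + c 2 3 = (0 :: 'k)"
proof -
  obtain C where C: "q = (\<Sum>i<4. \<Sum>j<4. mconst (C i j) * (l i * l j))" using quadric_expand assms(1) by blast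
  have diag: "C p p = 0" if p: "p < 4" for p
  proof -
    have "mpoly_eval q (x p) = C p p"
      using less_4_cases[OF p] by (elim disjE) (simp_all add: C sum_lessThan_4 mpoly_eval_simps dual)
    then show ?thesis using p assms(2)[of p] t_ge_5 by simp
  qed
  let ?c = "\<lambda>i j. C i j + C j i"
  have "q = mconst (?c 0 1) * (l 0 * l 1) + mconst (?c 0 2) * (l 0 * l 2) + mconst (?c 0 3) * (l 0 * l 3)
      + mconst (?c 1 2) * (l 1 * l 2) + mconst (?c 1 3) * (l 1 * l 3) + mconst (?c 2 3) * (l 2 * l 3)"
    unfolding C sum_lessThan_4 using diag by (simp add: mconst_add algebra_simps)
  moreover from this have "mpoly_eval q (x 4) = ?c 0 1 + ?c 0 2 + ?c 0 3 + ?c 1 2 + ?c 1 3 + ?c 2 3"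
    by (simp only: mpoly_eval_simps mpoly_eval_const mpoly_eval_lform) (simp add: dot_g_4)
  ultimately show thesis using that[of ?c] assms(2)[of 4] t_ge_5 by simp
qed

end

context gp5
begin

lemma basis_12: "is_basis 1 2 Es"
  unfolding is_basis_def
proof (intro conjI indep_Es set_Es ballI)
  fix z assume z: "z \<in> Z \<inter> kc 1 2"
  then obtain q where q: "homogeneous 2 q" "koszul_diff z = Poly_Mapping.single {} q"
    "\<And>p. p < t \<Longrightarrow> mpoly_eval q (x p) = 0" using koszul_diff_quadric by blast
  obtain c :: "nat \<Rightarrow> nat \<Rightarrow> 'k" where c: "q = mconst (c 0 1) * (l 0 * l 1) + mconst (c 0 2) * (l 0 * l 2) + mconst (c 0 3) * (l 0 * l 3)
      + mconst (c 1 2) * (l 1 * l 2) + mconst (c 1 3) * (l 1 * l 3) + mconst (c 2 3) * (l 2 * l (3::nat))"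
    "c 0 1 + c 0 2 + c 0 3 + c 1 2 + c 1 3 + c 2 3 = (0 :: 'k)" using quadric_normal_form[OF q(1,3)] by blast
  let ?d = "\<lambda>k. c (pi k) (pj k)"
  have dE: "koszul_diff (E k) = Poly_Mapping.single {} (l (pi k) * l (pj k) - l 2 * l 3)" for k
    by (simp add: E_def D_def koszul_diff_diff_eq koszul_diff_pscale_evec single_diff)
  have "koszul_diff (lincomb ?d Es) = (\<Sum>k<5. Poly_Mapping.single {} (mconst (?d k) * (l (pi k) * l (pj k) - l 2 * l 3)))"
    unfolding lincomb_map koszul_diff_sum koszul_diff_pscale dE
    by (simp add: pscale_def wedge_single wedge_sign_def)
  also have "\<dots> = Poly_Mapping.single {} (\<Sum>k<5. mconst (?d k) * (l (pi k) * l (pj k) - l 2 * l 3))"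
    by (rule additive_sum[symmetric]) (simp add: single_add)
  also have "(\<Sum>k<5. mconst (?d k) * (l (pi k) * l (pj k) - l 2 * l 3)) = q"
  proof -
    \<comment> \<open>The condition at the fifth point turns every admissible quadric into a
      combination of differences with the reference term.\<close>
    have c23: "c 2 3 = - (c 0 1 + c 0 2 + c 0 3 + c 1 2 + c 1 3)" by (rule minus_unique[OF c(2), symmetric])
    show ?thesis unfolding c(1) sum_lessThan_5 c23
      by (simp add: mconst_add mconst_uminus mconst_diff algebra_simps)
  qed
  finally have "koszul_diff z = koszul_diff (lincomb ?d Es)" using q(2) by simp
  then have "z - lincomb ?d Es \<in> B" using z lincomb_kc[OF set_Es(2)] by (intro same_quadric) auto
  then show "\<exists>c. z - lincomb c Es \<in> B" by blast
qed

text \<open>Orthogonality to all differences of mixed products makes \<open>sg i j z\<close> a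
  single constant \<open>\<kappa>\<close>. Then the constant three-form \<open>b\<close> differs
  from each local primitive \<open>Y p z\<close> by a multiple of \<open>om p\<close>, so it is a
  primitive at all five points.\<close>

lemma pairing_nondegenerate:
  assumes z: "z \<in> Z" "z \<in> kc 2 3" and zero: "\<And>k. k < 5 \<Longrightarrow> sigma (wedge (E k) z) = 0"
  shows "z \<in> B"
proof -
  have all: "sigma (wedge y z) = 0" if y: "y \<in> Z" "y \<in> kc 1 2" for y
  proof -
    obtain c where "y - lincomb c Es \<in> B" using is_basis_span[OF basis_12 y] .
    then have "wedge (y - lincomb c Es) z \<in> B" using z by (intro Bd_wedge_left)
    then have "sigma (wedge (y - lincomb c Es) z) = 0"
      using kc_E_wedge[OF kc_diff[OF y(2) lincomb_kc[OF set_Es(2)]] z(2)] by (rule sigma_Bd)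
    moreover have "sigma (wedge (lincomb c Es) z) = 0"
      unfolding lincomb_map wedge_sum_left wedge_pscale_left lin_functional_sum[OF sigma_functional]
        lin_functional_scale[OF sigma_functional] using zero by simp
    ultimately show ?thesis by (simp add: wedge_diff_left lin_functional_diff[OF sigma_functional])
  qed
  define \<kappa> where "\<kappa> = sg 0 1 z"
  have \<kappa>: "tau j i z = tau j 4 z + \<kappa>" if "i < 4" "j < 4" "i \<noteq> j" for i j
  proof -
    have "sigma (wedge (D i j 0 1) z) = 0" using that by (intro all D_Z D_kc) auto
    then show ?thesis using that sigma_D_wedge[of i j 0 1 z] by (simp add: \<kappa>_def sg_def algebra_simps)
  qed
  define b where "b = Y 4 z + pscale (mconst \<kappa>) (om 4)"
  have Y: "Y p z \<in> kc 3 3" for p using Y_kc[OF z(2), of p] by simp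
  have b: "b \<in> kc 3 3" unfolding b_def by (intro kc_add kc_scale Y om_kc)
  have iY: "iota (x p) (Y p z) = evk (x p) z" if "p < t" for p
    using iota_Y[OF z(1), of 1 3 p] z(2) that by (simp add: numeral_2_eq_2)
  show ?thesis
  proof (rule bd_by_points[OF z(2)])
    show "b \<in> kc (Suc 2) 3" using b by simp
    fix p assume p: "p < t"
    show "iota (x p) b = evk (x p) z"
    proof (cases "p = 4")
      case True
      then show ?thesis using iY[OF p] by (simp add: b_def iota_add iota_pscale iota_iota)
    next
      case False
      then have p4: "p < 4" using point_cases[OF p] by auto
      have "b = Y p z + pscale (mconst (tau p 4 z + \<kappa> - tau p p z)) (om p)"
      proof (rule threeform_eqI[OF b])
        show "Y p z + pscale (mconst (tau p 4 z + \<kappa> - tau p p z)) (om p) \<in> kc 3 3"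
          by (intro kc_add kc_scale Y om_kc)
        fix j :: nat assume j: "j < 4"
        show "topc (wedge (eps j) b) =
            topc (wedge (eps j) (Y p z + pscale (mconst (tau p 4 z + \<kappa> - tau p p z)) (om p)))"
          using j p4 \<kappa>[of p j]
          by (cases "j = p") (auto simp: b_def wedge_add_right wedge_pscale_right evec_iota_vol dual dot_g_4
              simp flip: tau_def mconst_mult)
      qed
      then show ?thesis using iY[OF p] by (simp add: iota_add iota_pscale iota_iota)
    qed
  qed
qed

lemma basis_23: "is_basis 2 3 Fs"
  unfolding is_basis_def
proof (intro conjI indep_Fs set_Fs ballI)
  fix z assume z: "z \<in> Z \<inter> kc 2 3"
  let ?c = "\<lambda>k. - sigma (wedge (E k) z)"
  have "z - lincomb ?c Fs \<in> B"
  proof (rule pairing_nondegenerate)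
    show "z - lincomb ?c Fs \<in> Z" "z - lincomb ?c Fs \<in> kc 2 3"
      using z lincomb_Zc[OF set_Fs(1)] lincomb_kc[OF set_Fs(2)] Zc_diff kc_diff by blast+
    fix k :: nat assume k: "k < 5"
    have "sigma (wedge (E k) (lincomb ?c Fs)) = (\<Sum>m<5. if m = k then sigma (wedge (E k) z) else 0)"
      unfolding lincomb_map wedge_sum_right wedge_pscale_right lin_functional_sum[OF sigma_functional]
        lin_functional_scale[OF sigma_functional]
      using k sigma_E_FF by (intro sum.cong) auto
    then show "sigma (wedge (E k) (z - lincomb ?c Fs)) = 0"
      using k by (simp add: wedge_diff_right lin_functional_diff[OF sigma_functional])
  qed
  then show "\<exists>c. z - lincomb c Fs \<in> B" by blast
qed

lemma sigma_zero_Bd: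
  assumes "z \<in> Z" "z \<in> kc 3 5" "sigma z = 0"
  shows "z \<in> B"
proof (rule bd_35[OF assms(1,2)])
  fix p assume "4 \<le> p" "p < t"
  then have "p = 4" using t5 by simp
  then show "(\<Sum>i<4. stop i z * dot (g i) (x p)) = stop p z"
    using assms(3) by (simp add: dot_g_4 sigma_def)
qed

abbreviation "G0 \<equiv> wedge (E 0) (FF 0)"

lemma G0: "G0 \<in> Z" "G0 \<in> kc 3 5" "sigma G0 = -1"
  using Zc_wedge[OF E_Z[of 0] FF_Z[of 0]] kc_E_wedge[OF E_kc FF_kc] sigma_E_FF[of 0 0] by simp_all

lemma basis_35: "is_basis 3 5 [G0]"
  unfolding is_basis_def indep_def
proof (intro conjI ballI allI impI)
  fix c i assume c: "lincomb c [G0] \<in> B" and i: "i < length [G0]"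
  then have "sigma (pscale (mconst (c 0)) G0) = 0"
    using G0 by (intro sigma_Bd kc_scale) (simp_all add: lincomb_Cons)
  then show "c i = 0" using i G0 by (simp add: lin_functional_scale[OF sigma_functional])
next
  fix z assume z: "z \<in> Z \<inter> kc 3 5"
  have "z - pscale (mconst (- sigma z)) G0 \<in> B"
    using z G0 by (intro sigma_zero_Bd Zc_diff Zc_pscale kc_diff kc_scale)
      (auto simp: lin_functional_diff[OF sigma_functional] lin_functional_scale[OF sigma_functional])
  then show "\<exists>c. z - lincomb c [G0] \<in> B"
    by (intro exI[of _ "\<lambda>_. - sigma z"]) (simp add: lincomb_Cons)
qed (use G0 in auto)

text \<open>With five points the interpolation \<open>prim24\<close> meets every condition, so
  nothing obstructs.\<close>

lemma zero_24: "z \<in> Z \<Longrightarrow> z \<in> kc 2 4 \<Longrightarrow> z \<in> B"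
  using bd_by_points[of z 2 4 "prim24 z"] prim24_kc[of z] iota_prim24_small[of z] t5
  by (simp add: numeral_3_eq_3 numeral_2_eq_2)

lemma max_mult_rank_5: "max_mult_rank A"
proof (rule mmr12)
  show "pdim 1 2 1 2 = mult_rank_bound A 1 2 1 2"
  proof (rule pdim_rank_bound_zero)
    have e: "(1 + 1 :: nat) = 2" "(2 + 2 :: nat) = 4" by simp_all
    show "Z \<inter> kc 1 2 \<subseteq> B \<or> Z \<inter> kc 1 2 \<subseteq> B \<or> Z \<inter> kc (1 + 1) (2 + 2) \<subseteq> B"
      unfolding e using zero_24 by blast
  qed
  have "pdim 1 2 2 3 = length [G0]"
  proof (rule alg_dim_product_space)
    show "indep [G0]" using is_basisD(1)[OF basis_35] .
    show "cl ` set [G0] \<subseteq> {cl (wedge z w) |z w. z \<in> Z \<inter> kc 1 2 \<and> w \<in> Z \<inter> kc 2 3}"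
      using E_Z[of 0] E_kc FF_Z[of 0] FF_kc by fastforce
    fix z w assume "z \<in> Z" "z \<in> kc 1 2" "w \<in> Z" "w \<in> kc 2 3"
    then show "\<exists>c. wedge z w - lincomb c [G0] \<in> B"
      by (intro is_basis_ex[OF basis_35] kc_E_wedge Zc_wedge)
  qed
  moreover have "mult_rank_bound A 1 2 2 3 = min (5 * 5) 1"
    unfolding bound_12_23 alg_dim_component[OF basis_12] alg_dim_component[OF basis_23]
      alg_dim_component[OF basis_35] by simp
  ultimately show "pdim 1 2 2 3 = mult_rank_bound A 1 2 2 3" by simp
qed

text \<open>The quadrics, the linear syzygies and \<open>G0\<close> come first in the bases. All
  other elements of degrees 1 and 2 lie in the higher strand, where every product exceeds the last
  possible internal degree.\<close>

lemma class_G5: "has_class A (Class_G 5)"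
proof -
  obtain e2 where e2: "is_basis 1 3 e2" by (rule obtain_basis)
  obtain f2 where f2: "is_basis 2 4 f2" by (rule obtain_basis)
  obtain g2 where g2: "is_basis 3 4 g2" by (rule obtain_basis)
  let ?e = "Es @ e2" and ?f = "Fs @ f2" and ?g = "[G0] @ g2"
  have hb: "hom_basis A 1 (length ?e) (\<lambda>j. cl (?e ! (j - 1)))" "hom_basis A 2 (length ?f) (\<lambda>j. cl (?f ! (j - 1)))"
    using hom_basis_strands[of 1 Es e2] hom_basis_strands[of 2 Fs f2] basis_12 basis_23 e2 f2
    by (simp_all add: eval_nat_numeral)
  have hb3: "hom_basis A 3 (length ?g) (\<lambda>j. cl (?g ! (j - 1)))"
  proof (rule hom_basis_append[OF basis_35 g2])
    fix d' :: nat assume "d' \<noteq> 5" "d' \<noteq> 4"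
    then show "Z \<inter> kc 3 d' \<subseteq> B" using nonzero_range[of _ 3 d'] by fastforce
  qed simp
  have me: "?e ! (i - 1) \<in> Z \<and> (if i \<le> 5 then ?e ! (i - 1) = E (i - 1) else ?e ! (i - 1) \<in> kc 1 3)"
    if "i \<in> {1..length ?e}" for i
  proof (cases "i \<le> 5")
    case True
    then show ?thesis using that E_Z[of "i - 1"] by (auto simp: nth_append simp del: upt_Suc)
  next
    case False
    then have "?e ! (i - 1) \<in> set e2" using that by (auto simp: nth_append)
    then show ?thesis using False is_basisD[OF e2] by auto
  qed
  have mf: "?f ! (i - 1) \<in> Z \<and> (if i \<le> 5 then ?f ! (i - 1) = FF (i - 1) else ?f ! (i - 1) \<in> kc 2 4)"
    if "i \<in> {1..length ?f}" for i
  proof (cases "i \<le> 5")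
    case True
    then show ?thesis using that FF_Z[of "i - 1"] by (auto simp: nth_append simp del: upt_Suc)
  next
    case False
    then have "?f ! (i - 1) \<in> set f2" using that by (auto simp: nth_append)
    then show ?thesis using False is_basisD[OF f2] by auto
  qed
  have ee: "cl (?e ! (i - 1)) \<otimes>\<^bsub>A\<^esub> cl (?e ! (j - 1)) = \<zero>\<^bsub>A\<^esub>"
    if i: "i \<in> {1..length ?e}" and j: "j \<in> {1..length ?e}" for i j
  proof -
    let ?a = "?e ! (i - 1)" and ?b = "?e ! (j - 1)"
    have Z: "?a \<in> Z" "?b \<in> Z" using me[OF i] me[OF j] by auto
    obtain d1 where d1: "?a \<in> kc 1 d1" "2 \<le> d1" using me[OF i] E_kc[of "i - 1"] by (cases "i \<le> 5") auto
    obtain d2 where d2: "?b \<in> kc 1 d2" "2 \<le> d2" using me[OF j] E_kc[of "j - 1"] by (cases "j \<le> 5") auto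
    have k: "wedge ?a ?b \<in> kc 2 (d1 + d2)" using kc_wedge[OF d1(1) d2(1)] by (simp add: numeral_2_eq_2)
    have "wedge ?a ?b \<in> B"
    proof (cases "d1 + d2 = 4")
      case True
      then show ?thesis using zero_24 k Zc_wedge[OF Z] by simp
    next
      case False
      then show ?thesis using strand_zero[OF Zc_wedge[OF Z] k] d1 d2 by simp
    qed
    then show ?thesis using Z by (simp add: cl_mult cl_eq_zero Zc_wedge)
  qed
  have ef: "cl (?e ! (i - 1)) \<otimes>\<^bsub>A\<^esub> cl (?f ! (j - 1)) = (if i = j \<and> i \<le> 5 then cl G0 else \<zero>\<^bsub>A\<^esub>)"
    if i: "i \<in> {1..length ?e}" and j: "j \<in> {1..length ?f}" for i j
  proof -
    let ?a = "?e ! (i - 1)" and ?b = "?f ! (j - 1)"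
    have Z: "?a \<in> Z" "?b \<in> Z" using me[OF i] mf[OF j] by auto
    show ?thesis
    proof (cases "i \<le> 5 \<and> j \<le> 5")
      case True
      then have ab: "?a = E (i - 1)" "?b = FF (j - 1)" using me[OF i] mf[OF j] by auto
      \<comment> \<open>The value of \<open>sigma\<close> determines the class, and all diagonal
        products share the value -1 with \<open>G0\<close>.\<close>
      let ?c = "if i = j then 1 else (0::'k)"
      have ij: "i - 1 < 5" "j - 1 < 5" "(i - 1 = j - 1) = (i = j)" using True i j by auto
      have "sigma (wedge ?a ?b) = - ?c" unfolding ab using sigma_E_FF[OF ij(1,2)] ij(3) by simp
      moreover have "wedge ?a ?b \<in> kc 3 5" unfolding ab by (rule kc_E_wedge[OF E_kc FF_kc])
      ultimately have "wedge ?a ?b - pscale (mconst ?c) G0 \<in> B"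
        using Zc_diff[OF Zc_wedge[OF Z] Zc_pscale[OF G0(1), of "mconst ?c"]] kc_diff[OF _ kc_scale[OF G0(2), of ?c]] G0(3)
        by (intro sigma_zero_Bd)
          (simp_all add: lin_functional_diff[OF sigma_functional] lin_functional_scale[OF sigma_functional])
      then have "cl (wedge ?a ?b) = cl (pscale (mconst ?c) G0)"
        using Z G0 by (subst cl_eq_iff) (auto intro: Zc_wedge Zc_pscale)
      then show ?thesis using True Z by (simp add: cl_mult cl_zero)
    next
      case False
      obtain d1 where d1: "?a \<in> kc 1 d1" "2 \<le> d1" "\<not> i \<le> 5 \<Longrightarrow> d1 = 3"
        using me[OF i] E_kc[of "i - 1"] by (cases "i \<le> 5") auto
      obtain d2 where d2: "?b \<in> kc 2 d2" "3 \<le> d2" "\<not> j \<le> 5 \<Longrightarrow> d2 = 4"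
        using mf[OF j] FF_kc[of "j - 1"] by (cases "j \<le> 5") auto
      have k: "wedge ?a ?b \<in> kc 3 (d1 + d2)" using kc_wedge[OF d1(1) d2(1)] by (simp add: eval_nat_numeral)
      have "5 < d1 + d2" using d1 d2 False by (cases "i \<le> 5"; cases "j \<le> 5") auto
      then have "wedge ?a ?b \<in> B" using strand_zero[OF Zc_wedge[OF Z] k] by simp
      then show ?thesis using Z False by (auto simp: cl_mult cl_eq_zero Zc_wedge)
    qed
  qed
  have op: "only_products A (length ?e) (\<lambda>j. cl (?e ! (j - 1))) (length ?f) (\<lambda>j. cl (?f ! (j - 1)))
      (\<lambda>i j. None) (\<lambda>i j. if i = j \<and> i \<le> 5 then Some (cl (?g ! (1 - 1))) else None)"
    unfolding only_products_def using ee ef by simp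
  show ?thesis
    unfolding has_class.simps
    by (intro exI[of _ "length ?e"] exI[of _ "length ?f"] exI[of _ "length ?g"] exI[of _ "\<lambda>j. cl (?e ! (j - 1))"]
        exI[of _ "\<lambda>j. cl (?f ! (j - 1))"] exI[of _ "\<lambda>j. cl (?g ! (j - 1))"] conjI hb hb3 op) auto
qed

end

section \<open>Quadrics and linear syzygies\<close>

lemma pideal_antimono: "t \<le> t' \<Longrightarrow> pideal t' x \<subseteq> pideal t x"
  by (auto simp: pideal_def)

lemma Zc_antimono: "t \<le> t' \<Longrightarrow> Zc t' x \<subseteq> Zc t x"
  using pideal_antimono[of t t' x] by (auto simp: tor_cycles_def)

lemma single_empty_eq_iff [simp]: "Poly_Mapping.single {} p = Poly_Mapping.single {} q \<longleftrightarrow> p = q"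
  by (metis lookup_single_eq)

context gp
begin

text \<open>In this strand the coefficients are linear forms, and no nonzero one lies in the ideal;
  so working modulo \<open>JK\<close> adds no boundaries to those of the Koszul complex.\<close>

lemma Bd_linear_strand:
  assumes "z \<in> kc (Suc i) (Suc (Suc i))"
  shows "z \<in> B \<longleftrightarrow> koszul_diff z = 0"
proof
  assume "z \<in> B"
  then obtain b where b: "b \<in> kc (Suc (Suc i)) (Suc (Suc i))" "z - koszul_diff b \<in> JK t x"
    using assms by (rule Bd_kc)
  have kc: "z - koszul_diff b \<in> kc (Suc i) (Suc (Suc i))" using assms kc_koszul_diff[OF b(1)] by (rule kc_diff)
  have "lk (z - koszul_diff b) S = 0" for S
    using no_linear_forms[of "lk (z - koszul_diff b) S"] kc_lookup[OF kc, of S] b(2) by (simp add: JK_def)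
  then have "z - koszul_diff b = 0" by (intro koszul_eqI) simp
  then have "z = koszul_diff b" by simp
  then show "koszul_diff z = 0" by (metis koszul_diff_diff)
next
  assume "koszul_diff z = 0"
  then obtain b where "koszul_diff b = z" using koszul_exact_kc[OF assms] by blast
  then show "z \<in> B" using koszul_diff_Bd by metis
qed

lemma lift_quadric:
  assumes "homogeneous 2 q"
  obtains z where "z \<in> kc 1 2" "koszul_diff z = Poly_Mapping.single {} q"
proof -
  have "Poly_Mapping.single {} q \<in> kc 0 2" using kc_single[of "{}" 0 2 q] assms by simp
  then obtain z where "z \<in> kc (Suc 0) 2" "koszul_diff z = Poly_Mapping.single {} q"
    using koszul_exact_kc[of "Poly_Mapping.single {} q" 0 2] by auto
  then show thesis using that by simp
qed

lemma quadric_cycle: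
  assumes "z \<in> kc 1 2" "koszul_diff z = Poly_Mapping.single {} q"
  shows "z \<in> Z \<longleftrightarrow> (\<forall>p<t. mpoly_eval q (x p) = 0)"
proof -
  have dz: "koszul_diff z \<in> kc 0 2" using assms(1) kc_koszul_diff by (metis One_nat_def)
  have h: "homogeneous 2 q" using kc_lookup[OF dz, of "{}"] assms(2) by simp
  show ?thesis
    unfolding Zc_iff assms(2) JK_def using pideal_homogeneous[OF h, of t x] pideal_zero[of t x]
    by (auto simp: lookup_single when_def dest: spec[of _ "{}"])
qed

end

text \<open>Quadrics separate the points, so passing through the new point \<open>x t\<close> is a
  nontrivial condition: a quadric \<open>h\<close> through the old points that misses
  \<open>x t\<close> completes a basis.\<close>

lemma adim_12_Suc:
  assumes "gp t x g" "gp (Suc t) x g"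
  shows "alg_dim (tor_algebra (pideal t x)) (component (tor_algebra (pideal t x)) 1 2) =
    Suc (alg_dim (tor_algebra (pideal (Suc t) x)) (component (tor_algebra (pideal (Suc t) x)) 1 2))"
proof -
  interpret T: gp t x g by fact
  interpret S: gp "Suc t" x g by fact
  obtain zs where zs: "S.is_basis 1 2 zs" by (rule S.obtain_basis)
  obtain h where h: "homogeneous 2 h" "\<And>q. q < Suc t \<Longrightarrow> mpoly_eval h (x q) = (if q = t then 1 else 0)"
    using S.sep2 by (auto simp: separated_def)
  obtain w where w: "w \<in> kc 1 2" "koszul_diff w = Poly_Mapping.single {} h"
    using T.lift_quadric[OF h(1)] .
  have wZ: "w \<in> Zc t x" using T.quadric_cycle[OF w] h(2) by simp
  have zsT: "set zs \<subseteq> Zc t x" using S.is_basisD(3)[OF zs] Zc_antimono[of t "Suc t" x] by auto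
  have zsk: "set zs \<subseteq> kc 1 2" using S.is_basisD(2)[OF zs] .
  have Bd: "z \<in> Bd t x \<longleftrightarrow> z \<in> Bd (Suc t) x" if "z \<in> kc 1 2" for z
    using T.Bd_linear_strand[of z 0] S.Bd_linear_strand[of z 0] that by (simp add: numeral_2_eq_2)
  have ev0: "mpoly_eval (lk (koszul_diff z) {}) (x t) = 0" if z: "z \<in> Zc (Suc t) x" "z \<in> kc 1 2" for z
  proof -
    obtain q where "koszul_diff z = Poly_Mapping.single {} q" "\<And>p. p < Suc t \<Longrightarrow> mpoly_eval q (x p) = 0"
      using S.koszul_diff_quadric[OF z] by blast
    then show ?thesis by simp
  qed
  have l: "lincomb c (zs @ [w]) = lincomb c zs + pscale (mconst (c (length zs))) w" for c
    by (simp add: lincomb_append lincomb_Cons)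
  have "T.is_basis 1 2 (zs @ [w])"
    unfolding T.is_basis_def T.indep_def
  proof (intro conjI allI impI ballI)
    show "set (zs @ [w]) \<subseteq> Zc t x" "set (zs @ [w]) \<subseteq> kc 1 2" using zsT zsk w wZ by auto
    fix c i assume c: "lincomb c (zs @ [w]) \<in> Bd t x" and i: "i < length (zs @ [w])"
    have "lincomb c (zs @ [w]) \<in> kc 1 2" unfolding l using zsk w by (intro kc_add kc_scale lincomb_kc)
    then have "koszul_diff (lincomb c (zs @ [w])) = 0"
      using c T.Bd_linear_strand[of "lincomb c (zs @ [w])" 0] by (simp add: numeral_2_eq_2)
    then have "koszul_diff (lincomb c zs) + pscale (mconst (c (length zs))) (Poly_Mapping.single {} h) = 0"
      unfolding l by (simp add: koszul_diff_add koszul_diff_pscale w)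
    then have "lk (koszul_diff (lincomb c zs)) {} + mconst (c (length zs)) * h = 0"
      by (auto dest: arg_cong[where f = "\<lambda>a. lk a {}"] simp: lookup_add)
    then have "mpoly_eval (lk (koszul_diff (lincomb c zs)) {}) (x t) + c (length zs) * mpoly_eval h (x t) = 0"
      by (auto dest!: arg_cong[where f = "\<lambda>f. mpoly_eval f (x t)"] simp: mpoly_eval_simps)
    \<comment> \<open>Evaluation at the new point: the quadrics lifted by \<open>zs\<close> vanish
      there and \<open>h\<close> does not.\<close>
    then have last: "c (length zs) = 0"
      using ev0[OF lincomb_Zc[OF S.is_basisD(3)[OF zs]] lincomb_kc[OF zsk]] h(2)[of t] by simp
    then have "lincomb c zs \<in> Bd t x" using c l by simp
    then have "lincomb c zs \<in> Bd (Suc t) x" using Bd lincomb_kc[OF zsk] by simp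
    then show "c i = 0" using S.indepD[OF S.is_basisD(1)[OF zs]] last i by (cases "i = length zs") auto
  next
    fix z assume "z \<in> Zc t x \<inter> kc 1 2"
    then have z: "z \<in> Zc t x" "z \<in> kc 1 2" by auto
    obtain q where q: "homogeneous 2 q" "koszul_diff z = Poly_Mapping.single {} q"
      "\<And>p. p < t \<Longrightarrow> mpoly_eval q (x p) = 0" using T.koszul_diff_quadric[OF z] by blast
    let ?e = "mpoly_eval q (x t)"
    let ?z = "z - pscale (mconst ?e) w"
    have zk: "?z \<in> kc 1 2" using z w by (intro kc_diff kc_scale)
    have dz: "koszul_diff ?z = Poly_Mapping.single {} (q - mconst ?e * h)"
      by (rule koszul_eqI) (simp add: koszul_diff_diff_eq koszul_diff_pscale q w lookup_minus lookup_single when_def)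
    have "?z \<in> Zc (Suc t) x"
      unfolding S.quadric_cycle[OF zk dz] using q(3) h(2)
      by (auto simp: mpoly_eval_simps less_Suc_eq)
    then obtain c where c: "?z - lincomb c zs \<in> Bd (Suc t) x" using S.is_basis_span[OF zs _ zk] by blast
    then have "?z - lincomb c zs \<in> Bd t x" using Bd[OF kc_diff[OF zk lincomb_kc[OF zsk]]] by simp
    moreover have "lincomb (\<lambda>i. if i < length zs then c i else ?e) (zs @ [w]) = lincomb c zs + pscale (mconst ?e) w"
      unfolding l by (simp cong: lincomb_cong)
    ultimately show "\<exists>c. z - lincomb c (zs @ [w]) \<in> Bd t x"
      by (intro exI[of _ "\<lambda>i. if i < length zs then c i else ?e"]) (simp add: algebra_simps)
  qed
  then show ?thesis using T.alg_dim_component S.alg_dim_component[OF zs] by simp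
qed

context gp
begin

lemma JK_decompose:
  assumes span: "\<And>f. homogeneous 2 f \<Longrightarrow> f \<in> pideal t x \<Longrightarrow> \<exists>c. f = (\<Sum>k<N. mconst (c k) * q k)"
    and w: "w \<in> JK t x" "w \<in> kc i (i + 2)"
  obtains \<omega> where "\<And>k. \<omega> k \<in> kc i i" "w = (\<Sum>k<N. pscale (q k) (\<omega> (k::nat)))"
proof -
  have "\<exists>c. lk w S = (\<Sum>k<N. mconst (c k) * q k)" for S
    using span[of "lk w S"] w kc_lookup[OF w(2), of S] by (simp add: JK_def)
  then obtain c where c: "\<And>S. lk w S = (\<Sum>k<N. mconst (c S k) * q k)" by metis
  define \<omega> :: "nat \<Rightarrow> (4, 'k) koszul" where "\<omega> k = (\<Sum>S\<in>{S. card S = i}. Poly_Mapping.single S (mconst (c S k)))" for k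
  have kc: "\<omega> k \<in> kc i i" for k
    unfolding \<omega>_def using kc_single[OF _ homogeneous_const] by (intro kc_sum) force
  have lw: "lk (\<omega> k) S = (if card S = i then mconst (c S k) else 0)" for k S
    by (simp add: \<omega>_def lookup_sum lookup_single when_def)
  have "w = (\<Sum>k<N. pscale (q k) (\<omega> k))"
  proof (rule koszul_eqI)
    fix S
    show "lk w S = lk (\<Sum>k<N. pscale (q k) (\<omega> k)) S"
    proof (cases "card S = i")
      case True
      then show ?thesis unfolding c lookup_sum lookup_pscale lw by (simp add: mult.commute)
    next
      case False
      then have "lk w S = 0" using kc_card[OF w(2), of S] by auto
      then show ?thesis using False by (simp add: lookup_sum lw)
    qed
  qed
  with kc show thesis by (rule that)
qed

text \<open>Up to a Koszul boundary, \<open>w\<close> is a combination of the quadrics with constant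
  forms \<open>\<omega> k\<close>. Differentiating removes the boundary and turns the given
  coefficients, corrected by exact terms, into a syzygy. Products are shown to be nonzero by
  contradicting what is known about linear syzygies.\<close>

lemma boundary_syzygy:
  assumes span: "\<And>f. homogeneous 2 f \<Longrightarrow> f \<in> pideal t x \<Longrightarrow> \<exists>c. f = (\<Sum>k<N. mconst (c k) * q k)"
    and w: "w \<in> B" "w \<in> kc (Suc i) (Suc i + 2)"
    and dw: "koszul_diff w = (\<Sum>k<N. pscale (q k) (L k))"
  obtains \<omega> where "\<And>k. \<omega> k \<in> kc (Suc i) (Suc i)" "(\<Sum>k<N. pscale (q k) (L k - koszul_diff (\<omega> (k::nat)))) = 0"
proof -
  obtain b where b: "b \<in> kc (Suc (Suc i)) (Suc i + 2)" "w - koszul_diff b \<in> JK t x" using w by (rule Bd_kc)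
  have kc: "w - koszul_diff b \<in> kc (Suc i) (Suc i + 2)" using w(2) kc_koszul_diff[OF b(1)] by (rule kc_diff)
  obtain \<omega> where \<omega>: "\<And>k. \<omega> k \<in> kc (Suc i) (Suc i)" "w - koszul_diff b = (\<Sum>k<N. pscale (q k) (\<omega> k))"
    using JK_decompose[OF span b(2) kc] by blast
  have "koszul_diff w = koszul_diff (w - koszul_diff b)" by (simp add: koszul_diff_diff_eq koszul_diff_diff)
  also have "\<dots> = (\<Sum>k<N. pscale (q k) (koszul_diff (\<omega> k)))" unfolding \<omega>(2) by (simp add: koszul_diff_sum koszul_diff_pscale)
  finally have "(\<Sum>k<N. pscale (q k) (L k - koszul_diff (\<omega> k))) = 0"
    unfolding dw by (simp add: pscale_diff_right sum_subtractf)
  with \<omega>(1) show thesis by (rule that)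
qed

lemma linear_strand_lookup:
  assumes "X \<in> kc i (Suc i)"
  obtains c where "lk X S = lform c"
  using homogeneous_1_eq[of "lk X S"] kc_lookup[OF assms, of S] by auto

lemma point_with_coords: "dot (g i) (\<lambda>v. \<Sum>j<4. y j * x j v) = y i" if "i < 4"
proof -
  have "dot (g i) (\<lambda>v. \<Sum>j<4. y j * x j v) = (\<Sum>j<4. y j * dot (g i) (x j))"
    unfolding dot_def by (simp add: sum_distrib_left algebra_simps) (rule sum.swap)
  also have "\<dots> = (\<Sum>j<4. if j = i then y i else 0)" using that dual by (intro sum.cong) auto
  finally show ?thesis using that by simp
qed

end

text \<open>
  The linear syzygies of the quadrics through six points, in coordinates. The first three quadrics
  are the minors of the matrix with columns \<open>(y\<^sub>i - y\<^sub>0, a\<^sub>i y\<^sub>i - a\<^sub>0 y\<^sub>0)\<close>; they cut out the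
  twisted cubic through the points, and their syzygies are the rows of the matrix.
\<close>

lemma twisted_cubic_syzygies:
  fixes a b :: "nat \<Rightarrow> 'k::field_char_0" and L :: "nat \<Rightarrow> nat \<Rightarrow> 'k"
  assumes a: "a 1 \<noteq> a 2" "a 1 \<noteq> a 3" "a 2 \<noteq> a 3" and b: "b 2 \<noteq> b 3" "b 3 \<noteq> b 1" "b 1 \<noteq> b 2"
    and H: "\<And>y0 y1 y2 y3.
      (L 0 0 * y0 + L 0 1 * y1 + L 0 2 * y2 + L 0 3 * y3) * ((a 3 - a 2) * y2 * y3 + (a 2 - a 0) * y0 * y2 + (a 0 - a 3) * y0 * y3) +
      (L 1 0 * y0 + L 1 1 * y1 + L 1 2 * y2 + L 1 3 * y3) * ((a 1 - a 3) * y1 * y3 + (a 3 - a 0) * y0 * y3 + (a 0 - a 1) * y0 * y1) +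
      (L 2 0 * y0 + L 2 1 * y1 + L 2 2 * y2 + L 2 3 * y3) * ((a 2 - a 1) * y1 * y2 + (a 1 - a 0) * y0 * y1 + (a 0 - a 2) * y0 * y2) +
      (L 3 0 * y0 + L 3 1 * y1 + L 3 2 * y2 + L 3 3 * y3) * (y0 * ((b 2 - b 3) * y1 + (b 3 - b 1) * y2 + (b 1 - b 2) * y3)) = 0"
  shows "L 3 0 = 0" "L 3 1 = 0" "L 3 2 = 0" "L 3 3 = 0"
    and "\<exists>\<alpha> \<beta>. \<forall>k<3. \<forall>i<4. L k i = (if i = 0 then - (\<alpha> + \<beta> * a 0) else if i = Suc k then \<alpha> + \<beta> * a i else 0)"
proof -
  have nz: "a 2 - a 1 \<noteq> 0" "a 1 - a 3 \<noteq> 0" "a 3 - a 2 \<noteq> 0" "b 2 - b 3 \<noteq> 0" "b 3 - b 1 \<noteq> 0" "b 1 - b 2 \<noteq> 0"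
    using a b by auto
  \<comment> \<open>Points with coordinates 0, 1 and -1 give equations for the sum and the
    difference of two unknowns, and in characteristic zero both can be recovered.\<close>
  have two: "u = 0 \<and> v = 0" if "(u + v) * c = 0" "(u - v) * c = 0" "c \<noteq> 0" for u v c :: 'k
  proof -
    from that have "u + v = 0" "u = v" by auto
    then show ?thesis by auto
  qed
  have L2: "L 2 1 = 0 \<and> L 2 2 = 0"
    by (rule two[of _ _ "a 2 - a 1"]) (use H[of 0 1 1 0] H[of 0 1 "-1" 0] nz in \<open>simp_all add: algebra_simps\<close>)
  have L1: "L 1 1 = 0 \<and> L 1 3 = 0"
    by (rule two[of _ _ "a 1 - a 3"]) (use H[of 0 1 0 1] H[of 0 1 0 "-1"] nz in \<open>simp_all add: algebra_simps\<close>)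
  have L0: "L 0 2 = 0 \<and> L 0 3 = 0"
    by (rule two[of _ _ "a 3 - a 2"]) (use H[of 0 0 1 1] H[of 0 0 1 "-1"] nz in \<open>simp_all add: algebra_simps\<close>)
  \<comment> \<open>The affine function with coefficients \<open>\<alpha>\<close> and
    \<open>\<beta>\<close> is interpolated from \<open>L 0 1\<close> and \<open>L 1 2\<close>; the
    equation at the point \<open>(0, 1, 1, 1)\<close> then forces the third value
    \<open>L 2 3\<close>.\<close>
  define \<beta> where "\<beta> = (L 1 2 - L 0 1) / (a 2 - a 1)"
  define \<alpha> where "\<alpha> = L 0 1 - \<beta> * a 1"
  have e1: "L 0 1 = \<alpha> + \<beta> * a 1" by (simp add: \<alpha>_def)
  have e2: "L 1 2 = \<alpha> + \<beta> * a 2"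
  proof -
    have "\<beta> * (a 2 - a 1) = L 1 2 - L 0 1" using nz by (simp add: \<beta>_def)
    then show ?thesis by (simp add: \<alpha>_def algebra_simps)
  qed
  have "L 0 1 * (a 3 - a 2) + L 1 2 * (a 1 - a 3) + L 2 3 * (a 2 - a 1) = 0"
    using H[of 0 1 1 1] L0 L1 L2 by simp
  then have "(L 2 3 - (\<alpha> + \<beta> * a 3)) * (a 2 - a 1) = 0" unfolding e1 e2 by (simp add: algebra_simps)
  then have e3: "L 2 3 = \<alpha> + \<beta> * a 3" using nz by simp
  let ?L = "L 3 0"
  \<comment> \<open>The deviation of the coefficients of \<open>y0\<close> from their expected
    value; the remaining equations show that all three deviations vanish.\<close>
  define p where "p k = L k 0 + \<alpha> + \<beta> * a 0" for k
  have p: "L 0 0 = p 0 - \<alpha> - \<beta> * a 0" "L 1 0 = p 1 - \<alpha> - \<beta> * a 0" "L 2 0 = p 2 - \<alpha> - \<beta> * a 0"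
    by (simp_all add: p_def)
  have c1: "((p 2 - p 1) * (a 1 - a 0) + ?L * (b 2 - b 3)) = 0 \<and> L 3 1 = 0"
  proof -
    have "((p 2 - p 1) * (a 1 - a 0) + ?L * (b 2 - b 3)) + L 3 1 * (b 2 - b 3) = 0"
      using H[of 1 1 0 0] L0 L1 L2 unfolding e1 e2 e3 p by (simp add: algebra_simps)
    moreover have "((p 2 - p 1) * (a 1 - a 0) + ?L * (b 2 - b 3)) - L 3 1 * (b 2 - b 3) = 0"
      using H[of 1 "-1" 0 0] L0 L1 L2 unfolding e1 e2 e3 p by (simp add: algebra_simps)
    ultimately have "((p 2 - p 1) * (a 1 - a 0) + ?L * (b 2 - b 3)) = 0 \<and> L 3 1 * (b 2 - b 3) = 0"
      by (intro two[of _ _ 1]) simp_all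
    then show ?thesis using nz by auto
  qed
  have c2: "((p 0 - p 2) * (a 2 - a 0) + ?L * (b 3 - b 1)) = 0 \<and> L 3 2 = 0"
  proof -
    have "((p 0 - p 2) * (a 2 - a 0) + ?L * (b 3 - b 1)) + L 3 2 * (b 3 - b 1) = 0"
      using H[of 1 0 1 0] L0 L1 L2 unfolding e1 e2 e3 p by (simp add: algebra_simps)
    moreover have "((p 0 - p 2) * (a 2 - a 0) + ?L * (b 3 - b 1)) - L 3 2 * (b 3 - b 1) = 0"
      using H[of 1 0 "-1" 0] L0 L1 L2 unfolding e1 e2 e3 p by (simp add: algebra_simps)
    ultimately have "((p 0 - p 2) * (a 2 - a 0) + ?L * (b 3 - b 1)) = 0 \<and> L 3 2 * (b 3 - b 1) = 0"
      by (intro two[of _ _ 1]) simp_all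
    then show ?thesis using nz by auto
  qed
  have c3: "((p 1 - p 0) * (a 3 - a 0) + ?L * (b 1 - b 2)) = 0 \<and> L 3 3 = 0"
  proof -
    have "((p 1 - p 0) * (a 3 - a 0) + ?L * (b 1 - b 2)) + L 3 3 * (b 1 - b 2) = 0"
      using H[of 1 0 0 1] L0 L1 L2 unfolding e1 e2 e3 p by (simp add: algebra_simps)
    moreover have "((p 1 - p 0) * (a 3 - a 0) + ?L * (b 1 - b 2)) - L 3 3 * (b 1 - b 2) = 0"
      using H[of 1 0 0 "-1"] L0 L1 L2 unfolding e1 e2 e3 p by (simp add: algebra_simps)
    ultimately have "((p 1 - p 0) * (a 3 - a 0) + ?L * (b 1 - b 2)) = 0 \<and> L 3 3 * (b 1 - b 2) = 0"
      by (intro two[of _ _ 1]) simp_all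
    then show ?thesis using nz by auto
  qed
  have E12: "p 0 * (a 2 - a 0) - p 1 * (a 1 - a 0) + ?L * (b 2 - b 1) = 0"
    using H[of 1 1 1 0] L0 L1 L2 c1 c2 c3 unfolding e1 e2 e3 p by (simp add: algebra_simps)
  have E13: "p 2 * (a 1 - a 0) - p 0 * (a 3 - a 0) + ?L * (b 1 - b 3) = 0"
    using H[of 1 1 0 1] L0 L1 L2 c1 c2 c3 unfolding e1 e2 e3 p by (simp add: algebra_simps)
  have E23: "p 1 * (a 3 - a 0) - p 2 * (a 2 - a 0) + ?L * (b 3 - b 2) = 0"
    using H[of 1 0 1 1] L0 L1 L2 c1 c2 c3 unfolding e1 e2 e3 p by (simp add: algebra_simps)
  \<comment> \<open>In these combinations \<open>L 3 0\<close> and the two other deviations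
    cancel.\<close>
  have "p 2 * (a 2 - a 1) = (p 0 * (a 2 - a 0) - p 1 * (a 1 - a 0) + ?L * (b 2 - b 1)) - ((p 2 - p 1) * (a 1 - a 0) + ?L * (b 2 - b 3)) - ((p 0 - p 2) * (a 2 - a 0) + ?L * (b 3 - b 1))"
    by (simp add: algebra_simps)
  then have "p 2 * (a 2 - a 1) = 0" by (simp only: E12 c1[THEN conjunct1] c2[THEN conjunct1] diff_zero)
  then have p2: "p 2 = 0" using nz by simp
  have "p 1 * (a 1 - a 3) = (p 2 * (a 1 - a 0) - p 0 * (a 3 - a 0) + ?L * (b 1 - b 3)) - ((p 2 - p 1) * (a 1 - a 0) + ?L * (b 2 - b 3)) - ((p 1 - p 0) * (a 3 - a 0) + ?L * (b 1 - b 2))"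
    by (simp add: algebra_simps)
  then have "p 1 * (a 1 - a 3) = 0" by (simp only: E13 c1[THEN conjunct1] c3[THEN conjunct1] diff_zero)
  then have p1: "p 1 = 0" using nz by simp
  have "p 0 * (a 3 - a 2) = (p 1 * (a 3 - a 0) - p 2 * (a 2 - a 0) + ?L * (b 3 - b 2)) - ((p 0 - p 2) * (a 2 - a 0) + ?L * (b 3 - b 1)) - ((p 1 - p 0) * (a 3 - a 0) + ?L * (b 1 - b 2))"
    by (simp add: algebra_simps)
  then have "p 0 * (a 3 - a 2) = 0" by (simp only: E23 c2[THEN conjunct1] c3[THEN conjunct1] diff_zero)
  then have p0: "p 0 = 0" using nz by simp
  show "L 3 0 = 0" "L 3 1 = 0" "L 3 2 = 0" "L 3 3 = 0" using c1 c2 c3 p0 p1 p2 nz by auto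
  have "L k i = (if i = 0 then - (\<alpha> + \<beta> * a 0) else if i = Suc k then \<alpha> + \<beta> * a i else 0)" if "k < 3" "i < 4" for k i
  proof -
    from that have "k = 0 \<or> k = 1 \<or> k = 2" "i = 0 \<or> i = 1 \<or> i = 2 \<or> i = 3" by auto
    then show ?thesis using L0 L1 L2 e1 e2 e3 p p0 p1 p2 by (elim disjE) (simp_all add: numeral_2_eq_2 numeral_3_eq_3)
  qed
  then show "\<exists>\<alpha> \<beta>. \<forall>k<3. \<forall>i<4. L k i = (if i = 0 then - (\<alpha> + \<beta> * a 0) else if i = Suc k then \<alpha> + \<beta> * a i else 0)"
    by blast
qed

section \<open>Six points\<close>

lemma single_empty_zero_iff [simp]: "Poly_Mapping.single {} q = 0 \<longleftrightarrow> q = 0"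
  by (metis lookup_single_eq lookup_zero single_zero)

lemma gp_antimono:
  assumes "gp t x g" "5 \<le> t'" "t' \<le> t"
  shows "gp t' x g"
proof -
  interpret gp t x g by fact
  show ?thesis
  proof
    show "0 < t'" "5 \<le> t'" using assms by auto
    show "x p \<noteq> (\<lambda>_. 0)" if "p < t'" for p using that assms x_nonzero by simp
    show "separated 2 t' x"
      unfolding separated_def
    proof (intro allI impI)
      fix p assume "p < t'"
      then obtain h where "homogeneous 2 h" "\<forall>q<t. mpoly_eval h (x q) = (if q = p then 1 else 0)"
        using sep2 assms(3) unfolding separated_def by (meson order.strict_trans2)
      then show "\<exists>h. homogeneous 2 h \<and> (\<forall>q<t'. mpoly_eval h (x q) = (if q = p then 1 else 0))"
        using assms(3) by (intro exI[of _ h]) simp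
    qed
    show "dot (g i) (x j) = (if i = j then 1 else 0)" if "i < 4" "j < 4" for i j using dual that .
    show "y v = (\<Sum>i<4. dot (g i) y * x i v)" for y v by (rule coord)
    show "x 4 v = (\<Sum>i<4. x i v)" for v by (rule x4)
  qed
qed

section \<open>Lifts of the minors and rows of a 2 by 3 matrix\<close>

lemma koszul_diff_evec_evec:
  "koszul_diff (wedge (evec c) (evec d)) = pscale (lform c) (evec d) - pscale (lform d) (evec c)"
proof -
  have "wedge (evec c) (Poly_Mapping.single {} (lform d)) = pscale (lform d) (evec c)"
    using wedge_pscale_right[of "evec c" "lform d" "Poly_Mapping.single {} 1"]
    by (simp add: pscale_def wedge_single wedge_sign_def wedge_one_right)
  then show ?thesis by (simp add: koszul_diff_evec_wedge koszul_diff_evec)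
qed

lemma kc_evec_evec: "wedge (evec c) (evec d) \<in> kc 2 2"
  using kc_wedge[OF evec_kc evec_kc] by (simp add: numeral_2_eq_2)

lemma evec_self [simp]: "wedge (evec c) (evec c) = 0" for c :: "'v::{finite,linorder} \<Rightarrow> 'k::field_char_0"
  by (rule wedge_self_odd[OF evec_kc]) simp

lemma evec_anticommute: "wedge (evec d) (evec c) = - wedge (evec c) (evec d)"
  using wedge_commute_kc[OF evec_kc evec_kc] by simp

text \<open>Lift of the minor with columns \<open>(m, n)\<close> and \<open>(m', n')\<close>. The
  covectors are taken from the second row; exchanging the rows gives another lift of the same minor,
  up to sign.\<close>

definition minor_cycle :: "('v::{finite,linorder} \<Rightarrow> 'k::comm_ring_1) \<Rightarrow> ('v \<Rightarrow> 'k) \<Rightarrow> ('v \<Rightarrow> 'k) \<Rightarrow> ('v \<Rightarrow> 'k) \<Rightarrow> ('v, 'k) koszul" where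
  "minor_cycle m n m' n' = pscale (lform m) (evec n') - pscale (lform m') (evec n)"

lemma minor_cycle_kc: "minor_cycle m n m' n' \<in> kc 1 2"
  unfolding minor_cycle_def using kc_pscale[OF homogeneous_lform evec_kc]
  by (intro kc_diff) (auto simp: numeral_2_eq_2)

lemma koszul_diff_minor_cycle:
  "koszul_diff (minor_cycle m n m' n') = Poly_Mapping.single {} (lform m * lform n' - lform m' * lform n)"
  by (simp add: minor_cycle_def koszul_diff_diff_eq koszul_diff_pscale_evec single_diff)

text \<open>Lift of the row syzygy that comes from expanding a determinant with the row
  \<open>n\<close> repeated: in the differential the covectors \<open>n1\<close>, \<open>n2\<close>,
  \<open>n3\<close> are multiplied by the minors.\<close>

definition row_cycle where
  "row_cycle m1 m2 m3 n1 n2 n3 = pscale (lform m1) (wedge (evec n2) (evec n3)) +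
     pscale (lform m2) (wedge (evec n3) (evec n1)) + pscale (lform m3) (wedge (evec n1) (evec n2))"

lemma row_cycle_kc: "row_cycle m1 m2 m3 n1 n2 n3 \<in> kc 2 3"
  unfolding row_cycle_def using kc_pscale[OF homogeneous_lform kc_evec_evec]
  by (intro kc_add) (auto simp: eval_nat_numeral)

lemma koszul_diff_row_cycle:
  "koszul_diff (row_cycle m1 m2 m3 n1 n2 n3) =
    pscale (lform m2 * lform n3 - lform m3 * lform n2) (evec n1) +
    pscale (lform m3 * lform n1 - lform m1 * lform n3) (evec n2) +
    pscale (lform m1 * lform n2 - lform m2 * lform n1) (evec n3)"
  unfolding row_cycle_def koszul_diff_add koszul_diff_pscale koszul_diff_evec_evec
  by (rule koszul_eqI) (simp add: lookup_add lookup_minus algebra_simps)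

text \<open>Only two terms contain three different covectors. Both have the coefficient
  \<open>m2 * m3\<close>, and they cancel because the threefold wedge is invariant under cyclic
  permutation.\<close>

lemma minor_row_zero:
  fixes m1 m2 m3 n1 n2 n3 :: "'v::{finite,linorder} \<Rightarrow> 'k::field_char_0"
  shows "wedge (minor_cycle m2 n2 m3 n3) (row_cycle m1 m2 m3 n1 n2 n3) = 0"
proof -
  let ?e = evec
  have s: "wedge (?e c) (wedge (?e c) z) = 0" for c :: "'v \<Rightarrow> 'k" and z by (simp flip: wedge_assoc)
  have s2: "wedge (?e c) (wedge (?e d) (?e c)) = 0" for c d :: "'v \<Rightarrow> 'k"
    using s[of c "?e d"] by (simp add: evec_anticommute[of d c] wedge_uminus_right)
  have r: "wedge (?e n3) (wedge (?e n1) (?e n2)) = wedge (?e n2) (wedge (?e n3) (?e n1))"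
  proof -
    have "wedge (?e n3) (wedge (?e n1) (?e n2)) = wedge (wedge (?e n1) (?e n2)) (?e n3)"
      using wedge_commute_kc[OF kc_evec_evec[of n1 n2] evec_kc[of n3]] by simp
    also have "\<dots> = wedge (?e n1) (wedge (?e n2) (?e n3))" by (rule wedge_assoc)
    also have "\<dots> = wedge (wedge (?e n2) (?e n3)) (?e n1)"
      using wedge_commute_kc[OF kc_evec_evec[of n2 n3] evec_kc[of n1]] by simp
    finally show ?thesis by (simp add: wedge_assoc)
  qed
  show ?thesis
    unfolding minor_cycle_def row_cycle_def
    by (simp add: wedge_add_right wedge_diff_left wedge_pscale_left wedge_pscale_right
        pscale_uminus_right s s2 r mult.commute)
qed

context gp
begin

text \<open>The correction \<open>?r\<close>, which pairs the three minors with the covectors of the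
  second row, has coefficients in the ideal and the same differential as the product. Hence the
  difference bounds in the Koszul complex.\<close>

lemma minor_product_Bd:
  assumes q: "lform m2 * lform n3 - lform m3 * lform n2 \<in> pideal t x"
    "lform m3 * lform n1 - lform m1 * lform n3 \<in> pideal t x"
    "lform m1 * lform n2 - lform m2 * lform n1 \<in> pideal t x"
  shows "wedge (minor_cycle m2 n2 m3 n3) (minor_cycle m3 n3 m1 n1) \<in> B"
proof -
  let ?q1 = "lform m2 * lform n3 - lform m3 * lform n2"
  let ?q2 = "lform m3 * lform n1 - lform m1 * lform n3"
  let ?q3 = "lform m1 * lform n2 - lform m2 * lform n1"
  let ?w = "wedge (minor_cycle m2 n2 m3 n3) (minor_cycle m3 n3 m1 n1)"
  let ?r = "pscale ?q1 (wedge (evec m3) (evec n1)) + pscale ?q2 (wedge (evec m3) (evec n2)) + pscale ?q3 (wedge (evec m3) (evec n3))"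
  have r: "?r \<in> JK t x" using q by (intro JK_add JK_pscale_ideal)
  have c: "wedge a (Poly_Mapping.single {} f) = pscale f a" for a and f :: "(4, 'k) mpoly"
    using wedge_pscale_right[of a f "Poly_Mapping.single {} 1"]
    by (simp add: pscale_def wedge_single wedge_sign_def wedge_one_right)
  have "koszul_diff ?w = pscale ?q1 (minor_cycle m3 n3 m1 n1) - pscale ?q2 (minor_cycle m2 n2 m3 n3)"
    unfolding koszul_leibniz_kc[OF minor_cycle_kc] koszul_diff_minor_cycle by (simp add: c) (simp add: pscale_def)
  also have "\<dots> = koszul_diff ?r"
    unfolding minor_cycle_def koszul_diff_add koszul_diff_pscale koszul_diff_evec_evec
    by (rule koszul_eqI) (simp add: lookup_add lookup_minus algebra_simps)
  finally have d: "koszul_diff (?w - ?r) = 0" by (simp add: koszul_diff_diff_eq)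
  have w: "?w \<in> kc 2 4" using kc_wedge[OF minor_cycle_kc minor_cycle_kc] by (simp add: eval_nat_numeral)
  have qh: "homogeneous 2 (lform a * lform b - lform c * lform d)" for a b c d :: "4 \<Rightarrow> 'k"
    using homogeneous_diff[OF homogeneous_mult[OF homogeneous_lform homogeneous_lform] homogeneous_mult[OF homogeneous_lform homogeneous_lform]]
    by (simp add: numeral_2_eq_2)
  have "?r \<in> kc 2 4" using kc_pscale[OF qh kc_evec_evec] by (intro kc_add) simp_all
  with w have "?w - ?r \<in> kc 2 4" by (rule kc_diff)
  from koszul_exact_kc[OF this d] obtain b where "koszul_diff b = ?w - ?r" by auto
  then have "?w - ?r \<in> B" using koszul_diff_Bd by metis
  then have "(?w - ?r) + ?r \<in> B" using JK_Bd[OF r] by (rule Bd_add)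
  then show ?thesis by simp
qed

end

lemma sum_lessThan_3: "(\<Sum>i<3. f i) = f 0 + f 1 + f (2::nat)" for f :: "nat \<Rightarrow> 'b::comm_monoid_add"
  by (simp add: eval_nat_numeral add_ac)

section \<open>The twisted cubic through six points\<close>

locale gp6 = gp t x g for t and x :: "nat \<Rightarrow> 4 \<Rightarrow> 'k::field_char_0" and g +
  fixes b :: "nat \<Rightarrow> 'k"
  assumes t6: "t = 6"
    and b_nz: "\<And>i. i < 4 \<Longrightarrow> b i \<noteq> 0"
    and b_inj: "\<And>i j. i < 4 \<Longrightarrow> j < 4 \<Longrightarrow> i \<noteq> j \<Longrightarrow> b i \<noteq> b j"
    and x5: "\<And>v. x 5 v = (\<Sum>i<4. b i * x i v)"
begin

text \<open>This scaling makes the second matrix row vanish at the sixth point, whose coordinates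
  are the \<open>b i\<close>; the first row vanishes at the fifth. At a frame point the columns are
  proportional, so the minors vanish at all six.\<close>

definition a :: "nat \<Rightarrow> 'k" where "a i = 1 / b i"

lemma a_inj: "i < 4 \<Longrightarrow> j < 4 \<Longrightarrow> i \<noteq> j \<Longrightarrow> a i \<noteq> a j"
  using b_nz b_inj by (auto simp: a_def)

lemma dot_g_5: "i < 4 \<Longrightarrow> dot (g i) (x 5) = b i"
  using point_with_coords[of i b] x5[abs_def] by simp

lemma point6_cases: "p < t \<Longrightarrow> p = 5 \<or> p = 4 \<or> p < 4"
  using t6 by auto

definition mv :: "nat \<Rightarrow> 4 \<Rightarrow> 'k" where "mv i v = g i v - g 0 v"
definition nv :: "nat \<Rightarrow> 4 \<Rightarrow> 'k" where "nv i v = a i * g i v - a 0 * g 0 v"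
text \<open>The plane through \<open>x 0\<close>, \<open>x 4\<close> and \<open>x 5\<close>. Since
  \<open>l 0\<close> vanishes at the other three points, the product of the two is a quadric through
  all six.\<close>

definition lam :: "4 \<Rightarrow> 'k" where "lam v = (b 2 - b 3) * g 1 v + (b 3 - b 1) * g 2 v + (b 1 - b 2) * g 3 v"

lemma dot_mv: "dot (mv i) y = dot (g i) y - dot (g 0) y"
  by (simp add: dot_def mv_def[abs_def] algebra_simps sum_subtractf)

lemma dot_nv: "dot (nv i) y = a i * dot (g i) y - a 0 * dot (g 0) y"
  by (simp add: dot_def nv_def[abs_def] algebra_simps sum_subtractf sum_distrib_left)

lemma dot_lam: "dot lam y = (b 2 - b 3) * dot (g 1) y + (b 3 - b 1) * dot (g 2) y + (b 1 - b 2) * dot (g 3) y"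
proof -
  have "dot lam y = (\<Sum>v\<in>UNIV. (b 2 - b 3) * (g 1 v * y v) + (b 3 - b 1) * (g 2 v * y v) + (b 1 - b 2) * (g 3 v * y v))"
    unfolding dot_def lam_def by (rule sum.cong) (simp_all add: algebra_simps)
  then show ?thesis by (simp add: dot_def sum.distrib sum_distrib_left)
qed

definition qq :: "nat \<Rightarrow> (4, 'k) mpoly" where
  "qq k = (if k = 0 then lform (mv 2) * lform (nv 3) - lform (mv 3) * lform (nv 2)
     else if k = 1 then lform (mv 3) * lform (nv 1) - lform (mv 1) * lform (nv 3)
     else if k = 2 then lform (mv 1) * lform (nv 2) - lform (mv 2) * lform (nv 1)
     else lform lam * l 0)"

definition ZZ :: "nat \<Rightarrow> (4, 'k) koszul" where
  "ZZ k = (if k = 0 then minor_cycle (mv 2) (nv 2) (mv 3) (nv 3)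
     else if k = 1 then minor_cycle (mv 3) (nv 3) (mv 1) (nv 1)
     else if k = 2 then minor_cycle (mv 1) (nv 1) (mv 2) (nv 2)
     else pscale (lform lam) (eps 0))"

lemma ZZ_kc: "ZZ k \<in> kc 1 2"
  unfolding ZZ_def using minor_cycle_kc kc_lform_evec by auto

lemma koszul_diff_ZZ: "koszul_diff (ZZ k) = Poly_Mapping.single {} (qq k)"
  by (simp add: ZZ_def qq_def koszul_diff_minor_cycle koszul_diff_pscale_evec)

lemma eval_qq:
  "mpoly_eval (qq 0) y = (a 3 - a 2) * dot (g 2) y * dot (g 3) y + (a 2 - a 0) * dot (g 0) y * dot (g 2) y + (a 0 - a 3) * dot (g 0) y * dot (g 3) y"
  "mpoly_eval (qq 1) y = (a 1 - a 3) * dot (g 1) y * dot (g 3) y + (a 3 - a 0) * dot (g 0) y * dot (g 3) y + (a 0 - a 1) * dot (g 0) y * dot (g 1) y"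
  "mpoly_eval (qq 2) y = (a 2 - a 1) * dot (g 1) y * dot (g 2) y + (a 1 - a 0) * dot (g 0) y * dot (g 1) y + (a 0 - a 2) * dot (g 0) y * dot (g 2) y"
  "mpoly_eval (qq 3) y = dot (g 0) y * ((b 2 - b 3) * dot (g 1) y + (b 3 - b 1) * dot (g 2) y + (b 1 - b 2) * dot (g 3) y)"
  by (simp_all add: qq_def mpoly_eval_simps dot_mv dot_nv dot_lam algebra_simps)

lemma qq_vanish: "k < 4 \<Longrightarrow> p < t \<Longrightarrow> mpoly_eval (qq k) (x p) = 0"
proof -
  assume k: "k < 4" and p: "p < t"
  have ab: "a i * b i = 1" if "i < 4" for i using b_nz[OF that] by (simp add: a_def)
  from point6_cases[OF p] show ?thesis
  proof (elim disjE)
    assume p5: "p = 5"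
    \<comment> \<open>Because \<open>a i * b i = 1\<close>, every term becomes a difference of
      coordinates of the sixth point, and the three differences sum to zero.\<close>
    have d: "(a i - a j) * b j * b i = b j - b i" if "i < 4" "j < 4" for i j
    proof -
      have "(a i - a j) * b j * b i = (a i * b i) * b j - (a j * b j) * b i" by (simp add: algebra_simps)
      then show ?thesis using ab that by simp
    qed
    have "(a i - a j) * b j * b i + (a j - a h) * b h * b j + (a h - a i) * b h * b i = 0"
      if "i < 4" "j < 4" "h < 4" for i j h
      using d[OF that(1,2)] d[OF that(2,3)] d[OF that(3,1)] by (simp add: mult_ac)
    from this[of 3 2 0] this[of 1 3 0] this[of 2 1 0] show ?thesis
      using less_4_cases[OF k] by (elim disjE) (simp_all add: p5 eval_qq[unfolded One_nat_def] dot_g_5 algebra_simps)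
  next
    assume "p = 4"
    then show ?thesis using less_4_cases[OF k] by (elim disjE) (simp_all add: eval_qq[unfolded One_nat_def] dot_g_4)
  next
    assume "p < 4"
    then show ?thesis using less_4_cases[OF k] less_4_cases[of p]
      by (elim disjE) (simp_all add: eval_qq[unfolded One_nat_def] dual)
  qed
qed

lemma ZZ_Z: "k < 4 \<Longrightarrow> ZZ k \<in> Z"
  using quadric_cycle[OF ZZ_kc koszul_diff_ZZ] qq_vanish by blast

lemma homogeneous_qq: "homogeneous 2 (qq k)"
proof -
  have "koszul_diff (ZZ k) \<in> kc 0 2" using kc_koszul_diff ZZ_kc by (metis One_nat_def)
  then show ?thesis using kc_lookup[of "koszul_diff (ZZ k)" 0 2 "{}"] by (simp add: koszul_diff_ZZ)
qed

lemma qq_ideal: "k < 4 \<Longrightarrow> qq k \<in> pideal t x"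
  using pideal_homogeneous[OF homogeneous_qq] qq_vanish by blast

lemma ab_diff: "a 3 - a 2 \<noteq> 0" "a 1 - a 3 \<noteq> 0" "a 2 - a 1 \<noteq> 0" "b 2 - b 3 \<noteq> 0"
  using a_inj[of 3 2] a_inj[of 1 3] a_inj[of 2 1] b_inj[of 2 3] by auto

definition pt :: "'k \<Rightarrow> 'k \<Rightarrow> 'k \<Rightarrow> 'k \<Rightarrow> 4 \<Rightarrow> 'k" where
  "pt y0 y1 y2 y3 = (\<lambda>v. \<Sum>j<4. ([y0, y1, y2, y3] ! j) * x j v)"

lemma dot_pt:
  "dot (g 0) (pt y0 y1 y2 y3) = y0" "dot (g 1) (pt y0 y1 y2 y3) = y1"
  "dot (g 2) (pt y0 y1 y2 y3) = y2" "dot (g 3) (pt y0 y1 y2 y3) = y3"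
  by (simp_all add: pt_def point_with_coords)

lemma qq_independent:
  assumes "(\<Sum>k<4. mconst (c k) * qq k) = 0" "k < 4"
  shows "c k = 0"
proof -
  have e: "(\<Sum>k<4. c k * mpoly_eval (qq k) y) = 0" for y
    using arg_cong[OF assms(1), of "\<lambda>f. mpoly_eval f y"] by (simp add: mpoly_eval_simps)
  \<comment> \<open>At a point with exactly two nonzero coordinates only their product survives, and
    each minor has one such product, without the coordinate 0, that occurs in no other
    quadric.\<close>
  have "c 0 = 0" using e[of "pt 0 0 1 1"] ab_diff unfolding sum_lessThan_4 eval_qq dot_pt by simp
  moreover have "c 1 = 0" using e[of "pt 0 1 0 1"] ab_diff unfolding sum_lessThan_4 eval_qq dot_pt by simp
  moreover have "c 2 = 0" using e[of "pt 0 1 1 0"] ab_diff unfolding sum_lessThan_4 eval_qq dot_pt by simp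
  ultimately have "c 3 = 0" using e[of "pt 1 1 0 0"] ab_diff unfolding sum_lessThan_4 eval_qq dot_pt by simp
  with \<open>c 0 = 0\<close> \<open>c 1 = 0\<close> \<open>c 2 = 0\<close> show ?thesis using less_4_cases[OF assms(2)] by auto
qed

abbreviation "Zs \<equiv> map ZZ [0..<4]"

lemma set_Zs: "set Zs \<subseteq> Z" "set Zs \<subseteq> kc 1 2"
  using ZZ_Z ZZ_kc by auto

lemma koszul_diff_lincomb_Zs: "koszul_diff (lincomb c Zs) = Poly_Mapping.single {} (\<Sum>k<4. mconst (c k) * qq k)"
proof -
  have "koszul_diff (lincomb c Zs) = (\<Sum>k<4. Poly_Mapping.single {} (mconst (c k) * qq k))"
    unfolding lincomb_map koszul_diff_sum koszul_diff_pscale koszul_diff_ZZ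
    by (simp add: pscale_def wedge_single wedge_sign_def)
  then show ?thesis by (subst additive_sum[of "Poly_Mapping.single {}"]) (simp_all add: single_add)
qed

lemma indep_Zs: "indep Zs"
  unfolding indep_def
proof (intro conjI set_Zs allI impI)
  fix c i assume c: "lincomb c Zs \<in> B" and i: "i < length Zs"
  have "koszul_diff (lincomb c Zs) = 0"
    using c Bd_linear_strand[of "lincomb c Zs" 0] lincomb_kc[OF set_Zs(2)] by (simp add: numeral_2_eq_2)
  then have "(\<Sum>k<4. mconst (c k) * qq k) = 0"
    unfolding koszul_diff_lincomb_Zs by simp
  then show "c i = 0" using qq_independent i by simp
qed

text \<open>Five points leave five quadrics and the sixth point removes one, so four independent
  quadrics are a basis.\<close>

lemma basis_12: "is_basis 1 2 Zs"
proof -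
  have g5: "gp 5 x g"
    using gp_antimono[OF gp_axioms] t6 by simp
  interpret P: gp5 5 x g by (rule gp5.intro[OF g5]) (simp add: gp5_axioms_def)
  have "alg_dim (tor_algebra (pideal 5 x)) (component (tor_algebra (pideal 5 x)) 1 2) = Suc (adim 1 2)"
    using adim_12_Suc[of 5 x g] g5 gp_axioms t6 by simp
  moreover have "alg_dim (tor_algebra (pideal 5 x)) (component (tor_algebra (pideal 5 x)) 1 2) = 5"
    using P.alg_dim_component[OF P.basis_12] by simp
  ultimately have "adim 1 2 = 4" by simp
  moreover obtain zs where zs: "is_basis 1 2 zs" by (rule obtain_basis)
  ultimately have "length zs = 4" using alg_dim_component by simp
  then show ?thesis using indep_is_basis[OF indep_Zs set_Zs(2) zs] by simp
qed

lemma quadric_span: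
  assumes "homogeneous 2 f" "f \<in> pideal t x"
  shows "\<exists>c. f = (\<Sum>k<4. mconst (c k) * qq k)"
proof -
  obtain z where z: "z \<in> kc 1 2" "koszul_diff z = Poly_Mapping.single {} f" using lift_quadric[OF assms(1)] .
  then have "z \<in> Z" using quadric_cycle[OF z] assms(2) pideal_homogeneous[OF assms(1)] by blast
  then obtain c where c: "z - lincomb c Zs \<in> B" using is_basis_span[OF basis_12 _ z(1)] by blast
  have "koszul_diff (z - lincomb c Zs) = 0"
    using c Bd_linear_strand[of "z - lincomb c Zs" 0] kc_diff[OF z(1) lincomb_kc[OF set_Zs(2)]] by (simp add: numeral_2_eq_2)
  then have "Poly_Mapping.single {} f = Poly_Mapping.single {} (\<Sum>k<4. mconst (c k) * qq k)"
    using z(2) by (simp add: koszul_diff_diff_eq koszul_diff_lincomb_Zs)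
  then show ?thesis by auto
qed

lemma linear_syzygies:
  assumes "(\<Sum>k<4. qq k * lform (L k)) = 0"
  obtains \<alpha> \<beta> where "\<And>k. k < 3 \<Longrightarrow> L k = (\<lambda>v. \<alpha> * mv (Suc k) v + \<beta> * nv (Suc k) v)" "L 3 = (\<lambda>_. 0)"
proof -
  have L: "L k v = (\<Sum>i<4. dot (L k) (x i) * g i v)" for k v by (rule covector_expand)
  let ?M = "\<lambda>k i. dot (L k) (x i)"
  have H: "(?M 0 0 * y0 + ?M 0 1 * y1 + ?M 0 2 * y2 + ?M 0 3 * y3) * ((a 3 - a 2) * y2 * y3 + (a 2 - a 0) * y0 * y2 + (a 0 - a 3) * y0 * y3) +
      (?M 1 0 * y0 + ?M 1 1 * y1 + ?M 1 2 * y2 + ?M 1 3 * y3) * ((a 1 - a 3) * y1 * y3 + (a 3 - a 0) * y0 * y3 + (a 0 - a 1) * y0 * y1) +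
      (?M 2 0 * y0 + ?M 2 1 * y1 + ?M 2 2 * y2 + ?M 2 3 * y3) * ((a 2 - a 1) * y1 * y2 + (a 1 - a 0) * y0 * y1 + (a 0 - a 2) * y0 * y2) +
      (?M 3 0 * y0 + ?M 3 1 * y1 + ?M 3 2 * y2 + ?M 3 3 * y3) * (y0 * ((b 2 - b 3) * y1 + (b 3 - b 1) * y2 + (b 1 - b 2) * y3)) = 0"
    for y0 y1 y2 y3
  proof -
    have d: "dot (L k) (pt y0 y1 y2 y3) = ?M k 0 * y0 + ?M k 1 * y1 + ?M k 2 * y2 + ?M k 3 * y3" for k
      by (subst dot_coord) (simp only: sum_lessThan_4 dot_pt mult.commute)
    have "(\<Sum>k<4. dot (L k) (pt y0 y1 y2 y3) * mpoly_eval (qq k) (pt y0 y1 y2 y3)) = 0"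
      using arg_cong[OF assms, of "\<lambda>f. mpoly_eval f (pt y0 y1 y2 y3)"]
      by (simp add: mpoly_eval_simps mult.commute)
    then show ?thesis unfolding sum_lessThan_4 eval_qq dot_pt d .
  qed
  have ne: "a 1 \<noteq> a 2" "a 1 \<noteq> a 3" "a 2 \<noteq> a 3" "b 2 \<noteq> b 3" "b 3 \<noteq> b 1" "b 1 \<noteq> b 2"
    using a_inj b_inj by auto
  note T = twisted_cubic_syzygies[where L = ?M, OF ne H]
  obtain \<alpha> \<beta> where ab: "\<And>k i. k < 3 \<Longrightarrow> i < 4 \<Longrightarrow>
      ?M k i = (if i = 0 then - (\<alpha> + \<beta> * a 0) else if i = Suc k then \<alpha> + \<beta> * a i else 0)"
    using T(5) by blast
  have "L k = (\<lambda>v. \<alpha> * mv (Suc k) v + \<beta> * nv (Suc k) v)" if k: "k < 3" for k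
  proof
    fix v
    have "k = 0 \<or> k = 1 \<or> k = 2" using k by auto
    then show "L k v = \<alpha> * mv (Suc k) v + \<beta> * nv (Suc k) v"
      using ab[OF k] by (elim disjE) (simp_all add: L sum_lessThan_4 mv_def nv_def algebra_simps numeral_2_eq_2 numeral_3_eq_3)
  qed
  moreover have "L 3 = (\<lambda>_. 0)"
  proof
    fix v
    show "L 3 v = 0" unfolding L[of 3 v] sum_lessThan_4 using T(1-4) by simp
  qed
  ultimately show thesis using that by blast
qed

text \<open>\<open>SM\<close> and \<open>SN\<close> lift the two rows of the matrix of the twisted cubic.\<close>

definition SM :: "(4, 'k) koszul" where "SM = row_cycle (nv 1) (nv 2) (nv 3) (mv 1) (mv 2) (mv 3)"
definition SN :: "(4, 'k) koszul" where "SN = row_cycle (mv 1) (mv 2) (mv 3) (nv 1) (nv 2) (nv 3)"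

lemma SM_kc: "SM \<in> kc 2 3" and SN_kc: "SN \<in> kc 2 3"
  by (simp_all add: SM_def SN_def row_cycle_kc)

lemma koszul_diff_SM: "koszul_diff SM = - (\<Sum>k<3. pscale (qq k) (evec (mv (Suc k))))"
  unfolding SM_def koszul_diff_row_cycle sum_lessThan_3
  by (rule koszul_eqI) (simp add: qq_def lookup_add lookup_minus algebra_simps eval_nat_numeral)

lemma koszul_diff_SN: "koszul_diff SN = (\<Sum>k<3. pscale (qq k) (evec (nv (Suc k))))"
  unfolding SN_def koszul_diff_row_cycle sum_lessThan_3
  by (rule koszul_eqI) (simp add: qq_def lookup_add lookup_minus algebra_simps eval_nat_numeral)

lemma SM_Z: "SM \<in> Z" and SN_Z: "SN \<in> Z"
  unfolding Zc_iff koszul_diff_SM koszul_diff_SN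
  by (intro JK_uminus JK_sum JK_pscale_ideal qq_ideal, simp)+

lemma set_S: "set [SM, SN] \<subseteq> Z" "set [SM, SN] \<subseteq> kc 2 3"
  using SM_Z SN_Z SM_kc SN_kc by auto

lemma koszul_diff_lincomb_S:
  "koszul_diff (lincomb c [SM, SN]) = (\<Sum>k<3. pscale (qq k) (evec (\<lambda>v. - c 0 * mv (Suc k) v + c 1 * nv (Suc k) v)))"
  unfolding evec_add[of "\<lambda>v. - c 0 * mv (Suc _) v"] evec_scale
  by (simp add: lincomb_Cons koszul_diff_add koszul_diff_pscale koszul_diff_SM koszul_diff_SN sum_lessThan_3
      pscale_add_right pscale_uminus_right pscale_uminus_left mconst_uminus pscale_diff_right mult.commute algebra_simps)

lemma linear_strand_B: "z \<in> kc 2 3 \<Longrightarrow> z \<in> B \<longleftrightarrow> koszul_diff z = 0"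
  using Bd_linear_strand[of z 1] by (simp add: numeral_2_eq_2 numeral_3_eq_3)

lemma indep_S: "indep [SM, SN]"
  unfolding indep_def
proof (intro conjI set_S allI impI)
  fix c i assume c: "lincomb c [SM, SN] \<in> B" and i: "i < length [SM, SN]"
  have "koszul_diff (lincomb c [SM, SN]) = 0"
    using c linear_strand_B[OF lincomb_kc[OF set_S(2)]] by simp
  then have 0: "(\<Sum>k<3. pscale (qq k) (evec (\<lambda>v. - c 0 * mv (Suc k) v + c 1 * nv (Suc k) v))) = 0"
    unfolding koszul_diff_lincomb_S .
  have lke: "lk (evec h) {v} = mconst (h v)" for h :: "4 \<Rightarrow> 'k" and v
    by (simp add: evec_def lookup_sum lookup_single when_def)
  have z: "- c 0 * mv (Suc k) v + c 1 * nv (Suc k) v = 0" if k: "k < 3" for k v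
  proof -
    let ?d = "\<lambda>k. if k < 3 then - c 0 * mv (Suc k) v + c 1 * nv (Suc k) v else 0"
    have "lk (\<Sum>k<3. pscale (qq k) (evec (\<lambda>v. - c 0 * mv (Suc k) v + c 1 * nv (Suc k) v))) {v} = 0"
      unfolding 0 by simp
    then have "(\<Sum>k<4. mconst (?d k) * qq k) = 0"
      by (simp add: lookup_add lke sum_lessThan_3 sum_lessThan_4 mult.commute)
    from qq_independent[OF this, of k] k show ?thesis by simp
  qed
  have d: "- c 0 + c 1 * a (Suc k) = 0" if k: "k < 3" for k
  proof -
    have "dot (\<lambda>v. - c 0 * mv (Suc k) v + c 1 * nv (Suc k) v) (x (Suc k)) = 0"
      unfolding z[OF k] by (simp add: dot_def)
    moreover have "dot (\<lambda>v. - c 0 * mv (Suc k) v + c 1 * nv (Suc k) v) (x (Suc k)) =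
        - c 0 * dot (mv (Suc k)) (x (Suc k)) + c 1 * dot (nv (Suc k)) (x (Suc k))"
      by (simp add: dot_def algebra_simps sum.distrib sum_distrib_left sum_subtractf sum_negf)
    ultimately show ?thesis using k by (simp add: dot_mv dot_nv dual)
  qed
  have "c 1 * (a 1 - a 2) = 0" using d[of 0] d[of 1] by (simp add: algebra_simps numeral_2_eq_2)
  then have "c 1 = 0" using ab_diff by auto
  moreover from this have "c 0 = 0" using d[of 0] by simp
  ultimately show "c i = 0" using i by (cases i) auto
qed

text \<open>The differential of such a cycle is a combination of the quadrics with constant
  covectors, and applying the differential again yields a linear syzygy. Those are known, so the
  cycle is a combination of the two row lifts.\<close>

lemma basis_23: "is_basis 2 3 [SM, SN]"
  unfolding is_basis_def
proof (intro conjI indep_S set_S ballI)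
  fix z assume "z \<in> Z \<inter> kc 2 3"
  then have z: "z \<in> Z" "z \<in> kc 2 3" by auto
  have dz: "koszul_diff z \<in> kc 1 3" using kc_koszul_diff z(2) by (metis One_nat_def numeral_2_eq_2)
  have "koszul_diff z \<in> JK t x" using z(1) by (simp add: Zc_iff)
  moreover have "koszul_diff z \<in> kc 1 (1 + 2)" using dz by (simp add: eval_nat_numeral)
  ultimately obtain \<omega> where \<omega>: "\<And>k. \<omega> k \<in> kc 1 1" "koszul_diff z = (\<Sum>k<4. pscale (qq k) (\<omega> k))"
    using JK_decompose[where N = 4 and q = qq, OF quadric_span] by blast
  have "\<exists>L. \<omega> k = evec L" for k
  proof -
    have "\<omega> k = evec (\<lambda>v. Poly_Mapping.lookup (lk (\<omega> k) {v}) 0)"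
    proof (rule koszul_eqI)
      fix S :: "4 set"
      have lke: "lk (evec h) T = (\<Sum>v\<in>UNIV. if {v} = T then mconst (h v) else 0)" for h :: "4 \<Rightarrow> 'k" and T
        by (simp add: evec_def lookup_sum lookup_single when_def)
      show "lk (\<omega> k) S = lk (evec (\<lambda>v. Poly_Mapping.lookup (lk (\<omega> k) {v}) 0)) S"
      proof (cases "card S = 1")
        case True
        then obtain v where S: "S = {v}" by (auto simp: card_1_singleton_iff)
        have "homogeneous 0 (lk (\<omega> k) {v})" using kc_lookup[OF \<omega>(1), of k "{v}"] by simp
        then have "lk (\<omega> k) {v} = mconst (Poly_Mapping.lookup (lk (\<omega> k) {v}) 0)"
          by (simp only: homogeneous_0_iff)
        moreover have "lk (evec h) {v} = mconst (h v)" for h :: "4 \<Rightarrow> 'k" unfolding lke by simp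
        ultimately show ?thesis unfolding S by (simp only:)
      next
        case False
        then have "lk (\<omega> k) S = 0" using kc_card[OF \<omega>(1), of k S] by auto
        moreover have "{v} \<noteq> S" for v using False by auto
        ultimately show ?thesis unfolding lke by simp
      qed
    qed
    then show ?thesis by blast
  qed
  then obtain L where L: "\<And>k. \<omega> k = evec (L k)" by metis
  have "koszul_diff (koszul_diff z) = (\<Sum>k<4. Poly_Mapping.single {} (qq k * lform (L k)))"
    unfolding \<omega>(2) L by (simp add: koszul_diff_sum koszul_diff_pscale_evec)
  also have "\<dots> = Poly_Mapping.single {} (\<Sum>k<4. qq k * lform (L k))"
    by (rule additive_sum[symmetric]) (simp add: single_add)
  finally have "(\<Sum>k<4. qq k * lform (L k)) = 0"
    by (simp add: koszul_diff_diff)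
  then obtain \<alpha> \<beta> where ab: "\<And>k. k < 3 \<Longrightarrow> L k = (\<lambda>v. \<alpha> * mv (Suc k) v + \<beta> * nv (Suc k) v)" "L 3 = (\<lambda>_. 0)"
    using linear_syzygies by blast
  let ?c = "\<lambda>i. if i = 0 then - \<alpha> else \<beta>"
  have "evec (\<lambda>_. 0) = (0 :: (4, 'k) koszul)" by (simp add: evec_def)
  then have "koszul_diff z = (\<Sum>k<3. pscale (qq k) (evec (L k)))"
    unfolding \<omega>(2) L sum_lessThan_4 sum_lessThan_3 ab(2) by simp
  also have "\<dots> = koszul_diff (lincomb ?c [SM, SN])"
    unfolding koszul_diff_lincomb_S using ab(1) by (intro sum.cong refl) simp
  finally have "koszul_diff (z - lincomb ?c [SM, SN]) = 0" by (simp add: koszul_diff_diff_eq)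
  then have "z - lincomb ?c [SM, SN] \<in> B"
    using linear_strand_B[OF kc_diff[OF z(2) lincomb_kc[OF set_S(2)]]] by simp
  then show "\<exists>c. z - lincomb c [SM, SN] \<in> B" by blast
qed

end

lemma less_3_cases: "k < (3::nat) \<Longrightarrow> k = 0 \<or> k = 1 \<or> k = 2"
  by auto

lemma wedge_kc_1_1: "z \<in> kc 1 d \<Longrightarrow> w \<in> kc 1 e \<Longrightarrow> wedge z w \<in> kc 2 (d + e)"
  using kc_wedge[of z 1 d w 1 e] by (simp add: numeral_2_eq_2)

lemma wedge_kc_1_2: "z \<in> kc 1 d \<Longrightarrow> w \<in> kc 2 e \<Longrightarrow> wedge z w \<in> kc 3 (d + e)"
  using kc_wedge[of z 1 d w 2 e] by (simp add: eval_nat_numeral)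

lemma anticommute_kc_1: "z \<in> kc 1 d \<Longrightarrow> w \<in> kc 1 e \<Longrightarrow> wedge w z = - wedge z w"
  using wedge_commute_kc[of z 1 d w 1 e] by simp

section \<open>Products for six points\<close>

context gp6
begin

lemma ZZ_ZZ_Bd: "i < 3 \<Longrightarrow> j < 3 \<Longrightarrow> wedge (ZZ i) (ZZ j) \<in> B"
proof -
  assume ij: "i < 3" "j < 3"
  have q: "qq 0 \<in> pideal t x" "qq 1 \<in> pideal t x" "qq 2 \<in> pideal t x" by (simp_all add: qq_ideal)
  have z: "ZZ 0 = minor_cycle (mv 2) (nv 2) (mv 3) (nv 3)" "ZZ 1 = minor_cycle (mv 3) (nv 3) (mv 1) (nv 1)"
    "ZZ 2 = minor_cycle (mv 1) (nv 1) (mv 2) (nv 2)" by (simp_all add: ZZ_def)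
  have 01: "wedge (ZZ 0) (ZZ 1) \<in> B"
    unfolding z by (rule minor_product_Bd) (use q in \<open>simp_all add: qq_def\<close>)
  have 12: "wedge (ZZ 1) (ZZ 2) \<in> B"
    unfolding z by (rule minor_product_Bd) (use q in \<open>simp_all add: qq_def\<close>)
  have 20: "wedge (ZZ 2) (ZZ 0) \<in> B"
    unfolding z by (rule minor_product_Bd) (use q in \<open>simp_all add: qq_def\<close>)
  have op: "wedge (ZZ j) (ZZ i) \<in> B" if "wedge (ZZ i) (ZZ j) \<in> B" for i j
    using Bd_uminus[OF that] anticommute_kc_1[OF ZZ_kc ZZ_kc, of i j] by simp
  have self: "wedge (ZZ i) (ZZ i) = 0" for i by (rule wedge_self_odd[OF ZZ_kc]) simp
  show ?thesis
    using less_3_cases[OF ij(1)] less_3_cases[OF ij(2)] 01 12 20 op[OF 01] op[OF 12] op[OF 20]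
    by (elim disjE) (simp_all add: self)
qed

text \<open>The lifts \<open>ZZ k\<close> annihilate \<open>SN\<close> on the nose. For
  \<open>SM\<close> the rows exchange roles, so \<open>ZZ k\<close> is replaced by the lift of the
  same quadric built from the other row, which has the same class.\<close>

lemma ZZ_S_Bd:
  assumes k: "k < 3"
  shows "wedge (ZZ k) SN \<in> B" "wedge (ZZ k) SM \<in> B"
proof -
  have SN: "SN = row_cycle (mv 2) (mv 3) (mv 1) (nv 2) (nv 3) (nv 1)" "SN = row_cycle (mv 3) (mv 1) (mv 2) (nv 3) (nv 1) (nv 2)"
    by (simp_all add: SN_def row_cycle_def add_ac)
  have SM: "SM = row_cycle (nv 2) (nv 3) (nv 1) (mv 2) (mv 3) (mv 1)" "SM = row_cycle (nv 3) (nv 1) (nv 2) (mv 3) (mv 1) (mv 2)"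
    by (simp_all add: SM_def row_cycle_def add_ac)
  have N: "wedge (minor_cycle (mv 2) (nv 2) (mv 3) (nv 3)) SN = 0"
    "wedge (minor_cycle (mv 3) (nv 3) (mv 1) (nv 1)) SN = 0"
    "wedge (minor_cycle (mv 1) (nv 1) (mv 2) (nv 2)) SN = 0"
    using minor_row_zero SN SN_def by metis+
  have M: "wedge (minor_cycle (nv 2) (mv 2) (nv 3) (mv 3)) SM = 0"
    "wedge (minor_cycle (nv 3) (mv 3) (nv 1) (mv 1)) SM = 0"
    "wedge (minor_cycle (nv 1) (mv 1) (nv 2) (mv 2)) SM = 0"
    using minor_row_zero SM SM_def by metis+
  from less_3_cases[OF k] show "wedge (ZZ k) SN \<in> B"
    by (elim disjE) (simp_all add: ZZ_def N[unfolded One_nat_def])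
  obtain y where y: "y \<in> kc 1 2" "koszul_diff y = koszul_diff (ZZ k)" "wedge y SM = 0"
  proof -
    have "koszul_diff (- minor_cycle n m n' m') = koszul_diff (minor_cycle m n m' n')" for m n m' n' :: "4 \<Rightarrow> 'k"
      by (simp add: koszul_diff_uminus koszul_diff_minor_cycle mult.commute flip: single_uminus)
    then show thesis
      using less_3_cases[OF k] M that[OF kc_uminus[OF minor_cycle_kc]]
      by (elim disjE) (simp_all add: ZZ_def wedge_uminus_left)
  qed
  then have "ZZ k - y \<in> B" using ZZ_kc by (intro same_quadric) auto
  then have "wedge (ZZ k - y) SM \<in> B" using SM_Z by (rule Bd_wedge_left)
  then show "wedge (ZZ k) SM \<in> B" using y by (simp add: wedge_diff_left)
qed

text \<open>That the fourth quadric is a nonzerodivisor modulo the minors appears here as its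
  absence from all linear syzygies. If the product bounds, \<open>boundary_syzygy\<close> gives a
  syzygy in which the coefficient of \<open>qq 3\<close> is \<open>z\<close> minus an exact term;
  this coefficient is therefore zero.\<close>

lemma mult_q3_injective:
  assumes z: "z \<in> kc (Suc i) (Suc (Suc i))" and dz: "koszul_diff z = (\<Sum>k<3. pscale (qq k) (L k))"
    and L: "\<And>k. L k \<in> kc i i" and B: "wedge (ZZ 3) z \<in> B"
  shows "z \<in> B"
proof -
  let ?L = "\<lambda>k. if k < 3 then - wedge (ZZ 3) (L k) else z"
  have "wedge (ZZ 3) z \<in> kc (1 + Suc i) (2 + Suc (Suc i))" using ZZ_kc z by (rule kc_wedge)
  then have w: "wedge (ZZ 3) z \<in> kc (Suc (Suc i)) (Suc (Suc i) + 2)" by (simp add: numeral_2_eq_2)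
  have "koszul_diff (wedge (ZZ 3) z) = pscale (qq 3) z - (\<Sum>k<3. pscale (qq k) (wedge (ZZ 3) (L k)))"
    unfolding koszul_leibniz_kc[OF ZZ_kc] koszul_diff_ZZ dz by (simp add: wedge_sum_right wedge_pscale_right flip: pscale_def)
  also have "\<dots> = (\<Sum>k<4. pscale (qq k) (?L k))"
    by (simp add: sum_lessThan_3 sum_lessThan_4 pscale_uminus_right)
  finally obtain \<omega> where \<omega>: "\<And>k. \<omega> k \<in> kc (Suc (Suc i)) (Suc (Suc i))"
    "(\<Sum>k<4. pscale (qq k) (?L k - koszul_diff (\<omega> k))) = 0"
    using boundary_syzygy[where N = 4 and q = qq and L = ?L, OF quadric_span B w] by blast
  let ?X = "\<lambda>k. ?L k - koszul_diff (\<omega> k)"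
  have "wedge (ZZ 3) (L k) \<in> kc (Suc i) (Suc (Suc i))" for k
    using kc_wedge[OF ZZ_kc L, of 3 k] by (simp add: numeral_2_eq_2)
  then have X: "?X k \<in> kc (Suc i) (Suc (Suc i))" for k
    using z kc_koszul_diff[OF \<omega>(1)] by (auto intro!: kc_diff kc_uminus)
  have "lk (?X 3) S = 0" for S
  proof -
    have "\<exists>c. lk (?X k) S = lform c" for k using linear_strand_lookup[OF X, of k S] by blast
    then obtain c where c: "\<And>k. lk (?X k) S = lform (c k)" by metis
    have "lk (\<Sum>k<4. pscale (qq k) (?X k)) S = 0" unfolding \<omega>(2) by simp
    then have "(\<Sum>k<4. qq k * lform (c k)) = 0" unfolding lookup_sum lookup_pscale c .
    then have "c 3 = (\<lambda>_. 0)" by (rule linear_syzygies)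
    then show ?thesis unfolding c by (simp add: lform_def)
  qed
  then have "?X 3 = 0" by (intro koszul_eqI) simp
  then have "z = koszul_diff (\<omega> 3)" by simp
  then show ?thesis using koszul_diff_Bd by metis
qed

abbreviation "us24 \<equiv> map (\<lambda>k. wedge (ZZ 3) (ZZ k)) [0..<3]"
abbreviation "us35 \<equiv> [wedge (ZZ 3) SM, wedge (ZZ 3) SN]"

lemma set_us24: "set us24 \<subseteq> Z" "set us24 \<subseteq> kc 2 4"
  using wedge_kc_1_1[OF ZZ_kc ZZ_kc] by (auto intro!: Zc_wedge ZZ_Z)

lemma set_us35: "set us35 \<subseteq> Z" "set us35 \<subseteq> kc 3 5"
  using wedge_kc_1_2[OF ZZ_kc SM_kc] wedge_kc_1_2[OF ZZ_kc SN_kc]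
  by (auto intro!: Zc_wedge ZZ_Z SM_Z SN_Z)

lemma indep_us24: "indep us24"
  unfolding indep_def
proof (intro conjI set_us24 allI impI)
  fix c i assume c: "lincomb c us24 \<in> B" and i: "i < length us24"
  let ?z = "\<Sum>k<3. pscale (mconst (c k)) (ZZ k)"
  have "lincomb c us24 = wedge (ZZ 3) ?z" by (simp add: lincomb_map wedge_sum_right wedge_pscale_right)
  then have zB: "wedge (ZZ 3) ?z \<in> B" using c by simp
  have zk: "?z \<in> kc (Suc 0) (Suc (Suc 0))" using kc_scale[OF ZZ_kc] by (intro kc_sum) (simp add: numeral_2_eq_2)
  have dz: "koszul_diff ?z = (\<Sum>k<3. pscale (qq k) (Poly_Mapping.single {} (mconst (c k))))"
    by (simp add: koszul_diff_sum koszul_diff_pscale koszul_diff_ZZ) (simp add: pscale_def wedge_single wedge_sign_def mult.commute)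
  have L: "Poly_Mapping.single {} (mconst (c k)) \<in> kc 0 0" for k
    using kc_single[of "{}" 0 0 "mconst (c k)", OF _ homogeneous_const] by simp
  have "?z \<in> B" by (rule mult_q3_injective[OF zk dz L zB])
  moreover have "?z = lincomb (\<lambda>k. if k < 3 then c k else 0) Zs"
    by (simp add: lincomb_map sum_lessThan_3 sum_lessThan_4)
  ultimately have "(if i < 3 then c i else 0) = 0"
    using indepD[OF indep_Zs, of "\<lambda>k. if k < 3 then c k else 0" i] i by simp
  then show "c i = 0" using i by simp
qed

lemma indep_us35: "indep us35"
  unfolding indep_def
proof (intro conjI set_us35 allI impI)
  fix c i assume c: "lincomb c us35 \<in> B" and i: "i < length us35"
  have "lincomb c us35 = wedge (ZZ 3) (lincomb c [SM, SN])"
    by (simp add: lincomb_Cons wedge_add_right wedge_pscale_right)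
  then have "wedge (ZZ 3) (lincomb c [SM, SN]) \<in> B" using c by simp
  moreover have "lincomb c [SM, SN] \<in> kc (Suc 1) (Suc (Suc 1))"
    using lincomb_kc[OF set_S(2)] by (simp add: eval_nat_numeral)
  ultimately have "lincomb c [SM, SN] \<in> B"
    by (intro mult_q3_injective[where i = 1, OF _ koszul_diff_lincomb_S evec_kc]) auto
  then show "c i = 0" using indepD[OF indep_S, of c i] i by simp
qed

text \<open>At the sixth point \<open>prim24 z\<close> has to agree with \<open>Y 5 z\<close> minus
  a multiple of \<open>om 5\<close>. Comparing coordinates \<open>i\<close> gives this multiple as
  \<open>gam i z\<close>. A primitive exists as soon as the four values agree, which is three
  conditions.\<close>

definition gam :: "nat \<Rightarrow> (4, 'k) koszul \<Rightarrow> 'k" where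
  "gam i z = alpha i z - ((\<Sum>j<4. b j * tau i j z) - tau i 5 z) / b i"

lemma gam_functional: "lin_functional (gam i)"
  using lin_functional_add[OF tau_functional] lin_functional_scale[OF tau_functional]
  by (simp add: lin_functional_def gam_def alpha_def sum_lessThan_4 algebra_simps add_divide_distrib diff_divide_distrib)

lemma gam_zero_Bd:
  assumes z: "z \<in> Z" "z \<in> kc 2 4" and gam: "\<And>i. i < 3 \<Longrightarrow> gam i z = gam 3 z"
  shows "z \<in> B"
proof (rule bd_by_points[OF z(2)])
  show "prim24 z \<in> kc (Suc 2) 4" using prim24_kc[OF z(2)] by (simp add: eval_nat_numeral)
  fix p assume p: "p < t"
  show "iota (x p) (prim24 z) = evk (x p) z"
  proof (cases "p = 5")
    case False
    then show ?thesis using iota_prim24_small[OF z] point6_cases[OF p] by auto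
  next
    case True
    have Y: "Y i z \<in> kc 3 3" for i using Y_kc[OF z(2), of i] by simp
    have gi: "gam i z = gam 3 z" if "i < 4" for i using gam[of i] that by (cases "i = 3") auto
    have "(\<Sum>i<4. pscale (mconst (b i)) (Y i z - pscale (mconst (alpha i z)) (om i))) =
        Y 5 z - pscale (mconst (gam 3 z)) (om 5)"
    proof (rule threeform_eqI)
      show "(\<Sum>i<4. pscale (mconst (b i)) (Y i z - pscale (mconst (alpha i z)) (om i))) \<in> kc 3 3"
        by (intro kc_sum kc_scale kc_diff Y om_kc)
      show "Y 5 z - pscale (mconst (gam 3 z)) (om 5) \<in> kc 3 3" by (intro kc_scale kc_diff Y om_kc)
      fix i :: nat assume i: "i < 4"
      have s: "(\<Sum>j<4. b j * (alpha j z * dot (g i) (x j))) = b i * alpha i z"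
      proof -
        have "(\<Sum>j<4. b j * (alpha j z * dot (g i) (x j))) = (\<Sum>j<4. if j = i then b i * alpha i z else 0)"
          using i dual by (intro sum.cong) auto
        then show ?thesis using i by simp
      qed
      have l: "topc (wedge (eps i) (\<Sum>i<4. pscale (mconst (b i)) (Y i z - pscale (mconst (alpha i z)) (om i)))) =
          (\<Sum>j<4. b j * tau i j z) - b i * alpha i z"
        unfolding wedge_sum_right wedge_pscale_right wedge_diff_right evec_iota_vol topc_simps topc_vol tau_def[symmetric]
        by (simp add: right_diff_distrib sum_subtractf s)
      have r: "topc (wedge (eps i) (Y 5 z - pscale (mconst (gam 3 z)) (om 5))) = tau i 5 z - gam 3 z * b i"
        unfolding wedge_pscale_right wedge_diff_right evec_iota_vol topc_simps topc_vol tau_def[symmetric] dot_g_5[OF i] by simp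
      have e: "gam 3 z = alpha i z - ((\<Sum>j<4. b j * tau i j z) - tau i 5 z) / b i"
        using gi[OF i] unfolding gam_def[of i] by simp
      have "gam 3 z * b i = alpha i z * b i - ((\<Sum>j<4. b j * tau i j z) - tau i 5 z)"
      proof -
        have "(u - v / c) * c = u * c - v" if "c \<noteq> 0" for u v c :: 'k
          using that by (simp add: left_diff_distrib)
        then show ?thesis unfolding e using b_nz[OF i] by blast
      qed
      then show "topc (wedge (eps i) (\<Sum>i<4. pscale (mconst (b i)) (Y i z - pscale (mconst (alpha i z)) (om i)))) =
          topc (wedge (eps i) (Y 5 z - pscale (mconst (gam 3 z)) (om 5)))"
        unfolding l r by (simp add: mult.commute)
    qed
    moreover have "(\<Sum>i<4. pscale (mconst (dot (g i) (x 5))) (Y i z - pscale (mconst (alpha i z)) (om i))) =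
        (\<Sum>i<4. pscale (mconst (b i)) (Y i z - pscale (mconst (alpha i z)) (om i)))"
      using dot_g_5 by simp
    ultimately have "iota (x 5) (prim24 z) = iota (x 5) (Y 5 z)"
      by (simp add: iota_prim24 iota_diff iota_pscale iota_iota)
    then show ?thesis using iota_Y[OF z(1), of 1 4 5] z(2) t6 True by (simp add: numeral_2_eq_2)
  qed
qed

lemma basis_24: "is_basis 2 4 us24"
proof -
  obtain zs where zs: "is_basis 2 4 zs" by (rule obtain_basis)
  have "length zs \<le> 3"
  proof (rule indep_length_le[where \<phi> = "\<lambda>i z. gam i z - gam 3 z"])
    show "lin_functional (\<lambda>z. gam i z - gam 3 z)" for i
      using gam_functional by (simp add: lin_functional_def algebra_simps)
    show "z \<in> B" if "z \<in> Z" "z \<in> kc 2 4" "\<forall>i<3. gam i z - gam 3 z = 0" for z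
      using that by (intro gam_zero_Bd) auto
  qed (use is_basisD[OF zs] in auto)
  then show ?thesis by (intro indep_is_basis[OF indep_us24 set_us24(2) zs]) simp
qed

text \<open>There is one obstruction for each point beyond the frame: \<open>sigma\<close> for the
  fifth, and for the sixth the analogous condition with weights \<open>b j\<close>. The two products
  attain this bound.\<close>

lemma basis_35: "is_basis 3 5 us35"
proof -
  obtain zs where zs: "is_basis 3 5 zs" by (rule obtain_basis)
  let ?\<phi> = "\<lambda>(i :: nat) z. if i = 0 then sigma z else stop 5 z - (\<Sum>j<4. b j * stop j z)"
  have "length zs \<le> 2"
  proof (rule indep_length_le[where \<phi> = ?\<phi>])
    have "lin_functional (\<lambda>z. stop 5 z - (\<Sum>j<4. b j * stop j z))"
      using lin_functional_add[OF stop_functional] lin_functional_scale[OF stop_functional]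
      by (simp add: lin_functional_def sum_lessThan_4 algebra_simps)
    then show "lin_functional (?\<phi> i)" for i using sigma_functional by (cases "i = 0") auto
    fix z assume z: "z \<in> Z" "z \<in> kc 3 5" "\<forall>i<(2 :: nat). ?\<phi> i z = 0"
    have s: "sigma z = 0" "stop 5 z = (\<Sum>j<4. b j * stop j z)"
      using z(3)[rule_format, of 0] z(3)[rule_format, of 1] by simp_all
    show "z \<in> B"
    proof (rule bd_35[OF z(1,2)])
      fix p assume "4 \<le> p" "p < t"
      then have "p = 4 \<or> p = 5" using t6 by auto
      then show "(\<Sum>i<4. stop i z * dot (g i) (x p)) = stop p z"
        using s by (auto simp: sum_lessThan_4 dot_g_4 dot_g_5[unfolded One_nat_def] sigma_def mult.commute)
    qed
  qed (use is_basisD[OF zs] in auto)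
  then show ?thesis by (intro indep_is_basis[OF indep_us35 set_us35(2) zs]) simp
qed

lemma max_mult_rank_6: "max_mult_rank A"
proof (rule mmr12)
  have "pdim 1 2 1 2 = length us24"
  proof (rule alg_dim_product_space[OF indep_us24])
    show "cl ` set us24 \<subseteq> {cl (wedge z w) |z w. z \<in> Z \<inter> kc 1 2 \<and> w \<in> Z \<inter> kc 1 2}"
    proof
      fix y assume "y \<in> cl ` set us24"
      then obtain k where "k < 3" "y = cl (wedge (ZZ 3) (ZZ k))" by auto
      then show "y \<in> {cl (wedge z w) |z w. z \<in> Z \<inter> kc 1 2 \<and> w \<in> Z \<inter> kc 1 2}"
        using ZZ_Z[of 3] ZZ_Z[of k] ZZ_kc by fastforce
    qed
    fix z w assume "z \<in> Z" "z \<in> kc 1 2" "w \<in> Z" "w \<in> kc 1 2"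
    then show "\<exists>c. wedge z w - lincomb c us24 \<in> B"
      using wedge_kc_1_1[of z 2 w 2] by (intro is_basis_ex[OF basis_24] Zc_wedge) auto
  qed
  \<comment> \<open>Four quadrics and a target of dimension 3: the bound is the minimum of 6 and
    3.\<close>
  then show "pdim 1 2 1 2 = mult_rank_bound A 1 2 1 2"
    unfolding bound_12_12 alg_dim_component[OF basis_12] alg_dim_component[OF basis_24]
    by (simp add: numeral_eq_Suc)
  have "pdim 1 2 2 3 = length us35"
  proof (rule alg_dim_product_space[OF indep_us35])
    show "cl ` set us35 \<subseteq> {cl (wedge z w) |z w. z \<in> Z \<inter> kc 1 2 \<and> w \<in> Z \<inter> kc 2 3}"
      using ZZ_Z[of 3] ZZ_kc SM_Z SN_Z SM_kc SN_kc by fastforce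
    fix z w assume "z \<in> Z" "z \<in> kc 1 2" "w \<in> Z" "w \<in> kc 2 3"
    then show "\<exists>c. wedge z w - lincomb c us35 \<in> B"
      using wedge_kc_1_2[of z 2 w 3] by (intro is_basis_ex[OF basis_35] Zc_wedge) auto
  qed
  then show "pdim 1 2 2 3 = mult_rank_bound A 1 2 2 3"
    unfolding bound_12_23 alg_dim_component[OF basis_12] alg_dim_component[OF basis_23] alg_dim_component[OF basis_35]
    by simp
qed

end

lemma (in tor_points) nth_append_basis:
  assumes zs: "is_basis i d zs" and ws: "is_basis i d' ws" and j: "j \<in> {1..length (zs @ ws)}"
  shows "(zs @ ws) ! (j - 1) \<in> Z \<and>
    (if j \<le> length zs then (zs @ ws) ! (j - 1) = zs ! (j - 1) \<and> (zs @ ws) ! (j - 1) \<in> kc i d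
     else (zs @ ws) ! (j - 1) \<in> kc i d')"
proof (cases "j \<le> length zs")
  case True
  then have "zs ! (j - 1) \<in> set zs" "(zs @ ws) ! (j - 1) = zs ! (j - 1)" using j by (auto simp: nth_append)
  then show ?thesis using True is_basisD[OF zs] by auto
next
  case False
  then have "(zs @ ws) ! (j - 1) \<in> set ws" using j by (auto simp: nth_append)
  then show ?thesis using False is_basisD[OF ws] by auto
qed

context gp6
begin

text \<open>The element \<open>e_4\<close> of the class is \<open>ZZ 3\<close>. Its products with
  the minors open the basis of degree 2, followed by \<open>SM\<close> and \<open>SN\<close>, and
  its products with these two open the basis of degree 3.\<close>

lemma class_H32: "has_class A (Class_H 3 2)"
proof -
  obtain e2 where e2: "is_basis 1 3 e2" by (rule obtain_basis)
  obtain g2 where g2: "is_basis 3 4 g2" by (rule obtain_basis)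
  let ?e = "Zs @ e2" and ?f = "us24 @ [SM, SN]" and ?g = "us35 @ g2"
  let ?E = "\<lambda>j. cl (?e ! (j - 1))" and ?F = "\<lambda>j. cl (?f ! (j - 1))" and ?G = "\<lambda>j. cl (?g ! (j - 1))"
  have hb1: "hom_basis A 1 (length ?e) ?E"
    using hom_basis_strands[of 1 Zs e2] basis_12 e2 by (simp add: eval_nat_numeral)
  have hb2: "hom_basis A 2 (length ?f) ?F"
  proof (rule hom_basis_append[OF basis_24 basis_23])
    fix d' :: nat assume "d' \<noteq> 4" "d' \<noteq> 3"
    then show "Z \<inter> kc 2 d' \<subseteq> B" using nonzero_range[of _ 2 d'] by fastforce
  qed simp
  have hb3: "hom_basis A 3 (length ?g) ?G"
  proof (rule hom_basis_append[OF basis_35 g2])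
    fix d' :: nat assume "d' \<noteq> 5" "d' \<noteq> 4"
    then show "Z \<inter> kc 3 d' \<subseteq> B" using nonzero_range[of _ 3 d'] by fastforce
  qed simp
  have me: "?e ! (i - 1) \<in> Z \<and> (if i \<le> 4 then ?e ! (i - 1) = ZZ (i - 1) else ?e ! (i - 1) \<in> kc 1 3)"
    if "i \<in> {1..length ?e}" for i
    using nth_append_basis[OF basis_12 e2 that] that by (auto split: if_splits simp del: upt_Suc)
  have mf: "?f ! (i - 1) \<in> Z \<and> (if i \<le> 3 then ?f ! (i - 1) = wedge (ZZ 3) (ZZ (i - 1)) \<and> ?f ! (i - 1) \<in> kc 2 4
      else if i = 4 then ?f ! (i - 1) = SM else ?f ! (i - 1) = SN)"
    if "i \<in> {1..length ?f}" for i
  proof -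
    have "i \<le> 3 \<or> i = 4 \<or> i = 5" using that by auto
    then show ?thesis
      using nth_append_basis[OF basis_24 basis_23 that] that by (auto split: if_splits simp del: upt_Suc simp: nth_append)
  qed
  have z1: "cl a \<otimes>\<^bsub>A\<^esub> cl b = \<zero>\<^bsub>A\<^esub>" if "a \<in> Z" "b \<in> Z" "wedge a b \<in> B" for a b
    using that by (simp add: cl_mult cl_eq_zero Zc_wedge)
  have ee: "?E i \<otimes>\<^bsub>A\<^esub> ?E j = (if i = 4 \<and> j \<le> 3 then ?F j else if j = 4 \<and> i \<le> 3 then \<ominus>\<^bsub>A\<^esub> ?F i else \<zero>\<^bsub>A\<^esub>)"
    if i: "i \<in> {1..length ?e}" and j: "j \<in> {1..length ?e}" for i j
  proof (cases "i \<le> 4 \<and> j \<le> 4")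
    case True
    have e: "?e ! (i - 1) = ZZ (i - 1)" "?e ! (j - 1) = ZZ (j - 1)" using me[OF i] me[OF j] True by auto
    have ZZ: "ZZ (i - 1) \<in> Z" "ZZ (j - 1) \<in> Z" using ZZ_Z True i j by auto
    consider "i = 4" "j \<le> 3" | "j = 4" "i \<le> 3" | "i = 4" "j = 4" | "i \<le> 3" "j \<le> 3" using True by linarith
    then show ?thesis
    proof cases
      case 1
      then have f: "?f ! (j - 1) = wedge (ZZ 3) (ZZ (j - 1))" using mf[of j] j by auto
      show ?thesis using 1 ZZ unfolding e f by (simp add: cl_mult)
    next
      case 2
      then have f: "?f ! (i - 1) = wedge (ZZ 3) (ZZ (i - 1))" using mf[of i] i by auto
      have "wedge (ZZ (i - 1)) (ZZ 3) = - wedge (ZZ 3) (ZZ (i - 1))" by (rule anticommute_kc_1[OF ZZ_kc ZZ_kc])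
      then show ?thesis using 2 ZZ unfolding e f by (simp add: cl_mult cl_uminus Zc_wedge)
    next
      case 3
      have "wedge (ZZ 3) (ZZ 3) = 0" by (rule wedge_self_odd[OF ZZ_kc]) simp
      then show ?thesis using 3 ZZ z1[of "ZZ 3" "ZZ 3"] unfolding e by simp
    next
      case 4
      then have "i - 1 < 3" "j - 1 < 3" using i j by auto
      then have "wedge (ZZ (i - 1)) (ZZ (j - 1)) \<in> B" by (rule ZZ_ZZ_Bd)
      then show ?thesis using 4 z1[OF ZZ] unfolding e by simp
    qed
  next
    case False
    let ?a = "?e ! (i - 1)" and ?b = "?e ! (j - 1)"
    have Z: "?a \<in> Z" "?b \<in> Z" using me[OF i] me[OF j] by auto
    obtain d1 where d1: "?a \<in> kc 1 d1" "2 \<le> d1" "\<not> i \<le> 4 \<Longrightarrow> d1 = 3"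
      using me[OF i] ZZ_kc[of "i - 1"] by (cases "i \<le> 4") auto
    obtain d2 where d2: "?b \<in> kc 1 d2" "2 \<le> d2" "\<not> j \<le> 4 \<Longrightarrow> d2 = 3"
      using me[OF j] ZZ_kc[of "j - 1"] by (cases "j \<le> 4") auto
    have "4 < d1 + d2" using d1 d2 False by (cases "i \<le> 4"; cases "j \<le> 4") auto
    then have "wedge ?a ?b \<in> B" using strand_zero[OF Zc_wedge[OF Z] wedge_kc_1_1[OF d1(1) d2(1)]] by linarith
    then have "?E i \<otimes>\<^bsub>A\<^esub> ?E j = \<zero>\<^bsub>A\<^esub>" by (rule z1[OF Z])
    moreover have "\<not> (i = 4 \<and> j \<le> 3)" "\<not> (j = 4 \<and> i \<le> 3)" using False by auto
    ultimately show ?thesis by (simp only: if_False)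
  qed
  have ef: "?E i \<otimes>\<^bsub>A\<^esub> ?F j = (if i = 4 \<and> 3 < j then ?G (j - 3) else \<zero>\<^bsub>A\<^esub>)"
    if i: "i \<in> {1..length ?e}" and j: "j \<in> {1..length ?f}" for i j
  proof (cases "i \<le> 4 \<and> 3 < j")
    case True
    then have j45: "j = 4 \<or> j = 5" using j by auto
    have e: "?e ! (i - 1) = ZZ (i - 1)" using me[OF i] True by auto
    have ZZ: "ZZ (i - 1) \<in> Z" using ZZ_Z True i by auto
    have f: "?f ! (j - 1) = (if j = 4 then SM else SN)" using mf[OF j] True by auto
    show ?thesis
    proof (cases "i = 4")
      case True
      then show ?thesis using j45 ZZ SM_Z SN_Z unfolding e f by (elim disjE) (simp_all add: cl_mult)
    next
      case False
      then have "i - 1 < 3" using True i by auto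
      then have "wedge (ZZ (i - 1)) (if j = 4 then SM else SN) \<in> B" using ZZ_S_Bd by simp
      then show ?thesis using False ZZ SM_Z SN_Z z1 unfolding e f by simp
    qed
  next
    case False
    let ?a = "?e ! (i - 1)" and ?b = "?f ! (j - 1)"
    have Z: "?a \<in> Z" "?b \<in> Z" using me[OF i] mf[OF j] by auto
    obtain d1 where d1: "?a \<in> kc 1 d1" "2 \<le> d1" "\<not> i \<le> 4 \<Longrightarrow> d1 = 3"
      using me[OF i] ZZ_kc[of "i - 1"] by (cases "i \<le> 4") auto
    obtain d2 where d2: "?b \<in> kc 2 d2" "3 \<le> d2" "j \<le> 3 \<Longrightarrow> d2 = 4"
      using mf[OF j] SM_kc SN_kc by (cases "j \<le> 3"; cases "j = 4") auto
    have "5 < d1 + d2" using d1 d2 False by (cases "i \<le> 4"; cases "j \<le> 3") auto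
    then have "wedge ?a ?b \<in> B" using strand_zero[OF Zc_wedge[OF Z] wedge_kc_1_2[OF d1(1) d2(1)]] by linarith
    then have "?E i \<otimes>\<^bsub>A\<^esub> ?F j = \<zero>\<^bsub>A\<^esub>" by (rule z1[OF Z])
    moreover have "\<not> (i = 4 \<and> 3 < j)" using False by auto
    ultimately show ?thesis by (simp only: if_False)
  qed
  have op: "only_products A (length ?e) ?E (length ?f) ?F
      (\<lambda>i j. if i = 3 + 1 \<and> j \<le> 3 then Some (?F j) else None)
      (\<lambda>i j. if i = 3 + 1 \<and> 3 < j \<and> j \<le> 3 + 2 then Some (?G (j - 3)) else None)"
    unfolding only_products_def
  proof (intro conjI ballI)
    fix i j assume i: "i \<in> {1..length ?e}" and j: "j \<in> {1..length ?e}"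
    show "?E i \<otimes>\<^bsub>A\<^esub> ?E j = (case if i = 3 + 1 \<and> j \<le> 3 then Some (?F j) else None of Some y \<Rightarrow> y
        | None \<Rightarrow> (case if j = 3 + 1 \<and> i \<le> 3 then Some (?F i) else None of Some y \<Rightarrow> \<ominus>\<^bsub>A\<^esub> y | None \<Rightarrow> \<zero>\<^bsub>A\<^esub>))"
      unfolding ee[OF i j] by (simp split: option.splits)
  next
    fix i j assume i: "i \<in> {1..length ?e}" and j: "j \<in> {1..length ?f}"
    have "j \<le> 5" using j by auto
    then show "?E i \<otimes>\<^bsub>A\<^esub> ?F j = (case if i = 3 + 1 \<and> 3 < j \<and> j \<le> 3 + 2 then Some (?G (j - 3)) else None of Some y \<Rightarrow> y | None \<Rightarrow> \<zero>\<^bsub>A\<^esub>)"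
      unfolding ef[OF i j] by simp
  qed
  show ?thesis
    unfolding has_class.simps
    by (intro exI[of _ "length ?e"] exI[of _ "length ?f"] exI[of _ "length ?g"] exI[of _ ?E]
        exI[of _ ?F] exI[of _ ?G] conjI hb1 hb2 hb3 op) auto
qed

end

section \<open>Seven or more points\<close>

text \<open>Bidegree \<open>(2, 3)\<close> is where linear syzygies of quadrics live, so
  \<open>no_syz\<close> says that there are none.\<close>

locale gp_ns = gp t x g for t and x :: "nat \<Rightarrow> 4 \<Rightarrow> 'k::field_char_0" and g +
  assumes no_syz: "Z \<inter> kc 2 3 \<subseteq> B"
begin

definition quad :: "(4, 'k) koszul \<Rightarrow> (4, 'k) mpoly" where
  "quad z = lk (koszul_diff z) {}"

lemma koszul_diff_quad: "z \<in> Z \<Longrightarrow> z \<in> kc 1 2 \<Longrightarrow> koszul_diff z = Poly_Mapping.single {} (quad z)"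
  unfolding quad_def by (erule (1) koszul_diff_quadric) simp

lemma homogeneous_quad: "z \<in> Z \<Longrightarrow> z \<in> kc 1 2 \<Longrightarrow> homogeneous 2 (quad z)"
  unfolding quad_def by (erule (1) koszul_diff_quadric) simp

lemma koszul_diff_wedge_quad:
  assumes "z \<in> Z" "z \<in> kc 1 2" "w \<in> Z" "w \<in> kc 1 2"
  shows "koszul_diff (wedge z w) = pscale (quad z) w - pscale (quad w) z"
proof -
  have "wedge z (Poly_Mapping.single {} f) = pscale f z" for f :: "(4, 'k) mpoly"
    using wedge_pscale_right[of z f "Poly_Mapping.single {} 1"]
    by (simp add: pscale_def wedge_single wedge_sign_def wedge_one_right)
  then show ?thesis
    unfolding koszul_leibniz_kc[OF assms(2)] koszul_diff_quad[OF assms(1,2)] koszul_diff_quad[OF assms(3,4)]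
    by (simp add: pscale_def)
qed

text \<open>Without linear syzygies, the products of quadrics are independent in bidegree \<open>(2, 4)\<close>.\<close>

lemma no_syzygy_boundary:
  assumes zs: "is_basis 1 2 zs" and w: "w \<in> B" "w \<in> kc 2 4"
    and dw: "koszul_diff w = (\<Sum>k<length zs. pscale (quad (zs ! k)) (L k))"
    and L: "\<And>k. L k \<in> kc 1 2" and k: "k < length zs"
  shows "koszul_diff (L k) = 0"
proof -
  let ?N = "length zs" and ?q = "\<lambda>k. quad (zs ! k)"
  have zk: "zs ! k \<in> Z" "zs ! k \<in> kc 1 2" if "k < ?N" for k
    using is_basisD[OF zs] nth_mem[OF that] by auto
  have dl: "koszul_diff (lincomb c zs) = Poly_Mapping.single {} (\<Sum>k<?N. mconst (c k) * ?q k)" for c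
  proof -
    have "koszul_diff (lincomb c zs) = (\<Sum>k<?N. Poly_Mapping.single {} (mconst (c k) * ?q k))"
      unfolding lincomb_def koszul_diff_sum koszul_diff_pscale
      by (rule sum.cong) (simp_all add: koszul_diff_quad[OF zk] pscale_def wedge_single wedge_sign_def)
    then show ?thesis by (subst additive_sum[of "Poly_Mapping.single {}"]) (simp_all add: single_add)
  qed
  have B0: "z \<in> B \<longleftrightarrow> koszul_diff z = 0" if "z \<in> kc 1 2" for z
    using Bd_linear_strand[of z 0] that by (simp add: numeral_2_eq_2)
  have span: "\<exists>c. f = (\<Sum>k<?N. mconst (c k) * ?q k)" if f: "homogeneous 2 f" "f \<in> pideal t x" for f
  proof -
    obtain z where z: "z \<in> kc 1 2" "koszul_diff z = Poly_Mapping.single {} f" using lift_quadric[OF f(1)] .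
    then have "z \<in> Z" using quadric_cycle[OF z] f(2) pideal_homogeneous[OF f(1)] by blast
    then obtain c where "z - lincomb c zs \<in> B" using is_basis_span[OF zs _ z(1)] by blast
    then have "koszul_diff (z - lincomb c zs) = 0"
      using B0 kc_diff[OF z(1) lincomb_kc[OF is_basisD(2)[OF zs]]] by blast
    then have "Poly_Mapping.single {} f = Poly_Mapping.single {} (\<Sum>k<?N. mconst (c k) * ?q k)"
      using z(2) by (simp add: koszul_diff_diff_eq dl)
    then show ?thesis by auto
  qed
  have ind: "c k = 0" if "(\<Sum>k<?N. mconst (c k) * ?q k) = 0" "k < ?N" for c k
  proof -
    have "koszul_diff (lincomb c zs) = 0" unfolding dl that(1) by simp
    then have "lincomb c zs \<in> B" using B0 lincomb_kc[OF is_basisD(2)[OF zs]] by blast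
    then show ?thesis using indepD[OF is_basisD(1)[OF zs]] that(2) by blast
  qed
  \<comment> \<open>A linear syzygy makes \<open>?y\<close> a cycle of the Koszul complex. Its
    primitive is a cycle of bidegree \<open>(2, 3)\<close> modulo the ideal, hence trivial, so
    \<open>?y\<close> is zero and the quadrics being independent gives the claim.\<close>
  have syz: "c k = (\<lambda>_. 0)" if c: "(\<Sum>k<?N. ?q k * lform (c k)) = 0" and k: "k < ?N" for c k
  proof -
    let ?y = "\<Sum>k<?N. pscale (?q k) (evec (c k))"
    have qh: "homogeneous 2 (?q k)" if "k < ?N" for k
      by (rule homogeneous_quad[OF zk[OF that]])
    have "?y \<in> kc 1 3" using kc_pscale[OF qh evec_kc] by (intro kc_sum) simp
    moreover have "koszul_diff ?y = 0"
    proof -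
      have "koszul_diff ?y = (\<Sum>k<?N. Poly_Mapping.single {} (?q k * lform (c k)))"
        by (simp add: koszul_diff_sum koszul_diff_pscale_evec)
      also have "\<dots> = Poly_Mapping.single {} (\<Sum>k<?N. ?q k * lform (c k))"
        by (rule additive_sum[symmetric]) (simp add: single_add)
      finally show ?thesis by (simp add: c)
    qed
    ultimately obtain z where z: "z \<in> kc (Suc 1) 3" "koszul_diff z = ?y"
      using koszul_exact_kc[of ?y 1 3] by auto
    have "?y \<in> JK t x"
    proof (intro JK_sum JK_pscale_ideal)
      fix k assume "k \<in> {..<?N}"
      then show "?q k \<in> pideal t x" using zk[of k] by (auto simp: quad_def Zc_iff JK_def)
    qed
    then have "z \<in> Z" by (simp add: Zc_iff z)
    then have "z \<in> B" using no_syz z(1) by (auto simp: numeral_2_eq_2)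
    then have y0: "?y = 0" using Bd_linear_strand[of z 1] z by (simp add: numeral_2_eq_2 numeral_3_eq_3)
    show ?thesis
    proof
      fix v
      have lke: "lk (evec h) {v} = mconst (h v)" for h :: "4 \<Rightarrow> 'k"
        by (simp add: evec_def lookup_sum lookup_single when_def)
      have "lk ?y {v} = 0" unfolding y0 by simp
      then have "(\<Sum>k<?N. mconst (c k v) * ?q k) = 0" by (simp add: lookup_sum lke mult.commute)
      then show "c k v = 0" using ind[of "\<lambda>k. c k v" k] k by simp
    qed
  qed
  have w': "w \<in> kc (Suc 1) (Suc 1 + 2)" using w(2) by (simp add: eval_nat_numeral)
  obtain \<omega> where \<omega>: "\<And>k. \<omega> k \<in> kc (Suc 1) (Suc 1)" "(\<Sum>k<?N. pscale (?q k) (L k - koszul_diff (\<omega> k))) = 0"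
    using boundary_syzygy[where N = ?N and q = ?q and L = L, OF span w(1) w' dw] by blast
  have X: "L k - koszul_diff (\<omega> k) \<in> kc 1 (Suc 1)" for k
    using L[of k] kc_koszul_diff[OF \<omega>(1), of k] by (intro kc_diff) (simp_all add: numeral_2_eq_2)
  have "lk (L k - koszul_diff (\<omega> k)) S = 0" for S
  proof -
    have "\<exists>c. lk (L k - koszul_diff (\<omega> k)) S = lform c" for k using linear_strand_lookup[OF X, of k S] by blast
    then obtain c where c: "\<And>k. lk (L k - koszul_diff (\<omega> k)) S = lform (c k)" by metis
    have "lk (\<Sum>k<?N. pscale (?q k) (L k - koszul_diff (\<omega> k))) S = 0" unfolding \<omega>(2) by simp
    then have "(\<Sum>k<?N. ?q k * lform (c k)) = 0" unfolding lookup_sum lookup_pscale c .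
    then have "c k = (\<lambda>_. 0)" using syz k by blast
    then show ?thesis unfolding c by (simp add: lform_def)
  qed
  then have "L k - koszul_diff (\<omega> k) = 0" by (intro koszul_eqI) simp
  then show ?thesis by (simp add: koszul_diff_diff)
qed

lemma quad_zero:
  assumes zs: "is_basis 1 2 zs" and "koszul_diff (lincomb c zs) = 0" "k < length zs"
  shows "c k = 0"
proof -
  have "lincomb c zs \<in> B"
    using assms(2) Bd_linear_strand[of "lincomb c zs" 0] lincomb_kc[OF is_basisD(2)[OF zs]] by (simp add: numeral_2_eq_2)
  then show ?thesis using indepD[OF is_basisD(1)[OF zs]] assms(3) by blast
qed

lemma pdim_1223: "pdim 1 2 2 3 = mult_rank_bound A 1 2 2 3"
  by (rule pdim_rank_bound_zero) (use no_syz in blast)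

lemma other_products:
  assumes z: "z \<in> Z" "z \<in> kc 1 d" "d = 2 \<or> d = 3" and w: "w \<in> Z" "w \<in> kc 2 e" "e = 3 \<or> e = 4"
  shows "wedge z w \<in> B"
proof (cases "e = 3")
  case True
  then have "w \<in> B" using no_syz w by auto
  then show ?thesis using z by (intro Bd_wedge_right)
next
  case False
  then show ?thesis
    using strand_zero[OF Zc_wedge[OF z(1) w(1)] wedge_kc_1_2[OF z(2) w(2)]] z w by auto
qed

lemma products_11:
  assumes z: "z \<in> Z" "z \<in> kc 1 d" "d = 2 \<or> d = 3" and w: "w \<in> Z" "w \<in> kc 1 e" "e = 2 \<or> e = 3"
    and "d = 3 \<or> e = 3"
  shows "wedge z w \<in> B"
  using strand_zero[OF Zc_wedge[OF z(1) w(1)] wedge_kc_1_1[OF z(2) w(2)]] assms by auto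

end

lemma (in tor_points) wedge_diff_Bd:
  assumes "z - z' \<in> B" "w - w' \<in> B" "w \<in> Z" "z' \<in> Z"
  shows "wedge z w - wedge z' w' \<in> B"
proof -
  have "wedge z w - wedge z' w' = wedge (z - z') w + wedge z' (w - w')"
    by (simp add: wedge_diff_left wedge_diff_right)
  then show ?thesis using assms by (simp add: Bd_add Bd_wedge_left Bd_wedge_right)
qed

context gp_ns
begin

lemma product_lincomb:
  assumes zs: "is_basis 1 2 zs" and z: "z \<in> Z" "z \<in> kc 1 2" and w: "w \<in> Z" "w \<in> kc 1 2"
  obtains c d where "wedge z w - wedge (lincomb c zs) (lincomb d zs) \<in> B"
proof -
  obtain c where c: "z - lincomb c zs \<in> B" using is_basis_span[OF zs z] .
  obtain d where d: "w - lincomb d zs \<in> B" using is_basis_span[OF zs w] .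
  show ?thesis using that wedge_diff_Bd[OF c d w(1) lincomb_Zc[OF is_basisD(3)[OF zs]]] .
qed

text \<open>The products of two different quadrics are independent, so the rank is the binomial
  coefficient. Extending them to a basis of bidegree \<open>(2, 4)\<close> shows that the other
  entry of the minimum is no smaller.\<close>

lemma max_mult_rank_no_syzygy:
  assumes zs: "is_basis 1 2 zs" and us: "indep us" "set us \<subseteq> kc 2 4"
    and prod: "set us \<subseteq> {wedge z w | z w. z \<in> set zs \<and> w \<in> set zs}"
    and span: "\<And>c d. \<exists>e. wedge (lincomb c zs) (lincomb d zs) = lincomb e us"
    and len: "length us = length zs choose 2"
  shows "max_mult_rank A"
proof (rule mmr12[OF _ pdim_1223])
  have "pdim 1 2 1 2 = length us"
  proof (rule alg_dim_product_space[OF us(1)])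
    show "cl ` set us \<subseteq> {cl (wedge z w) |z w. z \<in> Z \<inter> kc 1 2 \<and> w \<in> Z \<inter> kc 1 2}"
      using prod is_basisD(2,3)[OF zs] by fastforce
    fix z w assume "z \<in> Z" "z \<in> kc 1 2" "w \<in> Z" "w \<in> kc 1 2"
    then show "\<exists>c. wedge z w - lincomb c us \<in> B"
      by (rule product_lincomb[OF zs]) (metis span)
  qed
  moreover obtain ws where ws: "is_basis 2 4 (us @ ws)" using extend_basis[OF us] .
  ultimately show "pdim 1 2 1 2 = mult_rank_bound A 1 2 1 2"
    unfolding bound_12_12 alg_dim_component[OF zs] alg_dim_component[OF ws] using len by simp
qed

text \<open>The common shape of the remaining multiplication tables: quadrics and their products
  come first, and every product that is not of two quadrics vanishes for degree reasons or by
  \<open>no_syz\<close>.\<close>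

lemma bases_no_syzygy:
  assumes zs: "is_basis 1 2 zs" and us: "indep us" "set us \<subseteq> kc 2 4"
  obtains m e n f l h where "hom_basis A 1 m e" "hom_basis A 2 n f" "hom_basis A 3 l h"
    "length zs \<le> m" "length us \<le> n" "\<forall>j\<in>{1..length us}. f j = cl (us ! (j - 1))"
    "\<forall>i\<in>{1..m}. \<forall>j\<in>{1..m}. e i \<otimes>\<^bsub>A\<^esub> e j =
      (if i \<le> length zs \<and> j \<le> length zs then cl (wedge (zs ! (i - 1)) (zs ! (j - 1))) else \<zero>\<^bsub>A\<^esub>)"
    "\<forall>i\<in>{1..m}. \<forall>j\<in>{1..n}. e i \<otimes>\<^bsub>A\<^esub> f j = \<zero>\<^bsub>A\<^esub>"
proof -
  obtain e2 where e2: "is_basis 1 3 e2" by (rule obtain_basis)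
  obtain f2 where f2: "is_basis 2 4 (us @ f2)" using extend_basis[OF us] .
  obtain g1 where g1: "is_basis 3 4 g1" by (rule obtain_basis)
  obtain g2 where g2: "is_basis 3 5 g2" by (rule obtain_basis)
  have f0: "is_basis 2 3 []" using no_syz by (simp add: zero_basis_iff)
  let ?e = "zs @ e2" and ?f = "us @ f2" and ?g = "g1 @ g2"
  have hb1: "hom_basis A 1 (length ?e) (\<lambda>j. cl (?e ! (j - 1)))"
    using hom_basis_strands[of 1 zs e2] zs e2 by (simp add: eval_nat_numeral)
  have hb2: "hom_basis A 2 (length ?f) (\<lambda>j. cl (?f ! (j - 1)))"
    using hom_basis_strands[of 2 "[]" ?f] f0 f2 by (simp add: eval_nat_numeral)
  have hb3: "hom_basis A 3 (length ?g) (\<lambda>j. cl (?g ! (j - 1)))"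
    using hom_basis_strands[of 3 g1 g2] g1 g2 by (simp add: eval_nat_numeral)
  have z1: "cl a \<otimes>\<^bsub>A\<^esub> cl b = \<zero>\<^bsub>A\<^esub>" if "a \<in> Z" "b \<in> Z" "wedge a b \<in> B" for a b
    using that by (simp add: cl_mult cl_eq_zero Zc_wedge)
  have me: "?e ! (i - 1) \<in> Z \<and> (if i \<le> length zs then ?e ! (i - 1) = zs ! (i - 1) \<and> ?e ! (i - 1) \<in> kc 1 2
      else ?e ! (i - 1) \<in> kc 1 3)" if "i \<in> {1..length ?e}" for i
    using nth_append_basis[OF zs e2 that] .
  have mf: "?f ! (i - 1) \<in> Z \<and> ?f ! (i - 1) \<in> kc 2 4" if "i \<in> {1..length ?f}" for i
    using nth_append_basis[OF f2 f0, of i] that by (auto split: if_splits)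
  show ?thesis
  proof (rule that[OF hb1 hb2 hb3])
    show "length zs \<le> length ?e" "length us \<le> length ?f" by simp_all
    show "\<forall>j\<in>{1..length us}. cl (?f ! (j - 1)) = cl (us ! (j - 1))" by (auto simp: nth_append)
    have deg: "\<exists>d. ?e ! (i - 1) \<in> kc 1 d \<and> (d = 2 \<or> d = 3) \<and> (\<not> i \<le> length zs \<longrightarrow> d = 3)"
      if "i \<in> {1..length ?e}" for i
      using me[OF that] by (cases "i \<le> length zs") auto
    show "\<forall>i\<in>{1..length ?e}. \<forall>j\<in>{1..length ?f}. cl (?e ! (i - 1)) \<otimes>\<^bsub>A\<^esub> cl (?f ! (j - 1)) = \<zero>\<^bsub>A\<^esub>"
    proof (intro ballI z1)
      fix i j assume i: "i \<in> {1..length ?e}" and j: "j \<in> {1..length ?f}"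
      show Z: "?e ! (i - 1) \<in> Z" "?f ! (j - 1) \<in> Z" using me[OF i] mf[OF j] by blast+
      obtain d where "?e ! (i - 1) \<in> kc 1 d" "d = 2 \<or> d = 3" using deg[OF i] by blast
      then show "wedge (?e ! (i - 1)) (?f ! (j - 1)) \<in> B"
        using other_products[OF Z(1) _ _ Z(2), of d 4] mf[OF j] by blast
    qed
    show "\<forall>i\<in>{1..length ?e}. \<forall>j\<in>{1..length ?e}. cl (?e ! (i - 1)) \<otimes>\<^bsub>A\<^esub> cl (?e ! (j - 1)) =
        (if i \<le> length zs \<and> j \<le> length zs then cl (wedge (zs ! (i - 1)) (zs ! (j - 1))) else \<zero>\<^bsub>A\<^esub>)"
    proof (intro ballI)
      fix i j assume i: "i \<in> {1..length ?e}" and j: "j \<in> {1..length ?e}"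
      show "cl (?e ! (i - 1)) \<otimes>\<^bsub>A\<^esub> cl (?e ! (j - 1)) =
          (if i \<le> length zs \<and> j \<le> length zs then cl (wedge (zs ! (i - 1)) (zs ! (j - 1))) else \<zero>\<^bsub>A\<^esub>)"
    proof (cases "i \<le> length zs \<and> j \<le> length zs")
      case True
      then have e: "?e ! (i - 1) = zs ! (i - 1)" "?e ! (j - 1) = zs ! (j - 1)" using me[OF i] me[OF j] by auto
      have "zs ! (i - 1) \<in> Z" "zs ! (j - 1) \<in> Z" using me[OF i] me[OF j] unfolding e by auto
      then show ?thesis using True unfolding e by (simp add: cl_mult)
    next
      case False
      obtain d1 where d1: "?e ! (i - 1) \<in> kc 1 d1" "d1 = 2 \<or> d1 = 3" "\<not> i \<le> length zs \<Longrightarrow> d1 = 3"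
        using deg[OF i] by blast
      obtain d2 where d2: "?e ! (j - 1) \<in> kc 1 d2" "d2 = 2 \<or> d2 = 3" "\<not> j \<le> length zs \<Longrightarrow> d2 = 3"
        using deg[OF j] by blast
      have "d1 = 3 \<or> d2 = 3" using False d1(3) d2(3) by blast
      then have "wedge (?e ! (i - 1)) (?e ! (j - 1)) \<in> B"
        using products_11[OF _ d1(1,2) _ d2(1,2)] me[OF i] me[OF j] by blast
      then have "cl (?e ! (i - 1)) \<otimes>\<^bsub>A\<^esub> cl (?e ! (j - 1)) = \<zero>\<^bsub>A\<^esub>"
        using me[OF i] me[OF j] z1 by blast
      then show ?thesis using if_not_P[OF False] by (rule trans[OF _ sym])
      qed
    qed
  qed
qed

lemma koszul_diff_products:
  assumes zs: "is_basis 1 2 zs" and "i < length zs" "j < length zs"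
  shows "koszul_diff (wedge (zs ! i) (zs ! j)) = pscale (quad (zs ! i)) (zs ! j) - pscale (quad (zs ! j)) (zs ! i)"
  using assms is_basisD(2,3)[OF zs] by (intro koszul_diff_wedge_quad) auto

text \<open>If \<open>w\<close> bounds, then each \<open>lincomb (c k) zs\<close> is a lift of the
  zero quadric, and the quadrics of a basis are independent.\<close>

lemma products_boundary:
  assumes zs: "is_basis 1 2 zs" and w: "w \<in> B" "w \<in> kc 2 4"
    and dw: "koszul_diff w = (\<Sum>k<length zs. pscale (quad (zs ! k)) (lincomb (c k) zs))"
    and "k < length zs" "j < length zs"
  shows "c k j = 0"
proof -
  have "\<And>k. lincomb (c k) zs \<in> kc 1 2" by (rule lincomb_kc[OF is_basisD(2)[OF zs]])
  from no_syzygy_boundary[OF zs w dw this assms(5)] show ?thesis by (rule quad_zero[OF zs _ assms(6)])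
qed

section \<open>Three, two, and at most one quadric\<close>

lemma three_quadrics:
  assumes zs: "is_basis 1 2 zs" "length zs = 3"
  shows "has_class A Class_T" "max_mult_rank A"
proof -
  obtain Z0 Z1 Z2 where zl: "zs = [Z0, Z1, Z2]" using zs(2) by (auto simp: numeral_3_eq_3 length_Suc_conv)
  let ?us = "[wedge Z1 Z2, wedge Z2 Z0, wedge Z0 Z1]"
  have Zk: "set zs \<subseteq> Z" "set zs \<subseteq> kc 1 2" using is_basisD[OF zs(1)] by auto
  then have kcs: "Z0 \<in> kc 1 2" "Z1 \<in> kc 1 2" "Z2 \<in> kc 1 2" unfolding zl by simp_all
  have sq: "wedge Z0 Z0 = 0" "wedge Z1 Z1 = 0" "wedge Z2 Z2 = 0"
    by (rule wedge_self_odd, rule kcs, simp)+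
  have anti: "wedge Z1 Z0 = - wedge Z0 Z1" "wedge Z0 Z2 = - wedge Z2 Z0" "wedge Z2 Z1 = - wedge Z1 Z2"
    by (rule anticommute_kc_1; rule kcs)+
  have us: "set ?us \<subseteq> Z" "set ?us \<subseteq> kc 2 4"
    using Zk wedge_kc_1_1[of _ 2 _ 2] unfolding zl by (auto intro: Zc_wedge)
  have d: "koszul_diff (wedge Z1 Z2) = pscale (quad Z1) Z2 - pscale (quad Z2) Z1"
    "koszul_diff (wedge Z2 Z0) = pscale (quad Z2) Z0 - pscale (quad Z0) Z2"
    "koszul_diff (wedge Z0 Z1) = pscale (quad Z0) Z1 - pscale (quad Z1) Z0"
    using koszul_diff_products[OF zs(1), of 1 2] koszul_diff_products[OF zs(1), of 2 0]
      koszul_diff_products[OF zs(1), of 0 1] unfolding zl by simp_all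
  have "indep ?us"
    unfolding indep_def
  proof (intro conjI us(1) allI impI)
    fix c i assume c: "lincomb c ?us \<in> B" and i: "i < length ?us"
    \<comment> \<open>Row \<open>k\<close> collects the terms with coefficient
      \<open>quad (zs ! k)\<close> in the differential of the combination; the result is a
      skew-symmetric matrix.\<close>
    let ?c = "\<lambda>k j. [[0, c 2, - c 1], [- c 2, 0, c 0], [c 1, - c 0, 0]] ! k ! j"
    have "koszul_diff (lincomb c ?us) = (\<Sum>k<length zs. pscale (quad (zs ! k)) (lincomb (?c k) zs))"
      unfolding zl by (simp add: lincomb_Cons koszul_diff_add koszul_diff_pscale d sum_lessThan_3 eval_nat_numeral
          pscale_add_right pscale_diff_right mconst_uminus pscale_uminus_left pscale_uminus_right)
        (simp add: algebra_simps)
    from products_boundary[OF zs(1) c lincomb_kc[OF us(2)] this, of 0 1]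
      products_boundary[OF zs(1) c lincomb_kc[OF us(2)] this, of 0 2]
      products_boundary[OF zs(1) c lincomb_kc[OF us(2)] this, of 1 2]
    have "c 2 = 0" "c 1 = 0" "c 0 = 0" using zs(2) by simp_all
    then show "c i = 0" using i less_3_cases[of i] by auto
  qed
  note us = this us(2)
  show "max_mult_rank A"
  proof (rule max_mult_rank_no_syzygy[OF zs(1) us])
    show "set ?us \<subseteq> {wedge z w |z w. z \<in> set zs \<and> w \<in> set zs}" unfolding zl by auto
    \<comment> \<open>The coefficients are the components of the cross product of \<open>c\<close>
      and \<open>d\<close>.\<close>
    show "\<exists>e. wedge (lincomb c zs) (lincomb d zs) = lincomb e ?us" for c d
      by (rule exI[of _ "\<lambda>k. [c 1 * d 2 - c 2 * d 1, c 2 * d 0 - c 0 * d 2, c 0 * d 1 - c 1 * d 0] ! k"])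
        (simp add: zl lincomb_Cons wedge_add_left wedge_add_right wedge_pscale_left wedge_pscale_right sq anti
          eval_nat_numeral mconst_diff mconst_mult pscale_diff_left pscale_uminus_right pscale_diff_right pscale_add_right algebra_simps)
    show "length ?us = length zs choose 2" using zs(2) by (simp add: eval_nat_numeral)
  qed
  obtain m e n f l h where b: "hom_basis A 1 m e" "hom_basis A 2 n f" "hom_basis A 3 l h"
    "length zs \<le> m" "length ?us \<le> n" "\<forall>j\<in>{1..length ?us}. f j = cl (?us ! (j - 1))"
    "\<forall>i\<in>{1..m}. \<forall>j\<in>{1..m}. e i \<otimes>\<^bsub>A\<^esub> e j =
      (if i \<le> length zs \<and> j \<le> length zs then cl (wedge (zs ! (i - 1)) (zs ! (j - 1))) else \<zero>\<^bsub>A\<^esub>)"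
    "\<forall>i\<in>{1..m}. \<forall>j\<in>{1..n}. e i \<otimes>\<^bsub>A\<^esub> f j = \<zero>\<^bsub>A\<^esub>"
    using bases_no_syzygy[OF zs(1) us] .
  have f: "f 1 = cl (wedge Z1 Z2)" "f 2 = cl (wedge Z2 Z0)" "f 3 = cl (wedge Z0 Z1)"
    using b(6)[rule_format, of 1] b(6)[rule_format, of 2] b(6)[rule_format, of 3] by (simp_all add: numeral_2_eq_2 numeral_3_eq_3)
  have clz: "cl (- wedge a b) = \<ominus>\<^bsub>A\<^esub> cl (wedge a b)" if "a \<in> set zs" "b \<in> set zs" for a b
    using that Zk(1) by (intro cl_uminus[symmetric] Zc_wedge) auto
  have op: "only_products A m e n f
      (\<lambda>i j. if (i, j) = (1, 2) then Some (f 3)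
             else if (i, j) = (3, 1) then Some (f 2)
             else if (i, j) = (2, 3) then Some (f 1) else None) (\<lambda>i j. None)"
    unfolding only_products_def
  proof (intro conjI ballI)
    fix i j assume i: "i \<in> {1..m}" and j: "j \<in> {1..m}"
    show "e i \<otimes>\<^bsub>A\<^esub> e j = (case if (i, j) = (1, 2) then Some (f 3)
             else if (i, j) = (3, 1) then Some (f 2) else if (i, j) = (2, 3) then Some (f 1) else None of Some y \<Rightarrow> y
        | None \<Rightarrow> (case if (j, i) = (1, 2) then Some (f 3)
             else if (j, i) = (3, 1) then Some (f 2) else if (j, i) = (2, 3) then Some (f 1) else None
          of Some y \<Rightarrow> \<ominus>\<^bsub>A\<^esub> y | None \<Rightarrow> \<zero>\<^bsub>A\<^esub>))"
    proof (cases "i \<le> 3 \<and> j \<le> 3")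
      case False
      then show ?thesis unfolding b(7)[rule_format, OF i j] zs(2) by auto
    next
      case True
      then have "i = 1 \<or> i = 2 \<or> i = 3" "j = 1 \<or> j = 2 \<or> j = 3" using i j by auto
      then show ?thesis
        unfolding b(7)[rule_format, OF i j] zs(2)
        by (elim disjE) (simp_all add: f[unfolded One_nat_def numeral_2_eq_2 numeral_3_eq_3] zl sq anti clz[unfolded zl] cl_zero numeral_2_eq_2 numeral_3_eq_3)
    qed
  next
    fix i j assume "i \<in> {1..m}" "j \<in> {1..n}"
    then show "e i \<otimes>\<^bsub>A\<^esub> f j = (case None of Some y \<Rightarrow> y | None \<Rightarrow> \<zero>\<^bsub>A\<^esub>)" using b(8) by simp
  qed
  show "has_class A Class_T"
    unfolding has_class.simps
    by (intro exI[of _ m] exI[of _ n] exI[of _ l] exI[of _ e] exI[of _ f] exI[of _ h] conjI b(1-3) op)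
      (use b(4,5) zs(2) in auto)
qed

lemma two_quadrics:
  assumes zs: "is_basis 1 2 zs" "length zs = 2"
  shows "has_class A (Class_H 1 0)" "max_mult_rank A"
proof -
  obtain Z0 Z1 where zl: "zs = [Z0, Z1]" using zs(2) by (auto simp: numeral_2_eq_2 length_Suc_conv)
  \<comment> \<open>The order of the factors matches the entry \<open>e_2 e_1 = f_1\<close> of the
    class.\<close>
  let ?us = "[wedge Z1 Z0]"
  have Zk: "set zs \<subseteq> Z" "set zs \<subseteq> kc 1 2" using is_basisD[OF zs(1)] by auto
  then have kcs: "Z0 \<in> kc 1 2" "Z1 \<in> kc 1 2" unfolding zl by simp_all
  have sq: "wedge Z0 Z0 = 0" "wedge Z1 Z1 = 0" by (rule wedge_self_odd, rule kcs, simp)+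
  have anti: "wedge Z0 Z1 = - wedge Z1 Z0" by (rule anticommute_kc_1; rule kcs)
  have us: "set ?us \<subseteq> Z" "set ?us \<subseteq> kc 2 4"
    using Zk wedge_kc_1_1[of _ 2 _ 2] unfolding zl by (auto intro: Zc_wedge)
  have d: "koszul_diff (wedge Z1 Z0) = pscale (quad Z1) Z0 - pscale (quad Z0) Z1"
    using koszul_diff_products[OF zs(1), of 1 0] unfolding zl by simp
  have "indep ?us"
    unfolding indep_def
  proof (intro conjI us(1) allI impI)
    fix c i assume c: "lincomb c ?us \<in> B" and i: "i < length ?us"
    let ?c = "\<lambda>k j. [[0, - c 0], [c 0, 0]] ! k ! j"
    have "koszul_diff (lincomb c ?us) = (\<Sum>k<length zs. pscale (quad (zs ! k)) (lincomb (?c k) zs))"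
      unfolding zl by (simp add: lincomb_Cons koszul_diff_pscale d lessThan_Suc
          pscale_diff_right mconst_uminus pscale_uminus_left pscale_uminus_right mult.commute)
    from products_boundary[OF zs(1) c lincomb_kc[OF us(2)] this, of 1 0]
    show "c i = 0" using i zs(2) by simp
  qed
  note us = this us(2)
  show "max_mult_rank A"
  proof (rule max_mult_rank_no_syzygy[OF zs(1) us])
    show "set ?us \<subseteq> {wedge z w |z w. z \<in> set zs \<and> w \<in> set zs}" unfolding zl by auto
    show "\<exists>e. wedge (lincomb c zs) (lincomb d zs) = lincomb e ?us" for c d
      by (rule exI[of _ "\<lambda>k. c 1 * d 0 - c 0 * d 1"])
        (simp add: zl lincomb_Cons wedge_add_left wedge_add_right wedge_pscale_left wedge_pscale_right sq anti
          mconst_diff mconst_mult pscale_diff_left pscale_uminus_right mult.commute)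
    show "length ?us = length zs choose 2" using zs(2) by simp
  qed
  obtain m e n f l h where b: "hom_basis A 1 m e" "hom_basis A 2 n f" "hom_basis A 3 l h"
    "length zs \<le> m" "length ?us \<le> n" "\<forall>j\<in>{1..length ?us}. f j = cl (?us ! (j - 1))"
    "\<forall>i\<in>{1..m}. \<forall>j\<in>{1..m}. e i \<otimes>\<^bsub>A\<^esub> e j =
      (if i \<le> length zs \<and> j \<le> length zs then cl (wedge (zs ! (i - 1)) (zs ! (j - 1))) else \<zero>\<^bsub>A\<^esub>)"
    "\<forall>i\<in>{1..m}. \<forall>j\<in>{1..n}. e i \<otimes>\<^bsub>A\<^esub> f j = \<zero>\<^bsub>A\<^esub>"
    using bases_no_syzygy[OF zs(1) us] .
  have f: "f 1 = cl (wedge Z1 Z0)" using b(6)[rule_format, of 1] by simp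
  have clz: "cl (- wedge Z1 Z0) = \<ominus>\<^bsub>A\<^esub> cl (wedge Z1 Z0)"
    using Zk(1) unfolding zl by (intro cl_uminus[symmetric] Zc_wedge) auto
  have op: "only_products A m e n f
      (\<lambda>i j. if i = 1 + 1 \<and> j \<le> 1 then Some (f j) else None)
      (\<lambda>i j. if i = 1 + 1 \<and> 1 < j \<and> j \<le> 1 + 0 then Some (h (j - 1)) else None)"
    unfolding only_products_def
  proof (intro conjI ballI)
    fix i j assume i: "i \<in> {1..m}" and j: "j \<in> {1..m}"
    show "e i \<otimes>\<^bsub>A\<^esub> e j = (case if i = 1 + 1 \<and> j \<le> 1 then Some (f j) else None of Some y \<Rightarrow> y
        | None \<Rightarrow> (case if j = 1 + 1 \<and> i \<le> 1 then Some (f i) else None of Some y \<Rightarrow> \<ominus>\<^bsub>A\<^esub> y | None \<Rightarrow> \<zero>\<^bsub>A\<^esub>))"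
    proof (cases "i \<le> 2 \<and> j \<le> 2")
      case False
      then show ?thesis unfolding b(7)[rule_format, OF i j] zs(2) by auto
    next
      case True
      then have "i = 1 \<or> i = 2" "j = 1 \<or> j = 2" using i j by auto
      then show ?thesis
        unfolding b(7)[rule_format, OF i j] zs(2)
        by (elim disjE) (simp_all add: f[unfolded One_nat_def] zl sq anti clz cl_zero numeral_2_eq_2)
    qed
  next
    fix i j assume "i \<in> {1..m}" "j \<in> {1..n}"
    then show "e i \<otimes>\<^bsub>A\<^esub> f j = (case if i = 1 + 1 \<and> 1 < j \<and> j \<le> 1 + 0 then Some (h (j - 1)) else None
        of Some y \<Rightarrow> y | None \<Rightarrow> \<zero>\<^bsub>A\<^esub>)" using b(8) by auto
  qed
  show "has_class A (Class_H 1 0)"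
    unfolding has_class.simps
    by (intro exI[of _ m] exI[of _ n] exI[of _ l] exI[of _ e] exI[of _ f] exI[of _ h] conjI b(1-3) op)
      (use b(4,5) zs(2) in auto)
qed

text \<open>A lift of a quadric has square zero, so products in bidegree \<open>(2, 4)\<close>
  vanish; every other product vanishes for degree reasons or because one factor is a linear syzygy.
  This covers nine points, with one quadric, and ten, with none.\<close>

lemma one_quadric:
  assumes zs: "is_basis 1 2 zs" "length zs \<le> 1"
  shows "has_class A (Class_H 0 0)" "max_mult_rank A"
proof -
  have zl: "zs = [] \<or> (\<exists>z. zs = [z])" using zs(2) by (cases zs) auto
  have sq: "wedge z z = 0" if "z \<in> set zs" for z
    using is_basisD(2)[OF zs(1)] that by (intro wedge_self_odd[of z 1 2]) auto
  have 0: "wedge (lincomb c zs) (lincomb d zs) = 0" for c d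
    using zl sq by (elim disjE exE) (simp_all add: lincomb_Cons wedge_pscale_left wedge_pscale_right)
  show "max_mult_rank A"
    by (rule max_mult_rank_no_syzygy[OF zs(1), of "[]"]) (use 0 zs(2) in \<open>auto simp: indep_def binomial_eq_0\<close>)
  show "has_class A (Class_H 0 0)"
  proof (rule has_class_H00, rule ccontr)
    fix z w i d j e
    assume z: "z \<in> Z" "z \<in> kc i d" and w: "w \<in> Z" "w \<in> kc j e" and ij: "0 < i" "0 < j" and n: "wedge z w \<notin> B"
    have zw: "z \<notin> B" "w \<notin> B" using n Bd_wedge_left[OF _ w(1)] Bd_wedge_right[OF z(1)] by blast+
    have "i + 1 \<le> d" "j + 1 \<le> e" "i + j \<le> 3" "d + e \<le> i + j + 2"
      using nonzero_range[of z i d] nonzero_range[of w j e] zw z w ij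
        nonzero_range[of "wedge z w" "i + j" "d + e"] n kc_wedge[OF z(2) w(2)] Zc_wedge[OF z(1) w(1)] by auto
    then have c: "d = i + 1" "e = j + 1" "i = 1 \<and> j = 1 \<or> i = 2 \<or> j = 2" using ij by auto
    from c(3) show False
    proof (elim disjE conjE)
      assume "i = 1" "j = 1"
      then have "z \<in> kc 1 2" "w \<in> kc 1 2" using z w c by (simp_all add: numeral_2_eq_2)
      then obtain a b where "wedge z w - wedge (lincomb a zs) (lincomb b zs) \<in> B"
        using product_lincomb[OF zs(1) z(1) _ w(1)] by blast
      then show False using n by (simp add: 0)
    next
      assume "i = 2"
      then show False using z zw(1) no_syz c(1) by (auto simp: numeral_2_eq_2 numeral_3_eq_3)
    next
      assume "j = 2"
      then show False using w zw(2) no_syz c(2) by (auto simp: numeral_2_eq_2 numeral_3_eq_3)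
    qed
  qed
qed

end

text \<open>A linear syzygy for all points is one for the first six, hence a combination of the two
  matrix rows. It must also be compatible with the seventh point: its covectors, weighted by the
  values \<open>Q k\<close> of the minors at \<open>x 6\<close>, sum to zero. Since
  \<open>Q 2\<close> is nonzero, which puts \<open>x 6\<close> off the cubic, the combination
  vanishes.\<close>

lemma no_syzygies:
  fixes x :: "nat \<Rightarrow> 4 \<Rightarrow> 'k::field_char_0"
  assumes "gp t x g" "7 \<le> t" "gp6 6 x g b"
    and q: "(1 / b 2 - 1 / b 1) * dot (g 1) (x 6) * dot (g 2) (x 6) + (1 / b 1 - 1 / b 0) * dot (g 0) (x 6) * dot (g 1) (x 6) +
      (1 / b 0 - 1 / b 2) * dot (g 0) (x 6) * dot (g 2) (x 6) \<noteq> 0"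
  shows "gp_ns t x g"
proof -
  interpret T: gp t x g by fact
  interpret S: gp6 6 x g b by fact
  have "z \<in> T.B" if z: "z \<in> T.Z" "z \<in> kc 2 3" for z
  proof -
    have "z \<in> S.Z" using z(1) Zc_antimono[of 6 t x] assms(2) by auto
    then obtain c where c: "z - lincomb c [S.SM, S.SN] \<in> S.B" using S.is_basis_span[OF S.basis_23 _ z(2)] by blast
    then have "koszul_diff (z - lincomb c [S.SM, S.SN]) = 0"
      using S.linear_strand_B[OF kc_diff[OF z(2) lincomb_kc[OF S.set_S(2)]]] by blast
    then have dz: "koszul_diff z = (\<Sum>k<3. pscale (S.qq k) (evec (\<lambda>v. - c 0 * S.mv (Suc k) v + c 1 * S.nv (Suc k) v)))"
      by (simp only: koszul_diff_diff_eq S.koszul_diff_lincomb_S) simp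
    define Q where "Q k = mpoly_eval (S.qq k) (x 6)" for k
    define h where "h k v = - c 0 * S.mv (Suc k) v + c 1 * S.nv (Suc k) v" for k v
    have Q2: "Q 2 \<noteq> 0" using q unfolding Q_def S.eval_qq(3) S.a_def by simp
    have e: "(\<Sum>k<3. Q k * h k v) = 0" for v
    proof -
      have lke: "lk (evec f) {v} = mconst (f v)" for f :: "4 \<Rightarrow> 'k"
        by (simp add: evec_def lookup_sum lookup_single when_def)
      have "lk (koszul_diff z) {v} \<in> pideal t x" using z(1) by (simp add: Zc_iff JK_def)
      then have "(\<Sum>k<3. S.qq k * mconst (h k v)) \<in> pideal t x"
        unfolding dz by (simp add: lookup_sum lke h_def)
      moreover have "homogeneous 2 (\<Sum>k<3. S.qq k * mconst (h k v))"
        using homogeneous_scale[OF S.homogeneous_qq] by (intro homogeneous_sum) (simp add: mult.commute)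
      ultimately have "mpoly_eval (\<Sum>k<3. S.qq k * mconst (h k v)) (x 6) = 0"
        using pideal_homogeneous assms(2) by fastforce
      then show ?thesis by (simp add: mpoly_eval_simps Q_def)
    qed
    have d: "(\<Sum>k<3. Q k * (- c 0 * dot (S.mv (Suc k)) y + c 1 * dot (S.nv (Suc k)) y)) = 0" for y
    proof -
      have "(\<Sum>k<3. Q k * (- c 0 * dot (S.mv (Suc k)) y + c 1 * dot (S.nv (Suc k)) y)) = (\<Sum>k<3. Q k * dot (h k) y)"
        by (rule sum.cong) (simp_all add: h_def[abs_def] dot_def algebra_simps sum.distrib sum_distrib_left sum_subtractf sum_negf)
      also have "\<dots> = (\<Sum>k<3. \<Sum>v\<in>UNIV. Q k * h k v * y v)"
        by (simp add: dot_def sum_distrib_left mult.assoc)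
      also have "\<dots> = (\<Sum>v\<in>UNIV. (\<Sum>k<3. Q k * h k v) * y v)"
        by (subst sum.swap) (simp add: sum_distrib_right)
      finally show ?thesis by (simp add: e)
    qed
    \<comment> \<open>The vectors \<open>x 1\<close>, \<open>x 2\<close> and \<open>x 3\<close> each
      see one of the three covectors, and \<open>x 0\<close> sees the sum of the weights.\<close>
    have k0: "Q 0 * (- c 0 + c 1 * S.a 1) = 0" "Q 1 * (- c 0 + c 1 * S.a 2) = 0" "Q 2 * (- c 0 + c 1 * S.a 3) = 0"
      using d[of "x 1"] d[of "x 2"] d[of "x 3"]
      by (simp_all add: S.dot_mv S.dot_nv S.dual sum_lessThan_3 numeral_2_eq_2 numeral_3_eq_3)
    have k3: "(Q 0 + Q 1 + Q 2) * (c 0 - c 1 * S.a 0) = 0"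
      using d[of "x 0"] by (simp add: S.dot_mv S.dot_nv S.dual sum_lessThan_3 algebra_simps del: mult_eq_0_iff)
    have c0: "c 0 = c 1 * S.a 3" using k0(3) Q2 by simp
    have "c 1 = 0"
    proof (rule ccontr)
      assume c1: "c 1 \<noteq> 0"
      have "Q 0 = 0" "Q 1 = 0" using k0(1,2) S.ab_diff c1 unfolding c0 by (auto simp: algebra_simps)
      then have "c 1 * (S.a 3 - S.a 0) = 0" using k3 Q2 unfolding c0 by (auto simp: algebra_simps)
      then show False using c1 S.a_inj[of 3 0] by simp
    qed
    then have "koszul_diff z = 0" unfolding dz using c0 by (simp add: evec_def)
    then show "z \<in> T.B" using T.Bd_linear_strand[of z 1] z(2) by (simp add: numeral_2_eq_2 numeral_3_eq_3)
  qed
  then show ?thesis by unfold_locales blast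
qed

text \<open>Six points leave four quadrics and every further point removes one; in particular
  separation by quadrics forces \<open>t \<le> 10\<close>.\<close>

lemma quadrics_count:
  fixes x :: "nat \<Rightarrow> 4 \<Rightarrow> 'k::field_char_0"
  assumes "gp t x g" "6 \<le> t" "gp6 6 x g b"
  shows "alg_dim (tor_algebra (pideal t x)) (component (tor_algebra (pideal t x)) 1 2) + t = 10"
  using assms(2,1)
proof (induction t rule: dec_induct)
  case base
  interpret S: gp6 6 x g b by fact
  show ?case using S.alg_dim_component[OF S.basis_12] by simp
next
  case (step n)
  have "gp n x g" using gp_antimono[OF step.prems, of n] step.hyps by simp
  then show ?case using adim_12_Suc[OF _ step.prems] step.IH by simp
qed

theorem six_points:
  assumes "gp6 6 x g b"
  shows "has_class (tor_algebra (pideal 6 x)) (Class_H 3 2)" "max_mult_rank (tor_algebra (pideal 6 x))"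
  using gp6.class_H32[OF assms] gp6.max_mult_rank_6[OF assms] .

theorem seven_or_more_points:
  assumes "gp t x g" "7 \<le> t" "gp6 6 x g b"
    and q: "(1 / b 2 - 1 / b 1) * dot (g 1) (x 6) * dot (g 2) (x 6) + (1 / b 1 - 1 / b 0) * dot (g 0) (x 6) * dot (g 1) (x 6) +
      (1 / b 0 - 1 / b 2) * dot (g 0) (x 6) * dot (g 2) (x 6) \<noteq> 0"
  defines "A \<equiv> tor_algebra (pideal t x)"
  shows "t = 7 \<Longrightarrow> has_class A Class_T" "t = 8 \<Longrightarrow> has_class A (Class_H 1 0)" "9 \<le> t \<Longrightarrow> has_class A (Class_H 0 0)"
    and "max_mult_rank A"
proof -
  interpret T: gp_ns t x g by (rule no_syzygies[OF assms(1-4)])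
  obtain zs where zs: "T.is_basis 1 2 zs" by (rule T.obtain_basis)
  have n: "length zs + t = 10"
    using quadrics_count[OF assms(1) _ assms(3)] assms(2) unfolding T.alg_dim_component[OF zs] by simp
  show "t = 7 \<Longrightarrow> has_class A Class_T" using T.three_quadrics(1)[OF zs] n by (simp add: A_def)
  show "t = 8 \<Longrightarrow> has_class A (Class_H 1 0)" using T.two_quadrics(1)[OF zs] n by (simp add: A_def)
  show "9 \<le> t \<Longrightarrow> has_class A (Class_H 0 0)" using T.one_quadric(1)[OF zs] n by (simp add: A_def)
  have "length zs = 3 \<or> length zs = 2 \<or> length zs \<le> 1" using n assms(2) by auto
  then show "max_mult_rank A"
    using T.three_quadrics(2)[OF zs] T.two_quadrics(2)[OF zs] T.one_quadric(2)[OF zs] unfolding A_def by blast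
qed

section \<open>Multihomogeneous functions\<close>

text \<open>The multidegree is explicit because only functions of equal multidegree add up to a
  multihomogeneous one.\<close>

definition multipoly :: "nat \<Rightarrow> (nat \<Rightarrow> nat) \<Rightarrow> ((nat \<Rightarrow> 'v::finite \<Rightarrow> 'k::comm_ring_1) \<Rightarrow> 'k) \<Rightarrow> bool" where
  "multipoly t d \<phi> \<longleftrightarrow> (\<exists>F.
     (\<forall>m\<in>Poly_Mapping.keys F. Poly_Mapping.keys m \<subseteq> {..<t} \<times> UNIV \<and>
        (\<forall>j<t. (\<Sum>v\<in>UNIV. Poly_Mapping.lookup m (j, v)) = d j)) \<and>
     (\<forall>x. mpoly_eval F (\<lambda>(j, v). x j v) = \<phi> x))"

lemma multipoly_zero: "multipoly t d (\<lambda>_. 0)"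
  unfolding multipoly_def by (rule exI[of _ 0]) simp

lemma multipoly_const: "multipoly t (\<lambda>_. 0) (\<lambda>_. c)"
  unfolding multipoly_def by (rule exI[of _ "mconst c"]) (simp add: mconst_def[of c, THEN arg_cong[of _ _ Poly_Mapping.keys]])

lemma multipoly_coord: "j < t \<Longrightarrow> multipoly t (\<lambda>i. if i = j then 1 else 0) (\<lambda>x. x j v)"
  unfolding multipoly_def
  by (rule exI[of _ "mvar (j, v)"])
    (auto simp: mvar_def[of "(j, v)", THEN arg_cong[of _ _ Poly_Mapping.keys]] lookup_single when_def)

lemma multipoly_add:
  assumes "multipoly t d \<phi>" "multipoly t d \<psi>"
  shows "multipoly t d (\<lambda>x. \<phi> x + \<psi> x)"
proof -
  obtain F G where "\<forall>m\<in>Poly_Mapping.keys F. Poly_Mapping.keys m \<subseteq> {..<t} \<times> UNIV \<and>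
        (\<forall>j<t. (\<Sum>v\<in>UNIV. Poly_Mapping.lookup m (j, v)) = d j)" "\<And>x. mpoly_eval F (\<lambda>(j, v). x j v) = \<phi> x"
      "\<forall>m\<in>Poly_Mapping.keys G. Poly_Mapping.keys m \<subseteq> {..<t} \<times> UNIV \<and>
        (\<forall>j<t. (\<Sum>v\<in>UNIV. Poly_Mapping.lookup m (j, v)) = d j)" "\<And>x. mpoly_eval G (\<lambda>(j, v). x j v) = \<psi> x"
    using assms unfolding multipoly_def by auto
  moreover from this have "Poly_Mapping.keys m \<subseteq> {..<t} \<times> UNIV \<and> (\<forall>j<t. (\<Sum>v\<in>UNIV. Poly_Mapping.lookup m (j, v)) = d j)"
    if "m \<in> Poly_Mapping.keys (F + G)" for m
    using Poly_Mapping.keys_add[of F G] that by blast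
  ultimately show ?thesis
    unfolding multipoly_def by (intro exI[of _ "F + G"]) (simp add: mpoly_eval_add)
qed

lemma multipoly_mult:
  assumes "multipoly t d \<phi>" "multipoly t e \<psi>"
  shows "multipoly t (\<lambda>j. d j + e j) (\<lambda>x. \<phi> x * \<psi> x)"
proof -
  obtain F G where F: "\<forall>m\<in>Poly_Mapping.keys F. Poly_Mapping.keys m \<subseteq> {..<t} \<times> UNIV \<and>
        (\<forall>j<t. (\<Sum>v\<in>UNIV. Poly_Mapping.lookup m (j, v)) = d j)" "\<And>x. mpoly_eval F (\<lambda>(j, v). x j v) = \<phi> x"
      and G: "\<forall>m\<in>Poly_Mapping.keys G. Poly_Mapping.keys m \<subseteq> {..<t} \<times> UNIV \<and>
        (\<forall>j<t. (\<Sum>v\<in>UNIV. Poly_Mapping.lookup m (j, v)) = e j)" "\<And>x. mpoly_eval G (\<lambda>(j, v). x j v) = \<psi> x"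
    using assms unfolding multipoly_def by auto
  have "Poly_Mapping.keys m \<subseteq> {..<t} \<times> UNIV \<and> (\<forall>j<t. (\<Sum>v\<in>UNIV. Poly_Mapping.lookup m (j, v)) = d j + e j)"
    if mem: "m \<in> Poly_Mapping.keys (F * G)" for m
  proof -
    obtain a b where m: "m = a + b" "a \<in> Poly_Mapping.keys F" "b \<in> Poly_Mapping.keys G"
      using keys_mult[of F G] mem by blast
    then have "Poly_Mapping.keys a \<subseteq> {..<t} \<times> UNIV" "Poly_Mapping.keys b \<subseteq> {..<t} \<times> UNIV"
      and d: "\<forall>j<t. (\<Sum>v\<in>UNIV. Poly_Mapping.lookup a (j, v)) = d j" "\<forall>j<t. (\<Sum>v\<in>UNIV. Poly_Mapping.lookup b (j, v)) = e j"
      using F(1) G(1) by blast+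
    then have "Poly_Mapping.keys m \<subseteq> {..<t} \<times> UNIV" unfolding m(1) using Poly_Mapping.keys_add[of a b] by blast
    then show ?thesis using d by (simp add: m(1) lookup_add sum.distrib)
  qed
  then show ?thesis
    unfolding multipoly_def using F(2) G(2) by (intro exI[of _ "F * G"]) (auto simp: mpoly_eval_mult)
qed

lemma multipoly_scale: "multipoly t d \<phi> \<Longrightarrow> multipoly t d (\<lambda>x. c * \<phi> x)"
  using multipoly_mult[OF multipoly_const, of t d \<phi> c] by simp

lemma multipoly_diff: "multipoly t d \<phi> \<Longrightarrow> multipoly t d \<psi> \<Longrightarrow> multipoly t d (\<lambda>x. \<phi> x - \<psi> x)"
  using multipoly_add[OF _ multipoly_scale, of t d \<phi> \<psi> "- 1"] by simp

lemma multipoly_sum: "(\<And>i. i \<in> I \<Longrightarrow> multipoly t d (\<phi> i)) \<Longrightarrow> multipoly t d (\<lambda>x. \<Sum>i\<in>I. \<phi> i x)"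
  by (induction I rule: infinite_finite_induct) (auto intro: multipoly_zero multipoly_add)

lemma multipoly_prod:
  "(\<And>i. i \<in> I \<Longrightarrow> multipoly t (d i) (\<phi> i)) \<Longrightarrow> multipoly t (\<lambda>j. \<Sum>i\<in>I. d i j) (\<lambda>x. \<Prod>i\<in>I. \<phi> i x)"
  by (induction I rule: infinite_finite_induct) (auto intro: multipoly_const multipoly_mult)

lemma multipoly_power: "j < t \<Longrightarrow> multipoly t (\<lambda>i. if i = j then n else 0) (\<lambda>x. x j v ^ n)"
  using multipoly_prod[of "{..<n}" t "\<lambda>_ i. if i = j then 1 else 0" "\<lambda>_ x. x j v"] multipoly_coord[of j t v]
  by (simp add: if_distrib cong: if_cong)

lemma multipoly_form:
  assumes h: "homogeneous r h" and j: "j < t"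
  shows "multipoly t (\<lambda>i. if i = j then r else 0) (\<lambda>x. mpoly_eval h (x j))"
  unfolding mpoly_eval_def
proof (intro multipoly_sum multipoly_scale)
  fix m assume m: "m \<in> Poly_Mapping.keys h"
  have "(\<lambda>i. \<Sum>v\<in>Poly_Mapping.keys m. if i = j then Poly_Mapping.lookup m v else 0) = (\<lambda>i. if i = j then r else 0)"
    using h m by (auto simp: homogeneous_def mon_deg_def)
  moreover have "multipoly t (\<lambda>i. \<Sum>v\<in>Poly_Mapping.keys m. if i = j then Poly_Mapping.lookup m v else 0)
      (\<lambda>x. \<Prod>v\<in>Poly_Mapping.keys m. x j v ^ Poly_Mapping.lookup m v)"
    by (intro multipoly_prod multipoly_power j)
  ultimately show "multipoly t (\<lambda>i. if i = j then r else 0) (\<lambda>x. \<Prod>v\<in>Poly_Mapping.keys m. x j v ^ Poly_Mapping.lookup m v)"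
    by (simp only:)
qed

text \<open>Every permutation term takes one entry from each column, so all terms have the same
  multidegree as soon as this holds within each column. For this reason points are always put in
  columns.\<close>

lemma multipoly_det:
  assumes "\<And>i l. i < n \<Longrightarrow> l < n \<Longrightarrow> multipoly t (d l) (\<lambda>x. M x i l)"
  shows "multipoly t (\<lambda>j. \<Sum>l<n. d l j) (\<lambda>x. det (mat n n (\<lambda>(i, l). M x i l)))"
proof -
  have e: "det (mat n n (\<lambda>(i, l). M x i l)) = (\<Sum>p\<in>{p. p permutes {0..<n}}. signof p * (\<Prod>i<n. M x i (p i)))" for x
  proof (subst det_def'[of _ n], simp, rule sum.cong[OF refl])
    fix p assume "p \<in> {p. p permutes {0..<n}}"
    then have "p i < n" if "i < n" for i using permutes_in_image[of p "{0..<n}" i] that by simp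
    then show "signof p * (\<Prod>i = 0..<n. mat n n (\<lambda>(i, l). M x i l) $$ (i, p i)) = signof p * (\<Prod>i<n. M x i (p i))"
      unfolding atLeast0LessThan by (intro arg_cong2[where f = "(*)"] prod.cong) auto
  qed
  show ?thesis
    unfolding e
  proof (intro multipoly_sum multipoly_scale)
    fix p assume "p \<in> {p. p permutes {0..<n}}"
    then have p: "p permutes {..<n}" by (simp add: atLeast0LessThan)
    have "multipoly t (\<lambda>j. \<Sum>i<n. d (p i) j) (\<lambda>x. \<Prod>i<n. M x i (p i))"
      using permutes_in_image[OF p] by (intro multipoly_prod assms) auto
    moreover have "(\<Sum>i<n. d (p i) j) = (\<Sum>l<n. d l j)" for j
      using sum.permute[OF p, of "\<lambda>l. d l j"] by (simp add: comp_def)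
    ultimately show "multipoly t (\<lambda>j. \<Sum>l<n. d l j) (\<lambda>x. \<Prod>i<n. M x i (p i))" by simp
  qed
qed

text \<open>The open set is the nonvanishing locus of \<open>\<phi>\<close>. Membership provides
  some coordinate vectors with \<open>\<phi> x \<noteq> 0\<close>, from which \<open>P\<close> has
  to follow; the sample \<open>x0\<close> shows that the set is nonempty.\<close>

lemma for_general_pointsI:
  fixes \<phi> :: "(nat \<Rightarrow> 'v::finite \<Rightarrow> 'k::field) \<Rightarrow> 'k"
  assumes "multipoly t d \<phi>" and x0: "\<phi> x0 \<noteq> 0" "\<And>j. j < t \<Longrightarrow> x0 j \<noteq> (\<lambda>_. 0)"
    and P: "\<And>p x. (\<And>j. j < t \<Longrightarrow> p j \<in> proj_space) \<Longrightarrow> (\<And>j. j < t \<Longrightarrow> x j \<in> p j) \<Longrightarrow> \<phi> x \<noteq> 0 \<Longrightarrow> P p"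
  shows "for_general_points t P"
proof -
  obtain F where F: "\<forall>m\<in>Poly_Mapping.keys F. Poly_Mapping.keys m \<subseteq> {..<t} \<times> UNIV \<and>
        (\<forall>j<t. (\<Sum>v\<in>UNIV. Poly_Mapping.lookup m (j, v)) = d j)" "\<And>x. mpoly_eval F (\<lambda>(j, v). x j v) = \<phi> x"
    using assms(1) unfolding multipoly_def by auto
  define U where "U = {p \<in> proj_tuples t. \<not> vanishes_at_tuple t F p}"
  have "multihomogeneous t F" using F(1) unfolding multihomogeneous_def by blast
  moreover have "proj_tuples t - U = {p \<in> proj_tuples t. \<forall>G\<in>{F}. vanishes_at_tuple t G p}"
    by (auto simp: U_def)
  ultimately have "zariski_open t U"
    unfolding zariski_open_def zariski_closed_def by (intro conjI exI[of _ "{F}"]) (auto simp: U_def)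
  moreover have "(\<lambda>j\<in>{..<t}. {\<lambda>v. c * x0 j v |c. c \<noteq> 0}) \<in> U"
  proof -
    have "x0 j \<in> {\<lambda>v. c * x0 j v |c. c \<noteq> 0}" for j by (auto intro!: exI[of _ 1])
    then show ?thesis
      using x0 F(2) by (auto simp: U_def proj_tuples_def vanishes_at_tuple_def proj_space_def intro!: exI[of _ x0])
  qed
  moreover have "P p" if "p \<in> U" for p
  proof -
    from that obtain x where "\<And>j. j < t \<Longrightarrow> x j \<in> p j" "\<phi> x \<noteq> 0"
      using F(2) by (auto simp: U_def vanishes_at_tuple_def)
    then show ?thesis using P that by (auto simp: U_def proj_tuples_def PiE_mem)
  qed
  ultimately show ?thesis unfolding for_general_points_def by blast
qed

section \<open>Separation of points by forms\<close>

lemma det_nonzero_inverse: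
  fixes A :: "'k::field mat"
  assumes A: "A \<in> carrier_mat n n" and "det A \<noteq> 0"
  obtains B where "\<forall>i<n. \<forall>j<n. (\<Sum>k<n. B i k * A $$ (k, j)) = (if i = j then 1 else 0)"
    "\<forall>i<n. \<forall>j<n. (\<Sum>k<n. A $$ (i, k) * B k j) = (if i = j then 1 else 0)"
proof
  let ?B = "\<lambda>i k. adj_mat A $$ (i, k) / det A"
  note adj = adj_mat[OF A]
  show "\<forall>i<n. \<forall>j<n. (\<Sum>k<n. ?B i k * A $$ (k, j)) = (if i = j then 1 else 0)"
  proof (intro allI impI)
    fix i j assume ij: "i < n" "j < n"
    have "(\<Sum>k<n. adj_mat A $$ (i, k) * A $$ (k, j)) = (adj_mat A * A) $$ (i, j)"
      using A adj(1) ij by (simp add: scalar_prod_def atLeast0LessThan)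
    then show "(\<Sum>k<n. ?B i k * A $$ (k, j)) = (if i = j then 1 else 0)"
      unfolding adj(3) using ij assms(2) by (simp add: sum_divide_distrib[symmetric])
  qed
  show "\<forall>i<n. \<forall>j<n. (\<Sum>k<n. A $$ (i, k) * ?B k j) = (if i = j then 1 else 0)"
  proof (intro allI impI)
    fix i j assume ij: "i < n" "j < n"
    have "(\<Sum>k<n. A $$ (i, k) * adj_mat A $$ (k, j)) = (A * adj_mat A) $$ (i, j)"
      using A adj(1) ij by (simp add: scalar_prod_def atLeast0LessThan)
    then show "(\<Sum>k<n. A $$ (i, k) * ?B k j) = (if i = j then 1 else 0)"
      unfolding adj(2) using ij assms(2) by (simp add: sum_divide_distrib[symmetric])
  qed
qed

lemma separated_cong: "(\<And>q. q < n \<Longrightarrow> x q = y q) \<Longrightarrow> separated r n x \<longleftrightarrow> separated r n y"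
  by (simp add: separated_def)

lemma separated_antimono: "separated r n x \<Longrightarrow> m \<le> n \<Longrightarrow> separated r m x"
  unfolding separated_def by (meson order.strict_trans2)

lemma separated_rescale:
  fixes x :: "nat \<Rightarrow> 'v \<Rightarrow> 'k::field"
  assumes "separated r n x" "\<And>p. p < n \<Longrightarrow> c p \<noteq> 0"
  shows "separated r n (\<lambda>p v. c p * x p v)"
  unfolding separated_def
proof (intro allI impI)
  fix p assume p: "p < n"
  obtain h where h: "homogeneous r h" "\<forall>q<n. mpoly_eval h (x q) = (if q = p then 1 else 0)"
    using assms(1) p unfolding separated_def by blast
  show "\<exists>h. homogeneous r h \<and> (\<forall>q<n. mpoly_eval h (\<lambda>v. c q * x q v) = (if q = p then 1 else 0))"
    using h(2) assms(2)[OF p]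
    by (intro exI[of _ "mconst (1 / c p ^ r) * h"])
      (auto simp: homogeneous_scale[OF h(1)] mpoly_eval_mult mpoly_eval_scale[OF h(1)])
qed

text \<open>The new form is normalized at \<open>x n\<close> and subtracted from the old separating
  forms to kill their values there.\<close>

lemma separated_extend:
  fixes x :: "nat \<Rightarrow> 'v \<Rightarrow> 'k::field"
  assumes sep: "separated r n x" and h: "homogeneous r h" "\<And>q. q < n \<Longrightarrow> mpoly_eval h (x q) = 0" "mpoly_eval h (x n) \<noteq> 0"
  shows "separated r (Suc n) x"
  unfolding separated_def
proof (intro allI impI)
  fix p assume p: "p < Suc n"
  define h' where "h' = mconst (1 / mpoly_eval h (x n)) * h"
  have h': "homogeneous r h'" "\<And>q. q < Suc n \<Longrightarrow> mpoly_eval h' (x q) = (if q = n then 1 else 0)"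
    using h by (auto simp: h'_def homogeneous_scale mpoly_eval_mult less_Suc_eq)
  show "\<exists>h. homogeneous r h \<and> (\<forall>q<Suc n. mpoly_eval h (x q) = (if q = p then 1 else 0))"
  proof (cases "p = n")
    case True
    then show ?thesis using h' by blast
  next
    case False
    then have "p < n" using p by simp
    then obtain f where f: "homogeneous r f" "\<forall>q<n. mpoly_eval f (x q) = (if q = p then 1 else 0)"
      using sep unfolding separated_def by blast
    show ?thesis
      using f h' False
      by (intro exI[of _ "f - mconst (mpoly_eval f (x n)) * h'"])
        (auto simp: homogeneous_diff homogeneous_scale mpoly_eval_diff mpoly_eval_mult less_Suc_eq)
  qed
qed

lemma separated_nonzero: "separated r n x \<Longrightarrow> 0 < r \<Longrightarrow> p < n \<Longrightarrow> x p \<noteq> (\<lambda>_. 0)"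
  for x :: "nat \<Rightarrow> 'v \<Rightarrow> 'k::field"
proof
  assume "separated r n x" "p < n" "0 < r" and x: "x p = (\<lambda>_. 0)"
  then obtain h where h: "homogeneous r h" "mpoly_eval h (x p) = 1" unfolding separated_def by fastforce
  show False using mpoly_eval_scale[OF h(1), of 0 "x p"] h(2) \<open>0 < r\<close> by (simp add: x zero_power)
qed

lemma vanishing_form_exists:
  fixes x :: "nat \<Rightarrow> 'v::finite \<Rightarrow> 'k::field"
  assumes "n < card {m :: 'v \<Rightarrow>\<^sub>0 nat. mon_deg m = r}"
  obtains h where "homogeneous r h" "h \<noteq> 0" "\<And>q. q < n \<Longrightarrow> mpoly_eval h (x q) = 0"
proof -
  let ?M = "{m :: 'v \<Rightarrow>\<^sub>0 nat. mon_deg m = r}"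
  obtain c where c: "\<exists>m\<in>?M. c m \<noteq> 0" "\<And>q. q < n \<Longrightarrow> (\<Sum>m\<in>?M. c m * mon_eval m (x q)) = 0"
    using linear_relation_exists[OF finite_mon_deg assms, of "\<lambda>q m. mon_eval m (x q)"] by blast
  let ?h = "\<Sum>m\<in>?M. Poly_Mapping.single m (c m)"
  show ?thesis
  proof (rule that)
    show "homogeneous r ?h" by (intro homogeneous_sum homogeneous_single) simp
    have "Poly_Mapping.lookup ?h m = c m" if "m \<in> ?M" for m
      using that by (simp add: lookup_sum lookup_single when_def sum.delta finite_mon_deg)
    then show "?h \<noteq> 0" using c(1) by (metis lookup_zero)
    show "mpoly_eval ?h (x q) = 0" if "q < n" for q using c(2)[OF that] by (simp add: mpoly_eval_sum)
  qed
qed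

lemma separated_extension_exists:
  fixes x :: "nat \<Rightarrow> 'v::finite \<Rightarrow> 'k::field"
  assumes inf: "infinite (UNIV :: 'k set)" and x: "separated r n x"
    and N: "n \<le> N" "N \<le> card {m :: 'v \<Rightarrow>\<^sub>0 nat. mon_deg m = r}"
  shows "\<exists>y. separated r N y \<and> (\<forall>q<n. y q = x q)"
  using N
proof (induction N rule: dec_induct)
  case base
  then show ?case using x by blast
next
  case (step N)
  then obtain y where y: "separated r N y" "\<forall>q<n. y q = x q" by auto
  have "N < card {m :: 'v \<Rightarrow>\<^sub>0 nat. mon_deg m = r}" using step.prems by simp
  then obtain h where h: "homogeneous r h" "h \<noteq> 0" "\<And>q. q < N \<Longrightarrow> mpoly_eval h (y q) = 0"
    using vanishing_form_exists by blast
  obtain z where z: "mpoly_eval h z \<noteq> 0" using mpoly_nonvanishing[OF inf h(2)] .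
  have "separated r N (y(N := z))" using y(1) separated_cong[of N y "y(N := z)" r] by simp
  then have "separated r (Suc N) (y(N := z))" by (rule separated_extend) (use h z in auto)
  moreover have "\<forall>q<n. (y(N := z)) q = x q" using y(2) step.hyps by simp
  ultimately show ?case by blast
qed

lemma lookup_mconst_mult: "Poly_Mapping.lookup (mconst k * q) m = k * Poly_Mapping.lookup q m"
  by (rule mpoly_additive_eq[where f = "\<lambda>q. Poly_Mapping.lookup (mconst k * q) m" and g = "\<lambda>q. k * Poly_Mapping.lookup q m"])
    (simp_all add: lookup_add distrib_left mconst_def mult_single lookup_single when_def)

text \<open>Separating forms are independent, hence they already span when there are as many of them
  as monomials; and a combination of them that vanishes at all the points is zero.\<close>

lemma separated_no_forms:
  fixes x :: "nat \<Rightarrow> 'v::finite \<Rightarrow> 'k::field"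
  assumes sep: "separated s N x" and N: "card {m :: 'v \<Rightarrow>\<^sub>0 nat. mon_deg m = s} \<le> N"
    and f: "homogeneous s f" "\<And>q. q < N \<Longrightarrow> mpoly_eval f (x q) = 0"
  shows "f = 0"
proof -
  let ?M = "{m :: 'v \<Rightarrow>\<^sub>0 nat. mon_deg m = s}"
  have "\<forall>p. \<exists>h. p < N \<longrightarrow> homogeneous s h \<and> (\<forall>q<N. mpoly_eval h (x q) = (if q = p then 1 else 0))"
    using sep unfolding separated_def by blast
  then obtain h where h: "\<And>p. p < N \<Longrightarrow> homogeneous s (h p)"
    "\<And>p q. p < N \<Longrightarrow> q < N \<Longrightarrow> mpoly_eval (h p) (x q) = (if q = p then 1 else 0)"
    unfolding choice_iff by blast
  \<comment> \<open>The separating forms followed by \<open>f\<close>: more forms than monomials, so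
    there is a relation, and evaluation at the points leaves only the term of
    \<open>f\<close>.\<close>
  define F where "F p = (if p < N then h p else f)" for p
  obtain e where e: "bij_betw e {0..<card ?M} ?M" using ex_bij_betw_nat_finite[OF finite_mon_deg] by blast
  obtain c where c: "\<exists>p\<in>{..N}. c p \<noteq> 0" "\<forall>a<card ?M. (\<Sum>p\<in>{..N}. c p * Poly_Mapping.lookup (F p) (e a)) = 0"
    using linear_relation_exists[of "{..N}" "card ?M" "\<lambda>a p. Poly_Mapping.lookup (F p) (e a)"] N by auto
  let ?g = "\<Sum>p\<le>N. mconst (c p) * F p"
  have "homogeneous s ?g" using h(1) f(1) by (intro homogeneous_sum homogeneous_scale) (auto simp: F_def)
  have g0: "?g = 0"
  proof (rule poly_mapping_eqI)
    fix m
    show "Poly_Mapping.lookup ?g m = Poly_Mapping.lookup 0 m"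
    proof (cases "m \<in> ?M")
      case True
      then have "m \<in> e ` {0..<card ?M}" using e unfolding bij_betw_def by blast
      then obtain a where "a < card ?M" "m = e a" by auto
      then show ?thesis using c(2) by (simp add: lookup_sum lookup_mconst_mult)
    next
      case False
      then show ?thesis using \<open>homogeneous s ?g\<close> unfolding homogeneous_def by (auto simp: in_keys_iff)
    qed
  qed
  have cq: "c q = 0" if q: "q < N" for q
  proof -
    have "0 = (\<Sum>p\<le>N. c p * mpoly_eval (F p) (x q))"
      using arg_cong[OF g0, of "\<lambda>g. mpoly_eval g (x q)"] by (simp add: mpoly_eval_simps)
    also have "\<dots> = (\<Sum>p\<le>N. if p = q then c q else 0)"
      using h(2)[OF _ q] f(2)[OF q] q by (intro sum.cong) (auto simp: F_def)
    finally show ?thesis using q by simp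
  qed
  then have cN: "c N \<noteq> 0" using c(1) by (metis atMost_iff le_neq_implies_less)
  have "mconst (c N) * f = ?g"
    using cq by (subst sum.mono_neutral_right[of "{..N}" "{N}"]) (auto simp: F_def)
  then have "mconst (1 / c N) * (mconst (c N) * f) = 0" using g0 by simp
  then show ?thesis using cN by (simp add: mult.assoc[symmetric] mconst_mult[symmetric])
qed

text \<open>The forms that separate the sample points are kept while the points move. The matrix of
  their values is the identity at the sample; wherever its determinant is nonzero, the inverse
  matrix combines them into separating forms.\<close>

lemma separated_open:
  fixes x0 :: "nat \<Rightarrow> 'v::finite \<Rightarrow> 'k::field"
  assumes "separated r n x0" "n \<le> t"
  obtains d \<phi> where "multipoly t d \<phi>" "\<phi> x0 \<noteq> 0" "\<forall>x. \<phi> x \<noteq> 0 \<longrightarrow> separated r n x"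
proof -
  have "\<forall>p. \<exists>h. p < n \<longrightarrow> homogeneous r h \<and> (\<forall>q<n. mpoly_eval h (x0 q) = (if q = p then 1 else 0))"
    using assms(1) unfolding separated_def by blast
  then obtain h where h: "\<And>p. p < n \<Longrightarrow> homogeneous r (h p)"
    "\<And>p q. p < n \<Longrightarrow> q < n \<Longrightarrow> mpoly_eval (h p) (x0 q) = (if q = p then 1 else 0)"
    unfolding choice_iff by blast
  define M where "M x = mat n n (\<lambda>(i, l). mpoly_eval (h i) (x l))" for x
  show ?thesis
  proof (rule that)
    show "multipoly t (\<lambda>j. \<Sum>l<n. if j = l then r else 0) (\<lambda>x. det (M x))"
      unfolding M_def using h(1) assms(2) by (intro multipoly_det multipoly_form) auto
    have "M x0 = 1\<^sub>m n" unfolding M_def using h(2) by (intro eq_matI) auto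
    then show "det (M x0) \<noteq> 0" by simp
    show "\<forall>x. det (M x) \<noteq> 0 \<longrightarrow> separated r n x"
    proof (intro allI impI)
      fix x assume "det (M x) \<noteq> 0"
      moreover have "M x \<in> carrier_mat n n" by (simp add: M_def)
      ultimately have "\<exists>B. \<forall>i<n. \<forall>j<n. (\<Sum>k<n. B i k * M x $$ (k, j)) = (if i = j then 1 else 0)"
        by (elim det_nonzero_inverse) (assumption, rule exI)
      then obtain B where B: "\<forall>i<n. \<forall>j<n. (\<Sum>k<n. B i k * M x $$ (k, j)) = (if i = j then 1 else 0)" ..
      show "separated r n x"
        unfolding separated_def
      proof (intro allI impI)
        fix p assume p: "p < n"
        have "mpoly_eval (\<Sum>k<n. mconst (B p k) * h k) (x q) = (if q = p then 1 else 0)" if "q < n" for q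
          using B[rule_format, OF p that] that by (auto simp: mpoly_eval_simps M_def)
        then show "\<exists>h. homogeneous r h \<and> (\<forall>q<n. mpoly_eval h (x q) = (if q = p then 1 else 0))"
          using h(1) by (intro exI[of _ "\<Sum>k<n. mconst (B p k) * h k"]) (auto intro!: homogeneous_sum homogeneous_scale)
      qed
    qed
  qed
qed

section \<open>Counting monomials in four variables\<close>

lemma card_mon_deg_1: "card {m :: 4 \<Rightarrow>\<^sub>0 nat. mon_deg m = 1} = 4"
proof -
  have "{m :: 4 \<Rightarrow>\<^sub>0 nat. mon_deg m = 1} = (\<lambda>v. Poly_Mapping.single v 1) ` UNIV"
  proof (intro equalityI subsetI)
    fix m :: "4 \<Rightarrow>\<^sub>0 nat" assume "m \<in> {m. mon_deg m = 1}"
    then have "mon_deg m = Suc 0" by simp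
    then obtain v n where "m = n + Poly_Mapping.single v 1" "mon_deg n = 0" using mon_deg_Suc by blast
    then show "m \<in> (\<lambda>v. Poly_Mapping.single v 1) ` UNIV" by (auto simp: mon_deg_eq_0)
  qed auto
  moreover have "inj (\<lambda>v :: 4. Poly_Mapping.single v (1 :: nat))"
    by (rule injI) (metis lookup_single_eq lookup_single_not_eq zero_neq_one)
  ultimately show ?thesis by (simp add: card_image)
qed

lemma single_add_single_eq:
  assumes "Poly_Mapping.single u (1::nat) + Poly_Mapping.single v 1 = Poly_Mapping.single u' 1 + Poly_Mapping.single v' 1"
  shows "u = u' \<and> v = v' \<or> u = v' \<and> v = u'"
proof -
  have l: "(if u = w then 1 else 0) + (if v = w then 1 else 0) = (if u' = w then 1 else 0) + (if v' = w then 1 else (0::nat))" for w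
    using arg_cong[OF assms, of "\<lambda>m. Poly_Mapping.lookup m w"] unfolding lookup_add lookup_single when_def .
  consider "u = u'" | "u = v'" | "u \<noteq> u'" "u \<noteq> v'" by blast
  then show ?thesis
  proof cases
    case 1
    then have "v = v'" using l[of v] by (simp split: if_splits)
    then show ?thesis using 1 by simp
  next
    case 2
    then have "v = u'" using l[of v] by (simp add: add.commute split: if_splits)
    then show ?thesis using 2 by simp
  next
    case 3
    then show ?thesis using l[of u] by simp
  qed
qed

lemma card_mon_deg_2: "card {m :: 4 \<Rightarrow>\<^sub>0 nat. mon_deg m = 2} = 10"
proof -
  obtain e where e: "bij_betw e {0..<4::nat} (UNIV :: 4 set)"
    using ex_bij_betw_nat_finite[of "UNIV :: 4 set"] by auto
  define I where "I = {(i, j). i \<le> j \<and> j < (4::nat)}"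
  define f where "f = (\<lambda>(i, j). Poly_Mapping.single (e i) (1::nat) + Poly_Mapping.single (e j) 1)"
  have inj: "i = j" if "e i = e j" "i < 4" "j < 4" for i j
    using e that by (auto simp: bij_betw_def inj_on_def)
  have "{m :: 4 \<Rightarrow>\<^sub>0 nat. mon_deg m = 2} = f ` I"
  proof (intro equalityI subsetI)
    fix m :: "4 \<Rightarrow>\<^sub>0 nat" assume "m \<in> {m. mon_deg m = 2}"
    then have "mon_deg m = Suc (Suc 0)" by simp
    then obtain v n where n: "m = n + Poly_Mapping.single v 1" "mon_deg n = Suc 0" using mon_deg_Suc by blast
    then obtain u n' where n': "n = n' + Poly_Mapping.single u 1" "mon_deg n' = 0" using mon_deg_Suc by blast
    have "\<exists>i<4. w = e i" for w
    proof -
      have "w \<in> e ` {0..<4}" using e unfolding bij_betw_def by simp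
      then show ?thesis by auto
    qed
    then obtain i j where ij: "i < 4" "j < 4" "u = e i" "v = e j" by metis
    show "m \<in> f ` I"
    proof (cases "i \<le> j")
      case True
      then show ?thesis using n n' ij by (intro image_eqI[of _ _ "(i, j)"]) (auto simp: f_def I_def mon_deg_eq_0)
    next
      case False
      then show ?thesis using n n' ij by (intro image_eqI[of _ _ "(j, i)"]) (auto simp: f_def I_def mon_deg_eq_0 add.commute)
    qed
  qed (auto simp: f_def mon_deg_add)
  moreover have "inj_on f I"
  proof (rule inj_onI)
    fix p q assume "p \<in> I" "q \<in> I" and eq: "f p = f q"
    then obtain i j k l where pq: "p = (i, j)" "q = (k, l)" "i \<le> j" "j < 4" "k \<le> l" "l < 4" by (auto simp: I_def)
    have "e i = e k \<and> e j = e l \<or> e i = e l \<and> e j = e k"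
      by (rule single_add_single_eq) (use eq in \<open>simp add: pq f_def\<close>)
    moreover have "i < 4" "k < 4" using pq by simp_all
    ultimately have "i = k \<and> j = l \<or> i = l \<and> j = k"
      using inj[of i k] inj[of j l] inj[of i l] inj[of j k] pq(4,6) by argo
    then show "p = q" using pq by auto
  qed
  moreover have "I = prod.swap ` (SIGMA j:{..<4}. {..j})" by (auto simp: I_def)
  then have "card I = (\<Sum>j<4. Suc j)" by (simp add: card_image)
  then have "card I = 10" by (simp add: eval_nat_numeral)
  ultimately show ?thesis by (simp add: card_image)
qed

text \<open>A crude bound, enough to see that some degree has at least \<open>t\<close>
  monomials.\<close>

lemma card_mon_deg_ge: "r < card {m :: 4 \<Rightarrow>\<^sub>0 nat. mon_deg m = r}"
proof -
  let ?f = "\<lambda>a. Poly_Mapping.single (0::4) a + Poly_Mapping.single 1 (r - a)"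
  have "Poly_Mapping.lookup (?f a) 0 = a" for a by (simp add: lookup_add lookup_single)
  then have "inj_on ?f {..r}" by (intro inj_on_inverseI[where g = "\<lambda>m. Poly_Mapping.lookup m 0"])
  moreover have "?f ` {..r} \<subseteq> {m. mon_deg m = r}" by (auto simp: mon_deg_add)
  ultimately have "card {..r} \<le> card {m :: 4 \<Rightarrow>\<^sub>0 nat. mon_deg m = r}"
    using card_inj_on_le[OF _ _ finite_mon_deg] by blast
  then show ?thesis by simp
qed

section \<open>Brackets\<close>

text \<open>A numbering of the four variables, chosen once, so that points become columns of
  matrices indexed by natural numbers.\<close>

definition en :: "nat \<Rightarrow> 4" where
  "en = (SOME e. bij_betw e {..<4} UNIV)"

lemma bij_en: "bij_betw en {..<4} UNIV"
  unfolding en_def using ex_bij_betw_nat_finite[of "UNIV :: 4 set"]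
  by (intro someI_ex[of "\<lambda>e. bij_betw e {..<4} UNIV"]) (simp add: atLeast0LessThan)

definition en_inv :: "4 \<Rightarrow> nat" where
  "en_inv = inv_into {..<4} en"

lemma en_inv_en [simp]: "k < 4 \<Longrightarrow> en_inv (en k) = k"
  unfolding en_inv_def using bij_en by (simp add: bij_betw_def)

lemma en_en_inv: "en_inv v < 4" "en (en_inv v) = v"
  using bij_betw_inv_into[OF bij_en] bij_betw_inv_into_right[OF bij_en, of v]
  by (auto simp: en_inv_def bij_betw_def)

lemma dot_en: "dot c y = (\<Sum>k<4. c (en k) * y (en k))"
  unfolding dot_def by (rule sum.reindex_bij_betw[OF bij_en, symmetric])

definition frame_mat :: "(nat \<Rightarrow> 4 \<Rightarrow> 'k) \<Rightarrow> 'k mat" where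
  "frame_mat x = mat 4 4 (\<lambda>(i, j). x j (en i))"

text \<open>The inverse matrix gives the dual basis, and Cramer's rule writes coordinates as
  quotients of determinants, which makes conditions on coordinates polynomial.\<close>

lemma frame_dual_basis:
  fixes x :: "nat \<Rightarrow> 4 \<Rightarrow> 'k::field"
  assumes "det (frame_mat x) \<noteq> 0"
  obtains g where "\<forall>i<4. \<forall>j<4. dot (g i) (x j) = (if i = j then 1 else 0)"
    "\<forall>y v. y v = (\<Sum>i<4. dot (g i) y * x i v)"
    "\<forall>i<4. \<forall>y. det (frame_mat (x(i := y))) = dot (g i) y * det (frame_mat x)"
proof -
  let ?A = "frame_mat x"
  have A: "?A \<in> carrier_mat 4 4" by (simp add: frame_mat_def)
  obtain B where B: "\<forall>i<4. \<forall>j<4. (\<Sum>k<4. B i k * ?A $$ (k, j)) = (if i = j then 1 else 0)"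
    "\<forall>i<4. \<forall>j<4. (\<Sum>k<4. ?A $$ (i, k) * B k j) = (if i = j then 1 else 0)"
    by (rule det_nonzero_inverse[OF A assms])
  define g where "g i v = B i (en_inv v)" for i v
  have dg: "dot (g i) y = (\<Sum>k<4. B i k * y (en k))" for i y
    unfolding dot_en by (rule sum.cong) (auto simp: g_def)
  have coord: "y v = (\<Sum>i<4. dot (g i) y * x i v)" for y v
  proof -
    let ?r = "en_inv v"
    have r: "?r < 4" "en ?r = v" using en_en_inv by auto
    have "(\<Sum>i<4. dot (g i) y * x i v) = (\<Sum>k<4. (\<Sum>i<4. ?A $$ (?r, i) * B i k) * y (en k))"
      unfolding dg sum_distrib_right using r by (subst sum.swap) (simp add: frame_mat_def algebra_simps)
    also have "\<dots> = (\<Sum>k<4. if k = ?r then y (en k) else 0)"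
      using B(2) r(1) by (intro sum.cong) auto
    finally show ?thesis using r by simp
  qed
  show ?thesis
  proof (rule that)
    show "\<forall>i<4. \<forall>j<4. dot (g i) (x j) = (if i = j then 1 else 0)"
      using B(1) by (simp add: dg frame_mat_def)
    show "\<forall>y v. y v = (\<Sum>i<4. dot (g i) y * x i v)" using coord by blast
    show "\<forall>i<4. \<forall>y. det (frame_mat (x(i := y))) = dot (g i) y * det (frame_mat x)"
    proof (intro allI impI)
      fix i y assume i: "i < (4::nat)"
      let ?c = "vec 4 (\<lambda>i. dot (g i) y)"
      have "(?A *\<^sub>v ?c) $ r = y (en r)" if "r < 4" for r
        using that coord[of y "en r"]
        by (simp add: frame_mat_def scalar_prod_def atLeast0LessThan mult.commute)
      then have "replace_col ?A (?A *\<^sub>v ?c) i = frame_mat (x(i := y))"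
        by (intro eq_matI) (auto simp: replace_col_def frame_mat_def)
      then show "det (frame_mat (x(i := y))) = dot (g i) y * det (frame_mat x)"
        using cramer_lemma_mat[OF A, of ?c i] i by simp
    qed
  qed
qed

text \<open>The frame determinant with its vector \<open>i\<close> exchanged for \<open>x p\<close>;
  up to the common factor \<open>det (frame_mat x)\<close> it is the coordinate \<open>i\<close> of
  \<open>x p\<close>.\<close>

definition bracket :: "nat \<Rightarrow> nat \<Rightarrow> (nat \<Rightarrow> 4 \<Rightarrow> 'k::comm_ring_1) \<Rightarrow> 'k" where
  "bracket i p x = det (frame_mat (x(i := x p)))"

definition bracket_deg :: "nat \<Rightarrow> nat \<Rightarrow> nat \<Rightarrow> nat" where
  "bracket_deg i p j = (\<Sum>l<4. if j = (if l = i then p else l) then 1 else 0)"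

text \<open>Written as sums on both sides to avoid subtraction of natural numbers. The multidegree
  splits into a part depending on \<open>i\<close> and a part depending on \<open>p\<close>, so
  exchanging indices between two brackets does not change the multidegree of their product.\<close>

lemma bracket_deg_eq:
  "i < 4 \<Longrightarrow> bracket_deg i p j + (if j = i then 1 else 0) = (if j < 4 then 1 else 0) + (if j = p then 1 else 0)"
  unfolding bracket_deg_def sum_lessThan_4 using less_4_cases[of i] less_4_cases[of j] by auto

lemma multipoly_bracket:
  assumes "4 \<le> t" "p < t"
  shows "multipoly t (bracket_deg i p) (bracket i p :: _ \<Rightarrow> 'k::comm_ring_1)"
proof -
  have "multipoly t (\<lambda>j. if j = (if l = i then p else l) then 1 else 0) (\<lambda>x :: nat \<Rightarrow> 4 \<Rightarrow> 'k. (x(i := x p)) l (en r))"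
    if "l < 4" for l r
  proof -
    have e: "(\<lambda>x. (x(i := x p)) l (en r)) = (\<lambda>x :: nat \<Rightarrow> 4 \<Rightarrow> 'k. x (if l = i then p else l) (en r))" by auto
    have "(if l = i then p else l) < t" using that assms by simp
    then show ?thesis unfolding e by (rule multipoly_coord)
  qed
  then show ?thesis
    unfolding bracket_def[abs_def] bracket_deg_def[abs_def] frame_mat_def by (intro multipoly_det) auto
qed

text \<open>After normalization of the frame, vanishing of this expression means
  \<open>b i = b j\<close>.\<close>

definition cross_bracket :: "nat \<Rightarrow> nat \<Rightarrow> (nat \<Rightarrow> 4 \<Rightarrow> 'k::comm_ring_1) \<Rightarrow> 'k" where
  "cross_bracket i j x = bracket i 4 x * bracket j 5 x - bracket j 4 x * bracket i 5 x"

lemma multipoly_cross: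
  assumes "6 \<le> t" "i < 4" "j < 4"
  shows "multipoly t (\<lambda>k. bracket_deg i 4 k + bracket_deg j 5 k) (cross_bracket i j)"
proof -
  have "(\<lambda>k. bracket_deg j 4 k + bracket_deg i 5 k) = (\<lambda>k. bracket_deg i 4 k + bracket_deg j 5 k)"
  proof
    fix k
    show "bracket_deg j 4 k + bracket_deg i 5 k = bracket_deg i 4 k + bracket_deg j 5 k"
      using bracket_deg_eq[OF assms(2), of 4 k] bracket_deg_eq[OF assms(2), of 5 k]
        bracket_deg_eq[OF assms(3), of 4 k] bracket_deg_eq[OF assms(3), of 5 k] by linarith
  qed
  then have "multipoly t (\<lambda>k. bracket_deg i 4 k + bracket_deg j 5 k) (\<lambda>x. bracket j 4 x * bracket i 5 x)"
    using multipoly_mult[OF multipoly_bracket[of t 4 j] multipoly_bracket[of t 5 i]] assms by simp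
  moreover have "multipoly t (\<lambda>k. bracket_deg i 4 k + bracket_deg j 5 k) (\<lambda>x. bracket i 4 x * bracket j 5 x)"
    using assms by (intro multipoly_mult multipoly_bracket) auto
  ultimately show ?thesis unfolding cross_bracket_def[abs_def] by (rule multipoly_diff[rotated])
qed

text \<open>
  Clearing denominators in the condition that the seventh point does not lie on the twisted cubic
  through the first six.
\<close>

definition cubic_bracket :: "(nat \<Rightarrow> 4 \<Rightarrow> 'k::comm_ring_1) \<Rightarrow> 'k" where
  "cubic_bracket x =
     cross_bracket 2 1 x * bracket 0 5 x * bracket 0 4 x * (bracket 1 6 x * bracket 2 6 x) +
     cross_bracket 1 0 x * bracket 2 5 x * bracket 2 4 x * (bracket 0 6 x * bracket 1 6 x) +
     cross_bracket 0 2 x * bracket 1 5 x * bracket 1 4 x * (bracket 0 6 x * bracket 2 6 x)"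

lemma multipoly_cubic:
  assumes "7 \<le> t"
  shows "\<exists>d. multipoly t d (cubic_bracket :: _ \<Rightarrow> 'k::comm_ring_1)"
proof -
  let ?d = "\<lambda>h i j k. bracket_deg i 4 k + bracket_deg j 5 k + bracket_deg h 5 k + bracket_deg h 4 k + (bracket_deg i 6 k + bracket_deg j 6 k)"
  let ?f = "\<lambda>h i j (x :: nat \<Rightarrow> 4 \<Rightarrow> 'k). cross_bracket i j x * bracket h 5 x * bracket h 4 x * (bracket i 6 x * bracket j 6 x)"
  have m: "multipoly t (?d h i j) (?f h i j)" if "i < 4" "j < 4" for h i j
    using that assms by (intro multipoly_mult multipoly_bracket multipoly_cross) auto
  have "?d h i j k = ?d 0 2 1 k" if "(h, i, j) = (2, 1, 0) \<or> (h, i, j) = (1, 0, 2)" for h i j k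
    using that bracket_deg_eq[of 0 4 k] bracket_deg_eq[of 1 4 k] bracket_deg_eq[of 2 4 k]
      bracket_deg_eq[of 0 5 k] bracket_deg_eq[of 1 5 k] bracket_deg_eq[of 2 5 k]
      bracket_deg_eq[of 0 6 k] bracket_deg_eq[of 1 6 k] bracket_deg_eq[of 2 6 k]
    by (elim disjE) (simp only: prod.inject, linarith)+
  then have "?d 2 1 0 = ?d 0 2 1" "?d 1 0 2 = ?d 0 2 1" by auto
  then have "multipoly t (?d 0 2 1) (\<lambda>x. ?f 0 2 1 x + ?f 2 1 0 x + ?f 1 0 2 x)"
    using m[of 2 1 0] m[of 1 0 2] m[of 0 2 1] by (intro multipoly_add) simp_all
  moreover have "(\<lambda>x. ?f 0 2 1 x + ?f 2 1 0 x + ?f 1 0 2 x) = cubic_bracket"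
    by (rule ext) (simp add: cubic_bracket_def mult.commute)
  ultimately show ?thesis by auto
qed

section \<open>General points\<close>

definition expected_class :: "nat \<Rightarrow> tor_class" where
  "expected_class t = (if t = 5 then Class_G 5 else if t = 6 then Class_H 3 2 else if t = 7 then Class_T
     else if t = 8 then Class_H 1 0 else Class_H 0 0)"

text \<open>Scaling the frame vectors by the coordinates of \<open>x 4\<close> makes
  \<open>x 4\<close> their sum. The dual covectors are divided by the same factors, so coordinates
  of the other points become quotients of brackets.\<close>

lemma normalized_frame:
  fixes x :: "nat \<Rightarrow> 4 \<Rightarrow> 'k::field_char_0"
  assumes t: "5 \<le> t" and sep: "separated 2 t x"
    and D: "det (frame_mat x) \<noteq> 0" and B: "\<And>i. i < 4 \<Longrightarrow> bracket i 4 x \<noteq> 0"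
  obtains c G where "\<forall>j. c j \<noteq> 0" "gp t (\<lambda>j v. c j * x j v) G"
    "\<forall>i<4. \<forall>p\<ge>4. dot (G i) (\<lambda>v. c p * x p v) = bracket i p x / bracket i 4 x"
proof -
  obtain g where g: "\<forall>i<4. \<forall>j<4. dot (g i) (x j) = (if i = j then 1 else 0)"
    "\<forall>y v. y v = (\<Sum>i<4. dot (g i) y * x i v)"
    "\<forall>i<4. \<forall>y. det (frame_mat (x(i := y))) = dot (g i) y * det (frame_mat x)"
    by (rule frame_dual_basis[OF D])
  have br: "bracket i p x = dot (g i) (x p) * det (frame_mat x)" if "i < 4" for i p
    using g(3) that by (simp add: bracket_def)
  define c where "c j = (if j < 4 then dot (g j) (x 4) else 1)" for j
  define G where "G i v = g i v / c i" for i v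
  have c: "c j \<noteq> 0" for j using B[of j] br[of j 4] by (auto simp: c_def)
  have dG: "dot (G i) y = dot (g i) y / c i" for i y
    unfolding dot_def G_def by (simp add: sum_divide_distrib)
  have ds: "dot f (\<lambda>v. a * y v) = a * dot f y" for f y and a :: 'k
    by (simp add: dot_def sum_distrib_left algebra_simps)
  have sX: "separated 2 t (\<lambda>j v. c j * x j v)" by (rule separated_rescale[OF sep c])
  have "gp t (\<lambda>j v. c j * x j v) G"
  proof
    show "0 < t" "5 \<le> t" using t by auto
    show "separated 2 t (\<lambda>j v. c j * x j v)" by (rule sX)
    show "(\<lambda>v. c p * x p v) \<noteq> (\<lambda>_. 0)" if "p < t" for p
      using separated_nonzero[OF sX _ that] by simp
    show "dot (G i) (\<lambda>v. c j * x j v) = (if i = j then 1 else 0)" if "i < 4" "j < 4" for i j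
      using that g(1) c by (simp add: dG ds)
    show "y v = (\<Sum>i<4. dot (G i) y * (c i * x i v))" for y v
      using c g(2)[rule_format, of y v] by (simp add: dG)
    show "c 4 * x 4 v = (\<Sum>i<4. c i * x i v)" for v
      using g(2)[rule_format, of "x 4" v] by (simp add: c_def)
  qed
  moreover have "\<forall>i<4. \<forall>p\<ge>4. dot (G i) (\<lambda>v. c p * x p v) = bracket i p x / bracket i 4 x"
    using D by (auto simp: ds dG br c_def)
  ultimately show ?thesis using that c by blast
qed

text \<open>Translates the bracket conditions into the coordinates of a normalized frame. The
  conclusion is about rescaled vectors, which represent the same points.\<close>

lemma expected_class_5_to_10:
  fixes x :: "nat \<Rightarrow> 4 \<Rightarrow> 'k::field_char_0"
  assumes t: "5 \<le> t" and sep: "separated 2 t x"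
    and D: "det (frame_mat x) \<noteq> 0" and B: "\<And>i. i < 4 \<Longrightarrow> bracket i 4 x \<noteq> 0"
    and six: "\<And>i. 6 \<le> t \<Longrightarrow> i < 4 \<Longrightarrow> bracket i 5 x \<noteq> 0"
      "\<And>i j. 6 \<le> t \<Longrightarrow> i < j \<Longrightarrow> j < 4 \<Longrightarrow> cross_bracket i j x \<noteq> 0"
    and seven: "7 \<le> t \<Longrightarrow> cubic_bracket x \<noteq> 0"
  obtains c where "\<forall>j. c j \<noteq> 0"
    "has_class (tor_algebra (pideal t (\<lambda>j v. c j * x j v))) (expected_class t)"
    "max_mult_rank (tor_algebra (pideal t (\<lambda>j v. c j * x j v)))"
proof -
  obtain c G where c: "\<forall>j. c j \<noteq> 0" and gp: "gp t (\<lambda>j v. c j * x j v) G"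
    and br: "\<forall>i<4. \<forall>p\<ge>4. dot (G i) (\<lambda>v. c p * x p v) = bracket i p x / bracket i 4 x"
    by (rule normalized_frame[OF t sep D B])
  define X where "X = (\<lambda>j v. c j * x j v)"
  note gp = gp[folded X_def]
  define b where "b i = dot (G i) (X 5)" for i
  have b: "b i = bracket i 5 x / bracket i 4 x" if "i < 4" for i
    using br that by (simp add: b_def X_def)
  have six_locale: "gp6 6 X G b" if t6: "6 \<le> t"
  proof (intro gp6.intro gp6_axioms.intro)
    show "gp 6 X G" by (rule gp_antimono[OF gp _ t6]) simp
    then interpret S: gp 6 X G .
    show "b i \<noteq> 0" if "i < 4" for i using six(1)[OF t6 that] B[OF that] b[OF that] by simp
    show "b i \<noteq> b j" if ij: "i < 4" "j < 4" "i \<noteq> j" for i j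
    proof
      assume "b i = b j"
      then have "bracket i 4 x * bracket j 5 x = bracket j 4 x * bracket i 5 x"
        using ij B by (simp add: b frac_eq_eq mult.commute)
      then have "cross_bracket i j x = 0" "cross_bracket j i x = 0" by (simp_all add: cross_bracket_def)
      then show False using six(2)[OF t6, of i j] six(2)[OF t6, of j i] ij by (cases "i < j") auto
    qed
    show "X 5 v = (\<Sum>i<4. b i * X i v)" for v using S.coord[of "X 5" v] by (simp add: b_def)
  qed simp
  consider "t = 5" | "t = 6" | "7 \<le> t" using t by linarith
  then have "has_class (tor_algebra (pideal t X)) (expected_class t) \<and> max_mult_rank (tor_algebra (pideal t X))"
  proof cases
    case 1
    then have "gp5 t X G" using gp by (intro gp5.intro gp5_axioms.intro)
    then show ?thesis using gp5.class_G5 gp5.max_mult_rank_5 1 by (auto simp: expected_class_def)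
  next
    case 2
    then show ?thesis using six_points[OF six_locale] by (simp add: expected_class_def)
  next
    case 3
    define \<beta> \<gamma> \<epsilon> where "\<beta> i = bracket i 4 x" and "\<gamma> i = bracket i 5 x" and "\<epsilon> i = bracket i 6 x" for i
    have nz: "\<beta> 0 \<noteq> 0" "\<beta> 1 \<noteq> 0" "\<beta> 2 \<noteq> 0" "\<gamma> 0 \<noteq> 0" "\<gamma> 1 \<noteq> 0" "\<gamma> 2 \<noteq> 0"
      using B six(1) 3 by (simp_all add: \<beta>_def \<gamma>_def)
    have e: "dot (G i) (X 6) = \<epsilon> i / \<beta> i" if "i < 4" for i using br that by (simp add: X_def \<beta>_def \<epsilon>_def)
    have b': "b i = \<gamma> i / \<beta> i" if "i < 4" for i using b that by (simp add: \<beta>_def \<gamma>_def)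
    let ?q = "(1 / b 2 - 1 / b 1) * dot (G 1) (X 6) * dot (G 2) (X 6) + (1 / b 1 - 1 / b 0) * dot (G 0) (X 6) * dot (G 1) (X 6) +
      (1 / b 0 - 1 / b 2) * dot (G 0) (X 6) * dot (G 2) (X 6)"
    have "?q * (\<beta> 0 * \<beta> 1 * \<beta> 2 * \<gamma> 0 * \<gamma> 1 * \<gamma> 2) = cubic_bracket x"
      using nz unfolding cubic_bracket_def cross_bracket_def \<beta>_def[symmetric] \<gamma>_def[symmetric] \<epsilon>_def[symmetric]
      by (simp add: e b') (simp add: field_simps)
    then have "?q \<noteq> 0" using seven[OF 3] by auto
    note res = seven_or_more_points[OF gp 3 six_locale this]
    have "t = 7 \<or> t = 8 \<or> 9 \<le> t" using 3 by auto
    then show ?thesis using res 3 by (auto simp: expected_class_def)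
  qed
  then show ?thesis using that c unfolding X_def by blast
qed

lemma expected_class_separated:
  fixes x :: "nat \<Rightarrow> 4 \<Rightarrow> 'k::field_char_0"
  assumes "0 < r" "r \<le> Suc s" "r < 2 * s" "0 < t" "N \<le> t" "separated r t x" "separated s N x"
    and N: "card {m :: 4 \<Rightarrow>\<^sub>0 nat. mon_deg m = s} \<le> N"
  shows "has_class (tor_algebra (pideal t x)) (Class_H 0 0)" "max_mult_rank (tor_algebra (pideal t x))"
proof -
  interpret p3_points t x s r
  proof
    show "x p \<noteq> (\<lambda>_. 0)" if "p < t" for p by (rule separated_nonzero[OF assms(6,1) that])
    show "f = 0" if "homogeneous s f" "f \<in> pideal t x" for f
    proof (rule separated_no_forms[OF assms(7) N that(1)])
      show "mpoly_eval f (x q) = 0" if "q < N" for q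
        using \<open>f \<in> pideal t x\<close> pideal_homogeneous[OF \<open>homogeneous s f\<close>] that assms(5) by simp
    qed
  qed (use assms in auto)
  show "has_class (tor_algebra (pideal t x)) (Class_H 0 0)" "max_mult_rank (tor_algebra (pideal t x))"
    using trivial_case[OF assms(3)] .
qed

section \<open>Sample points and the final case distinction\<close>

lemma proj_space_scale: "P \<in> proj_space \<Longrightarrow> y \<in> P \<Longrightarrow> c \<noteq> 0 \<Longrightarrow> (\<lambda>v. c * y v) \<in> P"
  for c :: "'k::field"
proof -
  assume "P \<in> proj_space" "y \<in> P" "c \<noteq> 0"
  then obtain z d where "P = {\<lambda>v. c * z v |c. c \<noteq> 0}" "y = (\<lambda>v. d * z v)" "d \<noteq> 0"
    by (auto simp: proj_space_def)
  then show ?thesis using \<open>c \<noteq> 0\<close> by (auto intro!: exI[of _ "c * d"] simp: mult.assoc)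
qed

text \<open>The frame, the unit point, the point \<open>(1, 2, 3, 4)\<close> with distinct nonzero
  coordinates, and \<open>(1, 0, 1, 0)\<close> as seventh point, where only one of the three terms
  of \<open>cubic_bracket\<close> survives.\<close>

definition sample_point :: "nat \<Rightarrow> 4 \<Rightarrow> 'k::field_char_0" where
  "sample_point p v = (let i = en_inv v in
     if p < 4 then (if i = p then 1 else 0) else if p = 4 then 1 else if p = 5 then of_nat (Suc i)
     else if i = 0 \<or> i = 2 then 1 else 0)"

lemma quadric_mult: "homogeneous 1 f \<Longrightarrow> homogeneous 1 g \<Longrightarrow> homogeneous 2 (f * g)"
  using homogeneous_mult[of 1 f 1 g] by (simp add: numeral_2_eq_2)

lemma separated_sample: "separated 2 7 (sample_point :: nat \<Rightarrow> 4 \<Rightarrow> 'k::field_char_0)"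
proof -
  let ?x = "sample_point :: nat \<Rightarrow> 4 \<Rightarrow> 'k"
  let ?X = "\<lambda>i. mvar (en i) :: (4, 'k) mpoly"
  note ev = mpoly_eval_mult mpoly_eval_diff sample_point_def Let_def
  have hX: "homogeneous 1 (?X i)" for i by (rule homogeneous_var)
  have "separated 2 4 ?x"
    unfolding separated_def
  proof (intro allI impI)
    fix p assume "p < (4::nat)"
    then show "\<exists>h. homogeneous 2 h \<and> (\<forall>q<4. mpoly_eval h (?x q) = (if q = p then 1 else 0))"
      by (intro exI[of _ "?X p * ?X p"]) (auto simp: ev intro!: quadric_mult hX)
  qed
  then have "separated 2 (Suc 4) ?x"
    by (rule separated_extend[where h = "?X 0 * ?X 1"])
      (auto intro!: quadric_mult hX simp: ev dest!: less_4_cases)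
  then have "separated 2 (Suc 5) ?x"
    by (intro separated_extend[where h = "?X 0 * ?X 1 - ?X 2 * ?X 3"])
      (auto intro!: homogeneous_diff quadric_mult hX simp: ev dest!: less_5_cases)
  \<comment> \<open>The quadric contains \<open>(1, 2, 3, 4)\<close> because
    \<open>2 * 3 = 2 + 4\<close>, and it takes the value 2 at \<open>(1, 0, 1, 0)\<close>.\<close>
  then have "separated 2 (Suc 6) ?x"
  proof (intro separated_extend[where h = "?X 0 * (mconst 2 * ?X 2 - ?X 1 - ?X 3)"])
    fix q assume "q < (6::nat)"
    then have "q = 0 \<or> q = 1 \<or> q = 2 \<or> q = 3 \<or> q = 4 \<or> q = 5" by auto
    then show "mpoly_eval (?X 0 * (mconst 2 * ?X 2 - ?X 1 - ?X 3)) (?x q) = 0"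
      by (elim disjE) (simp_all add: ev)
  qed (auto intro!: homogeneous_diff quadric_mult hX homogeneous_scale simp: ev)
  then show ?thesis by simp
qed

lemma sample_brackets:
  fixes y :: "nat \<Rightarrow> 4 \<Rightarrow> 'k::field_char_0"
  assumes y: "\<And>q. q < 7 \<Longrightarrow> y q = sample_point q"
  shows "det (frame_mat y) = 1" "i < 4 \<Longrightarrow> bracket i p y = y p (en i)"
proof -
  have "frame_mat y = 1\<^sub>m 4"
    unfolding frame_mat_def using y by (intro eq_matI) (auto simp: sample_point_def)
  then show d: "det (frame_mat y) = 1" by simp
  then have "det (frame_mat y) \<noteq> 0" by simp
  then obtain g where g: "\<forall>i<4. \<forall>j<4. dot (g i) (y j) = (if i = j then 1 else 0)"
    "\<forall>y' v. y' v = (\<Sum>i<4. dot (g i) y' * y i v)"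
    "\<forall>i<4. \<forall>y'. det (frame_mat (y(i := y'))) = dot (g i) y' * det (frame_mat y)"
    by (rule frame_dual_basis)
  assume i: "i < 4"
  have "y p (en i) = (\<Sum>l<4. dot (g l) (y p) * y l (en i))" using g(2) by blast
  also have "\<dots> = (\<Sum>l<4. if l = i then dot (g i) (y p) else 0)"
    using i y by (intro sum.cong) (auto simp: sample_point_def)
  finally show "bracket i p y = y p (en i)" using g(3) i d by (simp add: bracket_def)
qed

lemma general_points_5_to_10:
  assumes t: "5 \<le> t" "t \<le> 10"
  shows "for_general_points t (\<lambda>p :: nat \<Rightarrow> (4 \<Rightarrow> 'k::field_char_0) set.
    has_class (tor_algebra (vanishing_ideal (p ` {..<t}))) (expected_class t) \<and>
    max_mult_rank (tor_algebra (vanishing_ideal (p ` {..<t}))))"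
proof -
  obtain y :: "nat \<Rightarrow> 4 \<Rightarrow> 'k" where y: "separated 2 10 y" "\<forall>q<7. y q = sample_point q"
    using separated_extension_exists[OF infinite_UNIV_char_0 separated_sample, of 10] by (auto simp: card_mon_deg_2)
  have sep: "separated 2 t y" by (rule separated_antimono[OF y(1) t(2)])
  obtain d0 and \<phi>0 :: "(nat \<Rightarrow> 4 \<Rightarrow> 'k) \<Rightarrow> 'k" where \<phi>0: "multipoly t d0 \<phi>0" "\<phi>0 y \<noteq> 0" "\<forall>x. \<phi>0 x \<noteq> 0 \<longrightarrow> separated 2 t x"
    by (rule separated_open[OF sep order.refl])
  let ?I = "{(i, j). i < j \<and> j < (4::nat)}"
  have fI: "finite ?I" by (rule finite_subset[of _ "{..<4} \<times> {..<4}"]) auto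
  \<comment> \<open>The bracket \<open>bracket 0 0\<close> replaces a column by itself, so it is the
    frame determinant. The factors \<open>\<phi>6\<close> and \<open>\<phi>7\<close> are set to 1
    when there is no sixth or seventh point.\<close>
  define \<phi>5 where "\<phi>5 x = bracket 0 0 x * (\<Prod>i<4. bracket i 4 x)" for x :: "nat \<Rightarrow> 4 \<Rightarrow> 'k"
  define \<phi>6 where "\<phi>6 x = (if 6 \<le> t then (\<Prod>i<4. bracket i 5 x) * (\<Prod>(i, j)\<in>?I. cross_bracket i j x) else 1)"
    for x :: "nat \<Rightarrow> 4 \<Rightarrow> 'k"
  define \<phi>7 where "\<phi>7 x = (if 7 \<le> t then cubic_bracket x else 1)" for x :: "nat \<Rightarrow> 4 \<Rightarrow> 'k"
  have "multipoly t (\<lambda>k. bracket_deg 0 0 k + (\<Sum>i<4. bracket_deg i 4 k)) \<phi>5"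
    unfolding \<phi>5_def[abs_def] using t by (intro multipoly_mult multipoly_prod multipoly_bracket) auto
  moreover have "\<exists>d. multipoly t d \<phi>6"
  proof (cases "6 \<le> t")
    case True
    have "multipoly t (\<lambda>k. \<Sum>ij\<in>?I. bracket_deg (fst ij) 4 k + bracket_deg (snd ij) 5 k)
        (\<lambda>x :: nat \<Rightarrow> 4 \<Rightarrow> 'k. \<Prod>(i, j)\<in>?I. cross_bracket i j x)"
      unfolding case_prod_beta using True by (intro multipoly_prod multipoly_cross) auto
    then show ?thesis
      unfolding \<phi>6_def[abs_def] using True
      by (intro exI[of _ "\<lambda>k. (\<Sum>i<4. bracket_deg i 5 k) + (\<Sum>ij\<in>?I. bracket_deg (fst ij) 4 k + bracket_deg (snd ij) 5 k)"])
        (auto intro!: multipoly_mult multipoly_prod multipoly_bracket)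
  next
    case False
    then show ?thesis unfolding \<phi>6_def[abs_def] using multipoly_const[of t "1 :: 'k"] by auto
  qed
  moreover have "\<exists>d. multipoly t d \<phi>7"
    unfolding \<phi>7_def[abs_def] using multipoly_cubic[of t] multipoly_const[of t "1 :: 'k"] by (cases "7 \<le> t") auto
  ultimately obtain d5 d6 d7 where \<phi>: "multipoly t d5 \<phi>5" "multipoly t d6 \<phi>6" "multipoly t d7 \<phi>7" by blast
  have br: "bracket i p y = sample_point p (en i)" if "i < 4" "p < 7" for i p
    using sample_brackets(2)[of y i p] y(2) that by simp
  show ?thesis
  proof (rule for_general_pointsI[OF multipoly_mult[OF multipoly_mult[OF \<phi>0(1) \<phi>(1)] multipoly_mult[OF \<phi>(2,3)]]])
    have "\<phi>5 y \<noteq> 0" using br by (auto simp: \<phi>5_def sample_point_def)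
    moreover have "\<phi>6 y \<noteq> 0"
    proof -
      have "cross_bracket i j y \<noteq> 0" if "i < j" "j < 4" for i j
        using that br by (simp add: cross_bracket_def sample_point_def)
      moreover have "bracket i 5 y \<noteq> 0" if "i < 4" for i
        using br[OF that, of 5] that by (simp add: sample_point_def del: of_nat_Suc)
      ultimately show ?thesis using fI by (auto simp: \<phi>6_def)
    qed
    moreover have "\<phi>7 y \<noteq> 0"
      using br by (simp add: \<phi>7_def cubic_bracket_def cross_bracket_def sample_point_def)
    ultimately show "\<phi>0 y * \<phi>5 y * (\<phi>6 y * \<phi>7 y) \<noteq> 0" using \<phi>0(2) by simp
    show "y j \<noteq> (\<lambda>_. 0)" if "j < t" for j by (rule separated_nonzero[OF sep _ that]) simp
    fix p :: "nat \<Rightarrow> (4 \<Rightarrow> 'k) set" and x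
    assume p: "\<And>j. j < t \<Longrightarrow> p j \<in> proj_space" "\<And>j. j < t \<Longrightarrow> x j \<in> p j"
      and "\<phi>0 x * \<phi>5 x * (\<phi>6 x * \<phi>7 x) \<noteq> 0"
    then have nz: "\<phi>0 x \<noteq> 0" "\<phi>5 x \<noteq> 0" "\<phi>6 x \<noteq> 0" "\<phi>7 x \<noteq> 0" by auto
    have D: "det (frame_mat x) \<noteq> 0" using nz(2) by (auto simp: \<phi>5_def bracket_def)
    obtain c where c: "\<forall>j. c j \<noteq> 0"
      "has_class (tor_algebra (pideal t (\<lambda>j v. c j * x j v))) (expected_class t)"
      "max_mult_rank (tor_algebra (pideal t (\<lambda>j v. c j * x j v)))"
    proof (rule expected_class_5_to_10[OF t(1) \<phi>0(3)[rule_format, OF nz(1)] D])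
      show "bracket i 4 x \<noteq> 0" if "i < 4" for i using nz(2) that by (auto simp: \<phi>5_def)
      show "bracket i 5 x \<noteq> 0" if "6 \<le> t" "i < 4" for i using nz(3) that by (auto simp: \<phi>6_def)
      show "cross_bracket i j x \<noteq> 0" if "6 \<le> t" "i < j" "j < 4" for i j
        using nz(3) that fI by (auto simp: \<phi>6_def)
      show "cubic_bracket x \<noteq> 0" if "7 \<le> t" using nz(4) that by (simp add: \<phi>7_def)
    qed
    have "vanishing_ideal (p ` {..<t}) = pideal t (\<lambda>j v. c j * x j v)"
      using p c(1) by (intro vanishing_ideal_eq_pideal proj_space_scale) auto
    then show "has_class (tor_algebra (vanishing_ideal (p ` {..<t}))) (expected_class t) \<and>
        max_mult_rank (tor_algebra (vanishing_ideal (p ` {..<t})))"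
      using c(2,3) by simp
  qed
qed

lemma general_points_separated:
  fixes y :: "nat \<Rightarrow> 4 \<Rightarrow> 'k::field_char_0"
  assumes rs: "0 < r" "r \<le> Suc s" "r < 2 * s" "0 < t" "N \<le> t"
    and y: "separated r t y" "separated s N y" and N: "card {m :: 4 \<Rightarrow>\<^sub>0 nat. mon_deg m = s} \<le> N"
  shows "for_general_points t (\<lambda>p :: nat \<Rightarrow> (4 \<Rightarrow> 'k) set.
    has_class (tor_algebra (vanishing_ideal (p ` {..<t}))) (Class_H 0 0) \<and>
    max_mult_rank (tor_algebra (vanishing_ideal (p ` {..<t}))))"
proof -
  obtain d \<phi> where \<phi>: "multipoly t d \<phi>" "\<phi> y \<noteq> 0" "\<forall>x. \<phi> x \<noteq> 0 \<longrightarrow> separated r t x"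
    by (rule separated_open[OF y(1) order.refl])
  obtain e \<psi> where \<psi>: "multipoly t e \<psi>" "\<psi> y \<noteq> 0" "\<forall>x. \<psi> x \<noteq> 0 \<longrightarrow> separated s N x"
    by (rule separated_open[OF y(2) rs(5)])
  show ?thesis
  proof (rule for_general_pointsI[OF multipoly_mult[OF \<phi>(1) \<psi>(1)]])
    show "\<phi> y * \<psi> y \<noteq> 0" using \<phi>(2) \<psi>(2) by simp
    show "y j \<noteq> (\<lambda>_. 0)" if "j < t" for j by (rule separated_nonzero[OF y(1) rs(1) that])
    fix p :: "nat \<Rightarrow> (4 \<Rightarrow> 'k) set" and x
    assume p: "\<And>j. j < t \<Longrightarrow> p j \<in> proj_space" "\<And>j. j < t \<Longrightarrow> x j \<in> p j" and "\<phi> x * \<psi> x \<noteq> 0"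
    then have "\<phi> x \<noteq> 0" "\<psi> x \<noteq> 0" by auto
    then have "separated r t x" "separated s N x" using \<phi>(3) \<psi>(3) by blast+
    moreover have e: "vanishing_ideal (p ` {..<t}) = pideal t x"
      by (rule vanishing_ideal_eq_pideal) (use p in auto)
    ultimately show "has_class (tor_algebra (vanishing_ideal (p ` {..<t}))) (Class_H 0 0) \<and>
        max_mult_rank (tor_algebra (vanishing_ideal (p ` {..<t})))"
      unfolding e by (intro conjI expected_class_separated[OF rs _ _ N])
  qed
qed

text \<open>Here \<open>r = s = 1\<close>: linear forms separate four points, and none of them
  except zero vanishes at all four.\<close>

lemma general_points_4:
  "for_general_points 4 (\<lambda>p :: nat \<Rightarrow> (4 \<Rightarrow> 'k::field_char_0) set.
    has_class (tor_algebra (vanishing_ideal (p ` {..<4}))) (Class_H 0 0) \<and>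
    max_mult_rank (tor_algebra (vanishing_ideal (p ` {..<4}))))"
proof -
  have "separated 1 0 (\<lambda>_ (_ :: 4). 0 :: 'k)" by (simp add: separated_def)
  from separated_extension_exists[OF infinite_UNIV_char_0 this, of 4]
  obtain y :: "nat \<Rightarrow> 4 \<Rightarrow> 'k" where y: "separated 1 4 y" unfolding card_mon_deg_1 by auto
  show ?thesis by (rule general_points_separated[OF _ _ _ _ _ y y eq_refl[OF card_mon_deg_1]]) simp_all
qed

text \<open>Take for \<open>r\<close> the least degree with at least \<open>t\<close> monomials, and
  \<open>s = r - 1\<close>. There are ten quadratic monomials, so eleven points force
  \<open>3 \<le> r\<close>, and then \<open>r = s + 1\<close> is less than
  \<open>2 * s\<close>.\<close>

lemma general_points_ge_11:
  assumes t: "11 \<le> t"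
  shows "for_general_points t (\<lambda>p :: nat \<Rightarrow> (4 \<Rightarrow> 'k::field_char_0) set.
    has_class (tor_algebra (vanishing_ideal (p ` {..<t}))) (Class_H 0 0) \<and>
    max_mult_rank (tor_algebra (vanishing_ideal (p ` {..<t}))))"
proof -
  define N where "N r = card {m :: 4 \<Rightarrow>\<^sub>0 nat. mon_deg m = r}" for r
  define r where "r = (LEAST r. t \<le> N r)"
  have "t \<le> N t" using card_mon_deg_ge[of t] by (simp add: N_def)
  then have r: "t \<le> N r" "\<And>s. s < r \<Longrightarrow> \<not> t \<le> N s" unfolding r_def by (auto intro: LeastI dest: not_less_Least)
  have "{m :: 4 \<Rightarrow>\<^sub>0 nat. mon_deg m = 0} = {0}" by (auto simp: mon_deg_eq_0)
  then have N: "N 0 = 1" "N 1 = 4" "N 2 = 10" using card_mon_deg_1 card_mon_deg_2 by (simp_all add: N_def)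
  have "r \<noteq> k" if "N k < 11" for k using r(1) t that by (metis leD order.strict_trans2)
  from this[of 0] this[of 1] this[of 2] have "r \<noteq> 0" "r \<noteq> 1" "r \<noteq> 2" unfolding N by simp_all
  then have r3: "3 \<le> r" by linarith
  define s where "s = r - 1"
  have s: "r = Suc s" "2 \<le> s" using r3 by (auto simp: s_def)
  have Ns: "N s \<le> t" using r(2)[of s] s(1) by simp
  have "separated s 0 (\<lambda>_ (_ :: 4). 0 :: 'k)" by (simp add: separated_def)
  from separated_extension_exists[OF infinite_UNIV_char_0 this, of "N s"]
  obtain z :: "nat \<Rightarrow> 4 \<Rightarrow> 'k" where z: "separated s (N s) z" unfolding N_def by auto
  \<comment> \<open>The first \<open>N s\<close> sample points are chosen in degree \<open>s\<close>
    and stay separated in degree \<open>r\<close>; the remaining ones are then added in degree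
    \<open>r\<close>.\<close>
  have "separated r (N s) z"
    unfolding s(1) using s(2) by (intro separated_Suc[OF z] separated_nonzero[OF z]) auto
  then obtain y where y: "separated r t y" "\<forall>q<N s. y q = z q"
    using separated_extension_exists[OF infinite_UNIV_char_0 _ Ns] r(1) unfolding N_def by blast
  have "separated s (N s) y" using z separated_cong[of "N s" y z s] y(2) by simp
  from general_points_separated[OF _ _ _ _ Ns y(1) this] show ?thesis using s t by (simp add: N_def)
qed

theorem theorem4p6:
  fixes t :: nat
  assumes "t \<ge> 4"
  shows "for_general_points t
    (\<lambda>p :: nat \<Rightarrow> (4 \<Rightarrow> 'k::{alg_closed_field,field_char_0}) set.
       let A = tor_algebra (vanishing_ideal (p ` {..<t})) in
         (t = 4 \<longrightarrow> has_class A (Class_H 0 0)) \<and>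
         (t = 5 \<longrightarrow> has_class A (Class_G 5)) \<and>
         (t = 6 \<longrightarrow> has_class A (Class_H 3 2)) \<and>
         (t = 7 \<longrightarrow> has_class A Class_T) \<and>
         (t = 8 \<longrightarrow> has_class A (Class_H 1 0)) \<and>
         (t \<ge> 9 \<longrightarrow> has_class A (Class_H 0 0)) \<and>
         max_mult_rank A)"
proof -
  have "for_general_points t (\<lambda>p :: nat \<Rightarrow> (4 \<Rightarrow> 'k) set.
      has_class (tor_algebra (vanishing_ideal (p ` {..<t}))) (expected_class t) \<and>
      max_mult_rank (tor_algebra (vanishing_ideal (p ` {..<t}))))"
  proof -
    consider "t = 4" | "5 \<le> t" "t \<le> 10" | "11 \<le> t" using assms by linarith
    then show ?thesis
    proof cases
      case 1
      then show ?thesis using general_points_4[where 'k = 'k] by (simp add: expected_class_def)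
    next
      case 2
      then show ?thesis by (rule general_points_5_to_10)
    next
      case 3
      then show ?thesis using general_points_ge_11[OF 3, where 'k = 'k] by (simp add: expected_class_def)
    qed
  qed
  then obtain U where "zariski_open t U" "U \<noteq> {}" "\<forall>p\<in>U.
      has_class (tor_algebra (vanishing_ideal (p ` {..<t} :: (4 \<Rightarrow> 'k) set set))) (expected_class t) \<and>
      max_mult_rank (tor_algebra (vanishing_ideal (p ` {..<t})))"
    unfolding for_general_points_def by blast
  then show ?thesis
    unfolding for_general_points_def Let_def by (intro exI[of _ U]) (auto simp: expected_class_def)
qed

end
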